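(* Let $\mathcal{H}$ be a finite set of 2-connected cubic graphs, and let $\mathcal{G}$ be the class of matching covered graphs such that a matching covered graph $G$ belongs to $\mathcal{G}$ if and only if no $H\in\mathcal{H}$ is an $S$-minor of $G$. Then a matching covered graph $G$ belongs to $\mathcal{G}$ if and only if $G$ is $K_4(\mathcal{H})$-free, that is, if and only if no $K_4$-decoration of any $H\in\mathcal{H}$ is a conformal minor of $G$.
   Context: Graphs are finite and loopless; multiple edges are allowed. A graph is matchable if it has a perfect matching (the empty graph is matchable). A connected graph with at least two vertices is matching covered if each edge lies in some perfect matching. A graph is cubic if every vertex has degree three. Every 2-connected cubic graph is matching covered; the graph $\Theta$ (two vertices joined by three edges) counts as 2-connected. Conformal minors: A subgraph $H$ of $G$ is conformal if $G-V(H)$ is matchable. A bi-subdivision of a graph $J$ is a graph obtained from $J$ by subdividing each edge of some subset of $E(J)$ with an even number of subdivision vertices. A matching covered graph $J$ is a conformal minor of a matching covered graph $G$ if $G$ has a conformal subgraph that is a bi-subdivision of $J$. For a finite set $\mathcal{J}$ of matching covered graphs, $G$ is $\mathcal{J}$-free if no $J\in\mathcal{J}$ is a conformal minor of $G$. Removable ears: A path is odd if it has an odd number of edges. For a path $P$ whose internal vertices have degree two in $G$, $G-P$ denotes the graph obtained from $G$ by deleting the edges and internal vertices of $P$. A removable single ear of a matching covered graph $G$ is an odd path $P$, all of whose internal vertices have degree two in $G$, such that $G-P$ is matching covered. A removable double ear is a pair $(P,Q)$ of vertex-disjoint odd paths, all of whose internal vertices have degree two in $G$, such that neither $G-P$ nor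 $G-Q$ is matching covered, but $G-P-Q$ is matching covered. A removable ear is a removable single or double ear. Separating cuts: For $X\subseteq V(G)$, $\partial(X)$ is the set of edges with exactly one end in $X$; the shores of this cut are $X$ and $\overline{X}=V(G)-X$. $G/X$ denotes the graph obtained by shrinking $X$ to a single vertex and deleting all edges with both ends in $X$. A cut $C=\partial(X)$ of a matching covered graph $G$ is separating if both $C$-contractions $G/X$ and $G/\overline{X}$ are matching covered. $S$-minors: A matching covered graph $J$ is an $S$-minor of a matching covered graph $G$ if $J$ can be obtained (up to isomorphism) from $G$ by a (possibly empty) sequence of operations, each being either deletion of a removable ear or contraction of a shore of a separating cut (i.e. passing to a $C$-contraction for a separating cut $C$). $K_4$-decorations: For a 2-connected cubic graph $J$ and $T\subseteq V(J)$ (possibly empty or all of $V(J)$), $J^T\odot K_4$ is the cubic graph obtained from $J$ by replacing each vertex $v\in T$ by a triangle, the three edges of $J$ incident with $v$ becoming incident with the three distinct vertices of the triangle. Each such graph is called a $K_4$-decoration of $J$. $K_4(J)=\{J^T\odot K_4: T\subseteq V(J)\}$ (up to isomorphism), and $K_4(\mathcal{H})=\bigcup_{H\in\mathcal{H}}K_4(H)$. *)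

theory Defs imports Main begin

text \<open>Finite loopless multigraphs. The edges are named objects, so that parallel edges are
  allowed; an edge is mapped to the two-element set of its ends.\<close>

record ('v, 'e) mgraph =
  verts :: "'v set"
  edges :: "'e set"
  ends  :: "'e \<Rightarrow> 'v set"

definition multigraph :: "('v, 'e) mgraph \<Rightarrow> bool" where
  "multigraph G \<longleftrightarrow> finite (verts G) \<and> finite (edges G) \<and>
     (\<forall>e\<in>edges G. ends G e \<subseteq> verts G \<and> card (ends G e) = 2)"

definition incident_edges :: "('v, 'e) mgraph \<Rightarrow> 'v \<Rightarrow> 'e set" where
  "incident_edges G v = {e \<in> edges G. v \<in> ends G e}"

definition degree :: "('v, 'e) mgraph \<Rightarrow> 'v \<Rightarrow> nat" where
  "degree G v = card (incident_edges G v)"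

definition graph_iso :: "('v, 'e) mgraph \<Rightarrow> ('w, 'f) mgraph \<Rightarrow> bool" where
  "graph_iso G H \<longleftrightarrow> (\<exists>f g. bij_betw f (verts G) (verts H) \<and> bij_betw g (edges G) (edges H) \<and>
     (\<forall>e\<in>edges G. ends H (g e) = f ` ends G e))"

definition subgraph :: "('v, 'e) mgraph \<Rightarrow> ('v, 'e) mgraph \<Rightarrow> bool" where
  "subgraph H G \<longleftrightarrow> multigraph H \<and> verts H \<subseteq> verts G \<and> edges H \<subseteq> edges G \<and>
     (\<forall>e\<in>edges H. ends H e = ends G e)"

definition delete_verts :: "('v, 'e) mgraph \<Rightarrow> 'v set \<Rightarrow> ('v, 'e) mgraph" where
  "delete_verts G X =
     \<lparr>verts = verts G - X, edges = {e \<in> edges G. ends G e \<inter> X = {}}, ends = ends G\<rparr>"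

definition adjacency :: "('v, 'e) mgraph \<Rightarrow> 'v rel" where
  "adjacency G = {(u, v). \<exists>e\<in>edges G. ends G e = {u, v}}"

definition graph_connected :: "('v, 'e) mgraph \<Rightarrow> bool" where
  "graph_connected G \<longleftrightarrow> verts G \<noteq> {} \<and> (\<forall>u\<in>verts G. \<forall>v\<in>verts G. (u, v) \<in> (adjacency G)\<^sup>*)"

text \<open>The bound is two vertices rather than the customary three: the only cubic graph
  affected by this is the graph with two vertices joined by three edges, which is
  to count as 2-connected.\<close>

definition two_connected :: "('v, 'e) mgraph \<Rightarrow> bool" where
  "two_connected G \<longleftrightarrow> 2 \<le> card (verts G) \<and> graph_connected G \<and>
     (\<forall>v\<in>verts G. graph_connected (delete_verts G {v}))"

definition cubic :: "('v, 'e) mgraph \<Rightarrow> bool" where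
  "cubic G \<longleftrightarrow> (\<forall>v\<in>verts G. degree G v = 3)"

definition perfect_matching :: "('v, 'e) mgraph \<Rightarrow> 'e set \<Rightarrow> bool" where
  "perfect_matching G M \<longleftrightarrow> M \<subseteq> edges G \<and> (\<forall>v\<in>verts G. \<exists>!e. e \<in> M \<and> v \<in> ends G e)"

definition matchable :: "('v, 'e) mgraph \<Rightarrow> bool" where
  "matchable G \<longleftrightarrow> (\<exists>M. perfect_matching G M)"

definition matching_covered :: "('v, 'e) mgraph \<Rightarrow> bool" where
  "matching_covered G \<longleftrightarrow> multigraph G \<and> graph_connected G \<and> 2 \<le> card (verts G) \<and>
     (\<forall>e\<in>edges G. \<exists>M. perfect_matching G M \<and> e \<in> M)"


section \<open>Conformal minors\<close>

definition conformal_subgraph :: "('v, 'e) mgraph \<Rightarrow> ('v, 'e) mgraph \<Rightarrow> bool" where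
  "conformal_subgraph H G \<longleftrightarrow> subgraph H G \<and> matchable (delete_verts G (verts H))"

text \<open>Each edge \<open>e\<close>, traversed from \<open>s e\<close> to \<open>t e\<close>, is subdivided by \<open>k e\<close> new vertices
  \<open>Inr (e, 1), \<dots>, Inr (e, k e)\<close>; the edges of the resulting path are
  \<open>(e, 0), \<dots>, (e, k e)\<close>. An edge with \<open>k e = 0\<close> is not subdivided.\<close>

definition subdivision_point ::
    "('e \<Rightarrow> 'v) \<Rightarrow> ('e \<Rightarrow> 'v) \<Rightarrow> ('e \<Rightarrow> nat) \<Rightarrow> 'e \<Rightarrow> nat \<Rightarrow> 'v + 'e \<times> nat" where
  "subdivision_point s t k e i =
     (if i = 0 then Inl (s e) else if i \<le> k e then Inr (e, i) else Inl (t e))"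

definition subdivide ::
    "('v, 'e) mgraph \<Rightarrow> ('e \<Rightarrow> 'v) \<Rightarrow> ('e \<Rightarrow> 'v) \<Rightarrow> ('e \<Rightarrow> nat) \<Rightarrow> ('v + 'e \<times> nat, 'e \<times> nat) mgraph" where
  "subdivide J s t k =
     \<lparr>verts = Inl ` verts J \<union> Inr ` {(e, i). e \<in> edges J \<and> 1 \<le> i \<and> i \<le> k e},
      edges = {(e, i). e \<in> edges J \<and> i \<le> k e},
      ends = (\<lambda>(e, i). {subdivision_point s t k e i, subdivision_point s t k e (Suc i)})\<rparr>"

definition bisubdivision :: "('w, 'f) mgraph \<Rightarrow> ('v, 'e) mgraph \<Rightarrow> bool" where
  "bisubdivision H J \<longleftrightarrow> (\<exists>s t k. (\<forall>e\<in>edges J. ends J e = {s e, t e} \<and> even (k e)) \<and>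
     graph_iso H (subdivide J s t k))"

definition conformal_minor :: "('w, 'f) mgraph \<Rightarrow> ('v, 'e) mgraph \<Rightarrow> bool" where
  "conformal_minor J G \<longleftrightarrow> matching_covered J \<and> matching_covered G \<and>
     (\<exists>H. conformal_subgraph H G \<and> bisubdivision H J)"

definition free_of :: "('w, 'f) mgraph set \<Rightarrow> ('v, 'e) mgraph \<Rightarrow> bool" where
  "free_of \<J> G \<longleftrightarrow> (\<forall>J\<in>\<J>. \<not> conformal_minor J G)"


section \<open>Removable ears\<close>

text \<open>A path is given by its list of vertices together with its list of edges.\<close>

type_synonym ('v, 'e) gpath = "'v list \<times> 'e list"

definition is_path :: "('v, 'e) mgraph \<Rightarrow> ('v, 'e) gpath \<Rightarrow> bool" where
  "is_path G = (\<lambda>(vs, es). length vs = Suc (length es) \<and> distinct vs \<and> set vs \<subseteq> verts G \<and>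
     (\<forall>i<length es. es ! i \<in> edges G \<and> ends G (es ! i) = {vs ! i, vs ! Suc i}))"

definition internal_verts :: "('v, 'e) gpath \<Rightarrow> 'v set" where
  "internal_verts P = set (butlast (tl (fst P)))"

text \<open>The candidates for ears: odd paths whose internal vertices have degree two.\<close>

definition odd_ear_path :: "('v, 'e) mgraph \<Rightarrow> ('v, 'e) gpath \<Rightarrow> bool" where
  "odd_ear_path G P \<longleftrightarrow> is_path G P \<and> odd (length (snd P)) \<and>
     (\<forall>v\<in>internal_verts P. degree G v = 2)"

definition delete_path :: "('v, 'e) mgraph \<Rightarrow> ('v, 'e) gpath \<Rightarrow> ('v, 'e) mgraph" where
  "delete_path G P =
     \<lparr>verts = verts G - internal_verts P, edges = edges G - set (snd P), ends = ends G\<rparr>"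

definition removable_single_ear :: "('v, 'e) mgraph \<Rightarrow> ('v, 'e) gpath \<Rightarrow> bool" where
  "removable_single_ear G P \<longleftrightarrow> matching_covered G \<and> odd_ear_path G P \<and>
     matching_covered (delete_path G P)"

definition removable_double_ear ::
    "('v, 'e) mgraph \<Rightarrow> ('v, 'e) gpath \<Rightarrow> ('v, 'e) gpath \<Rightarrow> bool" where
  "removable_double_ear G P Q \<longleftrightarrow> matching_covered G \<and> odd_ear_path G P \<and> odd_ear_path G Q \<and>
     set (fst P) \<inter> set (fst Q) = {} \<and>
     \<not> matching_covered (delete_path G P) \<and> \<not> matching_covered (delete_path G Q) \<and>
     matching_covered (delete_path (delete_path G P) Q)"


section \<open>Separating cuts and S-minors\<close>

text \<open>Shrinking \<open>X\<close> to a single vertex, for nonempty \<open>X\<close>. A member of \<open>X\<close> serves as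
  the contraction vertex, so that the vertex type is unchanged and contractions can be
  iterated; up to isomorphism the choice is immaterial.\<close>

definition contract :: "('v, 'e) mgraph \<Rightarrow> 'v set \<Rightarrow> ('v, 'e) mgraph" where
  "contract G X = (let f = (\<lambda>v. if v \<in> X then (SOME x. x \<in> X) else v) in
     \<lparr>verts = f ` verts G, edges = {e \<in> edges G. \<not> ends G e \<subseteq> X}, ends = (\<lambda>e. f ` ends G e)\<rparr>)"

text \<open>The cut is represented by its shore \<open>X\<close>. The shores of a separating cut are nonempty
  in any case, since contracting an empty shore would add an isolated vertex; this is
  made explicit because \<open>contract G {}\<close> does not add one.\<close>

definition separating :: "('v, 'e) mgraph \<Rightarrow> 'v set \<Rightarrow> bool" where
  "separating G X \<longleftrightarrow> matching_covered G \<and> X \<noteq> {} \<and> X \<subset> verts G \<and>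
     matching_covered (contract G X) \<and> matching_covered (contract G (verts G - X))"

text \<open>Since \<open>X\<close> is a shore of a separating cut if and only if its complement is, the
  last rule covers both contractions.\<close>

inductive S_step :: "('v, 'e) mgraph \<Rightarrow> ('v, 'e) mgraph \<Rightarrow> bool" where
  single_ear: "removable_single_ear G P \<Longrightarrow> S_step G (delete_path G P)"
| double_ear: "removable_double_ear G P Q \<Longrightarrow> S_step G (delete_path (delete_path G P) Q)"
| contraction: "separating G X \<Longrightarrow> S_step G (contract G X)"

definition S_minor :: "('w, 'f) mgraph \<Rightarrow> ('v, 'e) mgraph \<Rightarrow> bool" where
  "S_minor J G \<longleftrightarrow> matching_covered J \<and> matching_covered G \<and>
     (\<exists>G'. S_step\<^sup>*\<^sup>* G G' \<and> graph_iso G' J)"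


section \<open>$K_4$-decorations\<close>

text \<open>A vertex \<open>v \<notin> T\<close> becomes \<open>(v, None)\<close>. A vertex \<open>v \<in> T\<close> becomes the triangle
  with vertices \<open>(v, Some e)\<close>, where \<open>e\<close> ranges over the three edges at \<open>v\<close>; the edge \<open>e\<close>
  is reattached to \<open>(v, Some e)\<close>. The triangle edge \<open>Inr (v, e)\<close> is the one opposite to
  \<open>(v, Some e)\<close>.\<close>

definition K4_decoration ::
    "('v, 'e) mgraph \<Rightarrow> 'v set \<Rightarrow> ('v \<times> 'e option, 'e + 'v \<times> 'e) mgraph" where
  "K4_decoration J T =
     \<lparr>verts = {(v, None) | v. v \<in> verts J - T} \<union>
              {(v, Some e) | v e. v \<in> verts J \<inter> T \<and> e \<in> incident_edges J v},
      edges = Inl ` edges J \<union> Inr ` {(v, e). v \<in> verts J \<inter> T \<and> e \<in> incident_edges J v},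
      ends = (\<lambda>x. case x of
          Inl e \<Rightarrow> (\<lambda>v. (v, if v \<in> T then Some e else None)) ` ends J e
        | Inr (v, e) \<Rightarrow> (\<lambda>e'. (v, Some e')) ` (incident_edges J v - {e}))\<rparr>"

definition K4_decorations ::
    "('v, 'e) mgraph \<Rightarrow> ('v \<times> 'e option, 'e + 'v \<times> 'e) mgraph set" where
  "K4_decorations J = {K4_decoration J T | T. T \<subseteq> verts J}"

end

theory Submission imports Defs begin

text \<open>If a conformal subgraph \<open>L\<close> of \<open>G\<close> is a bi-subdivision of a \<open>K\<^sub>4\<close>-decoration of \<open>H\<close>, then the two-ear
  theorem of Lovasz and Plummer leads from \<open>G\<close> to \<open>L\<close> by deleting removable ears, and contracting the subdivided
  edges and then the triangles, which are shores of separating cuts, leads from \<open>L\<close> to \<open>H\<close>.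

  Conversely, lifting the steps of an \<open>S\<close>-minor back to \<open>G\<close> represents every vertex of \<open>H\<close> by a set \<open>B\<close> of vertices
  of \<open>G\<close> with three terminals, such that \<open>B\<close> without any one of them is matchable. By contracting blossoms,
  \<open>B\<close> contains, up to a matching, either three even paths from a common centre to the terminals or such a
  structure with a triangle in place of the centre. The first case keeps the vertex of \<open>H\<close>, the second one
  replaces it by a triangle.\<close>

section \<open>Matchings of a symmetric relation\<close>

text \<open>Triangles cannot be avoided: a bag that is itself a triangle, with its three vertices as
  terminals, contains no disjoint even paths from a common centre to all of them. What the steps of
  an \<open>S\<close>-minor leave behind is only that a bag stays matchable after the loss of any
  one terminal, and this weak condition survives the undoing of ear deletions and contractions in
  any order. To find structure in it, fix a matching that misses one terminal and follow alternating
  paths from there to the other two. The parity of their last meeting point decides between a common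
  centre and an odd cycle, which is then shrunk. Undoing the shrinking could nest triangles in
  triangles, but an inner triangle can always be traded for a centre, so one level is enough.
  Matchings are treated as involutions of vertex sets under a symmetric relation: shrinking only
  changes the relation, and the multiplicity of edges matters only when edges of \<open>G\<close>
  have to be named. The two-ear theorem is derived from Tutte's theorem by way of barriers.\<close>

definition is_mate :: "('v \<Rightarrow> 'v \<Rightarrow> bool) \<Rightarrow> 'v set \<Rightarrow> ('v \<Rightarrow> 'v) \<Rightarrow> bool" where
  "is_mate R U p \<longleftrightarrow> (\<forall>u\<in>U. p u \<in> U \<and> p (p u) = u \<and> p u \<noteq> u \<and> R u (p u))"

definition matchable_on :: "('v \<Rightarrow> 'v \<Rightarrow> bool) \<Rightarrow> 'v set \<Rightarrow> bool" where
  "matchable_on R U \<longleftrightarrow> (\<exists>p. is_mate R U p)"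

lemma is_mateD:
  assumes "is_mate R U p" "u \<in> U"
  shows "p u \<in> U" "p (p u) = u" "p u \<noteq> u" "R u (p u)"
  using assms unfolding is_mate_def by auto

lemma is_mate_subset:
  assumes "is_mate R U p" "C \<subseteq> U" "\<And>u. u \<in> C \<Longrightarrow> p u \<in> C"
  shows "is_mate R C p"
  using assms unfolding is_mate_def by blast

lemma matchable_on_empty [simp]: "matchable_on R {}"
  unfolding matchable_on_def is_mate_def by simp

lemma matchable_on_pair: "R u v \<Longrightarrow> R v u \<Longrightarrow> u \<noteq> v \<Longrightarrow> matchable_on R {u, v}"
  unfolding matchable_on_def is_mate_def
  by (rule exI[of _ "\<lambda>x. if x = u then v else u"]) auto

lemma matchable_on_UN:
  assumes "\<And>i. i \<in> I \<Longrightarrow> matchable_on R (F i)"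
    and disj: "\<And>i j. i \<in> I \<Longrightarrow> j \<in> I \<Longrightarrow> i \<noteq> j \<Longrightarrow> F i \<inter> F j = {}"
  shows "matchable_on R (\<Union>i\<in>I. F i)"
proof -
  obtain p where p: "\<And>i. i \<in> I \<Longrightarrow> is_mate R (F i) (p i)"
    using assms(1) unfolding matchable_on_def by metis
  define k where "k x = (SOME i. i \<in> I \<and> x \<in> F i)" for x
  have k: "k x = i" if "i \<in> I" "x \<in> F i" for i x
  proof -
    have "k x \<in> I \<and> x \<in> F (k x)" unfolding k_def by (rule someI[of _ i]) (use that in auto)
    then show ?thesis using disj[of "k x" i] that by blast
  qed
  have "is_mate R (\<Union>i\<in>I. F i) (\<lambda>x. p (k x) x)"
    unfolding is_mate_def
  proof
    fix u assume "u \<in> (\<Union>i\<in>I. F i)"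
    then obtain i where i: "i \<in> I" "u \<in> F i" by blast
    note q = is_mateD[OF p[OF i(1)] i(2)]
    show "p (k u) u \<in> (\<Union>i\<in>I. F i) \<and> p (k (p (k u) u)) (p (k u) u) = u \<and> p (k u) u \<noteq> u \<and> R u (p (k u) u)"
      using q i k[OF i] k[OF i(1) q(1)] by auto
  qed
  then show ?thesis unfolding matchable_on_def by blast
qed

lemma matchable_on_Un:
  assumes "matchable_on R A" "matchable_on R B" "A \<inter> B = {}"
  shows "matchable_on R (A \<union> B)"
proof -
  have "matchable_on R (\<Union>b\<in>{True,False}. if b then A else B)"
    by (rule matchable_on_UN) (use assms in \<open>auto split: if_splits\<close>)
  then show ?thesis by (simp add: Un_commute)
qed

lemma matchable_on_Un':
  "matchable_on R A \<Longrightarrow> matchable_on R B \<Longrightarrow> A \<inter> B = {} \<Longrightarrow> C = A \<union> B \<Longrightarrow> matchable_on R C"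
  using matchable_on_Un by blast

lemma matchable_on_transport:
  assumes "matchable_on R' (f ` U)" "inj_on f U"
    and "\<And>u v. u \<in> U \<Longrightarrow> v \<in> U \<Longrightarrow> R' (f u) (f v) \<Longrightarrow> R u v"
  shows "matchable_on R U"
proof -
  obtain p where p: "is_mate R' (f ` U) p" using assms(1) unfolding matchable_on_def by blast
  let ?q = "\<lambda>u. inv_into U f (p (f u))"
  have "is_mate R U ?q" unfolding is_mate_def
  proof
    fix u assume u: "u \<in> U"
    note q = is_mateD[OF p imageI[OF u]]
    have a: "?q u \<in> U" "f (?q u) = p (f u)"
      using q(1) by (auto simp: inv_into_into f_inv_into_f)
    then have "?q (?q u) = u" using q(2) u assms(2) by (simp add: inv_into_f_f)
    moreover have "?q u \<noteq> u" using a q(3) by metis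
    ultimately show "?q u \<in> U \<and> ?q (?q u) = u \<and> ?q u \<noteq> u \<and> R u (?q u)"
      using a q(4) assms(3)[OF u a(1)] by simp
  qed
  then show ?thesis unfolding matchable_on_def by blast
qed

lemma matchable_on_mono:
  assumes "matchable_on R U" "\<And>u v. u \<in> U \<Longrightarrow> v \<in> U \<Longrightarrow> R u v \<Longrightarrow> R' u v"
  shows "matchable_on R' U"
  using matchable_on_transport[of R "\<lambda>x. x" U R'] assms by (auto simp: inj_on_def)

lemma is_mate_even_card:
  assumes "finite U" "is_mate R U p"
  shows "even (card U)"
  using assms
proof (induction "card U" arbitrary: U rule: less_induct)
  case less
  show ?case
  proof (cases "U = {}")
    case False
    then obtain u where u: "u \<in> U" by blast
    note q = is_mateD[OF less.prems(2) u]
    have m: "is_mate R (U - {u, p u}) p"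
      using less.prems(2) u q unfolding is_mate_def by (metis Diff_iff insertCI insertE singletonD)
    have c: "card U = card (U - {u, p u}) + 2"
      using u q less.prems(1) by (subst card_Diff_subset) (auto simp: card_insert_if dest: card_mono[of U "{u, p u}"])
    then have "even (card (U - {u, p u}))" using less.hyps m less.prems(1) by simp
    then show ?thesis using c by simp
  qed simp
qed

lemma matchable_on_even_card: "finite U \<Longrightarrow> matchable_on R U \<Longrightarrow> even (card U)"
  unfolding matchable_on_def using is_mate_even_card by blast

section \<open>The theorems of Hall and Tutte\<close>

lemma hall:
  assumes "finite S" "\<And>s. s \<in> S \<Longrightarrow> finite (N s)"
    and "\<And>X. X \<subseteq> S \<Longrightarrow> card X \<le> card (\<Union>(N ` X))"
  shows "\<exists>f. inj_on f S \<and> (\<forall>s\<in>S. f s \<in> N s)"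
  using assms
proof (induction "card S" arbitrary: S N rule: less_induct)
  case less
  show ?case
  proof (cases "S = {}")
    case False
    show ?thesis
    \<comment> \<open>The argument of Halmos and Vaughan. A tight set \<open>X\<close> is served
      from its own neighbourhood and uses it up exactly, so the condition for
      \<open>X \<union> Y\<close> gives the condition for \<open>Y\<close> after that neighbourhood
      is removed.\<close>
    proof (cases "\<exists>X. X \<noteq> {} \<and> X \<subset> S \<and> card (\<Union>(N ` X)) = card X")
      case True
      then obtain X where X: "X \<noteq> {}" "X \<subset> S" "card (\<Union>(N ` X)) = card X" by blast
      have fX: "finite X" using X less.prems(1) finite_subset by blast
      have fin: "finite (\<Union>(N ` Y))" if "Y \<subseteq> S" for Y
        using that less.prems finite_subset by blast
      have "\<exists>f. inj_on f X \<and> (\<forall>s\<in>X. f s \<in> N s)"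
        by (rule less.hyps) (use X less.prems fX in \<open>auto intro: psubset_card_mono\<close>)
      then obtain f where f: "inj_on f X" "\<forall>s\<in>X. f s \<in> N s" by blast
      let ?N = "\<lambda>s. N s - \<Union>(N ` X)"
      have "\<exists>g. inj_on g (S - X) \<and> (\<forall>s\<in>S - X. g s \<in> ?N s)"
      proof (rule less.hyps)
        show "card (S - X) < card S"
          using X less.prems(1) by (intro psubset_card_mono) auto
      next
        fix Y assume Y: "Y \<subseteq> S - X"
        have "card X + card Y = card (X \<union> Y)"
          using Y fX less.prems(1) finite_subset[of Y S] by (subst card_Un_disjoint) auto
        also have "\<dots> \<le> card (\<Union>(N ` (X \<union> Y)))" using less.prems(3)[of "X \<union> Y"] X Y by blast
        also have "\<Union>(N ` (X \<union> Y)) = \<Union>(N ` X) \<union> \<Union>(?N ` Y)" by auto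
        also have "card \<dots> = card (\<Union>(N ` X)) + card (\<Union>(?N ` Y))"
          by (rule card_Un_disjoint) (use fin[of X] fin[of Y] X Y finite_subset in auto)
        finally show "card Y \<le> card (\<Union>(?N ` Y))" using X(3) by simp
      qed (use less.prems in auto)
      then obtain g where g: "inj_on g (S - X)" "\<forall>s\<in>S - X. g s \<in> ?N s" by blast
      have fg: "f x \<noteq> g y" if "x \<in> X" "y \<in> S - X" for x y using that f(2) g(2) by auto
      have "inj_on (\<lambda>s. if s \<in> X then f s else g s) S"
      proof (rule inj_onI)
        fix x y assume "x \<in> S" "y \<in> S" "(if x \<in> X then f x else g x) = (if y \<in> X then f y else g y)"
        then show "x = y" using fg[of x y] fg[of y x] inj_onD[OF f(1), of x y] inj_onD[OF g(1), of x y]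
          by (auto split: if_splits)
      qed
      moreover have "\<forall>s\<in>S. (if s \<in> X then f s else g s) \<in> N s" using f g by auto
      ultimately show ?thesis by blast
    next
      case tight: False
      obtain s where s: "s \<in> S" using False by blast
      have "card {s} \<le> card (N s)" using less.prems(3)[of "{s}"] s by simp
      \<comment> \<open>Without a tight proper subset every such set has a neighbour to spare, so
        \<open>t\<close> may be reserved for \<open>s\<close>.\<close>
      then obtain t where t: "t \<in> N s" by fastforce
      let ?N = "\<lambda>s. N s - {t}"
      have "\<exists>g. inj_on g (S - {s}) \<and> (\<forall>x\<in>S - {s}. g x \<in> ?N x)"
      proof (rule less.hyps)
        show "card (S - {s}) < card S"
          using s less.prems(1) by (intro psubset_card_mono) auto
      next
        fix Y assume Y: "Y \<subseteq> S - {s}"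
        show "card Y \<le> card (\<Union>(?N ` Y))"
        proof (cases "Y = {}")
          case Fa: False
          have ne: "card (\<Union>(N ` Y)) \<noteq> card Y" using tight Y s Fa by blast
          have le: "card Y \<le> card (\<Union>(N ` Y))" using less.prems(3)[of Y] Y by blast
          have eq: "\<Union>(?N ` Y) = \<Union>(N ` Y) - {t}" by auto
          have "finite (\<Union>(N ` Y))" using Y less.prems(1,2) finite_subset[of Y S] by blast
          then have "card (\<Union>(N ` Y)) - 1 \<le> card (\<Union>(N ` Y) - {t})" by (simp add: card_Diff_singleton_if del: UN_iff)
          then show ?thesis using ne le unfolding eq by linarith
        qed simp
      qed (use less.prems in auto)
      then obtain g where g: "inj_on g (S - {s})" "\<forall>x\<in>S - {s}. g x \<in> ?N x" by blast
      have "inj_on (g(s := t)) S"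
        using g by (auto simp: inj_on_def)
      moreover have "\<forall>x\<in>S. (g(s := t)) x \<in> N x" using g t by auto
      ultimately show ?thesis by blast
    qed
  qed simp
qed

locale sym_rel =
  fixes R :: "'v \<Rightarrow> 'v \<Rightarrow> bool"
  assumes sym: "R u v \<Longrightarrow> R v u" and irrefl: "\<not> R u u"
begin

text \<open>The members of \<open>\<C>\<close> need not be connected: they are unions of components.\<close>

definition parts :: "'v set \<Rightarrow> 'v set \<Rightarrow> 'v set set \<Rightarrow> bool" where
  "parts V S \<C> \<longleftrightarrow> S \<subseteq> V \<and> \<Union>\<C> = V - S \<and> {} \<notin> \<C> \<and>
     (\<forall>C D. C \<in> \<C> \<longrightarrow> D \<in> \<C> \<longrightarrow> C \<noteq> D \<longrightarrow> C \<inter> D = {}) \<and>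
     (\<forall>C D x y. C \<in> \<C> \<longrightarrow> D \<in> \<C> \<longrightarrow> C \<noteq> D \<longrightarrow> x \<in> C \<longrightarrow> y \<in> D \<longrightarrow> \<not> R x y)"

definition odds :: "'v set set \<Rightarrow> 'v set set" where
  "odds \<C> = {C \<in> \<C>. odd (card C)}"

lemma partsD:
  assumes "parts V S \<C>"
  shows "S \<subseteq> V" "\<Union>\<C> = V - S" "{} \<notin> \<C>"
    "\<And>C D. C \<in> \<C> \<Longrightarrow> D \<in> \<C> \<Longrightarrow> C \<noteq> D \<Longrightarrow> C \<inter> D = {}"
    "\<And>C D x y. C \<in> \<C> \<Longrightarrow> D \<in> \<C> \<Longrightarrow> C \<noteq> D \<Longrightarrow> x \<in> C \<Longrightarrow> y \<in> D \<Longrightarrow> \<not> R x y"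
proof -
  note P = assms[unfolded parts_def]
  show "S \<subseteq> V" "\<Union>\<C> = V - S" "{} \<notin> \<C>" using P by simp_all
  show "\<And>C D. C \<in> \<C> \<Longrightarrow> D \<in> \<C> \<Longrightarrow> C \<noteq> D \<Longrightarrow> C \<inter> D = {}" using P by simp
  show "\<And>C D x y. C \<in> \<C> \<Longrightarrow> D \<in> \<C> \<Longrightarrow> C \<noteq> D \<Longrightarrow> x \<in> C \<Longrightarrow> y \<in> D \<Longrightarrow> \<not> R x y" using P by metis
qed

lemma parts_finite:
  assumes "finite V" "parts V S \<C>"
  shows "finite S" "finite \<C>" "\<And>C. C \<in> \<C> \<Longrightarrow> finite C"
proof -
  show "finite S" using assms(1) partsD(1)[OF assms(2)] finite_subset by auto
  have "\<Union>\<C> \<subseteq> V" using partsD(2)[OF assms(2)] by simp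
  then have f: "finite (\<Union>\<C>)" using assms(1) by (rule finite_subset)
  then show "finite \<C>" by (rule finite_UnionD)
  show "\<And>C. C \<in> \<C> \<Longrightarrow> finite C" using f finite_subset[of _ "\<Union>\<C>"] by blast
qed

lemma card_parts_parity:
  assumes "finite V" "parts V S \<C>"
  shows "even (card V) \<longleftrightarrow> even (card S + card (odds \<C>))"
proof -
  note fin = parts_finite[OF assms] and P = partsD[OF assms(2)]
  have "card V = card S + card (\<Union>\<C>)"
    using P assms(1) fin(1) by (metis card_Diff_subset card_mono le_add_diff_inverse)
  moreover have "card (\<Union>\<C>) = (\<Sum>C\<in>\<C>. card C)"
    using P fin by (intro card_Union_disjoint) (auto simp: pairwise_def disjnt_def)
  moreover have "even (\<Sum>C\<in>\<C>. card C) \<longleftrightarrow> even (card {C \<in> \<C>. odd (card C)})"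
    using fin(2) by (rule even_sum_iff)
  ultimately show ?thesis unfolding odds_def by simp
qed

text \<open>Vertices \<open>A\<close> taken out of \<open>S\<close> glue exactly the parts adjacent
  to them into one new part. Comparing the numbers of odd parts before and after yields the Hall
  condition for \<open>A\<close>, here in Tutte's theorem and later for minimal barriers.\<close>

lemma parts_shrink:
  assumes "parts V S \<C>" "A \<subseteq> S" "A \<noteq> {}"
  shows "parts V (S - A) (insert (A \<union> \<Union>{C \<in> \<C>. \<exists>a\<in>A. \<exists>c\<in>C. R a c}) (\<C> - {C \<in> \<C>. \<exists>a\<in>A. \<exists>c\<in>C. R a c}))"
proof -
  note P = partsD[OF assms(1)]
  let ?G = "{C \<in> \<C>. \<exists>a\<in>A. \<exists>c\<in>C. R a c}"
  define Q where "Q = A \<union> \<Union>?G"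
  have sep1: "Q \<inter> D = {}" if "D \<in> \<C> - ?G" for D
  proof -
    have "A \<inter> D = {}" using that P(2) assms(2) by blast
    moreover have "\<Union>?G \<inter> D = {}" using that P(4) by blast
    ultimately show ?thesis unfolding Q_def by blast
  qed
  have sep2: "\<not> R x y" if "D \<in> \<C> - ?G" "x \<in> Q" "y \<in> D" for D x y
    using that P(5)[of _ D x y] unfolding Q_def by blast
  have sep3: "\<not> R x y" if "D \<in> \<C> - ?G" "y \<in> Q" "x \<in> D" for D x y
    using sep2[OF that] sym by blast
  show ?thesis
    unfolding parts_def Q_def[symmetric]
  proof (intro conjI allI impI)
    show "\<Union> (insert Q (\<C> - ?G)) = V - (S - A)"
    proof -
      have "\<Union> (insert Q (\<C> - ?G)) = A \<union> \<Union>\<C>" unfolding Q_def by auto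
      also have "\<dots> = V - (S - A)" using P(1,2) assms(2) by auto
      finally show ?thesis .
    qed
    show "{} \<notin> insert (Q) (\<C> - ?G)" using P(3) assms(3) unfolding Q_def by auto
    show "S - A \<subseteq> V" using P(1) by auto
  next
    fix C D assume C: "C \<in> insert (Q) (\<C> - ?G)" and D: "D \<in> insert (Q) (\<C> - ?G)"
      and ne: "C \<noteq> D"
    consider "C = Q" "D \<in> \<C> - ?G" | "D = Q" "C \<in> \<C> - ?G" | "C \<in> \<C>" "D \<in> \<C>"
      using C D ne by (metis (no_types, lifting) DiffD1 insertE)
    then have "C \<inter> D = {} \<and> (\<forall>x\<in>C. \<forall>y\<in>D. \<not> R x y)"
    proof cases
      case 1 then show ?thesis using sep1[OF 1(2)] sep2[OF 1(2)] by simp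
    next
      case 2 then show ?thesis using sep1[OF 2(2)] sep3[OF 2(2)] by (simp add: Int_commute)
    next
      case 3 then show ?thesis using P(4)[of C D] P(5)[of C D] ne by simp
    qed
    then show "C \<inter> D = {}" and "\<And>x y. x \<in> C \<Longrightarrow> y \<in> D \<Longrightarrow> \<not> R x y" by auto
  qed
qed

lemma parts_refine:
  assumes "parts V S \<C>" "C \<in> \<C>" "parts C T \<D>"
  shows "parts V (S \<union> T) (\<C> - {C} \<union> \<D>)"
proof -
  note P = partsD[OF assms(1)] and Q = partsD[OF assms(3)]
  have sub: "D \<subseteq> C" if "D \<in> \<D>" for D using Q(2) that by blast
  have CT: "C \<inter> S = {}" "C \<subseteq> V" using P(2) assms(2) by blast+
  have "D \<inter> C = {}" if "D \<in> \<C> - {C}" for D using that P(4)[of D C] assms(2) by simp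
  then have "\<Union>(\<C> - {C}) = \<Union>\<C> - C" using assms(2) by blast
  then have U: "\<Union>(\<C> - {C}) = V - S - C" using P(2) by simp
  show ?thesis
    unfolding parts_def
  proof (intro conjI allI impI)
    show "S \<union> T \<subseteq> V" using P(1) Q(1) CT by blast
    show "\<Union> (\<C> - {C} \<union> \<D>) = V - (S \<union> T)" using U Q(1,2) CT by auto
    show "{} \<notin> \<C> - {C} \<union> \<D>" using P(3) Q(3) by blast
  next
    fix D E assume D: "D \<in> \<C> - {C} \<union> \<D>" and E: "E \<in> \<C> - {C} \<union> \<D>" and ne: "D \<noteq> E"
    consider "D \<in> \<C> - {C}" "E \<in> \<C> - {C}" | "D \<in> \<C> - {C}" "E \<in> \<D>" | "D \<in> \<D>" "E \<in> \<C> - {C}" | "D \<in> \<D>" "E \<in> \<D>"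
      using D E by blast
    then have "D \<inter> E = {} \<and> (\<forall>x\<in>D. \<forall>y\<in>E. \<not> R x y)"
    proof cases
      case 1 then show ?thesis using P(4)[of D E] P(5)[of D E] ne by simp
    next
      case 2 then show ?thesis using P(4)[of D C] P(5)[of D C] sub[of E] assms(2) by blast
    next
      case 3 then show ?thesis using P(4)[of C E] P(5)[of C E] sub[of D] assms(2) by blast
    next
      case 4 then show ?thesis using Q(4)[of D E] Q(5)[of D E] ne by simp
    qed
    then show "D \<inter> E = {}" and "\<And>x y. x \<in> D \<Longrightarrow> y \<in> E \<Longrightarrow> \<not> R x y" by auto
  qed
qed

lemma card_odds_refine:
  assumes "finite V" "parts V S \<C>" "C \<in> odds \<C>" "parts C T \<D>"
  shows "card (odds (\<C> - {C} \<union> \<D>)) = card (odds \<C>) - 1 + card (odds \<D>)"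
proof -
  have C: "C \<in> \<C>" using assms(3) unfolding odds_def by simp
  note P = partsD[OF assms(2)] and Q = partsD[OF assms(4)] and fin = parts_finite[OF assms(1,2)]
  have fD: "finite \<D>" by (rule parts_finite(2)[OF fin(3)[OF C] assms(4)])
  \<comment> \<open>Here it matters that parts are nonempty: a common member would be contained in
    \<open>C\<close> and disjoint from it.\<close>
  have "(\<C> - {C}) \<inter> \<D> = {}"
  proof (rule ccontr)
    assume "(\<C> - {C}) \<inter> \<D> \<noteq> {}"
    then obtain D where D: "D \<in> \<C>" "D \<noteq> C" "D \<in> \<D>" by blast
    then have "D \<subseteq> C" using Q(2) by blast
    then have "D = {}" using P(4)[OF D(1) C D(2)] by auto
    then show False using D(1) P(3) by simp
  qed
  then have "card (odds (\<C> - {C} \<union> \<D>)) = card (odds \<C> - {C}) + card (odds \<D>)"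
    using fin(2) fD unfolding odds_def by (subst card_Un_disjoint[symmetric]) (auto intro: arg_cong[where f = card])
  then show ?thesis using assms(3) by simp
qed

lemma matchable_on_star_union:
  assumes "inj_on f S" "\<And>s. s \<in> S \<Longrightarrow> \<exists>c\<in>f s. R s c \<and> matchable_on R (f s - {c})"
    and "\<And>s t. s \<in> S \<Longrightarrow> t \<in> S \<Longrightarrow> s \<noteq> t \<Longrightarrow> f s \<inter> f t = {}"
    and "S \<inter> \<Union>(f ` S) = {}"
  shows "matchable_on R (S \<union> \<Union>(f ` S))"
proof -
  have "matchable_on R (\<Union>s\<in>S. insert s (f s))"
  proof (rule matchable_on_UN)
    fix s assume s: "s \<in> S"
    then obtain c where c: "c \<in> f s" "R s c" "matchable_on R (f s - {c})" using assms(2) by blast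
    show "matchable_on R (insert s (f s))"
      by (rule matchable_on_Un'[OF matchable_on_pair[of R s c] c(3)])
        (use c s assms(4) sym irrefl in auto)
  qed (use assms(3,4) in blast)
  moreover have "(\<Union>s\<in>S. insert s (f s)) = S \<union> \<Union>(f ` S)" by auto
  ultimately show ?thesis by simp
qed

text \<open>Hall's theorem gives every vertex of \<open>S'\<close> a part of its own. As the numbers
  agree, every part is used, and a part that has lost its attached vertex is matchable inside
  itself.\<close>

lemma hall_parts:
  assumes "finite V" "parts V S \<C>" "S' \<subseteq> S" "\<C>' \<subseteq> \<C>" "card S' = card \<C>'"
    and surplus: "\<And>A. A \<subseteq> S' \<Longrightarrow> A \<noteq> {} \<Longrightarrow> card A \<le> card {C \<in> \<C>'. \<exists>a\<in>A. \<exists>c\<in>C. R a c}"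
    and crit: "\<And>s C c. s \<in> S' \<Longrightarrow> C \<in> \<C>' \<Longrightarrow> c \<in> C \<Longrightarrow> R s c \<Longrightarrow> matchable_on R (C - {c})"
  shows "matchable_on R (S' \<union> \<Union>\<C>')"
proof -
  note P = partsD[OF assms(2)] and fin = parts_finite[OF assms(1,2)]
  have fC: "finite \<C>'" and fS: "finite S'" using fin assms(3,4) finite_subset by blast+
  let ?N = "\<lambda>s. {C \<in> \<C>'. \<exists>c\<in>C. R s c}"
  have "\<exists>f. inj_on f S' \<and> (\<forall>s\<in>S'. f s \<in> ?N s)"
  proof (rule hall)
    fix A assume A: "A \<subseteq> S'"
    have "\<Union>(?N ` A) = {C \<in> \<C>'. \<exists>a\<in>A. \<exists>c\<in>C. R a c}" by blast
    then show "card A \<le> card (\<Union>(?N ` A))" using surplus[OF A] by (cases "A = {}") simp_all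
  qed (use fC fS in auto)
  then obtain f where f: "inj_on f S'" "\<And>s. s \<in> S' \<Longrightarrow> f s \<in> ?N s" by blast
  have im: "f ` S' = \<C>'"
    by (rule card_subset_eq[OF fC]) (use f assms(5) in \<open>auto simp: card_image\<close>)
  have "matchable_on R (S' \<union> \<Union>(f ` S'))"
  proof (rule matchable_on_star_union[OF f(1)])
    fix s assume s: "s \<in> S'"
    then show "\<exists>c\<in>f s. R s c \<and> matchable_on R (f s - {c})" using f(2)[OF s] crit[OF s, of "f s"] by blast
  next
    fix s t assume "s \<in> S'" "t \<in> S'" "s \<noteq> t"
    then show "f s \<inter> f t = {}"
      using P(4)[of "f s" "f t"] f(2)[of s] f(2)[of t] inj_onD[OF f(1), of s t] assms(4) by blast
  next
    show "S' \<inter> \<Union> (f ` S') = {}" using im P(2) assms(3,4) by blast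
  qed
  then show ?thesis using im by simp
qed

text \<open>In a minimal counterexample no \<open>S\<close> has more odd parts than vertices. A
  largest \<open>S\<close> with equality has only odd parts, each of them matchable after the loss
  of any one vertex, and Hall's theorem then matches \<open>V\<close> after all.\<close>

theorem tutte:
  assumes "finite V" "\<not> matchable_on R V"
  shows "\<exists>S \<C>. parts V S \<C> \<and> card S < card (odds \<C>)"
  using assms
proof (induction "card V" arbitrary: V rule: less_induct)
  case less
  show ?case
  proof (rule ccontr)
    assume neg: "\<not> ?thesis"
    then have le: "card (odds \<C>) \<le> card S" if "parts V S \<C>" for S \<C> using that by force
    have V: "V \<noteq> {}" using less.prems(2) by auto
    have p0: "parts V {} {V}" using V unfolding parts_def by auto
    \<comment> \<open>The choice \<open>S = {}\<close> shows that \<open>V\<close> has even order,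
      so equality is attained at size 0.\<close>
    have "odds {V} = {} "
      using le[OF p0] card_gt_0_iff[of "odds {V}"] unfolding odds_def by auto
    define tight where "tight k \<longleftrightarrow> (\<exists>S \<C>. parts V S \<C> \<and> card (odds \<C>) = card S \<and> k = card S)" for k
    have t0: "tight 0" unfolding tight_def
      by (rule exI[of _ "{}"], rule exI[of _ "{V}"]) (use p0 \<open>odds {V} = {}\<close> in simp)
    have tb: "k \<le> card V" if "tight k" for k
    proof -
      obtain S \<C> where S: "parts V S \<C>" "k = card S" using \<open>tight k\<close> unfolding tight_def by blast
      show ?thesis unfolding S(2) by (rule card_mono[OF less.prems(1) partsD(1)[OF S(1)]])
    qed
    define m where "m = (GREATEST k. tight k)"
    have "tight m" unfolding m_def by (rule GreatestI_nat[of tight 0 "card V"]) (use t0 tb in auto)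
    have mx: "k \<le> m" if "tight k" for k
      unfolding m_def by (rule Greatest_le_nat[where P = tight and b = "card V"]) (use that tb in auto)
    obtain S \<C> where SC: "parts V S \<C>" "card (odds \<C>) = card S" "m = card S"
      using \<open>tight m\<close> unfolding tight_def by blast
    note P = partsD[OF SC(1)] and fin = parts_finite[OF less.prems(1) SC(1)]
    have bigger: False if "C \<in> \<C>" "parts C T \<D>" "card S + card T \<le> card (odds (\<C> - {C} \<union> \<D>))" "T \<noteq> {}" for C T \<D>
    proof -
      have pr: "parts V (S \<union> T) (\<C> - {C} \<union> \<D>)" by (rule parts_refine[OF SC(1) that(1,2)])
      have T: "finite T" "S \<inter> T = {}"
        using parts_finite(1)[OF fin(3)[OF that(1)] that(2)] partsD(1)[OF that(2)] P(2) that(1) by auto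
      have c: "card (S \<union> T) = card S + card T" using T fin(1) by (simp add: card_Un_disjoint)
      have "tight (card (S \<union> T))" unfolding tight_def using pr le[OF pr] that(3) c by (intro exI[of _ "S \<union> T"]) auto
      then have "card (S \<union> T) \<le> card S" using mx SC(3) by simp
      then show False using c T(1) that(4) by simp
    qed
    \<comment> \<open>Moving one vertex of an even part into \<open>S\<close> would create one more
      odd part, and equality would hold for a larger \<open>S\<close>.\<close>
    have odd: "odd (card C)" if C: "C \<in> \<C>" for C
    proof (rule ccontr)
      assume ev: "\<not> odd (card C)"
      obtain c where c: "c \<in> C" using P(3) C by (cases "C = {}") auto
      have ne: "C - {c} \<noteq> {}" using ev fin(3)[OF C] c
        by (metis card.empty card_Suc_Diff1 odd_one One_nat_def)
      have pr: "parts C {c} {C - {c}}" using c ne unfolding parts_def by auto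
      have no: "C - {c} \<notin> \<C>" using P(4)[of "C - {c}" C] C ne c by blast
      have "odd (card (C - {c}))" using ev c fin(3)[OF C] ne by (auto simp: card_gt_0_iff)
      then have "odds (\<C> - {C} \<union> {C - {c}}) = insert (C - {c}) (odds \<C>)" using ev C unfolding odds_def by auto
      then have "card (odds (\<C> - {C} \<union> {C - {c}})) = card S + 1"
        using no SC(2) fin(2) unfolding odds_def by (simp add: card_insert_if)
      then show False using bigger[OF C pr] by simp
    qed
    then have oddsC: "odds \<C> = \<C>" unfolding odds_def by auto
    \<comment> \<open>Otherwise the induction hypothesis for \<open>C - {c}\<close> gives a set
      \<open>T\<close> with, by parity, at least two odd parts more than vertices. This excess pays
      for \<open>c\<close> and for the lost odd part \<open>C\<close>, so \<open>insert c T\<close>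
      enlarges \<open>S\<close>.\<close>
    have crit: "matchable_on R (C - {c})" if C: "C \<in> \<C>" and c: "c \<in> C" for C c
    proof (rule ccontr)
      assume nm: "\<not> matchable_on R (C - {c})"
      have fC: "finite (C - {c})" using fin(3)[OF C] by simp
      have CV: "C \<subseteq> V" using P(2) C by blast
      have "card (C - {c}) < card V"
        using c CV less.prems(1) by (intro psubset_card_mono) auto
      then obtain T \<D> where T: "parts (C - {c}) T \<D>" "card T < card (odds \<D>)"
        using less.hyps[OF _ fC nm] by blast
      have "even (card (C - {c}))" using odd[OF C] c fin(3)[OF C] by simp
      then have "even (card T + card (odds \<D>))" using card_parts_parity[OF fC T(1)] by simp
      then have ge: "card T + 2 \<le> card (odds \<D>)" using T(2) by presburger
      have pr: "parts C (insert c T) \<D>" using T(1) c unfolding parts_def by auto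
      have "finite T" "c \<notin> T" using parts_finite(1)[OF fC T(1)] partsD(1)[OF T(1)] by auto
      then have cT: "card (insert c T) = card T + 1" by simp
      have "0 < card S" using SC(2) oddsC C fin(2) card_gt_0_iff[of \<C>] by auto
      have "C \<in> odds \<C>" using C oddsC by simp
      then have e: "card (odds (\<C> - {C} \<union> \<D>)) = card S - 1 + card (odds \<D>)"
        using card_odds_refine[OF less.prems(1) SC(1) _ pr] SC(2) by simp
      have "card S + card (insert c T) \<le> card (odds (\<C> - {C} \<union> \<D>))"
        unfolding e cT using ge \<open>0 < card S\<close> by linarith
      then show False using bigger[OF C pr] by blast
    qed
    have "matchable_on R (S \<union> \<Union>\<C>)"
    proof (rule hall_parts[OF less.prems(1) SC(1)])
      fix A assume A: "A \<subseteq> S" "A \<noteq> {}"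
      let ?G = "{C \<in> \<C>. \<exists>a\<in>A. \<exists>c\<in>C. R a c}"
      let ?C' = "insert (A \<union> \<Union>?G) (\<C> - ?G)"
      have pr: "parts V (S - A) ?C'" by (rule parts_shrink[OF SC(1) A])
      have "finite (odds ?C')"
        by (rule finite_subset[OF _ parts_finite(2)[OF less.prems(1) pr]]) (auto simp: odds_def)
      \<comment> \<open>The parts not adjacent to \<open>A\<close> stay odd when \<open>A\<close> is
        returned, so there are at most \<open>card (S - A)\<close> of them, and at least
        \<open>card A\<close> parts are adjacent to \<open>A\<close>.\<close>
      moreover have "\<C> - ?G \<subseteq> odds ?C'" using odd unfolding odds_def by blast
      ultimately have "card (\<C> - ?G) \<le> card (odds ?C')" by (rule card_mono)
      then have "card (\<C> - ?G) \<le> card (S - A)" using le[OF pr] by (rule le_trans)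
      moreover have "card (\<C> - ?G) = card S - card ?G"
        using SC(2) oddsC fin(2) by (subst card_Diff_subset) auto
      moreover have "card (S - A) = card S - card A" using A fin(1) finite_subset by (subst card_Diff_subset) auto
      moreover have "card ?G \<le> card S" using SC(2) oddsC fin(2) card_mono[of \<C> ?G] by auto
      moreover have "card A \<le> card S" using A fin(1) card_mono by blast
      ultimately show "card A \<le> card ?G" by linarith
    qed (use crit SC(2) oddsC in auto)
    moreover have "S \<union> \<Union>\<C> = V" using P(1,2) by auto
    ultimately show False using less.prems(2) by simp
  qed
qed

section \<open>Barriers and the two-ear theorem\<close>

text \<open>Connectedness is stated through cuts because this is how it is used: a nonempty proper
  vertex set has an edge leaving it, and that edge lies in a perfect matching.\<close>

definition mcov :: "'v set \<Rightarrow> bool" where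
  "mcov V \<longleftrightarrow> finite V \<and> 2 \<le> card V \<and>
     (\<forall>X. X \<noteq> {} \<longrightarrow> X \<subset> V \<longrightarrow> (\<exists>x\<in>X. \<exists>y\<in>V - X. R x y)) \<and>
     (\<forall>u\<in>V. \<forall>v\<in>V. R u v \<longrightarrow> matchable_on R (V - {u, v}))"

lemma mcovD:
  assumes "mcov V"
  shows "finite V" "2 \<le> card V" "\<And>X. X \<noteq> {} \<Longrightarrow> X \<subset> V \<Longrightarrow> \<exists>x\<in>X. \<exists>y\<in>V - X. R x y"
    "\<And>u v. u \<in> V \<Longrightarrow> v \<in> V \<Longrightarrow> R u v \<Longrightarrow> matchable_on R (V - {u, v})"
  using assms unfolding mcov_def by auto

lemma mate_with_edge:
  assumes "matchable_on R (V - {u, v})" "u \<in> V" "v \<in> V" "R u v"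
  shows "\<exists>p. is_mate R V p \<and> p u = v \<and> p v = u"
proof -
  obtain p where p: "is_mate R (V - {u, v}) p" using assms(1) unfolding matchable_on_def by blast
  have ne: "u \<noteq> v" using assms(4) irrefl by blast
  have "is_mate R V (p(u := v, v := u))"
    unfolding is_mate_def
  proof
    fix x assume "x \<in> V"
    then consider "x = u" | "x = v" "x \<noteq> u" | "x \<in> V - {u, v}" by blast
    then show "(p(u := v, v := u)) x \<in> V \<and> (p(u := v, v := u)) ((p(u := v, v := u)) x) = x \<and>
        (p(u := v, v := u)) x \<noteq> x \<and> R x ((p(u := v, v := u)) x)"
    proof cases
      case 3
      then show ?thesis using is_mateD[OF p 3] by auto
    qed (use assms ne sym in auto)
  qed
  then show ?thesis using ne by auto
qed

lemma mcov_mate: "mcov V \<Longrightarrow> u \<in> V \<Longrightarrow> v \<in> V \<Longrightarrow> R u v \<Longrightarrow> \<exists>p. is_mate R V p \<and> p u = v \<and> p v = u"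
  using mate_with_edge mcovD(4) by blast

lemma mcov_matchable:
  assumes "mcov V"
  shows "matchable_on R V"
proof -
  obtain v where v: "v \<in> V" using mcovD(2)[OF assms] by fastforce
  have "{v} \<noteq> V" using mcovD(2)[OF assms] by auto
  then obtain y where "y \<in> V" "R v y" using mcovD(3)[OF assms, of "{v}"] v by blast
  then show ?thesis using mcov_mate[OF assms v] unfolding matchable_on_def by blast
qed

text \<open>Every counting argument for barriers sums the sizes of these sets over the parts. The
  set \<open>W\<close> is either all of \<open>V\<close> or \<open>V\<close> without two
  vertices.\<close>

definition leaving :: "('v \<Rightarrow> 'v) \<Rightarrow> 'v set \<Rightarrow> 'v set \<Rightarrow> 'v set" where
  "leaving p W C = {x \<in> C \<inter> W. p x \<notin> C}"

lemma leaving_parity: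
  assumes "finite W" "is_mate R W p"
  shows "even (card (C \<inter> W)) \<longleftrightarrow> even (card (leaving p W C))"
proof -
  have m: "is_mate R (C \<inter> W - leaving p W C) p"
    by (rule is_mate_subset[OF assms(2)]) (use is_mateD[OF assms(2)] in \<open>auto simp: leaving_def\<close>)
  then have "even (card (C \<inter> W - leaving p W C))" using is_mate_even_card assms(1) by blast
  moreover have "card (C \<inter> W) = card (C \<inter> W - leaving p W C) + card (leaving p W C)"
    using assms(1) by (subst card_Un_disjoint[symmetric]) (auto simp: leaving_def intro: arg_cong[where f = card])
  ultimately show ?thesis by simp
qed

lemma leaving_empty_matchable:
  assumes "is_mate R W p" "leaving p W C = {}"
  shows "matchable_on R (C \<inter> W)"
proof -
  have "is_mate R (C \<inter> W) p"
    by (rule is_mate_subset[OF assms(1)]) (use is_mateD[OF assms(1)] assms(2) in \<open>auto simp: leaving_def\<close>)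
  then show ?thesis unfolding matchable_on_def by blast
qed

lemma leaving_to_S:
  assumes "parts V S \<C>" "W \<subseteq> V" "is_mate R W p" "C \<in> \<C>" "x \<in> leaving p W C"
  shows "p x \<in> S \<inter> W"
proof -
  have x: "x \<in> C" "x \<in> W" "p x \<notin> C" using assms(5) unfolding leaving_def by auto
  note q = is_mateD[OF assms(3) x(2)]
  have "p x \<notin> D" if "D \<in> \<C>" for D
    using partsD(5)[OF assms(1) assms(4) that, of x "p x"] x q(4) by blast
  then have "p x \<notin> V - S" using partsD(2)[OF assms(1)] by blast
  then show ?thesis using q(1) assms(2) by blast
qed

text \<open>Parts are mutually nonadjacent, so the partners of leaving vertices are distinct members
  of \<open>S\<close> that are not matched inside \<open>S\<close>.\<close>

lemma sum_leaving_le: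
  assumes "finite V" "parts V S \<C>" "W \<subseteq> V" "is_mate R W p"
  shows "(\<Sum>C\<in>\<C>. card (leaving p W C)) \<le> card {s \<in> S \<inter> W. p s \<notin> S}"
proof -
  note fin = parts_finite[OF assms(1,2)] and P = partsD[OF assms(2)]
  have sub: "leaving p W C \<subseteq> C \<inter> W" for C unfolding leaving_def by auto
  have "(\<Sum>C\<in>\<C>. card (leaving p W C)) = card (\<Union>C\<in>\<C>. leaving p W C)"
  proof (rule card_UN_disjoint[symmetric])
    show "\<forall>C\<in>\<C>. finite (leaving p W C)" using fin(3) sub finite_subset by (metis inf.bounded_iff)
    show "\<forall>C\<in>\<C>. \<forall>D\<in>\<C>. C \<noteq> D \<longrightarrow> leaving p W C \<inter> leaving p W D = {}"
      using P(4) sub by (metis (no_types, lifting) disjoint_iff inf.bounded_iff subsetD)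
  qed (rule fin(2))
  also have "\<dots> \<le> card {s \<in> S \<inter> W. p s \<notin> S}"
  proof (rule card_inj_on_le[where f = p])
    have W: "(\<Union>C\<in>\<C>. leaving p W C) \<subseteq> W" using sub by blast
    show "inj_on p (\<Union>C\<in>\<C>. leaving p W C)"
      using W is_mateD(2)[OF assms(4)] by (metis inj_on_def subsetD)
    show "p ` (\<Union>C\<in>\<C>. leaving p W C) \<subseteq> {s \<in> S \<inter> W. p s \<notin> S}"
    proof
      fix y assume "y \<in> p ` (\<Union>C\<in>\<C>. leaving p W C)"
      then obtain C x where x: "C \<in> \<C>" "x \<in> leaving p W C" "y = p x" by blast
      have "x \<in> C" "x \<in> W" using sub x(2) by auto
      then have "p y = x" "x \<notin> S" using is_mateD(2)[OF assms(4)] x(1,3) P(2) by auto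
      then show "y \<in> {s \<in> S \<inter> W. p s \<notin> S}" using leaving_to_S[OF assms(2,3,4) x(1,2)] x(3) by simp
    qed
    show "finite {s \<in> S \<inter> W. p s \<notin> S}" using fin(1) by simp
  qed
  finally show ?thesis .
qed

lemma sum_leaving_le_card:
  assumes "finite V" "parts V S \<C>" "W \<subseteq> V" "is_mate R W p"
  shows "(\<Sum>C\<in>\<C>. card (leaving p W C)) \<le> card (S \<inter> W)"
proof -
  have "card {s \<in> S \<inter> W. p s \<notin> S} \<le> card (S \<inter> W)"
    by (rule card_mono) (use parts_finite(1)[OF assms(1,2)] in auto)
  then show ?thesis using sum_leaving_le[OF assms] by linarith
qed

text \<open>Equality in Tutte's condition. Only one inequality is demanded: the other one holds in a
  matching covered graph, where moreover all parts turn out to be odd.\<close>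

definition barrier :: "'v set \<Rightarrow> 'v set \<Rightarrow> 'v set set \<Rightarrow> bool" where
  "barrier V S \<C> \<longleftrightarrow> parts V S \<C> \<and> S \<noteq> {} \<and> card S \<le> card (odds \<C>)"

lemma sum_ge_card:
  assumes "finite A" "B \<subseteq> A" "\<And>x. x \<in> B \<Longrightarrow> 1 \<le> f x"
  shows "card B \<le> (\<Sum>x\<in>A. f x :: nat)"
proof -
  have "card B = (\<Sum>x\<in>B. 1)" by simp
  also have "\<dots> \<le> (\<Sum>x\<in>B. f x)" by (rule sum_mono) (use assms in auto)
  also have "\<dots> \<le> (\<Sum>x\<in>A. f x)" by (rule sum_mono2) (use assms in auto)
  finally show ?thesis .
qed

lemma sum_ge_card2:
  assumes "finite A" "a \<in> A" "B \<subseteq> A - {a}" "\<And>x. x \<in> B \<Longrightarrow> 1 \<le> f x"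
  shows "card B + f a \<le> (\<Sum>x\<in>A. f x :: nat)"
  using sum_ge_card[of "A - {a}" B f] assms by (simp add: sum.remove)

context
  fixes V S \<C>
  assumes mc: "mcov V" and bar: "barrier V S \<C>"
begin

private lemma pr: "parts V S \<C>" and Sne: "S \<noteq> {}" and ge: "card S \<le> card (odds \<C>)"
  using bar unfolding barrier_def by auto

private lemmas P = partsD[OF pr] and fin = parts_finite[OF mcovD(1)[OF mc] pr]

private lemma odd_leaves: "is_mate R V p \<Longrightarrow> C \<in> odds \<C> \<Longrightarrow> 1 \<le> card (leaving p V C)"
proof -
  assume p: "is_mate R V p" and C: "C \<in> odds \<C>"
  then have "C \<inter> V = C" using P(2) unfolding odds_def by blast
  then have "odd (card (leaving p V C))"
    using leaving_parity[OF mcovD(1)[OF mc] p, of C] C unfolding odds_def by simp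
  then show ?thesis by (rule odd_pos[THEN Suc_leI, unfolded One_nat_def[symmetric]])
qed

text \<open>A perfect matching through an edge inside \<open>S\<close> would leave fewer than
  \<open>card S\<close> members of \<open>S\<close> for at least \<open>card S\<close> odd parts,
  each of which needs one.\<close>

lemma barrier_independent:
  assumes "s \<in> S" "t \<in> S"
  shows "\<not> R s t"
proof
  assume st: "R s t"
  obtain p where p: "is_mate R V p" "p s = t" using mcov_mate[OF mc _ _ st] assms P(1) by blast
  have "card (odds \<C>) \<le> (\<Sum>C\<in>\<C>. card (leaving p V C))"
    by (rule sum_ge_card) (use fin odd_leaves[OF p(1)] in \<open>auto simp: odds_def\<close>)
  also have "\<dots> \<le> card {s \<in> S \<inter> V. p s \<notin> S}" by (rule sum_leaving_le[OF mcovD(1)[OF mc] pr order_refl p(1)])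
  also have "\<dots> < card S"
    by (rule psubset_card_mono) (use fin(1) assms p(2) in auto)
  finally show False using ge by simp
qed

text \<open>By connectedness some edge leaves \<open>C\<close>. A perfect matching through it would
  spend a member of \<open>S\<close> on the even part \<open>C\<close> in addition to one on every
  odd part.\<close>

lemma barrier_odd:
  assumes C: "C \<in> \<C>"
  shows "odd (card C)"
proof (rule ccontr)
  assume ev: "\<not> odd (card C)"
  have "C \<noteq> {}" "C \<subset> V" using P(1,2,3) C Sne by blast+
  then obtain x y where xy: "x \<in> C" "y \<in> V - C" "R x y" using mcovD(3)[OF mc] by blast
  have "x \<in> V" using xy(1) \<open>C \<subset> V\<close> by blast
  then obtain p where p: "is_mate R V p" "p x = y" using mcov_mate[OF mc _ _ xy(3)] xy(2) by blast
  have "x \<in> leaving p V C" using xy p(2) \<open>x \<in> V\<close> unfolding leaving_def by auto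
  then have "1 \<le> card (leaving p V C)"
    using fin(3)[OF C] card_gt_0_iff[of "leaving p V C"] unfolding leaving_def by fastforce
  then have "card (odds \<C>) + 1 \<le> card (odds \<C>) + card (leaving p V C)" by simp
  also have "\<dots> \<le> (\<Sum>C\<in>\<C>. card (leaving p V C))"
    by (rule sum_ge_card2) (use fin odd_leaves[OF p(1)] C ev in \<open>auto simp: odds_def\<close>)
  also have "\<dots> \<le> card (S \<inter> V)" by (rule sum_leaving_le_card[OF mcovD(1)[OF mc] pr order_refl p(1)])
  also have "S \<inter> V = S" using P(1) by blast
  finally show False using ge by simp
qed

private lemma oddsC: "odds \<C> = \<C>" using barrier_odd unfolding odds_def by auto

lemma barrier_leaving:
  assumes p: "is_mate R V p" and C: "C \<in> \<C>"
  shows "card (leaving p V C) = 1"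
proof -
  have SV: "S \<inter> V = S" using P(1) by blast
  have "card (\<C> - {C}) + card (leaving p V C) \<le> (\<Sum>C\<in>\<C>. card (leaving p V C))"
    by (rule sum_ge_card2) (use fin odd_leaves[OF p] C oddsC in auto)
  also have "\<dots> \<le> card S" using sum_leaving_le_card[OF mcovD(1)[OF mc] pr order_refl p] SV by simp
  also have "\<dots> \<le> card \<C>" using ge oddsC by simp
  finally have "card (leaving p V C) \<le> 1" using C fin(2) by (auto simp: card_gt_0_iff)
  then show ?thesis using odd_leaves[OF p, of C] C oddsC by simp
qed

lemma barrier_card: "card \<C> = card S"
proof -
  obtain p where p: "is_mate R V p" using mcov_matchable[OF mc] unfolding matchable_on_def by blast
  have "card \<C> = (\<Sum>C\<in>\<C>. card (leaving p V C))" using barrier_leaving[OF p] by simp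
  also have "\<dots> \<le> card S"
    using sum_leaving_le_card[OF mcovD(1)[OF mc] pr order_refl p] P(1) by (simp add: Int_absorb2)
  finally show ?thesis using ge oddsC by simp
qed

lemma barrier_leaving_edge:
  assumes "is_mate R V p" "C \<in> \<C>" "x \<in> C" "p x \<notin> C"
  shows "leaving p V C = {x}"
proof -
  have "x \<in> leaving p V C" using assms P(2) unfolding leaving_def by blast
  moreover obtain z where "leaving p V C = {z}" using barrier_leaving[OF assms(1,2)] card_1_singletonE by blast
  ultimately show ?thesis by simp
qed

text \<open>The perfect matching through the edge crosses the boundary of \<open>C\<close> nowhere
  else, so it restricts to \<open>C - {c}\<close>.\<close>

lemma barrier_edge:
  assumes "C \<in> \<C>" "c \<in> C" "y \<in> V - C" "R c y"
  shows "y \<in> S" "matchable_on R (C - {c})"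
proof -
  have c: "c \<in> V" using assms(1,2) P(2) by blast
  obtain p where p: "is_mate R V p" "p c = y" using mcov_mate[OF mc c _ assms(4)] assms(3) by blast
  have lv: "leaving p V C = {c}" using barrier_leaving_edge[OF p(1) assms(1,2)] p(2) assms(3) by blast
  show "y \<in> S" using leaving_to_S[OF pr order_refl p(1) assms(1), of c] lv p(2) by auto
  have CV: "C \<subseteq> V" using assms(1) P(2) by blast
  have "is_mate R (C - {c}) p"
  proof (rule is_mate_subset[OF p(1)])
    fix u assume u: "u \<in> C - {c}"
    then have "u \<notin> leaving p V C" using lv by simp
    then have "p u \<in> C" using u CV unfolding leaving_def by blast
    moreover have "p u \<noteq> c"
    proof
      assume "p u = c"
      then have "u = y" using is_mateD(2)[OF p(1), of u] u CV p(2) by auto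
      then show False using u assms(3) by simp
    qed
    ultimately show "p u \<in> C - {c}" by simp
  qed (use CV in auto)
  then show "matchable_on R (C - {c})" unfolding matchable_on_def by blast
qed

lemma barrier_has_edge:
  assumes C: "C \<in> \<C>"
  shows "\<exists>c\<in>C. \<exists>s\<in>S. R c s"
proof -
  have "C \<noteq> {}" "C \<subset> V" using P(1,2,3) C Sne by blast+
  then obtain x y where "x \<in> C" "y \<in> V - C" "R x y" using mcovD(3)[OF mc] by blast
  then show ?thesis using barrier_edge(1)[OF C] by auto
qed

text \<open>Some edge leaves \<open>A\<close> together with its adjacent parts, and it must join
  such a part \<open>D\<close> to a member of \<open>S - A\<close>. A perfect matching through it
  spends \<open>D\<close> on a vertex outside \<open>A\<close>, while \<open>A\<close> still needs
  \<open>card A\<close> other adjacent parts.\<close>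

lemma barrier_surplus:
  assumes A: "A \<subset> S" "A \<noteq> {}"
  shows "card A < card {C \<in> \<C>. \<exists>a\<in>A. \<exists>c\<in>C. R a c}"
proof -
  let ?G = "{C \<in> \<C>. \<exists>a\<in>A. \<exists>c\<in>C. R a c}"
  let ?X = "A \<union> \<Union>?G"
  have "?X \<subseteq> V" using A P(1,2) by blast
  moreover obtain s where s: "s \<in> S" "s \<notin> A" using A by blast
  moreover have "s \<notin> \<Union>?G" using P(2) s(1) by blast
  ultimately have "?X \<subset> V" using P(1) by blast
  then obtain x y where xy: "x \<in> ?X" "y \<in> V - ?X" "R x y" using mcovD(3)[OF mc, of ?X] A(2) by blast
  have "x \<notin> A"
  proof
    assume xA: "x \<in> A"
    then have "y \<notin> S" using barrier_independent xy(3) A by blast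
    then obtain D where "D \<in> \<C>" "y \<in> D" using xy(2) P(2) by blast
    then have "D \<in> ?G" using xA xy(3) by blast
    then show False using xy(2) \<open>y \<in> D\<close> by blast
  qed
  then obtain D where D: "D \<in> ?G" "x \<in> D" using xy(1) by blast
  have DC: "D \<in> \<C>" using D by simp
  have yD: "y \<in> V - D" using xy(2) D(1) by blast
  have x: "x \<in> V" using D(2) DC P(2) by blast
  obtain p where p: "is_mate R V p" "p x = y" "p y = x" using mcov_mate[OF mc x _ xy(3)] xy(2) by blast
  have lvD: "leaving p V D = {x}" using barrier_leaving_edge[OF p(1) DC D(2)] p(2) yD by blast
  define f where "f a = (THE C. C \<in> \<C> \<and> p a \<in> C)" for a
  have f: "f a \<in> \<C> \<and> p a \<in> f a" if a: "a \<in> A" for a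
  proof -
    have aV: "a \<in> V" "a \<in> S" using a A P(1) by blast+
    have "p a \<notin> S" using barrier_independent[OF aV(2)] is_mateD(4)[OF p(1) aV(1)] by blast
    then obtain C where C: "C \<in> \<C>" "p a \<in> C" using is_mateD(1)[OF p(1) aV(1)] P(2) by blast
    show ?thesis unfolding f_def by (rule theI2[where a = C]) (use C P(4) in auto)
  qed
  have lv: "leaving p V (f a) = {p a}" if a: "a \<in> A" for a
  proof -
    have aV: "a \<in> V" "a \<in> S" using a A P(1) by blast+
    have "a \<notin> f a" using f[OF a] P(2) aV(2) by blast
    then show ?thesis using barrier_leaving_edge[OF p(1), of "f a" "p a"] f[OF a] is_mateD(2)[OF p(1) aV(1)] by simp
  qed
  have "inj_on f A"
  proof (rule inj_onI)
    fix a b assume ab: "a \<in> A" "b \<in> A" "f a = f b"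
    then have "p a = p b" using lv[OF ab(1)] lv[OF ab(2)] by simp
    then show "a = b" using is_mateD(2)[OF p(1)] ab A P(1) by (metis psubsetD subsetD)
  qed
  moreover have "f ` A \<subseteq> ?G - {D}"
  proof
    fix C assume "C \<in> f ` A"
    then obtain a where a: "a \<in> A" "C = f a" by blast
    have aV: "a \<in> V" using a A P(1) by blast
    have "f a \<noteq> D"
    proof
      assume "f a = D"
      then have "p a = x" using lv[OF a(1)] lvD by simp
      then have "a = y" using is_mateD(2)[OF p(1) aV] p(2) by simp
      then show False using xy(2) a(1) by blast
    qed
    then show "C \<in> ?G - {D}" using f[OF a(1)] a is_mateD(4)[OF p(1) aV] by blast
  qed
  ultimately have "card A \<le> card (?G - {D})" using fin(2) by (metis (no_types, lifting) card_inj_on_le finite_Diff finite_subset mem_Collect_eq subsetI)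
  also have "\<dots> < card ?G" using D(1) fin(2) by (intro psubset_card_mono) auto
  finally show ?thesis .
qed

text \<open>The surplus of one part absorbs the loss of \<open>K\<close> in the Hall
  condition.\<close>

lemma barrier_drop1:
  assumes s: "s \<in> S" and K: "K \<in> \<C>"
  shows "matchable_on R (V - K - {s})"
proof -
  have "matchable_on R ((S - {s}) \<union> \<Union>(\<C> - {K}))"
  proof (rule hall_parts[OF mcovD(1)[OF mc] pr])
    show "card (S - {s}) = card (\<C> - {K})" using barrier_card s K by simp
    fix A assume A: "A \<subseteq> S - {s}" "A \<noteq> {}"
    let ?G = "{C \<in> \<C>. \<exists>a\<in>A. \<exists>c\<in>C. R a c}"
    have eq: "{C \<in> \<C> - {K}. \<exists>a\<in>A. \<exists>c\<in>C. R a c} = ?G - {K}" by auto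
    have "A \<subset> S" using A s by blast
    then have "card A < card ?G" using A(2) by (rule barrier_surplus)
    moreover have "card ?G - 1 \<le> card (?G - {K})" using diff_card_le_card_Diff[of "{K}" ?G] by simp
    ultimately show "card A \<le> card {C \<in> \<C> - {K}. \<exists>a\<in>A. \<exists>c\<in>C. R a c}" unfolding eq by linarith
  next
    fix t C c assume "t \<in> S - {s}" "C \<in> \<C> - {K}" "c \<in> C" "R t c"
    then show "matchable_on R (C - {c})" using barrier_edge(2)[of C c t] sym P(1,2) by blast
  qed auto
  moreover have "(S - {s}) \<union> \<Union>(\<C> - {K}) = V - K - {s}"
  proof -
    have "\<Union>(\<C> - {K}) = \<Union>\<C> - K" using P(4)[OF _ K] K by blast
    then show ?thesis using P(1,2) K s by auto
  qed
  ultimately show ?thesis by simp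
qed

lemma barrier_same:
  assumes "s \<in> S" "t \<in> S" "s \<noteq> t"
  shows "\<not> matchable_on R (V - {s, t})"
proof
  assume "matchable_on R (V - {s, t})"
  then obtain p where p: "is_mate R (V - {s, t}) p" unfolding matchable_on_def by blast
  have fW: "finite (V - {s, t})" using mcovD(1)[OF mc] by simp
  have "card \<C> \<le> (\<Sum>C\<in>\<C>. card (leaving p (V - {s, t}) C))"
  proof (rule sum_ge_card)
    fix C assume C: "C \<in> \<C>"
    then have "C \<inter> (V - {s, t}) = C" using P(2) assms by blast
    then have "odd (card (leaving p (V - {s, t}) C))" using leaving_parity[OF fW p, of C] barrier_odd[OF C] by simp
    then show "1 \<le> card (leaving p (V - {s, t}) C)" by (cases "card (leaving p (V - {s, t}) C)") auto
  qed (use fin in auto)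
  also have "\<dots> \<le> card (S \<inter> (V - {s, t}))" by (rule sum_leaving_le_card[OF mcovD(1)[OF mc] pr _ p]) auto
  also have "\<dots> < card S" by (rule psubset_card_mono) (use assms fin(1) in auto)
  finally show False using barrier_card by simp
qed

text \<open>After the loss of \<open>s\<close> and \<open>x\<close> the remaining members of
  \<open>S\<close> are all used up by the other odd parts, so no matching edge leaves
  \<open>C\<close>. The right side does not mention \<open>s\<close>, which is what makes
  unmatchability transitive.\<close>

lemma barrier_critical:
  assumes s: "s \<in> S" and C: "C \<in> \<C>" and x: "x \<in> C"
  shows "matchable_on R (V - {s, x}) \<longleftrightarrow> matchable_on R (C - {x})"
proof
  assume "matchable_on R (C - {x})"
  then have "matchable_on R ((V - C - {s}) \<union> (C - {x}))"
    by (rule matchable_on_Un[OF barrier_drop1[OF s C]]) auto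
  moreover have "(V - C - {s}) \<union> (C - {x}) = V - {s, x}" using P(1,2) s C x by blast
  ultimately show "matchable_on R (V - {s, x})" by simp
next
  assume "matchable_on R (V - {s, x})"
  then obtain p where p: "is_mate R (V - {s, x}) p" unfolding matchable_on_def by blast
  let ?W = "V - {s, x}"
  have fW: "finite ?W" using mcovD(1)[OF mc] by simp
  have "card (\<C> - {C}) + card (leaving p ?W C) \<le> (\<Sum>C\<in>\<C>. card (leaving p ?W C))"
  proof (rule sum_ge_card2)
    fix D assume D: "D \<in> \<C> - {C}"
    then have "D \<inter> ?W = D" using P(2) P(4)[of D C] s C x by blast
    then have "odd (card (leaving p ?W D))" using leaving_parity[OF fW p, of D] barrier_odd[of D] D by simp
    then show "1 \<le> card (leaving p ?W D)" by (cases "card (leaving p ?W D)") auto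
  qed (use fin C in auto)
  also have "\<dots> \<le> card (S \<inter> ?W)" by (rule sum_leaving_le_card[OF mcovD(1)[OF mc] pr _ p]) auto
  also have "S \<inter> ?W = S - {s}" using P(1,2) C x by blast
  also have "card (S - {s}) = card (\<C> - {C})" using s C barrier_card by simp
  finally have "card (leaving p ?W C) = 0" by simp
  moreover have "finite (leaving p ?W C)" using fW unfolding leaving_def by simp
  ultimately have "leaving p ?W C = {}" by simp
  then have "matchable_on R (C \<inter> ?W)" using leaving_empty_matchable[OF p] by blast
  moreover have "C \<inter> ?W = C - {x}" using P(2) C s by blast
  ultimately show "matchable_on R (C - {x})" by simp
qed

end

text \<open>Tutte's theorem for \<open>V - {s, t}\<close> gives, by parity, an excess of two odd
  parts, just enough to take \<open>s\<close> and \<open>t\<close> into the set.\<close>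

lemma barrier_exists:
  assumes mc: "mcov V" and st: "s \<in> V" "t \<in> V" "s \<noteq> t" and nm: "\<not> matchable_on R (V - {s, t})"
  shows "\<exists>S \<C>. barrier V S \<C> \<and> s \<in> S \<and> t \<in> S"
proof -
  note fV = mcovD(1)[OF mc]
  have fW: "finite (V - {s, t})" using fV by simp
  obtain A \<C> where A: "parts (V - {s, t}) A \<C>" "card A < card (odds \<C>)"
    using tutte[OF fW nm] by blast
  have "even (card V)" using matchable_on_even_card[OF fV mcov_matchable[OF mc]] .
  moreover have "card (V - {s, t}) = card V - 2" using st fV by simp
  ultimately have "even (card (V - {s, t}))" by simp
  then have "even (card A + card (odds \<C>))" using card_parts_parity[OF fW A(1)] by simp
  then have ge: "card A + 2 \<le> card (odds \<C>)" using A(2) by presburger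
  have fA: "finite A" "A \<subseteq> V - {s, t}" using parts_finite(1)[OF fW A(1)] partsD(1)[OF A(1)] by auto
  have "card (insert s (insert t A)) = card A + 2" using fA st(3) by (auto simp: card_insert_if)
  moreover have "parts V (insert s (insert t A)) \<C>" using A(1) st unfolding parts_def by auto
  ultimately have "barrier V (insert s (insert t A)) \<C>" using ge unfolding barrier_def by simp
  then show ?thesis by blast
qed

text \<open>The transitivity behind the canonical partition of Kotzig and Lovasz. A vertex outside a
  barrier that contains \<open>x\<close> and \<open>y\<close> cannot tell them apart, by
  \<open>barrier_critical\<close>.\<close>

lemma unmatchable_trans:
  assumes mc: "mcov V" and V: "x \<in> V" "y \<in> V" "z \<in> V" and ne: "x \<noteq> y" "y \<noteq> z" "x \<noteq> z"
    and xy: "\<not> matchable_on R (V - {x, y})" and yz: "\<not> matchable_on R (V - {y, z})"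
  shows "\<not> matchable_on R (V - {x, z})"
proof -
  obtain S \<C> where S: "barrier V S \<C>" "x \<in> S" "y \<in> S" using barrier_exists[OF mc V(1,2) ne(1) xy] by blast
  note P = partsD[OF S(1)[unfolded barrier_def, THEN conjunct1]]
  show ?thesis
  proof (cases "z \<in> S")
    case True
    then show ?thesis using barrier_same[OF mc S(1) S(2) True ne(3)] by simp
  next
    case False
    then obtain C where C: "C \<in> \<C>" "z \<in> C" using V(3) P(2) by blast
    show ?thesis
      using barrier_critical[OF mc S(1) S(2) C] barrier_critical[OF mc S(1) S(3) C] yz by simp
  qed
qed

lemma minimal_barrier_drop2:
  assumes mc: "mcov V" and bar: "barrier V S \<C>" and st: "s \<in> S" "t \<in> S" "s \<noteq> t"
    and min: "\<And>S' \<C>'. barrier V S' \<C>' \<Longrightarrow> s \<in> S' \<Longrightarrow> t \<in> S' \<Longrightarrow> card S \<le> card S'"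
    and KL: "K \<in> \<C>" "L \<in> \<C>" "K \<noteq> L"
  shows "matchable_on R (V - K - L - {s, t})"
proof -
  have pr: "parts V S \<C>" using bar unfolding barrier_def by simp
  note P = partsD[OF pr] and fV = mcovD(1)[OF mc] and cC = barrier_card[OF mc bar]
  note fin = parts_finite[OF fV pr]
  have "matchable_on R ((S - {s, t}) \<union> \<Union>(\<C> - {K, L}))"
  proof (rule hall_parts[OF fV pr])
    show "card (S - {s, t}) = card (\<C> - {K, L})" using cC st KL fin by (simp add: card_Diff_subset)
    fix A assume A: "A \<subseteq> S - {s, t}" "A \<noteq> {}"
    let ?G = "{C \<in> \<C>. \<exists>a\<in>A. \<exists>c\<in>C. R a c}"
    have eq: "{C \<in> \<C> - {K, L}. \<exists>a\<in>A. \<exists>c\<in>C. R a c} = ?G - {K, L}" by auto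
    have AS: "A \<subset> S" using A st by blast
    have fA: "finite A" using AS fin(1) finite_subset by blast
    have lt: "card A < card ?G" by (rule barrier_surplus[OF mc bar AS A(2)])
    have "card ?G \<noteq> card A + 1"
    proof
      assume eqG: "card ?G = card A + 1"
      let ?Q = "A \<union> \<Union>?G"
      let ?C' = "insert ?Q (\<C> - ?G)"
      have pr': "parts V (S - A) ?C'" by (rule parts_shrink[OF pr _ A(2)]) (use A in blast)
      have cG: "card (\<C> - ?G) = card S - card ?G"
        using cC fin(2) by (subst card_Diff_subset) auto
      have leG: "card ?G \<le> card S" using cC fin(2) card_mono[of \<C> ?G] by auto
      have cS: "card (S - A) = card S - card A" using AS fA by (subst card_Diff_subset) auto
      have odd1: "C \<in> odds ?C'" if "C \<in> \<C> - ?G" for C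
        using that barrier_odd[OF mc bar, of C] unfolding odds_def by simp
      have QC: "?Q \<notin> \<C> - ?G"
      proof
        assume "?Q \<in> \<C> - ?G"
        then have "?Q \<subseteq> V - S" using P(2) by blast
        then show False using A by blast
      qed
      \<comment> \<open>Parity decides: \<open>S - A\<close> has one vertex more than there are
        untouched odd parts, so the merged part must be odd.\<close>
      have "odd (card ?Q)"
      proof (rule ccontr)
        assume "\<not> odd (card ?Q)"
        then have "odds ?C' = \<C> - ?G" using odd1 unfolding odds_def by blast
        then have "even (card (S - A) + card (\<C> - ?G))"
          using card_parts_parity[OF fV pr'] matchable_on_even_card[OF fV mcov_matchable[OF mc]] by simp
        then show False using cS cG eqG leG by simp
      qed
      then have "odds ?C' = ?C'" using odd1 unfolding odds_def by blast
      then have "card (odds ?C') = card (\<C> - ?G) + 1" using QC fin(2) by simp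
      then have "barrier V (S - A) ?C'" unfolding barrier_def using pr' st A cG cS eqG leG by auto
      then have "card S \<le> card (S - A)" using min st A by blast
      moreover have "0 < card A" using fA A(2) by (simp add: card_gt_0_iff)
      ultimately show False using cS eqG leG by linarith
    qed
    then have "card A + 2 \<le> card ?G" using lt by linarith
    moreover have "card ?G - card {K, L} \<le> card (?G - {K, L})" by (rule diff_card_le_card_Diff) simp
    moreover have "card {K, L} = 2" using KL(3) by simp
    ultimately show "card A \<le> card {C \<in> \<C> - {K, L}. \<exists>a\<in>A. \<exists>c\<in>C. R a c}" unfolding eq by linarith
  next
    fix r C c assume h: "r \<in> S - {s, t}" "C \<in> \<C> - {K, L}" "c \<in> C" "R r c"
    then have "r \<in> V - C" using P(1,2) by blast
    then show "matchable_on R (C - {c})" using barrier_edge(2)[OF mc bar, of C c r] sym h by blast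
  qed auto
  moreover have "(S - {s, t}) \<union> \<Union>(\<C> - {K, L}) = V - K - L - {s, t}"
  proof -
    have "D \<inter> (K \<union> L) = {}" if "D \<in> \<C> - {K, L}" for D using that P(4)[of D K] P(4)[of D L] KL by blast
    then have "\<Union>(\<C> - {K, L}) = \<Union>\<C> - (K \<union> L)" using KL(1,2) by blast
    then have eq: "\<Union>(\<C> - {K, L}) = V - S - (K \<union> L)" unfolding P(2) .
    have "K \<subseteq> V - S" "L \<subseteq> V - S" using P(2) KL by blast+
    then show ?thesis unfolding eq using P(1) st by blast
  qed
  ultimately show ?thesis by simp
qed

text \<open>Let \<open>k\<close> in \<open>K\<close> be adjacent to \<open>s\<close> in the barrier.
  Removing \<open>s\<close> and \<open>v\<close> leaves no perfect matching and removing
  \<open>s\<close> and \<open>k\<close> leaves one, so removing \<open>v\<close> and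
  \<open>k\<close> leaves one as well. In it \<open>L\<close> sends out at least two vertices and
  every further part at least one; no member of \<open>S\<close> is left for \<open>K\<close>, whose
  remainder is therefore matched inside itself.\<close>

lemma barrier_drop_vertex:
  assumes mc: "mcov V" and bar: "barrier V S \<C>" and KL: "K \<in> \<C>" "L \<in> \<C>" "K \<noteq> L"
    and v: "v \<in> L" "\<not> matchable_on R (L - {v})"
  shows "matchable_on R (V - K - {v})"
proof -
  have pr: "parts V S \<C>" using bar unfolding barrier_def by simp
  note P = partsD[OF pr] and fV = mcovD(1)[OF mc] and cC = barrier_card[OF mc bar]
  note fin = parts_finite[OF fV pr]
  obtain k s where ks: "k \<in> K" "s \<in> S" "R k s" using barrier_has_edge[OF mc bar KL(1)] by blast
  have sV: "s \<in> V - K" "k \<in> V" "v \<in> V" using P(1,2) ks KL v by blast+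
  have kv: "k \<noteq> v" "s \<noteq> v" "k \<noteq> s" using P(2) P(4)[OF KL] ks v(1) KL by blast+
  have sv: "\<not> matchable_on R (V - {s, v})" using barrier_critical[OF mc bar ks(2) KL(2) v(1)] v(2) by simp
  have "matchable_on R (K - {k})" by (rule barrier_edge(2)[OF mc bar KL(1) ks(1) sV(1) ks(3)])
  then have "matchable_on R (V - {s, k})" using barrier_critical[OF mc bar ks(2) KL(1) ks(1)] by simp
  then have "matchable_on R (V - {v, k})"
    using unmatchable_trans[OF mc, of s v k] sv sV kv by auto
  then obtain p where p: "is_mate R (V - {v, k}) p" unfolding matchable_on_def by blast
  let ?W = "V - {v, k}"
  let ?l = "\<lambda>C. card (leaving p ?W C)"
  have fW: "finite ?W" using fV by simp
  have fl: "finite (leaving p ?W C)" for C using fW unfolding leaving_def by simp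
  have odd: "1 \<le> ?l D" if D: "D \<in> \<C> - {K, L}" for D
  proof -
    have "D \<inter> ?W = D" using D P(2) P(4)[of D K] P(4)[of D L] KL ks v by blast
    then have "odd (?l D)" using leaving_parity[OF fW p, of D] barrier_odd[OF mc bar, of D] D by simp
    then show ?thesis by (cases "?l D") auto
  qed
  have LW: "L \<inter> ?W = L - {v}" and KW: "K \<inter> ?W = K - {k}" using P(2) P(4)[OF KL] KL ks v by blast+
  have evL: "even (?l L)" and evK: "even (?l K)"
    using leaving_parity[OF fW p, of L] leaving_parity[OF fW p, of K] LW KW
      barrier_odd[OF mc bar KL(2)] barrier_odd[OF mc bar KL(1)] v(1) ks(1) fin(3) KL by auto
  have "leaving p ?W L \<noteq> {}" using leaving_empty_matchable[OF p, of L] LW v(2) by auto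
  then have "?l L \<noteq> 0" using fl by simp
  then have l2: "2 \<le> ?l L" using evL by (auto elim!: evenE)
  have "card (\<C> - {K, L}) + ?l L \<le> (\<Sum>C\<in>\<C> - {K}. ?l C)"
    by (rule sum_ge_card2) (use fin KL odd in auto)
  then have "card (\<C> - {K, L}) + ?l L + ?l K \<le> (\<Sum>C\<in>\<C>. ?l C)"
    using sum.remove[OF fin(2) KL(1), of ?l] by linarith
  also have "\<dots> \<le> card (S \<inter> ?W)" by (rule sum_leaving_le_card[OF fV pr _ p]) auto
  also have "\<dots> \<le> card S" by (rule card_mono) (use fin in auto)
  also have "card S = card (\<C> - {K, L}) + 2"
  proof -
    have "card {K, L} = 2" "{K, L} \<subseteq> \<C>" using KL by auto
    then show ?thesis using cC card_mono[OF fin(2), of "{K, L}"] by (simp add: card_Diff_subset)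
  qed
  finally have "?l K = 0" using l2 by linarith
  then have lK: "leaving p ?W K = {}" using fl by simp
  have "is_mate R (V - K - {v}) p"
  proof (rule is_mate_subset[OF p])
    show "V - K - {v} \<subseteq> ?W" using ks(1) by blast
    fix u assume u: "u \<in> V - K - {v}"
    then have uW: "u \<in> ?W" using ks(1) by blast
    note q = is_mateD[OF p uW]
    have "p u \<notin> K"
    proof
      assume "p u \<in> K"
      then have "p u \<in> leaving p ?W K" using q(1,2) u unfolding leaving_def by simp
      then show False using lK by simp
    qed
    then show "p u \<in> V - K - {v}" using q(1) by blast
  qed
  then show ?thesis unfolding matchable_on_def by blast
qed

text \<open>Follow \<open>n\<close> and \<open>m\<close> in turn from \<open>w\<close> until
  \<open>n\<close> leads out of \<open>insert w L\<close>; \<open>P\<close> is the set of vertices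
  met. Outside \<open>P\<close> the mate \<open>m\<close> is intact, and on \<open>P - {u}\<close>
  the involution \<open>n\<close> is. No adjacency is asked of \<open>n\<close>, since it may
  contain pairs that stand for ears.\<close>

lemma alternating_exit:
  assumes "finite L" "w \<notin> L" "is_mate R L m" "\<And>x. x \<in> insert w L \<Longrightarrow> n (n x) = x \<and> n x \<noteq> x"
  shows "\<exists>P u. P \<subseteq> insert w L \<and> u \<in> P \<and> n u \<notin> insert w L \<and> (\<forall>x\<in>P - {u}. n x \<in> P - {u}) \<and>
    matchable_on R (insert w L - P)"
  using assms
proof (induction "card L" arbitrary: L w rule: less_induct)
  case less
  show ?case
  proof (cases "n w \<in> L")
    case False
    then have "n w \<notin> insert w L" using less.prems(4) by auto
    moreover have "insert w L - {w} = L" using less.prems(2) by auto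
    ultimately show ?thesis using less.prems(3)
      by (intro exI[of _ "{w}"] exI[of _ w]) (auto simp: matchable_on_def)
  next
    case True
    define r r' where "r = n w" and "r' = m r"
    have r: "r \<in> L" using True r_def by simp
    note q = is_mateD[OF less.prems(3) r, folded r'_def]
    have nr: "n r = w" using less.prems(4)[of w] r_def by simp
    let ?L = "L - {r, r'}"
    have "is_mate R ?L m"
    proof (rule is_mate_subset[OF less.prems(3)])
      fix u assume u: "u \<in> ?L"
      note qu = is_mateD[OF less.prems(3), of u]
      have "m u \<noteq> r" "m u \<noteq> r'" using qu u q r'_def by auto
      then show "m u \<in> ?L" using qu u by auto
    qed auto
    moreover have "card ?L < card L" by (rule psubset_card_mono) (use less.prems(1) r in auto)
    moreover have "n (n x) = x \<and> n x \<noteq> x" if "x \<in> insert r' ?L" for x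
      using less.prems(4)[of x] that q(1) by auto
    ultimately obtain P u where P: "P \<subseteq> insert r' ?L" "u \<in> P" "n u \<notin> insert r' ?L"
      "\<forall>x\<in>P - {u}. n x \<in> P - {u}" "matchable_on R (insert r' ?L - P)"
      using less.hyps[of ?L r'] less.prems(1) by blast
    have w: "w \<notin> P" "r \<notin> P" "w \<noteq> r" "r' \<noteq> w" using P(1) less.prems(2) r q by auto
    have nu: "n (n u) = u" using less.prems(4)[of u] P(1,2) q(1) by auto
    have "n u \<noteq> w" using nu P(2) w(2) r_def by metis
    moreover have "n u \<noteq> r" using nu nr P(2) w(1) by metis
    ultimately have nuw: "n u \<noteq> w" "n u \<noteq> r" by simp_all
    have "n u \<notin> insert w L" using P(3) nuw by auto
    moreover have "\<forall>x\<in>insert w (insert r P) - {u}. n x \<in> insert w (insert r P) - {u}"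
      using P(2,4) w nr r_def by auto
    moreover have "insert w L - insert w (insert r P) = insert r' ?L - P"
      using w r q P(1) less.prems(2) by auto
    moreover have "insert w (insert r P) \<subseteq> insert w L" using P(1) q(1) r by auto
    ultimately show ?thesis using P(2,5) by (intro exI[of _ "insert w (insert r P)"] exI[of _ u]) auto
  qed
qed

text \<open>The pairs \<open>{u, \<tau> u}\<close> are the ends of disjoint ears all of which can be added at once; one or two of
  them suffice. The counterexample \<open>U\<close> is minimal; an alternating path that leaves a part of a minimal barrier
  then yields a smaller one.\<close>

lemma two_pairs_matchable:
  assumes mc: "mcov V" and U: "U \<subseteq> V" "U \<noteq> {}" "\<And>u. u \<in> U \<Longrightarrow> \<tau> u \<in> U \<and> \<tau> (\<tau> u) = u \<and> \<tau> u \<noteq> u"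
    and mt: "matchable_on R (V - U)"
  shows "\<exists>u\<in>U. matchable_on R (V - {u, \<tau> u}) \<or>
    (\<exists>v\<in>U. v \<notin> {u, \<tau> u} \<and> matchable_on R (V - {u, \<tau> u, v, \<tau> v}))"
  using U mt
proof (induction "card U" arbitrary: U rule: less_induct)
  case less
  note fV = mcovD(1)[OF mc]
  have fU: "finite U" using less.prems(1) fV finite_subset by blast
  show ?case
  proof (rule ccontr)
    assume neg: "\<not> ?thesis"
    have min: False if "W \<subset> U" "W \<noteq> {}" "\<And>u. u \<in> W \<Longrightarrow> \<tau> u \<in> W" "matchable_on R (V - W)" for W
    proof -
      have "card W < card U" using psubset_card_mono[OF fU that(1)] .
      moreover have "\<tau> u \<in> W \<and> \<tau> (\<tau> u) = u \<and> \<tau> u \<noteq> u" if "u \<in> W" for u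
        using that \<open>W \<subset> U\<close> less.prems(3)[of u] \<open>\<And>u. u \<in> W \<Longrightarrow> \<tau> u \<in> W\<close> by blast
      ultimately have "\<exists>u\<in>W. matchable_on R (V - {u, \<tau> u}) \<or>
          (\<exists>v\<in>W. v \<notin> {u, \<tau> u} \<and> matchable_on R (V - {u, \<tau> u, v, \<tau> v}))"
        using less.hyps[of W] that less.prems(1) by blast
      then show False using neg that(1) by blast
    qed
    have nm1: "\<not> matchable_on R (V - {u, \<tau> u})" if "u \<in> U" for u using neg that by blast
    have nm2: "\<not> matchable_on R (V - {u, \<tau> u, v, \<tau> v})" if "u \<in> U" "v \<in> U" "v \<notin> {u, \<tau> u}" for u v
      using neg that by blast
    obtain s where s: "s \<in> U" using less.prems(2) by blast
    define t where "t = \<tau> s"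
    have t: "t \<in> U" "s \<noteq> t" "\<tau> t = s" using less.prems(3)[OF s] t_def by auto
    have stV: "s \<in> V" "t \<in> V" using s t less.prems(1) by auto
    have nst: "\<not> matchable_on R (V - {s, t})" using nm1[OF s] t_def by simp
    \<comment> \<open>The barrier through \<open>s\<close> and \<open>t\<close> is chosen of least
      size, as \<open>minimal_barrier_drop2\<close> requires.\<close>
    define Q where "Q k \<longleftrightarrow> (\<exists>S \<C>. barrier V S \<C> \<and> s \<in> S \<and> t \<in> S \<and> k = card S)" for k
    have "\<exists>k. Q k" unfolding Q_def using barrier_exists[OF mc stV t(2) nst] by blast
    then have "Q (LEAST k. Q k)" by (rule LeastI_ex)
    then obtain S \<C> where bar: "barrier V S \<C>" and sS: "s \<in> S" "t \<in> S" and cS: "card S = (LEAST k. Q k)"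
      unfolding Q_def by metis
    have minS: "card S \<le> card S'" if "barrier V S' \<C>'" "s \<in> S'" "t \<in> S'" for S' \<C>'
      unfolding cS by (rule Least_le) (use that in \<open>auto simp: Q_def\<close>)
    have pr: "parts V S \<C>" using bar unfolding barrier_def by simp
    note P = partsD[OF pr] and cC = barrier_card[OF mc bar] and fin = parts_finite[OF fV pr]
    obtain p where p: "is_mate R (V - U) p" using less.prems(4) unfolding matchable_on_def by blast
    \<comment> \<open>If \<open>p\<close> led out of every part, it would map one vertex of each
      part injectively into \<open>S - {s, t}\<close>, which is too small.\<close>
    have "\<exists>K\<in>\<C>. \<forall>x\<in>K - U. p x \<in> K"
    proof (rule ccontr)
      assume "\<not> ?thesis"
      then have "\<forall>K\<in>\<C>. \<exists>x. x \<in> K - U \<and> p x \<notin> K" by blast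
      then obtain x where x: "\<And>K. K \<in> \<C> \<Longrightarrow> x K \<in> K - U \<and> p (x K) \<notin> K" by metis
      have xW: "x K \<in> V - U" if "K \<in> \<C>" for K using x[OF that] that P(2) by blast
      have pS: "p (x K) \<in> S - {s, t}" if K: "K \<in> \<C>" for K
      proof -
        have "x K \<in> leaving p (V - U) K" using x[OF K] xW[OF K] unfolding leaving_def by blast
        then have "p (x K) \<in> S \<inter> (V - U)" using leaving_to_S[OF pr _ p K] by blast
        then show ?thesis using s t(1) by blast
      qed
      have "inj_on (\<lambda>K. p (x K)) \<C>"
      proof (rule inj_onI)
        fix K L assume KL: "K \<in> \<C>" "L \<in> \<C>" "p (x K) = p (x L)"
        then have "x K = x L" using is_mateD(2)[OF p] xW by metis
        then show "K = L" using P(4)[OF KL(1,2)] x[OF KL(1)] x[OF KL(2)] by (metis Diff_iff disjoint_iff)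
      qed
      then have "card \<C> \<le> card (S - {s, t})" by (rule card_inj_on_le) (use pS fin(1) in auto)
      also have "\<dots> < card S" by (rule psubset_card_mono) (use sS fin(1) in auto)
      finally show False using cC by simp
    qed
    then obtain K where K: "K \<in> \<C>" and Kp: "\<And>x. x \<in> K - U \<Longrightarrow> p x \<in> K" by blast
    have KV: "K \<subseteq> V" "K \<inter> S = {}" using P(2) K by blast+
    \<comment> \<open>The perfect matching of \<open>V\<close> in which each ear counts as an edge
      \<open>{u, \<tau> u}\<close>. As \<open>p\<close> stays inside \<open>K\<close>, an
      alternating path can leave \<open>K\<close> only through an ear.\<close>
    define n where "n x = (if x \<in> U then \<tau> x else p x)" for x
    have n: "n (n x) = x \<and> n x \<noteq> x" if "x \<in> V" for x
      using less.prems(3)[of x] is_mateD[OF p, of x] that unfolding n_def by auto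
    obtain w c where w: "w \<in> K" "c \<in> S" "R w c" using barrier_has_edge[OF mc bar K] by blast
    have "c \<in> V - K" using w(2) P(1) KV by blast
    then have "matchable_on R (K - {w})" by (rule barrier_edge(2)[OF mc bar K w(1) _ w(3)])
    then obtain m where m: "is_mate R (K - {w}) m" unfolding matchable_on_def by blast
    have ins: "insert w (K - {w}) = K" using w(1) by blast
    have "\<exists>P u. P \<subseteq> insert w (K - {w}) \<and> u \<in> P \<and> n u \<notin> insert w (K - {w}) \<and> (\<forall>x\<in>P - {u}. n x \<in> P - {u}) \<and>
        matchable_on R (insert w (K - {w}) - P)"
      by (rule alternating_exit[OF _ _ m]) (use fin(3)[OF K] n KV ins in auto)
    then obtain A u where A: "A \<subseteq> K" "u \<in> A" "n u \<notin> K" "\<And>x. x \<in> A - {u} \<Longrightarrow> n x \<in> A - {u}" "matchable_on R (K - A)"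
      unfolding ins by blast
    have uK: "u \<in> K" using A by blast
    have uU: "u \<in> U" using A(3) Kp[of u] uK unfolding n_def by (auto split: if_splits)
    define v where "v = \<tau> u"
    have v: "v \<in> U" "v \<notin> K" "\<tau> v = u" "v \<noteq> u" "v \<in> V"
      using less.prems(3)[OF uU] A(3) uU less.prems(1) unfolding v_def n_def by auto
    have mKA: "matchable_on R (K - (U \<inter> A))"
    proof (rule matchable_on_Un'[OF A(5)])
      show "matchable_on R (A - U)"
        unfolding matchable_on_def
      proof (rule exI, rule is_mate_subset[OF p])
        show "A - U \<subseteq> V - U" using A(1) KV by blast
        fix x assume x: "x \<in> A - U"
        then have "x \<noteq> u" using uU by blast
        then have "p x \<in> A" using A(4)[of x] x unfolding n_def by auto
        then show "p x \<in> A - U" using is_mateD(1)[OF p, of x] x A(1) KV by blast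
      qed
    qed (use A(1) in auto)
    \<comment> \<open>The set is closed under \<open>\<tau>\<close>, because \<open>n\<close>
      permutes \<open>A - {u}\<close> and \<open>v\<close> is paired with \<open>u\<close>; it
      misses \<open>s\<close>, so it is smaller than \<open>U\<close>.\<close>
    define W where "W = (U \<inter> A) \<union> {v}"
    have sW: "s \<notin> W"
    proof -
      have "s \<notin> A" using A(1) KV sS by blast
      moreover have "s \<noteq> v"
      proof
        assume "s = v"
        then have "t = u" using v(3) t_def by simp
        then show False using uK KV sS by blast
      qed
      ultimately show ?thesis unfolding W_def by simp
    qed
    have "\<not> matchable_on R (V - K - {v})"
    proof
      assume mt: "matchable_on R (V - K - {v})"
      have "matchable_on R (V - W)"
        by (rule matchable_on_Un'[OF mKA mt]) (use KV A(1) v(2) in \<open>auto simp: W_def\<close>)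
      moreover have "W \<subset> U" using sW s v(1) unfolding W_def by blast
      moreover have "\<tau> x \<in> W" if x: "x \<in> W" for x
      proof (cases "x = v \<or> x = u")
        case True then show ?thesis using v uU A(2) v_def unfolding W_def by auto
      next
        case False
        then have "x \<in> A - {u}" "x \<in> U" using x unfolding W_def by auto
        then have "\<tau> x \<in> A - {u}" using A(4)[of x] unfolding n_def by simp
        then show ?thesis using less.prems(3)[OF \<open>x \<in> U\<close>] unfolding W_def by blast
      qed
      ultimately show False using min[of W] unfolding W_def by blast
    qed
    note nK = this
    have vS: "v \<notin> S" using nK barrier_drop1[OF mc bar _ K] by blast
    then obtain L where L: "L \<in> \<C>" "v \<in> L" using v(5) P(2) by blast
    have KL: "K \<noteq> L" using L(2) v(2) by blast
    have mL: "matchable_on R (L - {v})" using nK barrier_drop_vertex[OF mc bar K L(1) KL L(2)] by blast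
    have sv: "matchable_on R (V - {s, v})" using barrier_critical[OF mc bar sS(1) L] mL by simp
    have ne: "s \<noteq> u" "s \<noteq> v" "t \<noteq> u" "t \<noteq> v" using sS KV uK L P(2) by blast+
    have uv: "\<not> matchable_on R (V - {u, v})" using nm1[OF uU] v_def by simp
    have uV: "u \<in> V" using uK KV by blast
    \<comment> \<open>By transitivity: as \<open>u\<close> and \<open>v\<close> cannot be removed
      together, \<open>s\<close> and \<open>u\<close> could fail only if \<open>s\<close> and
      \<open>v\<close> failed too.\<close>
    have "matchable_on R (V - {s, u})"
      using unmatchable_trans[OF mc, of s u v] stV uV v(4,5) ne uv sv by blast
    then have mK: "matchable_on R (K - {u})" using barrier_critical[OF mc bar sS(1) K uK] by simp
    have "matchable_on R (V - K - L - {s, t})"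
      by (rule minimal_barrier_drop2[OF mc bar sS t(2) minS K L(1) KL])
    then have "matchable_on R ((V - K - L - {s, t}) \<union> (K - {u}) \<union> (L - {v}))"
      using mK mL P(4)[OF K L(1) KL] by (intro matchable_on_Un) auto
    moreover have "(V - K - L - {s, t}) \<union> (K - {u}) \<union> (L - {v}) = V - {s, t, u, v}"
    proof -
      have "L \<subseteq> V - S" "K \<subseteq> V - S" using P(2) L(1) K by blast+
      moreover have "K \<inter> L = {}" using P(4)[OF K L(1) KL] .
      ultimately show ?thesis using sS uK L(2) by blast
    qed
    ultimately have "matchable_on R (V - {s, \<tau> s, u, \<tau> u})" unfolding t_def v_def by simp
    then show False using nm2[OF s uU] ne t_def by auto
  qed
qed

end

section \<open>Graphs and their adjacency relations\<close>

definition adj :: "('v, 'e) mgraph \<Rightarrow> 'v \<Rightarrow> 'v \<Rightarrow> bool" where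
  "adj G u v \<longleftrightarrow> (\<exists>e\<in>edges G. ends G e = {u, v})"

lemma multigraphD:
  assumes "multigraph G"
  shows "finite (verts G)" "finite (edges G)" "\<And>e. e \<in> edges G \<Longrightarrow> ends G e \<subseteq> verts G"
    "\<And>e. e \<in> edges G \<Longrightarrow> card (ends G e) = 2"
  using assms unfolding multigraph_def by auto

lemma multigraph_ends:
  assumes "multigraph G" "e \<in> edges G"
  obtains u v where "ends G e = {u, v}" "u \<noteq> v" "u \<in> verts G" "v \<in> verts G" "adj G u v"
proof -
  obtain u v where uv: "ends G e = {u, v}" "u \<noteq> v"
    using multigraphD(4)[OF assms] by (meson card_2_iff)
  then show ?thesis using that[of u v] multigraphD(3)[OF assms] assms(2) unfolding adj_def by auto
qed

lemma multigraph_other_end: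
  assumes "multigraph G" "e \<in> edges G" "u \<in> ends G e"
  obtains v where "ends G e = {u, v}" "u \<noteq> v" "u \<in> verts G" "v \<in> verts G" "adj G u v"
proof -
  obtain x y where xy: "ends G e = {x, y}" "x \<noteq> y" "x \<in> verts G" "y \<in> verts G" "adj G x y"
    using multigraph_ends[OF assms(1,2)] .
  have "adj G y x" using xy(5) unfolding adj_def by (metis insert_commute)
  then show ?thesis using xy assms(3) that[of x] that[of y] by (auto simp: insert_commute)
qed

lemma adjD:
  assumes "multigraph G" "adj G u v"
  shows "u \<in> verts G" "v \<in> verts G" "u \<noteq> v"
proof -
  obtain e where e: "e \<in> edges G" "ends G e = {u, v}" using assms(2) unfolding adj_def by blast
  then show "u \<in> verts G" "v \<in> verts G" using multigraphD(3)[OF assms(1) e(1)] by auto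
  show "u \<noteq> v" using multigraphD(4)[OF assms(1) e(1)] e(2) by auto
qed

lemma sym_rel_adj: "multigraph G \<Longrightarrow> sym_rel (adj G)"
proof
  show "adj G u v \<Longrightarrow> adj G v u" for u v unfolding adj_def by (metis insert_commute)
  show "\<not> adj G u u" if "multigraph G" for u using adjD(3)[OF that] by blast
qed

lemma perfect_matching_iff:
  assumes G: "multigraph G"
  shows "(\<exists>M. perfect_matching G M) \<longleftrightarrow> matchable_on (adj G) (verts G)"
proof
  assume "\<exists>M. perfect_matching G M"
  then obtain M where "perfect_matching G M" by blast
  then have M: "M \<subseteq> edges G" "\<And>v. v \<in> verts G \<Longrightarrow> \<exists>!e. e \<in> M \<and> v \<in> ends G e"
    unfolding perfect_matching_def by simp_all
  define el where "el v = (THE e. e \<in> M \<and> v \<in> ends G e)" for v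
  have el: "el v \<in> M" "v \<in> ends G (el v)" if "v \<in> verts G" for v
    using theI'[OF M(2)[OF that]] unfolding el_def by auto
  have elu: "e = el v" if "e \<in> M" "v \<in> ends G e" "v \<in> verts G" for e v
    using M(2)[OF that(3)] el[OF that(3)] that by blast
  have "\<exists>w. ends G (el v) = {v, w} \<and> v \<noteq> w \<and> w \<in> verts G" if v: "v \<in> verts G" for v
    using multigraph_other_end[OF G _ el(2)[OF v]] el(1)[OF v] M(1) by (metis subsetD)
  then obtain p where p: "\<And>v. v \<in> verts G \<Longrightarrow> ends G (el v) = {v, p v} \<and> v \<noteq> p v \<and> p v \<in> verts G"
    by metis
  have "is_mate (adj G) (verts G) p"
    unfolding is_mate_def
  proof
    fix v assume v: "v \<in> verts G"
    have e: "el v = el (p v)" using elu[OF el(1)[OF v], of "p v"] p[OF v] by auto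
    then have "{v, p v} = {p v, p (p v)}" using p[OF v] p[of "p v"] by auto
    moreover have "adj G v (p v)" unfolding adj_def using el(1)[OF v] M(1) p[OF v] by auto
    ultimately show "p v \<in> verts G \<and> p (p v) = v \<and> p v \<noteq> v \<and> adj G v (p v)"
      using p[OF v] by (auto simp: doubleton_eq_iff)
  qed
  then show "matchable_on (adj G) (verts G)" unfolding matchable_on_def by blast
next
  assume "matchable_on (adj G) (verts G)"
  then obtain p where p: "is_mate (adj G) (verts G) p" unfolding matchable_on_def by blast
  \<comment> \<open>The edge is chosen for the unordered pair, so that both partners select the same
    one among parallel edges.\<close>
  define c where "c X = (SOME e. e \<in> edges G \<and> ends G e = X)" for X
  have c: "c {v, p v} \<in> edges G \<and> ends G (c {v, p v}) = {v, p v}" if v: "v \<in> verts G" for v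
    unfolding c_def by (rule someI_ex) (use is_mateD(4)[OF p v] in \<open>auto simp: adj_def\<close>)
  have "perfect_matching G ((\<lambda>v. c {v, p v}) ` verts G)"
    unfolding perfect_matching_def
  proof (intro conjI ballI)
    show "(\<lambda>v. c {v, p v}) ` verts G \<subseteq> edges G" using c by blast
    fix v assume v: "v \<in> verts G"
    show "\<exists>!e. e \<in> (\<lambda>v. c {v, p v}) ` verts G \<and> v \<in> ends G e"
    proof (rule ex1I[of _ "c {v, p v}"])
      fix e assume e: "e \<in> (\<lambda>v. c {v, p v}) ` verts G \<and> v \<in> ends G e"
      then obtain w where w: "w \<in> verts G" "e = c {w, p w}" by blast
      then have "v = w \<or> v = p w" using e c[OF w(1)] by auto
      then have "{w, p w} = {v, p v}" using is_mateD(2)[OF p w(1)] by auto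
      then show "e = c {v, p v}" using w(2) by simp
    qed (use c[OF v] v in auto)
  qed
  then show "\<exists>M. perfect_matching G M" by blast
qed

lemma multigraph_delete_verts: "multigraph G \<Longrightarrow> multigraph (delete_verts G X)"
  unfolding multigraph_def delete_verts_def by auto

lemma adj_delete_verts: "adj (delete_verts G X) u v \<longleftrightarrow> adj G u v \<and> u \<notin> X \<and> v \<notin> X"
  unfolding adj_def delete_verts_def by auto

lemma matchable_on_delete_verts:
  "U \<inter> X = {} \<Longrightarrow> matchable_on (adj (delete_verts G X)) U \<longleftrightarrow> matchable_on (adj G) U"
  using matchable_on_mono[of "adj G" U "adj (delete_verts G X)"] matchable_on_mono[of "adj (delete_verts G X)" U "adj G"]
  by (auto simp: adj_delete_verts)

lemma matchable_delete_verts_iff: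
  assumes "multigraph G"
  shows "matchable (delete_verts G X) \<longleftrightarrow> matchable_on (adj G) (verts G - X)"
  unfolding matchable_def perfect_matching_iff[OF multigraph_delete_verts[OF assms]]
  using matchable_on_delete_verts[of "verts G - X" X G] by (auto simp: delete_verts_def)

lemma perfect_matching_edge_iff:
  assumes G: "multigraph G" and e: "e \<in> edges G"
  shows "(\<exists>M. perfect_matching G M \<and> e \<in> M) \<longleftrightarrow> matchable_on (adj G) (verts G - ends G e)"
proof -
  let ?D = "delete_verts G (ends G e)"
  have "(\<exists>M. perfect_matching G M \<and> e \<in> M) \<longleftrightarrow> (\<exists>M. perfect_matching ?D M)"
  proof
    assume "\<exists>M. perfect_matching G M \<and> e \<in> M"
    then obtain M where "perfect_matching G M" "e \<in> M" by blast
    then have M: "M \<subseteq> edges G" "\<And>v. v \<in> verts G \<Longrightarrow> \<exists>!e. e \<in> M \<and> v \<in> ends G e" "e \<in> M"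
      unfolding perfect_matching_def by simp_all
    have dj: "ends G f \<inter> ends G e = {}" if "f \<in> M" "f \<noteq> e" for f
      using M(2) M(3) that multigraphD(3)[OF G e] by blast
    have "perfect_matching ?D (M - {e})"
      unfolding perfect_matching_def
    proof (intro conjI ballI)
      show "M - {e} \<subseteq> edges ?D" using M(1) dj unfolding delete_verts_def by auto
      fix v assume "v \<in> verts ?D"
      then have v: "v \<in> verts G" "v \<notin> ends G e" unfolding delete_verts_def by auto
      then show "\<exists>!f. f \<in> M - {e} \<and> v \<in> ends ?D f" using M(2)[OF v(1)] unfolding delete_verts_def by auto
    qed
    then show "\<exists>M. perfect_matching ?D M" by blast
  next
    assume "\<exists>M. perfect_matching ?D M"
    then obtain M where "perfect_matching ?D M" by blast
    then have M: "M \<subseteq> edges ?D" "\<And>v. v \<in> verts ?D \<Longrightarrow> \<exists>!e. e \<in> M \<and> v \<in> ends ?D e"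
      unfolding perfect_matching_def by simp_all
    have dj: "ends G f \<inter> ends G e = {}" "f \<in> edges G" if "f \<in> M" for f
      using M(1) that unfolding delete_verts_def by auto
    have "perfect_matching G (insert e M)"
      unfolding perfect_matching_def
    proof (intro conjI ballI)
      show "insert e M \<subseteq> edges G" using dj e by blast
      fix v assume v: "v \<in> verts G"
      show "\<exists>!f. f \<in> insert e M \<and> v \<in> ends G f"
      proof (cases "v \<in> ends G e")
        case True then show ?thesis using dj by blast
      next
        case False
        then have "v \<in> verts ?D" using v unfolding delete_verts_def by simp
        then have "\<exists>!f. f \<in> M \<and> v \<in> ends G f" using M(2) unfolding delete_verts_def by simp
        then show ?thesis using False by blast
      qed
    qed
    then show "\<exists>M. perfect_matching G M \<and> e \<in> M" by blast
  qed
  also have "\<dots> \<longleftrightarrow> matchable_on (adj G) (verts G - ends G e)"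
    using matchable_delete_verts_iff[OF G, of "ends G e"] unfolding matchable_def .
  finally show ?thesis .
qed

lemma graph_connected_iff:
  assumes G: "multigraph G"
  shows "graph_connected G \<longleftrightarrow> verts G \<noteq> {} \<and>
    (\<forall>X. X \<noteq> {} \<longrightarrow> X \<subset> verts G \<longrightarrow> (\<exists>x\<in>X. \<exists>y\<in>verts G - X. adj G x y))"
proof -
  have adjacency: "(u, v) \<in> adjacency G \<longleftrightarrow> adj G u v" for u v unfolding adjacency_def adj_def by simp
  show ?thesis
  proof
    assume c: "graph_connected G"
    show "verts G \<noteq> {} \<and> (\<forall>X. X \<noteq> {} \<longrightarrow> X \<subset> verts G \<longrightarrow> (\<exists>x\<in>X. \<exists>y\<in>verts G - X. adj G x y))"
    proof (intro conjI allI impI)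
      show "verts G \<noteq> {}" using c unfolding graph_connected_def by blast
      fix X assume X: "X \<noteq> {}" "X \<subset> verts G"
      then obtain x y where xy: "x \<in> X" "y \<in> verts G" "y \<notin> X" by blast
      show "\<exists>x\<in>X. \<exists>y\<in>verts G - X. adj G x y"
      proof (rule ccontr)
        assume n: "\<not> ?thesis"
        have "(x, y) \<in> (adjacency G)\<^sup>*" using c xy X unfolding graph_connected_def by blast
        then have "y \<in> X"
        proof (induction rule: rtrancl_induct)
          case (step y z)
          then have "adj G y z" by (simp add: adjacency)
          then show ?case using n step.IH adjD(2)[OF G] by blast
        qed (use xy in simp)
        then show False using xy by simp
      qed
    qed
  next
    assume c: "verts G \<noteq> {} \<and> (\<forall>X. X \<noteq> {} \<longrightarrow> X \<subset> verts G \<longrightarrow> (\<exists>x\<in>X. \<exists>y\<in>verts G - X. adj G x y))"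
    show "graph_connected G"
      unfolding graph_connected_def
    proof (intro conjI ballI)
      show "verts G \<noteq> {}" using c by simp
      fix u v assume u: "u \<in> verts G" and v: "v \<in> verts G"
      let ?X = "{w \<in> verts G. (u, w) \<in> (adjacency G)\<^sup>*}"
      have "?X = verts G"
      proof (rule ccontr)
        assume "?X \<noteq> verts G"
        then have "?X \<subset> verts G" by blast
        moreover have "?X \<noteq> {}" using u by blast
        ultimately obtain x y where xy: "x \<in> ?X" "y \<in> verts G - ?X" "adj G x y" using c by meson
        then have "(u, y) \<in> (adjacency G)\<^sup>*" using adjacency by (auto intro: rtrancl_into_rtrancl)
        then show False using xy by blast
      qed
      then show "(u, v) \<in> (adjacency G)\<^sup>*" using v by blast
    qed
  qed
qed

text \<open>Apart from being a multigraph, the property depends on the adjacency relation alone: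
  parallel edges are exchangeable in a perfect matching.\<close>

lemma matching_covered_iff:
  "matching_covered G \<longleftrightarrow> multigraph G \<and> sym_rel.mcov (adj G) (verts G)"
proof (cases "multigraph G")
  case G: True
  interpret sym_rel "adj G" by (rule sym_rel_adj[OF G])
  have "(\<forall>e\<in>edges G. \<exists>M. perfect_matching G M \<and> e \<in> M) \<longleftrightarrow>
      (\<forall>u\<in>verts G. \<forall>v\<in>verts G. adj G u v \<longrightarrow> matchable_on (adj G) (verts G - {u, v}))" (is "?L \<longleftrightarrow> ?R")
  proof
    assume ?L
    then have L: "matchable_on (adj G) (verts G - ends G e)" if "e \<in> edges G" for e
      using perfect_matching_edge_iff[OF G that] that by simp
    show ?R
    proof (intro ballI impI)
      fix u v assume "adj G u v"
      then obtain e where "e \<in> edges G" "ends G e = {u, v}" unfolding adj_def by blast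
      then show "matchable_on (adj G) (verts G - {u, v})" using L[of e] by simp
    qed
  next
    assume r: ?R
    show ?L
    proof
      fix e assume e: "e \<in> edges G"
      obtain u v where "ends G e = {u, v}" "u \<in> verts G" "v \<in> verts G" "adj G u v"
        using multigraph_ends[OF G e] .
      then show "\<exists>M. perfect_matching G M \<and> e \<in> M" using r perfect_matching_edge_iff[OF G e] by simp
    qed
  qed
  moreover define C where "C \<longleftrightarrow> (\<forall>X. X \<noteq> {} \<longrightarrow> X \<subset> verts G \<longrightarrow> (\<exists>x\<in>X. \<exists>y\<in>verts G - X. adj G x y))"
  moreover have "verts G \<noteq> {}" if "2 \<le> card (verts G)" using that by auto
  ultimately show ?thesis
    unfolding matching_covered_def mcov_def graph_connected_iff[OF G] C_def[symmetric]
    using multigraphD(1)[OF G] G by metis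
qed (simp add: matching_covered_def)

section \<open>Attaching ears to a matching covered graph\<close>

lemma matchable_on_list:
  assumes "even (length vs)" "distinct vs" "successively R vs" "\<And>u v. R u v \<Longrightarrow> R v u"
  shows "matchable_on R (set vs)"
  using assms(1-3)
proof (induction "length vs" arbitrary: vs rule: less_induct)
  case less
  show ?case
  proof (cases vs)
    case (Cons a us)
    then obtain b ws where us: "us = b # ws" using less.prems(1) by (cases us) auto
    have "matchable_on R ({a, b} \<union> set ws)"
    proof (rule matchable_on_Un)
      show "matchable_on R {a, b}" by (rule matchable_on_pair) (use less.prems Cons us assms(4) in auto)
      show "matchable_on R (set ws)"
        by (rule less.hyps) (use less.prems Cons us in \<open>auto simp: successively_Cons\<close>)
    qed (use less.prems Cons us in auto)
    then show ?thesis using Cons us by simp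
  qed simp
qed

lemma crossing_index:
  assumes "\<not> P (vs ! 0)" "P (vs ! j)" "j < length vs"
  shows "\<exists>i. Suc i < length vs \<and> \<not> P (vs ! i) \<and> P (vs ! Suc i)"
  using assms(2,3)
proof (induction j)
  case (Suc j)
  then show ?case by (cases "P (vs ! j)") auto
qed (use assms(1) in simp)

lemma set_list_minus_pair:
  assumes "distinct vs" "Suc i < length vs"
  shows "set vs - {vs ! i, vs ! Suc i} = set (take i vs) \<union> set (drop (Suc (Suc i)) vs)"
    "set (take i vs) \<inter> set (drop (Suc (Suc i)) vs) = {}"
proof -
  have e: "vs = take i vs @ vs ! i # vs ! Suc i # drop (Suc (Suc i)) vs"
    using assms(2) by (metis Cons_nth_drop_Suc Suc_lessD append_take_drop_id)
  then have "distinct (take i vs @ vs ! i # vs ! Suc i # drop (Suc (Suc i)) vs)" using assms(1) by simp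
  moreover have "set vs = set (take i vs @ vs ! i # vs ! Suc i # drop (Suc (Suc i)) vs)" using e by simp
  ultimately show "set vs - {vs ! i, vs ! Suc i} = set (take i vs) \<union> set (drop (Suc (Suc i)) vs)"
    "set (take i vs) \<inter> set (drop (Suc (Suc i)) vs) = {}" by auto
qed

lemma successively_take: "successively R vs \<Longrightarrow> successively R (take i vs)"
  by (simp add: successively_conv_nth)

lemma successively_drop: "successively R vs \<Longrightarrow> successively R (drop i vs)"
  by (simp add: successively_conv_nth)

text \<open>Only the vertices are recorded. An even number of them makes the path odd, and the
  shortest ear is a single edge.\<close>

definition ear :: "('v \<Rightarrow> 'v \<Rightarrow> bool) \<Rightarrow> 'v set \<Rightarrow> 'v list \<Rightarrow> bool" where
  "ear R V vs \<longleftrightarrow> even (length vs) \<and> 2 \<le> length vs \<and> distinct vs \<and> successively R vs \<and>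
     hd vs \<in> V \<and> last vs \<in> V \<and> set (butlast (tl vs)) \<inter> V = {}"

lemma ear_decomp:
  assumes "ear R V vs"
  obtains a ws b where "vs = a # ws @ [b]" "a \<in> V" "b \<in> V" "set ws \<inter> V = {}" "even (length ws)"
    "distinct (a # ws @ [b])" "hd vs = a" "last vs = b" "butlast (tl vs) = ws"
proof -
  obtain a us where vs: "vs = a # us" using assms unfolding ear_def by (cases vs) auto
  have "us \<noteq> []" using assms vs unfolding ear_def by auto
  then have us: "us = butlast us @ [last us]" by simp
  show ?thesis
    by (rule that[of a "butlast us" "last us"]) (use assms vs us \<open>us \<noteq> []\<close> in \<open>auto simp: ear_def\<close>)
qed

context sym_rel begin

lemma ear_inner_matchable:
  assumes "ear R V vs"
  shows "matchable_on R (set vs - V)" "matchable_on R (set vs)" "set vs \<inter> V = {hd vs, last vs}"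
proof -
  obtain a ws b where w: "vs = a # ws @ [b]" "a \<in> V" "b \<in> V" "set ws \<inter> V = {}" "even (length ws)"
    "distinct (a # ws @ [b])" "hd vs = a" "last vs = b" using ear_decomp[OF assms] by metis
  have s: "successively R vs" using assms unfolding ear_def by simp
  have "matchable_on R (set ws)"
    by (rule matchable_on_list) (use w s sym in \<open>auto simp: successively_Cons successively_append_iff\<close>)
  moreover have "set vs - V = set ws" using w by auto
  ultimately show "matchable_on R (set vs - V)" by simp
  show "matchable_on R (set vs)"
    by (rule matchable_on_list) (use assms sym in \<open>auto simp: ear_def\<close>)
  show "set vs \<inter> V = {hd vs, last vs}" using w by auto
qed

text \<open>The edges of an odd path split into two matchings: those at even positions cover the
  whole path, those at odd positions exactly the inner vertices.\<close>

lemma ear_minus_edge_matchable: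
  assumes "ear R V vs" "Suc i < length vs"
  shows "even i \<Longrightarrow> matchable_on R (set vs - {vs ! i, vs ! Suc i})"
    "odd i \<Longrightarrow> matchable_on R (set vs - V - {vs ! i, vs ! Suc i})"
proof -
  have e: "even (length vs)" "distinct vs" "successively R vs" using assms(1) unfolding ear_def by auto
  note sp = set_list_minus_pair[OF e(2) assms(2)]
  show "matchable_on R (set vs - {vs ! i, vs ! Suc i})" if "even i"
    unfolding sp(1)
  proof (rule matchable_on_Un[OF _ _ sp(2)])
    show "matchable_on R (set (take i vs))"
      by (rule matchable_on_list) (use e that assms(2) sym in \<open>auto simp: successively_take\<close>)
    show "matchable_on R (set (drop (Suc (Suc i)) vs))"
      by (rule matchable_on_list) (use e that assms(2) sym in \<open>auto simp: successively_drop\<close>)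
  qed
  obtain a ws b where w: "vs = a # ws @ [b]" "a \<in> V" "b \<in> V" "set ws \<inter> V = {}" "even (length ws)"
    "distinct (a # ws @ [b])" using ear_decomp[OF assms(1)] by metis
  show "matchable_on R (set vs - V - {vs ! i, vs ! Suc i})" if od: "odd i"
  proof -
    obtain j where j: "i = Suc j" "even j" using od by (cases i) auto
    have "Suc (Suc j) \<noteq> Suc (length ws)" using j(2) w(5) by (metis Suc_inject even_Suc)
    then have jl: "Suc j < length ws" using assms(2) j w(1) by auto
    have n: "vs ! i = ws ! j" "vs ! Suc i = ws ! Suc j" using j jl w(1) by (auto simp: nth_append)
    have "set vs - V = set ws" using w by auto
    then have "set vs - V - {vs ! i, vs ! Suc i} = set ws - {ws ! j, ws ! Suc j}" using n by simp
    moreover have dw: "distinct ws" "successively R ws"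
      using w(6) e(3) w(1) by (auto simp: successively_Cons successively_append_iff)
    note sp' = set_list_minus_pair[OF dw(1) jl]
    have "matchable_on R (set ws - {ws ! j, ws ! Suc j})"
      unfolding sp'(1)
    proof (rule matchable_on_Un[OF _ _ sp'(2)])
      show "matchable_on R (set (take j ws))"
        by (rule matchable_on_list) (use dw w(5) j jl sym in \<open>auto simp: successively_take\<close>)
      show "matchable_on R (set (drop (Suc (Suc j)) ws))"
        by (rule matchable_on_list) (use dw w(5) j jl sym in \<open>auto simp: successively_drop\<close>)
    qed
    ultimately show ?thesis by simp
  qed
qed

text \<open>All ears are switched at once. Old edges and edges at odd positions are covered while
  the other ears match only their inner vertices. An edge at an even position is covered when every
  ear matches its own ends too, which is possible because \<open>V0\<close> without all these ends
  is matchable.\<close>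

lemma mcov_add_ears:
  assumes R0: "sym_rel R0" "sym_rel.mcov R0 V0" "\<And>u v. R0 u v \<Longrightarrow> R u v"
    and P: "finite \<P>" "\<And>vs. vs \<in> \<P> \<Longrightarrow> ear R V0 vs"
    and disj: "\<And>us vs. us \<in> \<P> \<Longrightarrow> vs \<in> \<P> \<Longrightarrow> us \<noteq> vs \<Longrightarrow> set us \<inter> set vs = {}"
    and mt: "matchable_on R0 (V0 - (\<Union>vs\<in>\<P>. {hd vs, last vs}))"
    and V: "V = V0 \<union> (\<Union>vs\<in>\<P>. set vs)"
    and R: "\<And>u v. R u v \<Longrightarrow> u \<in> V \<Longrightarrow> v \<in> V \<Longrightarrow> R0 u v \<and> u \<in> V0 \<and> v \<in> V0 \<or>
      (\<exists>vs\<in>\<P>. \<exists>i. Suc i < length vs \<and> {u, v} = {vs ! i, vs ! Suc i})"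
  shows "mcov V"
proof -
  interpret A: sym_rel R0 by (rule R0(1))
  note M0 = A.mcovD[OF R0(2)]
  have fV: "finite V" unfolding V using M0(1) P(1) by simp
  have up: "matchable_on R X" if "matchable_on R0 X" for X using matchable_on_mono[OF that] R0(3) by blast
  have inn: "matchable_on R (\<Union>vs\<in>\<Q>. set vs - V0)" if "\<Q> \<subseteq> \<P>" for \<Q>
    by (rule matchable_on_UN) (use that ear_inner_matchable(1) P(2) disj in blast)+
  have conn: "\<exists>x\<in>X. \<exists>y\<in>V - X. R x y" if X: "X \<noteq> {}" "X \<subset> V" for X
  proof -
    \<comment> \<open>A set that misses \<open>V0\<close> can be left along an ear, whose first
      vertex lies in \<open>V0\<close>. For a set that contains \<open>V0\<close> the same is
      applied to the complement.\<close>
    have reach: "\<exists>x\<in>Y. \<exists>y\<in>V - Y. R x y" if Y: "Y \<noteq> {}" "Y \<subseteq> V" "Y \<inter> V0 = {}" for Y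
    proof -
      obtain y vs where y: "y \<in> Y" "vs \<in> \<P>" "y \<in> set vs" using Y V by blast
      then obtain j where j: "j < length vs" "vs ! j = y" by (auto simp: in_set_conv_nth)
      have E: "ear R V0 vs" by (rule P(2)[OF y(2)])
      then have "vs ! 0 \<notin> Y" using Y(3) hd_conv_nth[of vs] unfolding ear_def by fastforce
      then obtain i where i: "Suc i < length vs" "vs ! i \<notin> Y" "vs ! Suc i \<in> Y"
        using crossing_index[of "\<lambda>x. x \<in> Y" vs j] j y(1) by blast
      have "R (vs ! i) (vs ! Suc i)" using E i(1) unfolding ear_def by (simp add: successively_conv_nth)
      moreover have "vs ! i \<in> V" using V y(2) i(1) by force
      ultimately show ?thesis using i sym by blast
    qed
    show ?thesis
    proof (cases "V0 \<inter> X = {}")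
      case True
      then show ?thesis using reach[of X] X by blast
    next
      case a: False
      show ?thesis
      proof (cases "V0 \<subseteq> X")
        case True
        then obtain x y where "x \<in> V - X" "y \<in> V - (V - X)" "R x y" using reach[of "V - X"] X by blast
        then show ?thesis using X sym by blast
      next
        case False
        then have "V0 \<inter> X \<subset> V0" by blast
        then obtain x y where "x \<in> V0 \<inter> X" "y \<in> V0 - (V0 \<inter> X)" "R0 x y" using M0(3)[OF a] by blast
        then show ?thesis using R0(3) V by blast
      qed
    qed
  qed
  have cov: "matchable_on R (V - {u, v})" if uv: "u \<in> V" "v \<in> V" "R u v" for u v
    using R[OF uv(3,1,2)]
  proof (elim disjE bexE exE conjE)
    assume h: "R0 u v" "u \<in> V0" "v \<in> V0"
    have "matchable_on R (V0 - {u, v})" using up M0(4)[OF h(2,3,1)] by blast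
    then show ?thesis by (rule matchable_on_Un'[OF _ inn[of \<P>]]) (use V h in auto)
  next
    fix vs i assume h: "vs \<in> \<P>" "Suc i < length vs" "{u, v} = {vs ! i, vs ! Suc i}"
    note E = P(2)[OF h(1)]
    have uvs: "u \<in> set vs" "v \<in> set vs" using h(2,3) by (auto simp: doubleton_eq_iff)
    show ?thesis
    proof (cases "even i")
      case True
      have full: "matchable_on R (\<Union>ws\<in>\<P>. set ws - (if ws = vs then {u, v} else {}))"
      proof (rule matchable_on_UN)
        fix ws assume w: "ws \<in> \<P>"
        show "matchable_on R (set ws - (if ws = vs then {u, v} else {}))"
          using ear_minus_edge_matchable(1)[OF E h(2) True] ear_inner_matchable(2)[OF P(2)[OF w]] h(3) by simp
      qed (use disj in blast)
      have "V0 - (\<Union>vs\<in>\<P>. {hd vs, last vs}) = V0 - (\<Union>vs\<in>\<P>. set vs)"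
        using ear_inner_matchable(3)[OF P(2)] by blast
      then have "matchable_on R (V0 - (\<Union>vs\<in>\<P>. set vs))" using up[OF mt] by simp
      then show ?thesis
      proof (rule matchable_on_Un'[OF _ full])
        have only: "ws = vs" if "ws \<in> \<P>" "u \<in> set ws \<or> v \<in> set ws" for ws
          using disj[OF that(1) h(1)] that(2) uvs by blast
        have "set ws - (if ws = vs then {u, v} else {}) = set ws - {u, v}" if "ws \<in> \<P>" for ws
          using only[OF that] by (cases "ws = vs") auto
        then have "(\<Union>ws\<in>\<P>. set ws - (if ws = vs then {u, v} else {})) = (\<Union>ws\<in>\<P>. set ws - {u, v})"
          by (intro SUP_cong) auto
        also have "\<dots> = (\<Union>ws\<in>\<P>. set ws) - {u, v}" by blast
        finally have "(\<Union>ws\<in>\<P>. set ws - (if ws = vs then {u, v} else {})) = (\<Union>ws\<in>\<P>. set ws) - {u, v}" .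
        then show "V - {u, v} = V0 - (\<Union>vs\<in>\<P>. set vs) \<union> (\<Union>ws\<in>\<P>. set ws - (if ws = vs then {u, v} else {}))"
          using V uvs h(1) by auto
      qed (auto split: if_splits)
    next
      case False
      have o: "matchable_on R (set vs - V0 - {u, v})"
        using ear_minus_edge_matchable(2)[OF E h(2) False] h(3) by simp
      obtain a ws b where w: "vs = a # ws @ [b]" "a \<in> V0" "b \<in> V0" "set ws \<inter> V0 = {}" "even (length ws)"
        using ear_decomp[OF E] by metis
      have "vs ! i \<notin> V0 \<and> vs ! Suc i \<notin> V0"
      proof -
        obtain j where j: "i = Suc j" "even j" using False by (cases i) auto
        have "Suc (Suc j) \<noteq> Suc (length ws)" using j(2) w(5) by (metis Suc_inject even_Suc)
        then have jl: "Suc j < length ws" using h(2) j w(1) by auto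
        have "vs ! i = ws ! j" "vs ! Suc i = ws ! Suc j" using j jl w(1) by (auto simp: nth_append)
        then show ?thesis using w(4) jl by (metis IntI Suc_lessD empty_iff nth_mem)
      qed
      then have uv0: "u \<notin> V0" "v \<notin> V0" using h(3) by (auto simp: doubleton_eq_iff)
      have "matchable_on R V0" using up A.mcov_matchable[OF R0(2)] by blast
      then have "matchable_on R (V0 \<union> (set vs - V0 - {u, v}))" by (rule matchable_on_Un[OF _ o]) blast
      then show ?thesis
      proof (rule matchable_on_Un'[OF _ inn[of "\<P> - {vs}"]])
        have "set ws \<inter> set vs = {}" if "ws \<in> \<P> - {vs}" for ws using disj[of ws vs] that h(1) by blast
        then have d: "(\<Union>ws\<in>\<P> - {vs}. set ws) \<inter> set vs = {}" by blast
        then show "(V0 \<union> (set vs - V0 - {u, v})) \<inter> (\<Union>ws\<in>\<P> - {vs}. set ws - V0) = {}" by blast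
        have "V = V0 \<union> (set vs \<union> (\<Union>ws\<in>\<P> - {vs}. set ws))" using V h(1) by blast
        then show "V - {u, v} = V0 \<union> (set vs - V0 - {u, v}) \<union> (\<Union>ws\<in>\<P> - {vs}. set ws - V0)"
          using d uvs uv0 by blast
      qed blast
    qed
  qed
  have "card V0 \<le> card V" using V fV by (intro card_mono) auto
  then have "2 \<le> card V" using M0(2) by simp
  then show ?thesis unfolding mcov_def using fV conn cov by blast
qed

end

section \<open>Ears of a conformal subgraph\<close>

lemma ear_walk:
  assumes "finite W" "x \<notin> W" "is_mate R W m" "\<And>y. y \<in> insert x W \<Longrightarrow> n (n y) = y \<and> n y \<noteq> y"
  shows "\<exists>vs. even (length vs) \<and> 2 \<le> length vs \<and> hd vs = x \<and> distinct vs \<and> set (butlast (tl vs)) \<subseteq> W \<and>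
    last vs \<notin> insert x W \<and> (\<forall>i. Suc i < length vs \<longrightarrow> vs ! Suc i = (if even i then n (vs ! i) else m (vs ! i)))"
  using assms
proof (induction "card W" arbitrary: W x rule: less_induct)
  case less
  show ?case
  proof (cases "n x \<in> W")
    case False
    then show ?thesis using less.prems(4)[of x]
      by (intro exI[of _ "[x, n x]"]) (auto simp: less_Suc_eq)
  next
    case True
    define r r' where "r = n x" and "r' = m r"
    have r: "r \<in> W" using True r_def by simp
    note q = is_mateD[OF less.prems(3) r, folded r'_def]
    have nr: "n r = x" using less.prems(4)[of x] r_def by simp
    let ?L = "W - {r, r'}"
    have mt: "is_mate R ?L m"
    proof (rule is_mate_subset[OF less.prems(3)])
      fix u assume u: "u \<in> ?L"
      note qu = is_mateD[OF less.prems(3), of u]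
      have "m u \<noteq> r" "m u \<noteq> r'" using qu u q r'_def by auto
      then show "m u \<in> ?L" using qu u by auto
    qed auto
    have c: "card ?L < card W" by (rule psubset_card_mono) (use less.prems(1) r in auto)
    have nn: "n (n y) = y \<and> n y \<noteq> y" if "y \<in> insert r' ?L" for y
      using less.prems(4)[of y] that q(1) by auto
    obtain vs where vs: "even (length vs)" "2 \<le> length vs" "hd vs = r'" "distinct vs"
      "set (butlast (tl vs)) \<subseteq> ?L" "last vs \<notin> insert r' ?L"
      "\<And>i. Suc i < length vs \<Longrightarrow> vs ! Suc i = (if even i then n (vs ! i) else m (vs ! i))"
      using less.hyps[OF c _ _ mt nn] less.prems(1) by blast
    obtain us where us: "vs = r' # us" using vs(2,3) by (cases vs) auto
    then have "us \<noteq> []" using vs(2) by auto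
    note us = us this
    define z where "z = last us"
    have use: "us = butlast us @ [z]" using us z_def by simp
    have bu: "set (butlast us) \<subseteq> ?L" using vs(5) us by simp
    have z: "z \<notin> insert r' ?L" using vs(6) us z_def by auto
    have len: "length vs = Suc (length us)" "0 < length us" using us by auto
    have zl: "vs ! (length vs - 1) = z" using us z_def by (simp add: last_conv_nth)
    define y where "y = vs ! (length vs - 2)"
    have yin: "y \<in> insert r' ?L"
    proof (cases "length us = 1")
      case True then show ?thesis using us y_def by simp
    next
      case False
      then have "2 \<le> length us" using len(2) by linarith
      then obtain k where k: "length us = Suc (Suc k)" by (metis add_2_eq_Suc le_Suc_ex)
      then have "y = butlast us ! k" "k < length (butlast us)"
        using us y_def by (auto simp: nth_butlast)
      then have "y \<in> set (butlast us)" by simp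
      then show ?thesis using bu by blast
    qed
    \<comment> \<open>As the list has even length, its last step follows \<open>n\<close>. Hence
      \<open>z\<close> is neither \<open>x\<close> nor \<open>r\<close>, because these two are each
      other's images under \<open>n\<close>.\<close>
    have zy: "z = n y"
    proof -
      have "Suc (length vs - 2) < length vs" "even (length vs - 2)" "Suc (length vs - 2) = length vs - 1" using vs(1,2) by auto
      then show ?thesis using vs(7)[of "length vs - 2"] zl y_def by simp
    qed
    have ny: "n z = y" using nn[OF yin] zy by simp
    have yx: "y \<noteq> x" "y \<noteq> r" using yin less.prems(2) q by auto
    have "z \<noteq> x" using ny yx(2) r_def by metis
    moreover have "z \<noteq> r" using ny nr yx(1) by metis
    ultimately have zn: "z \<notin> insert x W" using z by auto
    have xr: "x \<noteq> r" "x \<noteq> r'" "r \<noteq> r'" using r q less.prems(2) by auto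
    let ?vs = "x # r # vs"
    have "set us = insert z (set (butlast us))" by (subst use) simp
    then have sub: "set vs \<subseteq> insert r' (insert z ?L)" using us(1) bu by auto
    have "distinct ?vs" using vs(4) sub xr zn r q less.prems(2) by auto
    moreover have "set (butlast (tl ?vs)) \<subseteq> W" using us bu r q by (auto simp: butlast_append)
    moreover have "last ?vs \<notin> insert x W" using us zn z_def by simp
    moreover have "\<forall>i. Suc i < length ?vs \<longrightarrow> ?vs ! Suc i = (if even i then n (?vs ! i) else m (?vs ! i))"
    proof (intro allI impI)
      fix i assume i: "Suc i < length ?vs"
      consider "i = 0" | "i = 1" | j where "i = Suc (Suc j)" by (metis One_nat_def not0_implies_Suc)
      then show "?vs ! Suc i = (if even i then n (?vs ! i) else m (?vs ! i))"
        using vs(3,7) i r_def r'_def us by cases auto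
    qed
    ultimately show ?thesis using vs(1) by (intro exI[of _ ?vs]) simp
  qed
qed

lemma degree_internal:
  assumes L: "multigraph L" and P: "is_path L P" and v: "v \<in> internal_verts P"
    and only: "\<And>e. e \<in> edges L \<Longrightarrow> v \<in> ends L e \<Longrightarrow> e \<in> set (snd P)"
  shows "degree L v = 2"
proof -
  obtain vs es where Pe: "P = (vs, es)" by (cases P)
  have p: "length vs = Suc (length es)" "distinct vs"
    "\<And>i. i < length es \<Longrightarrow> es ! i \<in> edges L \<and> ends L (es ! i) = {vs ! i, vs ! Suc i}"
    using P unfolding Pe is_path_def by auto
  obtain j where j: "j < length (butlast (tl vs))" "v = butlast (tl vs) ! j"
    using v unfolding internal_verts_def Pe by (auto simp: in_set_conv_nth)
  have jl: "Suc j < length es" "v = vs ! Suc j" using j p(1) by (auto simp: nth_butlast nth_tl)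
  have "incident_edges L v = {es ! j, es ! Suc j}"
  proof (intro equalityI subsetI)
    fix e assume "e \<in> incident_edges L v"
    then have e: "e \<in> edges L" "v \<in> ends L e" unfolding incident_edges_def by auto
    then obtain i where i: "i < length es" "e = es ! i" using only unfolding Pe by (auto simp: in_set_conv_nth)
    then have "v = vs ! i \<or> v = vs ! Suc i" using e(2) p(3) by auto
    then have "i = Suc j \<or> i = j" using jl p(1,2) i(1) by (auto simp: nth_eq_iff_index_eq)
    then show "e \<in> {es ! j, es ! Suc j}" using i by auto
  next
    fix e assume "e \<in> {es ! j, es ! Suc j}"
    then show "e \<in> incident_edges L v" using p(3)[of j] p(3)[of "Suc j"] jl unfolding incident_edges_def by auto
  qed
  moreover have "es ! j \<noteq> es ! Suc j"
  proof
    assume "es ! j = es ! Suc j"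
    then have "{vs ! j, vs ! Suc j} = {vs ! Suc j, vs ! Suc (Suc j)}" using p(3)[of j] p(3)[of "Suc j"] jl by auto
    then have "vs ! j = vs ! Suc (Suc j)" by (auto simp: doubleton_eq_iff)
    then show False using p(1,2) jl by (simp add: nth_eq_iff_index_eq)
  qed
  ultimately show ?thesis unfolding degree_def by simp
qed

text \<open>The ears \<open>P u\<close> alternate between a perfect matching of \<open>G\<close> through an edge outside \<open>H\<close> and the
  perfect matching \<open>m\<close> of the complement of \<open>H\<close>.\<close>

lemma conformal_ears:
  assumes mcG: "matching_covered G" and mcH: "matching_covered H"
    and sub: "verts H \<subseteq> verts G" "edges H \<subseteq> edges G" "ends H = ends G"
    and conf: "matchable_on (adj G) (verts G - verts H)" and ne: "edges H \<noteq> edges G \<or> verts H \<noteq> verts G"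
  obtains U \<tau> P m where "U \<subseteq> verts H" "U \<noteq> {}" "\<And>u. u \<in> U \<Longrightarrow> \<tau> u \<in> U \<and> \<tau> (\<tau> u) = u \<and> \<tau> u \<noteq> u"
    "matchable_on (adj H) (verts H - U)" "is_mate (adj G) (verts G - verts H) m"
    "\<And>u. u \<in> U \<Longrightarrow> is_path G (P u) \<and> ear (adj G) (verts H) (fst (P u)) \<and> hd (fst (P u)) = u \<and>
      last (fst (P u)) = \<tau> u \<and> set (snd (P u)) \<inter> edges H = {} \<and> odd (length (snd (P u))) \<and>
      (\<forall>w\<in>set (fst (P u)) - verts H. m w \<in> set (fst (P u)))"
    "\<And>u v. u \<in> U \<Longrightarrow> v \<in> U \<Longrightarrow> v \<noteq> u \<Longrightarrow> v \<noteq> \<tau> u \<Longrightarrow> set (fst (P u)) \<inter> set (fst (P v)) = {}"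
proof -
  have G: "multigraph G" and H: "multigraph H" using mcG mcH unfolding matching_covered_def by auto
  interpret G: sym_rel "adj G" by (rule sym_rel_adj[OF G])
  interpret H: sym_rel "adj H" by (rule sym_rel_adj[OF H])
  have mG: "G.mcov (verts G)" and mH: "H.mcov (verts H)" using mcG mcH matching_covered_iff by auto
  define W where "W = verts G - verts H"
  have fW: "finite W" unfolding W_def using multigraphD(1)[OF G] by simp
  have Hne: "verts H \<noteq> {}" using mcH unfolding matching_covered_def by auto
  \<comment> \<open>The perfect matching has to be forced out of \<open>H\<close>: it is taken
    through an edge that is not in \<open>H\<close> but has an end there.\<close>
  have "\<exists>e u. e \<in> edges G - edges H \<and> u \<in> ends G e \<and> u \<in> verts H"
  proof (cases "verts H = verts G")
    case True
    then obtain e where e: "e \<in> edges G - edges H" using ne sub(2) by blast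
    then obtain u v where "ends G e = {u, v}" "u \<in> verts G" using multigraph_ends[OF G, of e] by blast
    then show ?thesis using e True by blast
  next
    case False
    then have "verts H \<subset> verts G" using sub(1) by blast
    then obtain x y where xy: "x \<in> verts H" "y \<in> verts G - verts H" "adj G x y" using G.mcovD(3)[OF mG Hne] by blast
    then obtain e where e: "e \<in> edges G" "ends G e = {x, y}" unfolding adj_def by blast
    then have "e \<notin> edges H" using multigraphD(3)[OF H, of e] sub(3) xy(2) by auto
    then show ?thesis using e xy(1) by blast
  qed
  then obtain e0 u0 where e0: "e0 \<in> edges G" "e0 \<notin> edges H" "u0 \<in> ends G e0" "u0 \<in> verts H" by blast
  obtain N where "perfect_matching G N" "e0 \<in> N" using mcG e0(1) unfolding matching_covered_def by blast
  then have N: "N \<subseteq> edges G" "\<And>v. v \<in> verts G \<Longrightarrow> \<exists>!e. e \<in> N \<and> v \<in> ends G e" "e0 \<in> N"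
    unfolding perfect_matching_def by simp_all
  define el where "el v = (THE e. e \<in> N \<and> v \<in> ends G e)" for v
  have el: "el v \<in> N" "v \<in> ends G (el v)" if "v \<in> verts G" for v
    using theI'[OF N(2)[OF that]] unfolding el_def by auto
  have elu: "e = el v" if "e \<in> N" "v \<in> ends G e" "v \<in> verts G" for e v
    using N(2)[OF that(3)] el[OF that(3)] that by blast
  have "\<exists>w. ends G (el v) = {v, w} \<and> v \<noteq> w \<and> w \<in> verts G" if v: "v \<in> verts G" for v
    using multigraph_other_end[OF G _ el(2)[OF v]] el(1)[OF v] N(1) by (metis subsetD)
  then obtain n where n: "\<And>v. v \<in> verts G \<Longrightarrow> ends G (el v) = {v, n v} \<and> v \<noteq> n v \<and> n v \<in> verts G"
    by metis
  have eln: "el (n v) = el v" if v: "v \<in> verts G" for v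
    using elu[OF el(1)[OF v], of "n v"] n[OF v] by auto
  have nn: "n (n v) = v" if v: "v \<in> verts G" for v
  proof -
    have "{v, n v} = {n v, n (n v)}" using n[OF v] n[of "n v"] eln[OF v] by auto
    then show ?thesis using n[OF v] by (auto simp: doubleton_eq_iff)
  qed
  obtain m where m: "is_mate (adj G) W m" using conf unfolding matchable_on_def W_def by blast
  define ml where "ml w = (SOME e. e \<in> edges G \<and> ends G e = {w, m w})" for w
  have ml: "ml w \<in> edges G \<and> ends G (ml w) = {w, m w}" if w: "w \<in> W" for w
    unfolding ml_def by (rule someI_ex) (use is_mateD(4)[OF m w] in \<open>auto simp: adj_def\<close>)
  \<comment> \<open>The test is on the edge \<open>el u\<close>, not on the partner
    \<open>n u\<close>, since an edge of \<open>H\<close> may be parallel to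
    \<open>el u\<close>.\<close>
  define U where "U = {u \<in> verts H. el u \<notin> edges H}"
  have UG: "u \<in> verts G" if "u \<in> U" for u using that sub(1) unfolding U_def by blast
  have HnW: "u \<notin> W" if "u \<in> verts H" for u using that unfolding W_def by simp
  have "\<forall>u\<in>U. \<exists>vs. even (length vs) \<and> 2 \<le> length vs \<and> hd vs = u \<and> distinct vs \<and> set (butlast (tl vs)) \<subseteq> W \<and>
    last vs \<notin> insert u W \<and> (\<forall>i. Suc i < length vs \<longrightarrow> vs ! Suc i = (if even i then n (vs ! i) else m (vs ! i)))"
  proof
    fix u assume u: "u \<in> U"
    show "\<exists>vs. even (length vs) \<and> 2 \<le> length vs \<and> hd vs = u \<and> distinct vs \<and> set (butlast (tl vs)) \<subseteq> W \<and>
      last vs \<notin> insert u W \<and> (\<forall>i. Suc i < length vs \<longrightarrow> vs ! Suc i = (if even i then n (vs ! i) else m (vs ! i)))"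
    proof (rule ear_walk[OF fW _ m])
      show "u \<notin> W" using u HnW unfolding U_def by blast
      fix y assume "y \<in> insert u W"
      then have "y \<in> verts G" using UG[OF u] W_def by auto
      then show "n (n y) = y \<and> n y \<noteq> y" using nn n[of y] by metis
    qed
  qed
  then obtain f where f: "\<And>u. u \<in> U \<Longrightarrow> even (length (f u)) \<and> 2 \<le> length (f u) \<and> hd (f u) = u \<and> distinct (f u) \<and>
      set (butlast (tl (f u))) \<subseteq> W \<and> last (f u) \<notin> insert u W \<and>
      (\<forall>i. Suc i < length (f u) \<longrightarrow> f u ! Suc i = (if even i then n (f u ! i) else m (f u ! i)))"
    by metis
  define g where "g u = map (\<lambda>i. if even i then el (f u ! i) else ml (f u ! i)) [0..<length (f u) - 1]" for u
  have inner: "f u ! i \<in> W" if "u \<in> U" "0 < i" "Suc i < length (f u)" for u i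
  proof -
    have "f u ! i = butlast (tl (f u)) ! (i - 1)" "i - 1 < length (butlast (tl (f u)))"
      using that by (auto simp: nth_butlast nth_tl)
    then have "f u ! i \<in> set (butlast (tl (f u)))" by (metis nth_mem)
    then show ?thesis using f[OF that(1)] by blast
  qed
  have f0: "f u ! 0 = u" if u: "u \<in> U" for u
    using f[OF u] by (metis hd_conv_nth length_0_conv not_numeral_le_zero)
  have step: "f u ! Suc i = (if even i then n (f u ! i) else m (f u ! i))" if "u \<in> U" "Suc i < length (f u)" for u i
    using f[OF that(1)] that(2) by blast
  have fV: "f u ! i \<in> verts G" if u: "u \<in> U" and i: "i < length (f u)" for u i
    using i
  proof (induction i)
    case 0 then show ?case using f0[OF u] UG[OF u] by simp
  next
    case (Suc i)
    then have IH: "f u ! i \<in> verts G" by simp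
    show ?case
    proof (cases "even i")
      case True then show ?thesis using step[OF u Suc.prems] n[OF IH] by simp
    next
      case False
      then have "0 < i" by (cases i) auto
      then have "f u ! i \<in> W" using inner[OF u _ Suc.prems] by simp
      then have "m (f u ! i) \<in> W" using is_mateD(1)[OF m] by blast
      then show ?thesis using step[OF u Suc.prems] False W_def by simp
    qed
  qed
  have gi: "g u ! i \<in> edges G \<and> ends G (g u ! i) = {f u ! i, f u ! Suc i}" if u: "u \<in> U" and i: "Suc i < length (f u)" for u i
  proof (cases "even i")
    case True
    then have "g u ! i = el (f u ! i)" using i unfolding g_def by simp
    then show ?thesis using n[OF fV[OF u Suc_lessD[OF i]]] el(1)[OF fV[OF u Suc_lessD[OF i]]] N(1) step[OF u i] True by auto
  next
    case False
    then have "0 < i" by (cases i) auto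
    have "g u ! i = ml (f u ! i)" using i False unfolding g_def by simp
    then show ?thesis using ml[OF inner[OF u \<open>0 < i\<close> i]] step[OF u i] False by auto
  qed
  have flast: "last (f u) \<in> verts H" if u: "u \<in> U" for u
  proof -
    have "f u \<noteq> []" using f[OF u] by auto
    then have "last (f u) \<in> verts G" using fV[OF u, of "length (f u) - 1"] by (simp add: last_conv_nth)
    then show ?thesis using f[OF u] unfolding W_def by blast
  qed
  have path: "is_path G (f u, g u)" if u: "u \<in> U" for u
  proof -
    have "length (f u) = Suc (length (g u))" using f[OF u] unfolding g_def by auto
    moreover have "set (f u) \<subseteq> verts G" using fV[OF u] by (auto simp: in_set_conv_nth)
    ultimately show ?thesis using f[OF u] gi[OF u] unfolding is_path_def by simp
  qed
  have earf: "ear (adj G) (verts H) (f u)" if u: "u \<in> U" for u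
  proof -
    have "successively (adj G) (f u)" unfolding successively_conv_nth
    proof (intro allI impI)
      fix i assume "Suc i < length (f u)"
      then show "adj G (f u ! i) (f u ! Suc i)" using gi[OF u, of i] unfolding adj_def by blast
    qed
    moreover have "set (butlast (tl (f u))) \<inter> verts H = {}" using f[OF u] HnW by blast
    moreover have "u \<in> verts H" using u unfolding U_def by simp
    ultimately show ?thesis unfolding ear_def using f[OF u] flast[OF u] by simp
  qed
  have gH: "g u ! i \<notin> edges H" if u: "u \<in> U" and i: "Suc i < length (f u)" for u i
  proof
    assume "g u ! i \<in> edges H"
    then have "f u ! i \<in> verts H" "f u ! Suc i \<in> verts H"
      using multigraphD(3)[OF H, of "g u ! i"] gi[OF u i] sub(3) by auto
    then have "\<not> 0 < i" "\<not> Suc (Suc i) < length (f u)" using inner[OF u _ i] inner[OF u, of "Suc i"] HnW by auto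
    then have "i = 0" by simp
    then have "g u ! i = el u" using f0[OF u] i unfolding g_def by simp
    then show False using \<open>g u ! i \<in> edges H\<close> u unfolding U_def by simp
  qed
  define C where "C u = set (f u)" for u
  have CH: "C u \<inter> verts H = {u, last (f u)}" if u: "u \<in> U" for u
    using G.ear_inner_matchable(3)[OF earf[OF u]] f[OF u] unfolding C_def by simp
  have CW: "C u - verts H \<subseteq> W" if u: "u \<in> U" for u
    using fV[OF u] unfolding C_def W_def by (auto simp: in_set_conv_nth)
  have odd_prev: "f u ! i = n (f u ! (i - 1))" if "u \<in> U" "odd i" "i < length (f u)" for u i
    using step[OF that(1), of "i - 1"] that(2,3) by (cases i) auto
  have Cn: "n x \<in> C u" if u: "u \<in> U" and x: "x \<in> C u" for u x
  proof -
    obtain i where i: "i < length (f u)" "x = f u ! i" using x unfolding C_def by (auto simp: in_set_conv_nth)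
    show ?thesis
    proof (cases "even i")
      case True
      then have "Suc i < length (f u)" using i(1) f[OF u] by (metis Suc_lessI even_Suc)
      then show ?thesis using step[OF u, of i] True i(2) unfolding C_def by (metis nth_mem)
    next
      case False
      then have "x = n (f u ! (i - 1))" using odd_prev[OF u _ i(1)] i(2) by simp
      then have "n x = f u ! (i - 1)" using nn[OF fV[OF u, of "i - 1"]] i(1) by simp
      then show ?thesis unfolding C_def using i(1) by auto
    qed
  qed
  have Cm: "m x \<in> C u" if u: "u \<in> U" and x: "x \<in> C u - verts H" for u x
  proof -
    obtain i where i: "i < length (f u)" "x = f u ! i" using x unfolding C_def by (auto simp: in_set_conv_nth)
    have i0: "0 < i" using x f0[OF u] i(2) u unfolding U_def by (cases i) auto
    have il: "Suc i < length (f u)"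
    proof (rule ccontr)
      assume "\<not> ?thesis"
      then have "i = length (f u) - 1" "f u \<noteq> []" using i(1) by auto
      then have "x = last (f u)" using i(2) by (simp add: last_conv_nth)
      then show False using flast[OF u] x by simp
    qed
    show ?thesis
    proof (cases "even i")
      case False
      then show ?thesis using step[OF u il] i(2) il unfolding C_def by (metis nth_mem)
    next
      case True
      then obtain j where j: "i = Suc j" "odd j" using i0 by (cases i) auto
      then have "x = m (f u ! j)" using step[OF u, of j] i by simp
      moreover have "f u ! j \<in> W" using inner[OF u, of j] j il by (cases j) auto
      ultimately have "m x = f u ! j" using is_mateD(2)[OF m] by simp
      then show ?thesis using j i(1) unfolding C_def by auto
    qed
  qed
  \<comment> \<open>The vertex set of an ear is minimal among the nonempty sets closed under
    \<open>n\<close> and, away from \<open>H\<close>, under \<open>m\<close>. Two ears that meet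
    therefore have the same vertices and, as they touch \<open>H\<close> only at their ends, the
    same ends.\<close>
  have Cmin: "X = C u" if u: "u \<in> U" and X: "X \<subseteq> C u" "X \<noteq> {}" "\<And>x. x \<in> X \<Longrightarrow> n x \<in> X" "\<And>x. x \<in> X - verts H \<Longrightarrow> m x \<in> X" for u X
  proof -
    have st: "f u ! i \<in> X \<longleftrightarrow> f u ! Suc i \<in> X" if i: "Suc i < length (f u)" for i
    proof (cases "even i")
      case True
      then have "f u ! Suc i = n (f u ! i)" using step[OF u i] by simp
      then show ?thesis using X(3) nn[OF fV[OF u Suc_lessD[OF i]]] by metis
    next
      case False
      then have e: "f u ! Suc i = m (f u ! i)" using step[OF u i] by simp
      have "0 < i" using False by (cases i) auto
      then have w: "f u ! i \<in> W" using inner[OF u _ i] by simp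
      then have "f u ! Suc i \<in> W" "m (f u ! Suc i) = f u ! i" using e is_mateD[OF m] by auto
      then show ?thesis using X(4) e w unfolding W_def by (metis Diff_iff)
    qed
    have all: "f u ! i \<in> X \<longleftrightarrow> f u ! 0 \<in> X" if "i < length (f u)" for i
      using that by (induction i) (use st in auto)
    obtain j where "j < length (f u)" "f u ! j \<in> X" using X(1,2) unfolding C_def by (auto simp: in_set_conv_nth subset_iff) 
    then have "\<And>i. i < length (f u) \<Longrightarrow> f u ! i \<in> X" using all by blast
    then show ?thesis using X(1) unfolding C_def by (auto simp: in_set_conv_nth)
  qed
  have Ceq: "C u = C v" if uv: "u \<in> U" "v \<in> U" and ne: "C u \<inter> C v \<noteq> {}" for u v
  proof -
    have cl: "n x \<in> C u \<inter> C v" if "x \<in> C u \<inter> C v" for x using Cn uv that by blast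
    have cl2: "m x \<in> C u \<inter> C v" if "x \<in> C u \<inter> C v - verts H" for x using Cm uv that by blast
    have "C u \<inter> C v = C u" by (rule Cmin[OF uv(1) _ ne cl cl2]) auto
    moreover have "C u \<inter> C v = C v" by (rule Cmin[OF uv(2) _ ne cl cl2]) auto
    ultimately show ?thesis by simp
  qed
  define \<tau> where "\<tau> u = last (f u)" for u
  have tau: "\<tau> u \<in> U \<and> \<tau> (\<tau> u) = u \<and> \<tau> u \<noteq> u" if u: "u \<in> U" for u
  proof -
    define z where "z = f u ! (length (f u) - 2)"
    have l2: "Suc (length (f u) - 2) = length (f u) - 1" "even (length (f u) - 2)" "Suc (length (f u) - 2) < length (f u)"
      using f[OF u] by auto
    have "f u \<noteq> []" using l2 by auto
    then have "\<tau> u = f u ! (length (f u) - 1)" unfolding \<tau>_def by (simp add: last_conv_nth)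
    then have tz: "\<tau> u = n z" using step[OF u l2(3)] l2 unfolding z_def by simp
    have zG: "z \<in> verts G" using fV[OF u] l2(3) unfolding z_def by simp
    have "g u ! (length (f u) - 2) = el z" using l2 unfolding g_def z_def by simp
    then have "el z \<notin> edges H" using gH[OF u l2(3)] by simp
    then have tU: "\<tau> u \<in> U" using eln[OF zG] tz flast[OF u] unfolding U_def \<tau>_def by simp
    have ne: "\<tau> u \<noteq> u" using f[OF u] unfolding \<tau>_def by blast
    have "\<tau> u \<in> C u" "\<tau> u \<in> C (\<tau> u)" using CH[OF u] CH[OF tU] unfolding \<tau>_def by blast+
    then have "C u = C (\<tau> u)" using Ceq[OF u tU] by blast
    then have "{u, \<tau> u} = {\<tau> u, \<tau> (\<tau> u)}" using CH[OF u] CH[OF tU] unfolding \<tau>_def by simp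
    then have "\<tau> (\<tau> u) = u" using ne by (auto simp: doubleton_eq_iff)
    then show ?thesis using tU ne by simp
  qed
  have disj: "C u \<inter> C v = {}" if "u \<in> U" "v \<in> U" "v \<noteq> u" "v \<noteq> \<tau> u" for u v
  proof (rule ccontr)
    assume "C u \<inter> C v \<noteq> {}"
    then have "C u = C v" using Ceq that by blast
    then have "v \<in> C u" "v \<in> verts H" using CH[OF that(2)] that(2) unfolding U_def by auto
    then show False using CH[OF that(1)] that(3,4) unfolding \<tau>_def by blast
  qed
  have mtH: "matchable_on (adj H) (verts H - U)"
    unfolding matchable_on_def
  proof (rule exI, unfold is_mate_def, rule ballI)
    fix u assume u: "u \<in> verts H - U"
    then have uG: "u \<in> verts G" and e: "el u \<in> edges H" using sub(1) unfolding U_def by auto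
    have nH: "n u \<in> verts H" using multigraphD(3)[OF H e] sub(3) n[OF uG] by auto
    have "el (n u) \<in> edges H" using eln[OF uG] e by simp
    then have "n u \<in> verts H - U" using nH unfolding U_def by simp
    moreover have "adj H u (n u)" unfolding adj_def using e sub(3) n[OF uG] by auto
    moreover have "n u \<noteq> u" using n[OF uG] by auto
    ultimately show "n u \<in> verts H - U \<and> n (n u) = u \<and> n u \<noteq> u \<and> adj H u (n u)" using nn[OF uG] by simp
  qed
  have "el u0 = e0" using elu[OF N(3) e0(3)] e0(4) sub(1) by blast
  then have Une: "U \<noteq> {}" using e0 unfolding U_def by blast
  show thesis
  proof (rule that[of U \<tau> m "\<lambda>u. (f u, g u)"])
    fix u assume u: "u \<in> U"
    have "set (g u) \<inter> edges H = {}"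
    proof -
      have "length (g u) = length (f u) - 1" unfolding g_def by simp
      then show ?thesis using gH[OF u] by (fastforce simp: in_set_conv_nth)
    qed
    moreover have "odd (length (g u))" using f[OF u] unfolding g_def by auto
    ultimately show "is_path G (f u, g u) \<and> ear (adj G) (verts H) (fst (f u, g u)) \<and> hd (fst (f u, g u)) = u \<and>
      last (fst (f u, g u)) = \<tau> u \<and> set (snd (f u, g u)) \<inter> edges H = {} \<and> odd (length (snd (f u, g u))) \<and>
      (\<forall>w\<in>set (fst (f u, g u)) - verts H. m w \<in> set (fst (f u, g u)))"
      using path[OF u] earf[OF u] f[OF u] Cm[OF u] unfolding \<tau>_def C_def by simp
  qed (use tau mtH m Une disj in \<open>auto simp: U_def W_def C_def\<close>)
qed

text \<open>The deletion is run backwards: one or two ears are added to \<open>H\<close> so that the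
  result is matching covered and deleting them is a permitted step. Each ear is closed under
  \<open>m\<close> outside \<open>H\<close>, so the new subgraph is conformal again.\<close>

lemma conformal_step:
  assumes mcG: "matching_covered G" and mcH: "matching_covered H"
    and sub: "verts H \<subseteq> verts G" "edges H \<subseteq> edges G" "ends H = ends G"
    and conf: "matchable_on (adj G) (verts G - verts H)" and ne: "edges H \<noteq> edges G \<or> verts H \<noteq> verts G"
  shows "\<exists>L. S_step L H \<and> matching_covered L \<and> verts L \<subseteq> verts G \<and> edges H \<subset> edges L \<and> edges L \<subseteq> edges G \<and>
    ends L = ends G \<and> matchable_on (adj G) (verts G - verts L)"
proof -
  have G: "multigraph G" and H: "multigraph H" using mcG mcH unfolding matching_covered_def by auto
  have mH: "sym_rel.mcov (adj H) (verts H)" using mcH matching_covered_iff by auto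
  obtain U \<tau> P m where U: "U \<subseteq> verts H" "U \<noteq> {}" "\<And>u. u \<in> U \<Longrightarrow> \<tau> u \<in> U \<and> \<tau> (\<tau> u) = u \<and> \<tau> u \<noteq> u"
    and mtU: "matchable_on (adj H) (verts H - U)" and m: "is_mate (adj G) (verts G - verts H) m"
    and P: "\<And>u. u \<in> U \<Longrightarrow> is_path G (P u) \<and> ear (adj G) (verts H) (fst (P u)) \<and> hd (fst (P u)) = u \<and>
      last (fst (P u)) = \<tau> u \<and> set (snd (P u)) \<inter> edges H = {} \<and> odd (length (snd (P u))) \<and>
      (\<forall>w\<in>set (fst (P u)) - verts H. m w \<in> set (fst (P u)))"
    and disj: "\<And>u v. u \<in> U \<Longrightarrow> v \<in> U \<Longrightarrow> v \<noteq> u \<Longrightarrow> v \<noteq> \<tau> u \<Longrightarrow> set (fst (P u)) \<inter> set (fst (P v)) = {}"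
    by (rule conformal_ears[OF mcG mcH sub conf ne]) (rule that; assumption)
  define p where "p u = fst (P u)" for u
  define q where "q u = snd (P u)" for u
  define I where "I u = internal_verts (P u)" for u
  define L where "L X = \<lparr>verts = verts H \<union> (\<Union>u\<in>X. set (p u)), edges = edges H \<union> (\<Union>u\<in>X. set (q u)), ends = ends G\<rparr>" for X
  have pI: "set (p u) = I u \<union> {u, \<tau> u}" "I u \<inter> verts H = {}" if u: "u \<in> U" for u
  proof -
    obtain a ws b where "p u = a # ws @ [b]" "set ws \<inter> verts H = {}" "hd (p u) = a" "last (p u) = b" "butlast (tl (p u)) = ws"
      using ear_decomp[of "adj G" "verts H" "p u"] P[OF u] p_def by metis
    then show "set (p u) = I u \<union> {u, \<tau> u}" "I u \<inter> verts H = {}"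
      using P[OF u] unfolding I_def internal_verts_def p_def by auto
  qed
  have path: "length (p u) = Suc (length (q u))" "distinct (p u)" "set (p u) \<subseteq> verts G"
    "\<And>i. i < length (q u) \<Longrightarrow> q u ! i \<in> edges G \<and> ends G (q u ! i) = {p u ! i, p u ! Suc i}" if u: "u \<in> U" for u
    using P[OF u] unfolding is_path_def p_def q_def by (auto simp: case_prod_beta)
  have qe: "q u \<noteq> []" if u: "u \<in> U" for u using P[OF u] unfolding q_def by auto
  have qends: "e \<in> edges G \<and> ends G e \<subseteq> set (p u) \<and> ends G e \<noteq> {}" if u: "u \<in> U" and e: "e \<in> set (q u)" for u e
  proof -
    obtain i where i: "i < length (q u)" "e = q u ! i" using e by (auto simp: in_set_conv_nth)
    then show ?thesis using path[OF u] by auto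
  qed
  have qdisj: "set (q u) \<inter> set (q v) = {}" if "u \<in> U" "v \<in> U" "v \<noteq> u" "v \<noteq> \<tau> u" for u v
    using qends[OF that(1)] qends[OF that(2)] disj[OF that] unfolding p_def by blast
  have Lsub: "verts (L X) \<subseteq> verts G" "edges (L X) \<subseteq> edges G" "ends (L X) = ends G" if "X \<subseteq> U" for X
  proof -
    have "(\<Union>u\<in>X. set (p u)) \<subseteq> verts G" "(\<Union>u\<in>X. set (q u)) \<subseteq> edges G"
      using path(3) qends that by blast+
    then show "verts (L X) \<subseteq> verts G" "edges (L X) \<subseteq> edges G" "ends (L X) = ends G"
      using sub unfolding L_def by auto
  qed
  have Lmul: "multigraph (L X)" if X: "X \<subseteq> U" for X
    unfolding multigraph_def
  proof (intro conjI ballI)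
    show "finite (verts (L X))" "finite (edges (L X))"
      using Lsub[OF X] multigraphD(1,2)[OF G] finite_subset by auto
    fix e assume e: "e \<in> edges (L X)"
    then have eG: "e \<in> edges G" using Lsub(2)[OF X] by blast
    show "card (ends (L X) e) = 2" using multigraphD(4)[OF G eG] unfolding L_def by simp
    show "ends (L X) e \<subseteq> verts (L X)"
      using e multigraphD(3)[OF H, of e] sub(3) qends X unfolding L_def by auto blast
  qed
  have Lmt: "matchable_on (adj G) (verts G - verts (L X))" if X: "X \<subseteq> U" for X
    unfolding matchable_on_def
  proof (rule exI, rule is_mate_subset[OF m])
    show "verts G - verts (L X) \<subseteq> verts G - verts H" unfolding L_def by auto
    fix w assume w: "w \<in> verts G - verts (L X)"
    then have w': "w \<in> verts G - verts H" unfolding L_def by auto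
    note mw = is_mateD[OF m w']
    have "m w \<notin> set (p u)" if u: "u \<in> X" for u
    proof
      assume "m w \<in> set (p u)"
      then have "m (m w) \<in> set (p u)" using P[of u] u X mw(1) unfolding p_def by blast
      then show False using w mw(2) u unfolding L_def by auto
    qed
    then show "m w \<in> verts G - verts (L X)" using mw(1) unfolding L_def by auto
  qed
  have Lmc: "matching_covered (L X)" if X: "X \<subseteq> U" "\<And>u v. u \<in> X \<Longrightarrow> v \<in> X \<Longrightarrow> v \<noteq> \<tau> u"
    and mt: "matchable_on (adj H) (verts H - (\<Union>u\<in>X. {u, \<tau> u}))" for X
  proof -
    interpret S: sym_rel "adj (L X)" by (rule sym_rel_adj[OF Lmul[OF X(1)]])
    have "S.mcov (verts (L X))"
    proof (rule S.mcov_add_ears[OF sym_rel_adj[OF H] mH, where \<P> = "p ` X"])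
      show "adj (L X) u v" if "adj H u v" for u v using that sub(3) unfolding adj_def L_def by auto
      show "finite (p ` X)" by (intro finite_imageI finite_subset[OF order_trans[OF X(1) U(1)] multigraphD(1)[OF H]])
      show "ear (adj (L X)) (verts H) vs" if vs: "vs \<in> p ` X" for vs
      proof -
        obtain u where u: "u \<in> X" "vs = p u" using vs by blast
        then have uU: "u \<in> U" using X(1) by blast
        have "successively (adj (L X)) (p u)"
          unfolding successively_conv_nth
        proof (intro allI impI)
          fix i assume "Suc i < length (p u)"
          then have i: "i < length (q u)" using path(1)[OF uU] by simp
          then have "q u ! i \<in> set (q u)" by simp
          then have "q u ! i \<in> edges (L X)" using u(1) unfolding L_def by auto
          then show "adj (L X) (p u ! i) (p u ! Suc i)" using path(4)[OF uU i] unfolding adj_def L_def by auto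
        qed
        then show ?thesis using P[OF uU] u(2) U(1) U(3)[OF uU] uU unfolding ear_def p_def by auto
      qed
      show "set us \<inter> set vs = {}" if h: "us \<in> p ` X" "vs \<in> p ` X" "us \<noteq> vs" for us vs
      proof -
        obtain u v where uv: "u \<in> X" "v \<in> X" "us = p u" "vs = p v" using h by blast
        then have "v \<noteq> u" using h(3) by blast
        then show ?thesis using disj[of u v] X uv unfolding p_def by blast
      qed
      have "(\<Union>vs\<in>p ` X. {hd vs, last vs}) = (\<Union>u\<in>X. {hd (p u), last (p u)})" by blast
      also have "\<dots> = (\<Union>u\<in>X. {u, \<tau> u})" by (rule SUP_cong) (use P X(1) in \<open>auto simp: p_def\<close>)
      finally show "matchable_on (adj H) (verts H - (\<Union>vs\<in>p ` X. {hd vs, last vs}))" using mt by simp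
      show "verts (L X) = verts H \<union> (\<Union>vs\<in>p ` X. set vs)" unfolding L_def by simp
      fix u v assume "adj (L X) u v"
      then obtain e where e: "e \<in> edges (L X)" "ends G e = {u, v}" unfolding adj_def L_def by auto
      show "adj H u v \<and> u \<in> verts H \<and> v \<in> verts H \<or> (\<exists>vs\<in>p ` X. \<exists>i. Suc i < length vs \<and> {u, v} = {vs ! i, vs ! Suc i})"
      proof (cases "e \<in> edges H")
        case True
        then have "adj H u v" using e(2) sub(3) unfolding adj_def by auto
        then show ?thesis using adjD[OF H] by blast
      next
        case False
        then obtain w where w: "w \<in> X" "e \<in> set (q w)" using e(1) unfolding L_def by auto
        then have wU: "w \<in> U" using X(1) by blast
        obtain i where i: "i < length (q w)" "e = q w ! i" using w(2) by (auto simp: in_set_conv_nth)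
        then have "Suc i < length (p w)" "{u, v} = {p w ! i, p w ! Suc i}"
          using path(1)[OF wU] path(4)[OF wU i(1)] e(2) by auto
        then show ?thesis using w(1) by blast
      qed
    qed
    then show ?thesis using Lmul[OF X(1)] matching_covered_iff by blast
  qed
  have Ledge: "edges H \<subset> edges (L X)" if X: "X \<subseteq> U" "X \<noteq> {}" for X
  proof -
    obtain u where u: "u \<in> X" using X by blast
    then have "q u ! 0 \<in> set (q u)" "set (q u) \<inter> edges H = {}" using qe[of u] P[of u] X(1) unfolding q_def by auto
    then show ?thesis using u unfolding L_def by auto
  qed
  have oep: "odd_ear_path (L X) (P u)" if X: "X \<subseteq> U" "\<And>u v. u \<in> X \<Longrightarrow> v \<in> X \<Longrightarrow> v \<noteq> \<tau> u" and u: "u \<in> X" for X u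
  proof -
    have uU: "u \<in> U" using u X(1) by blast
    have ip: "is_path (L X) (P u)"
    proof -
      have "q u ! i \<in> edges (L X)" if "i < length (q u)" for i
        using nth_mem[OF that] u unfolding L_def by auto
      moreover have "set (p u) \<subseteq> verts (L X)" using u unfolding L_def by auto
      ultimately show ?thesis using path[OF uU] unfolding is_path_def p_def q_def L_def by (auto simp: case_prod_beta)
    qed
    have "degree (L X) v = 2" if v: "v \<in> internal_verts (P u)" for v
    proof (rule degree_internal[OF Lmul[OF X(1)] ip v])
      fix e assume e: "e \<in> edges (L X)" "v \<in> ends (L X) e"
      have vI: "v \<notin> verts H" "v \<in> set (p u)" using v pI[OF uU] unfolding I_def by auto
      have "e \<notin> edges H" using e(2) vI(1) multigraphD(3)[OF H, of e] sub(3) unfolding L_def by auto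
      then obtain w where w: "w \<in> X" "e \<in> set (q w)" using e(1) unfolding L_def by auto
      have "v \<in> set (p w)" using qends[OF _ w(2)] w(1) X(1) e(2) unfolding L_def by auto
      then have "w = u" using disj[of u w] uU w(1) X vI(2) u unfolding p_def by blast
      then show "e \<in> set (snd (P u))" using w(2) unfolding q_def by simp
    qed
    then show ?thesis using ip P[OF uU] unfolding odd_ear_path_def by blast
  qed
  have del1: "delete_path (L {u}) (P u) = H" if u: "u \<in> U" for u
  proof (rule mgraph.equality)
    have "u \<in> verts H" "\<tau> u \<in> verts H" using u U(1) U(3)[OF u] by auto
    then have "verts H \<union> set (p u) - I u = verts H" using pI(2)[OF u] unfolding pI(1)[OF u] by auto
    then show "verts (delete_path (L {u}) (P u)) = verts H" unfolding delete_path_def L_def I_def by simp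
    show "edges (delete_path (L {u}) (P u)) = edges H"
      using P[OF u] unfolding delete_path_def L_def q_def by auto
  qed (use sub(3) in \<open>auto simp: delete_path_def L_def\<close>)
  have del2: "delete_path (L {u, v}) (P u) = L {v}" if u: "u \<in> U" "v \<in> U" "v \<noteq> u" "v \<noteq> \<tau> u" for u v
  proof (rule mgraph.equality)
    have "set (p u) \<inter> set (p v) = {}" using disj[OF u] unfolding p_def .
    then have "I u \<inter> set (p v) = {}" using pI(1)[OF u(1)] by blast
    moreover have "u \<in> verts H" "\<tau> u \<in> verts H" using u(1) U(1) U(3)[OF u(1)] by auto
    ultimately have "verts H \<union> (set (p u) \<union> set (p v)) - I u = verts H \<union> set (p v)"
      using pI(2)[OF u(1)] unfolding pI(1)[OF u(1)] by auto
    then show "verts (delete_path (L {u, v}) (P u)) = verts (L {v})" unfolding delete_path_def L_def I_def by simp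
    show "edges (delete_path (L {u, v}) (P u)) = edges (L {v})"
      using P[OF u(1)] qdisj[OF u] unfolding delete_path_def L_def q_def by auto
  qed (auto simp: delete_path_def L_def)
  have single: ?thesis if u: "u \<in> U" and mc: "matching_covered (L {u})" for u
  proof -
    have "removable_single_ear (L {u}) (P u)"
      unfolding removable_single_ear_def
    proof (intro conjI)
      show "odd_ear_path (L {u}) (P u)" by (rule oep) (use u U(3)[OF u] in auto)
    qed (use mc mcH del1[OF u] in auto)
    then have "S_step (L {u}) (delete_path (L {u}) (P u))" by (rule S_step.single_ear)
    then show ?thesis unfolding del1[OF u]
      using mc Lsub[of "{u}"] Lmt[of "{u}"] Ledge[of "{u}"] u by (intro exI[of _ "L {u}"]) simp
  qed
  obtain u where u: "u \<in> U" "matchable_on (adj H) (verts H - {u, \<tau> u}) \<or>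
    (\<exists>v\<in>U. v \<notin> {u, \<tau> u} \<and> matchable_on (adj H) (verts H - {u, \<tau> u, v, \<tau> v}))"
    using sym_rel.two_pairs_matchable[OF sym_rel_adj[OF H] mH U mtU] by blast
  show ?thesis
    using u(2)
  proof (elim disjE bexE conjE)
    assume "matchable_on (adj H) (verts H - {u, \<tau> u})"
    then have "matching_covered (L {u})" using Lmc[of "{u}"] U(3)[OF u(1)] u(1) by auto
    then show ?thesis using single[OF u(1)] by blast
  next
    fix v assume v: "v \<in> U" "v \<notin> {u, \<tau> u}" and mt: "matchable_on (adj H) (verts H - {u, \<tau> u, v, \<tau> v})"
    have tv: "\<tau> v \<noteq> u"
    proof
      assume "\<tau> v = u"
      then have "\<tau> u = v" using U(3)[OF v(1)] by auto
      then show False using v(2) by simp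
    qed
    have nt: "\<And>x y. x \<in> {u, v} \<Longrightarrow> y \<in> {u, v} \<Longrightarrow> y \<noteq> \<tau> x" using U(3)[OF u(1)] U(3)[OF v(1)] v(2) tv by auto
    have uvU: "{u, v} \<subseteq> U" using u(1) v(1) by simp
    have "(\<Union>x\<in>{u, v}. {x, \<tau> x}) = {u, \<tau> u, v, \<tau> v}" by auto
    then have mc2: "matching_covered (L {u, v})" using Lmc[OF uvU nt] mt by simp
    have d2: "delete_path (L {u, v}) (P u) = L {v}" "delete_path (L {u, v}) (P v) = L {u}"
      using del2[OF u(1) v(1)] del2[OF v(1) u(1)] v(2) tv by (auto simp: insert_commute)
    show ?thesis
    \<comment> \<open>A removable double ear must not leave a matching covered graph when only one
      of its paths is deleted. If it does, the other path is a single ear over \<open>H\<close> and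
      suffices.\<close>
    proof (cases "matching_covered (L {u}) \<or> matching_covered (L {v})")
      case True then show ?thesis using single u(1) v(1) by blast
    next
      case False
      have "removable_double_ear (L {u, v}) (P u) (P v)"
        unfolding removable_double_ear_def d2 del1[OF v(1)]
      proof (intro conjI)
        show "odd_ear_path (L {u, v}) (P u)" "odd_ear_path (L {u, v}) (P v)"
          using oep[OF uvU nt] by simp_all
        show "set (fst (P u)) \<inter> set (fst (P v)) = {}" using disj[OF u(1) v(1)] v(2) by simp
      qed (use False mc2 mcH in auto)
      then have "S_step (L {u, v}) (delete_path (delete_path (L {u, v}) (P u)) (P v))" by (rule S_step.double_ear)
      then have "S_step (L {u, v}) H" unfolding d2 del1[OF v(1)] .
      then show ?thesis
        using mc2 Lsub[OF uvU] Lmt[OF uvU] Ledge[OF uvU] by (intro exI[of _ "L {u, v}"]) simp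
    qed
  qed
qed

theorem conformal_subgraph_S_steps:
  assumes mcG: "matching_covered G" and mcH: "matching_covered H"
    and sub: "verts H \<subseteq> verts G" "edges H \<subseteq> edges G" "ends H = ends G"
    and conf: "matchable_on (adj G) (verts G - verts H)"
  shows "S_step\<^sup>*\<^sup>* G H"
  using mcH sub conf
proof (induction "card (edges G - edges H)" arbitrary: H rule: less_induct)
  case less
  have fin: "finite (edges G)" using mcG unfolding matching_covered_def multigraph_def by simp
  show ?case
  proof (cases "edges H = edges G \<and> verts H = verts G")
    case True
    then have "G = H" using less.prems(4) by (intro mgraph.equality) auto
    then show ?thesis by simp
  next
    case False
    then obtain L where L: "S_step L H" "matching_covered L" "verts L \<subseteq> verts G" "edges H \<subset> edges L"
      "edges L \<subseteq> edges G" "ends L = ends G" "matchable_on (adj G) (verts G - verts L)"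
      using conformal_step[OF mcG less.prems] by blast
    have "card (edges G - edges L) < card (edges G - edges H)"
      by (rule psubset_card_mono) (use fin L(4,5) in auto)
    then have "S_step\<^sup>*\<^sup>* G L" using less.hyps[OF _ L(2,3,5,6,7)] by blast
    then show ?thesis using L(1) by (rule rtranclp.rtrancl_into_rtrancl)
  qed
qed

section \<open>Contracting the fibres of a quotient\<close>

text \<open>The new vertex is a member \<open>z\<close> of \<open>Z\<close>, as in
  \<open>contract\<close>; the other members of \<open>Z\<close> become isolated.\<close>

definition collapse :: "('v \<Rightarrow> 'v \<Rightarrow> bool) \<Rightarrow> 'v set \<Rightarrow> 'v \<Rightarrow> 'v \<Rightarrow> 'v \<Rightarrow> bool" where
  "collapse R Z z u v \<longleftrightarrow> u \<notin> Z \<and> v \<notin> Z \<and> R u v \<or> u = z \<and> v \<notin> Z \<and> (\<exists>w\<in>Z. R w v) \<or>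
     v = z \<and> u \<notin> Z \<and> (\<exists>w\<in>Z. R u w)"

context sym_rel begin

lemma sym_rel_collapse: "z \<in> Z \<Longrightarrow> sym_rel (collapse R Z z)"
  by unfold_locales (auto simp: collapse_def irrefl intro: sym)

lemma collapse_matchable_outside:
  assumes "z \<in> Z" "U \<inter> Z = {}"
  shows "matchable_on (collapse R Z z) U \<longleftrightarrow> matchable_on R U"
  using assms matchable_on_mono[of R U "collapse R Z z"] matchable_on_mono[of "collapse R Z z" U R]
  by (auto simp: collapse_def)

text \<open>The edge at \<open>z\<close> is traced back to some \<open>w\<close> in
  \<open>Z\<close>, and the rest of \<open>Z\<close> is matched without \<open>w\<close>. The
  hypothesis \<open>crit\<close> is limited to vertices with a neighbour outside, since a separating
  cut says nothing about the others.\<close>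

lemma collapse_matchable_lift:
  assumes z: "z \<in> Z" "U \<inter> Z = {z}" and mt: "matchable_on (collapse R Z z) U"
    and crit: "\<And>w v. w \<in> Z \<Longrightarrow> v \<in> U - {z} \<Longrightarrow> R w v \<Longrightarrow> matchable_on R (Z - {w})"
  shows "matchable_on R (U - {z} \<union> Z)"
proof -
  obtain p where p: "is_mate (collapse R Z z) U p" using mt unfolding matchable_on_def by blast
  have zU: "z \<in> U" using z by blast
  note q = is_mateD[OF p zU]
  have pz: "p z \<notin> Z" using q z(2) by blast
  then obtain w where w: "w \<in> Z" "R w (p z)" using q(4) z(1) unfolding collapse_def by blast
  have "is_mate (collapse R Z z) (U - {z, p z}) p"
  proof (rule is_mate_subset[OF p])
    fix u assume u: "u \<in> U - {z, p z}"
    note r = is_mateD[OF p, of u]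
    have "p u \<noteq> z" "p u \<noteq> p z" using r q u by auto
    then show "p u \<in> U - {z, p z}" using r u by auto
  qed auto
  then have "matchable_on (collapse R Z z) (U - {z, p z})" unfolding matchable_on_def by blast
  moreover have "(U - {z, p z}) \<inter> Z = {}" using z by blast
  ultimately have m1: "matchable_on R (U - {z, p z})" using collapse_matchable_outside[OF z(1)] by blast
  have m2: "matchable_on R {w, p z}" by (rule matchable_on_pair) (use w pz sym in auto)
  have m3: "matchable_on R (Z - {w})" using crit[OF w(1) _ w(2)] q by blast
  have "matchable_on R ((U - {z, p z}) \<union> {w, p z} \<union> (Z - {w}))"
    by (intro matchable_on_Un m1 m2 m3) (use z w pz in auto)
  moreover have "(U - {z, p z}) \<union> {w, p z} \<union> (Z - {w}) = U - {z} \<union> Z" using z w pz q by auto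
  ultimately show ?thesis by simp
qed

end

lemma rep_in: "X \<noteq> {} \<Longrightarrow> (SOME x. x \<in> X) \<in> X"
  by (simp add: some_in_eq)

lemma contract_simps:
  "verts (contract G X) = (\<lambda>v. if v \<in> X then (SOME x. x \<in> X) else v) ` verts G"
  "edges (contract G X) = {e \<in> edges G. \<not> ends G e \<subseteq> X}"
  "ends (contract G X) = (\<lambda>e. (\<lambda>v. if v \<in> X then (SOME x. x \<in> X) else v) ` ends G e)"
  unfolding contract_def by (simp_all add: Let_def)

lemma verts_contract: "X \<noteq> {} \<Longrightarrow> X \<subseteq> verts G \<Longrightarrow> verts (contract G X) = insert (SOME x. x \<in> X) (verts G - X)"
  using rep_in[of X] unfolding contract_simps by (auto simp: image_def)

lemma adj_contract:
  assumes G: "multigraph G" and X: "X \<noteq> {}"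
  shows "adj (contract G X) = collapse (adj G) X (SOME x. x \<in> X)"
proof (intro ext)
  fix u v
  let ?z = "SOME x. x \<in> X" let ?f = "\<lambda>v. if v \<in> X then ?z else v"
  have z: "?z \<in> X" using rep_in[OF X] .
  show "adj (contract G X) u v = collapse (adj G) X ?z u v"
  proof
    assume "adj (contract G X) u v"
    then obtain e where e: "e \<in> edges G" "\<not> ends G e \<subseteq> X" "?f ` ends G e = {u, v}"
      unfolding adj_def contract_simps by auto
    obtain x y where xy: "ends G e = {x, y}" "adj G x y" using multigraph_ends[OF G e(1)] .
    have yx: "adj G y x" using sym_rel.sym[OF sym_rel_adj[OF G] xy(2)] .
    have "{?f x, ?f y} = {u, v}" using e(3) unfolding xy(1) by (simp only: image_insert image_empty)
    then consider "u = ?f x" "v = ?f y" | "u = ?f y" "v = ?f x" by (auto simp: doubleton_eq_iff)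
    then show "collapse (adj G) X ?z u v"
      using e(2) xy yx unfolding collapse_def by cases auto
  next
    assume c: "collapse (adj G) X ?z u v"
    have wit: "adj (contract G X) (?f x) (?f y)" if xy: "adj G x y" "\<not> {x, y} \<subseteq> X" for x y
    proof -
      obtain e where "e \<in> edges G" "ends G e = {x, y}" using xy(1) unfolding adj_def by blast
      then show ?thesis using xy(2) unfolding adj_def contract_simps by (intro bexI[of _ e]) auto
    qed
    show "adj (contract G X) u v"
      using c unfolding collapse_def
    proof (elim disjE conjE bexE)
      assume "u \<notin> X" "v \<notin> X" "adj G u v"
      then show ?thesis using wit[of u v] by simp
    next
      fix w assume "u = ?z" "v \<notin> X" "w \<in> X" "adj G w v"
      then show ?thesis using wit[of w v] by simp
    next
      fix w assume "v = ?z" "u \<notin> X" "w \<in> X" "adj G u w"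
      then show ?thesis using wit[of u w] by simp
    qed
  qed
qed

lemma multigraph_contract:
  assumes G: "multigraph G" and X: "X \<noteq> {}"
  shows "multigraph (contract G X)"
  unfolding multigraph_def
proof (intro conjI ballI)
  let ?z = "SOME x. x \<in> X" let ?f = "\<lambda>v. if v \<in> X then ?z else v"
  show "finite (verts (contract G X))" "finite (edges (contract G X))"
    using multigraphD(1,2)[OF G] unfolding contract_simps by auto
  fix e assume e: "e \<in> edges (contract G X)"
  then have e': "e \<in> edges G" "\<not> ends G e \<subseteq> X" unfolding contract_simps by auto
  show "ends (contract G X) e \<subseteq> verts (contract G X)"
    using multigraphD(3)[OF G e'(1)] unfolding contract_simps by blast
  obtain x y where xy: "ends G e = {x, y}" "x \<noteq> y" using multigraph_ends[OF G e'(1)] .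
  have "?f x \<noteq> ?f y" using xy e'(2) rep_in[OF X] by auto
  then have "card {?f x, ?f y} = 2" by simp
  then show "card (ends (contract G X) e) = 2" unfolding contract_simps xy(1) by (simp only: image_insert image_empty)
qed

definition crosses :: "('v, 'e) mgraph \<Rightarrow> ('v \<Rightarrow> 'w) \<Rightarrow> 'e \<Rightarrow> bool" where
  "crosses L \<pi> e \<longleftrightarrow> (\<exists>x\<in>ends L e. \<exists>y\<in>ends L e. \<pi> x \<noteq> \<pi> y)"

definition bag :: "('v, 'e) mgraph \<Rightarrow> ('v \<Rightarrow> 'w) \<Rightarrow> 'w \<Rightarrow> 'v set" where
  "bag L \<pi> w = {x \<in> verts L. \<pi> x = w}"

text \<open>Contracting every fibre of \<open>\<pi>\<close> turns \<open>L\<close> into a copy of \<open>J\<close>; the last three conditions make the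
  graph obtained from \<open>L\<close> by shrinking the complement of a fibre matching covered.\<close>

definition quotient_model :: "('v, 'e) mgraph \<Rightarrow> ('w, 'f) mgraph \<Rightarrow> ('v \<Rightarrow> 'w) \<Rightarrow> ('e \<Rightarrow> 'f) \<Rightarrow> bool" where
  "quotient_model L J \<pi> g \<longleftrightarrow> multigraph L \<and> \<pi> ` verts L = verts J \<and>
     bij_betw g {e \<in> edges L. crosses L \<pi> e} (edges J) \<and>
     (\<forall>e\<in>edges L. crosses L \<pi> e \<longrightarrow> ends J (g e) = \<pi> ` ends L e) \<and>
     (\<forall>w\<in>verts J. \<forall>X. X \<noteq> {} \<longrightarrow> X \<subset> bag L \<pi> w \<longrightarrow> (\<exists>x\<in>X. \<exists>y\<in>bag L \<pi> w - X. adj L x y)) \<and>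
     (\<forall>e\<in>edges L. crosses L \<pi> e \<longrightarrow> (\<forall>x\<in>ends L e. matchable_on (adj L) (bag L \<pi> (\<pi> x) - {x}))) \<and>
     (\<forall>e\<in>edges L. \<not> crosses L \<pi> e \<longrightarrow> (\<exists>f\<in>edges L. \<exists>x\<in>ends L f. crosses L \<pi> f \<and> x \<notin> ends L e \<and>
        (\<forall>y\<in>ends L e. \<pi> y = \<pi> x) \<and> matchable_on (adj L) (bag L \<pi> (\<pi> x) - ends L e - {x})))"

lemma quotient_modelD:
  assumes "quotient_model L J \<pi> g"
  shows "multigraph L" "\<pi> ` verts L = verts J" "bij_betw g {e \<in> edges L. crosses L \<pi> e} (edges J)"
    "\<And>e. e \<in> edges L \<Longrightarrow> crosses L \<pi> e \<Longrightarrow> ends J (g e) = \<pi> ` ends L e"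
    "\<And>w X. w \<in> verts J \<Longrightarrow> X \<noteq> {} \<Longrightarrow> X \<subset> bag L \<pi> w \<Longrightarrow> \<exists>x\<in>X. \<exists>y\<in>bag L \<pi> w - X. adj L x y"
    "\<And>e x. e \<in> edges L \<Longrightarrow> crosses L \<pi> e \<Longrightarrow> x \<in> ends L e \<Longrightarrow> matchable_on (adj L) (bag L \<pi> (\<pi> x) - {x})"
    "\<And>e. e \<in> edges L \<Longrightarrow> \<not> crosses L \<pi> e \<Longrightarrow> \<exists>f\<in>edges L. \<exists>x\<in>ends L f. crosses L \<pi> f \<and> x \<notin> ends L e \<and>
        (\<forall>y\<in>ends L e. \<pi> y = \<pi> x) \<and> matchable_on (adj L) (bag L \<pi> (\<pi> x) - ends L e - {x})"
  using assms unfolding quotient_model_def by simp_all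

lemma quotient_edge:
  assumes q: "quotient_model L J \<pi> g" and "adj J v w" "multigraph J"
  shows "\<exists>e x y. e \<in> edges L \<and> crosses L \<pi> e \<and> ends L e = {x, y} \<and> \<pi> x = v \<and> \<pi> y = w \<and> x \<in> verts L \<and> y \<in> verts L \<and> adj L x y"
proof -
  note Q = quotient_modelD[OF q]
  obtain d where d: "d \<in> edges J" "ends J d = {v, w}" using assms(2) unfolding adj_def by blast
  then have "d \<in> g ` {e \<in> edges L. crosses L \<pi> e}" using Q(3) unfolding bij_betw_def by simp
  then obtain e where e: "e \<in> edges L" "crosses L \<pi> e" "g e = d" by blast
  obtain x y where xy: "ends L e = {x, y}" "x \<in> verts L" "y \<in> verts L" "adj L x y"
    using multigraph_ends[OF Q(1) e(1)] by metis
  have "{\<pi> x, \<pi> y} = {v, w}" using Q(4)[OF e(1,2)] e(3) d(2) xy(1) by simp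
  then consider "\<pi> x = v" "\<pi> y = w" | "\<pi> y = v" "\<pi> x = w" by (auto simp: doubleton_eq_iff)
  then show ?thesis
  proof cases
    case 1 then show ?thesis using e xy by blast
  next
    case 2
    moreover have "adj L y x" using sym_rel.sym[OF sym_rel_adj[OF Q(1)] xy(4)] .
    moreover have "ends L e = {y, x}" using xy(1) by auto
    ultimately show ?thesis using e xy by blast
  qed
qed

lemma quotient_lift:
  assumes q: "quotient_model L J \<pi> g" and J: "multigraph J" and mt: "matchable_on (adj J) U"
  shows "matchable_on (adj L) {x \<in> verts L. \<pi> x \<in> U}"
proof -
  note Q = quotient_modelD[OF q]
  obtain p where p: "is_mate (adj J) U p" using mt unfolding matchable_on_def by blast
  \<comment> \<open>The union runs over the pairs \<open>{w, p w}\<close>, so that each edge of the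
    matching of \<open>J\<close> is lifted once.\<close>
  have "matchable_on (adj L) (\<Union>D\<in>(\<lambda>w. {w, p w}) ` U. {x \<in> verts L. \<pi> x \<in> D})"
  proof (rule matchable_on_UN)
    fix D assume "D \<in> (\<lambda>w. {w, p w}) ` U"
    then obtain w where w: "w \<in> U" "D = {w, p w}" by blast
    note pw = is_mateD[OF p w(1)]
    obtain e x y where e: "e \<in> edges L" "crosses L \<pi> e" "ends L e = {x, y}" "\<pi> x = w" "\<pi> y = p w"
      "x \<in> verts L" "y \<in> verts L" "adj L x y" using quotient_edge[OF q pw(4) J] by blast
    have b: "bag L \<pi> w = insert x (bag L \<pi> w - {x})" "bag L \<pi> (p w) = insert y (bag L \<pi> (p w) - {y})"
      using e unfolding bag_def by auto
    have "matchable_on (adj L) ({x, y} \<union> (bag L \<pi> w - {x}) \<union> (bag L \<pi> (p w) - {y}))"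
    proof (intro matchable_on_Un)
      have "adj L y x" using sym_rel.sym[OF sym_rel_adj[OF Q(1)] e(8)] .
      then show "matchable_on (adj L) {x, y}" using matchable_on_pair e(8) pw(3) e(4,5) by metis
      show "matchable_on (adj L) (bag L \<pi> w - {x})" "matchable_on (adj L) (bag L \<pi> (p w) - {y})"
        using Q(6)[OF e(1,2), of x] Q(6)[OF e(1,2), of y] e(3-5) by auto
    qed (use pw(3) e(4,5) in \<open>auto simp: bag_def\<close>)
    moreover have "{x, y} \<union> (bag L \<pi> w - {x}) \<union> (bag L \<pi> (p w) - {y}) = {x \<in> verts L. \<pi> x \<in> D}"
      using e w(2) unfolding bag_def by auto
    ultimately show "matchable_on (adj L) {x \<in> verts L. \<pi> x \<in> D}" by simp
  next
    fix C D assume "C \<in> (\<lambda>w. {w, p w}) ` U" "D \<in> (\<lambda>w. {w, p w}) ` U" "C \<noteq> D"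
    then obtain v w where vw: "v \<in> U" "w \<in> U" "C = {v, p v}" "D = {w, p w}" "C \<noteq> D" by blast
    have eq: "{v, p v} = {x, p x}" if "v \<in> U" "x \<in> {v, p v}" for v x
      using that is_mateD(2)[OF p that(1)] by auto
    have "C \<inter> D = {}"
    proof (rule ccontr)
      assume "C \<inter> D \<noteq> {}"
      then obtain x where "x \<in> C" "x \<in> D" by blast
      then have "C = {x, p x}" "D = {x, p x}" using eq[of v x] eq[of w x] vw by auto
      then show False using vw(5) by simp
    qed
    then show "{x \<in> verts L. \<pi> x \<in> C} \<inter> {x \<in> verts L. \<pi> x \<in> D} = {}" by blast
  qed
  moreover have "(\<Union>D\<in>(\<lambda>w. {w, p w}) ` U. {x \<in> verts L. \<pi> x \<in> D}) = {x \<in> verts L. \<pi> x \<in> U}"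
    using is_mateD(1)[OF p] by auto
  ultimately show ?thesis by simp
qed

text \<open>A perfect matching of \<open>J\<close> lifts with one edge of \<open>L\<close> for each
  of its edges and a near-perfect matching of every fibre. For an edge inside a fibre, the matching
  is lifted through the crossing edge supplied by the last condition of
  \<open>quotient_model\<close>.\<close>

lemma quotient_matching_covered:
  assumes q: "quotient_model L J \<pi> g" and mcJ: "matching_covered J"
  shows "matching_covered L"
proof -
  note Q = quotient_modelD[OF q]
  have J: "multigraph J" using mcJ unfolding matching_covered_def by simp
  interpret J: sym_rel "adj J" by (rule sym_rel_adj[OF J])
  interpret L: sym_rel "adj L" by (rule sym_rel_adj[OF Q(1)])
  have mJ: "J.mcov (verts J)" using mcJ matching_covered_iff by blast
  note fL = multigraphD(1)[OF Q(1)]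
  have c2: "2 \<le> card (verts L)"
    using J.mcovD(2)[OF mJ] card_image_le[OF fL, of \<pi>] Q(2) by simp
  have conn: "\<exists>x\<in>X. \<exists>y\<in>verts L - X. adj L x y" if X: "X \<noteq> {}" "X \<subset> verts L" for X
  proof (cases "\<exists>w\<in>verts J. bag L \<pi> w \<inter> X \<noteq> {} \<and> bag L \<pi> w - X \<noteq> {}")
    case True
    then obtain w where w: "w \<in> verts J" "bag L \<pi> w \<inter> X \<noteq> {}" "bag L \<pi> w - X \<noteq> {}" by blast
    then have "bag L \<pi> w \<inter> X \<subset> bag L \<pi> w" by blast
    then obtain x y where "x \<in> bag L \<pi> w \<inter> X" "y \<in> bag L \<pi> w - (bag L \<pi> w \<inter> X)" "adj L x y"
      using Q(5)[OF w(1,2)] by blast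
    then show ?thesis unfolding bag_def by blast
  next
    case False
    have un: "y \<in> X" if "x \<in> X" "y \<in> verts L" "\<pi> x = \<pi> y" for x y
    proof -
      have "\<pi> x \<in> verts J" "x \<in> bag L \<pi> (\<pi> x)" "y \<in> bag L \<pi> (\<pi> x)" using Q(2) X that unfolding bag_def by auto
      then show ?thesis using False that by blast
    qed
    have "\<pi> ` X \<subseteq> verts J" using Q(2) X by blast
    moreover obtain z where z: "z \<in> verts L" "z \<notin> X" using X by blast
    then have "\<pi> z \<in> verts J" "\<pi> z \<notin> \<pi> ` X" using Q(2) un by auto
    ultimately have "\<pi> ` X \<subset> verts J" by blast
    then obtain v w where vw: "v \<in> \<pi> ` X" "w \<in> verts J - \<pi> ` X" "adj J v w" using J.mcovD(3)[OF mJ, of "\<pi> ` X"] X by blast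
    obtain x y where xy: "\<pi> x = v" "\<pi> y = w" "x \<in> verts L" "y \<in> verts L" "adj L x y"
      using quotient_edge[OF q vw(3) J] by blast
    have "x \<in> X" using vw(1) xy(1,3) un by auto
    moreover have "y \<notin> X" using vw(2) xy(2) by blast
    ultimately show ?thesis using xy by blast
  qed
  have cov: "matchable_on (adj L) (verts L - {u, v})" if uv: "u \<in> verts L" "v \<in> verts L" "adj L u v" for u v
  proof -
    obtain e where e: "e \<in> edges L" "ends L e = {u, v}" using uv(3) unfolding adj_def by blast
    have rest: "matchable_on (adj L) {z \<in> verts L. \<pi> z \<notin> {\<pi> x, \<pi> y}}"
      if f: "f \<in> edges L" "crosses L \<pi> f" "ends L f = {x, y}" for f x y
    proof -
      have "ends J (g f) = {\<pi> x, \<pi> y}" using Q(4)[OF f(1,2)] f(3) by simp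
      moreover have "g f \<in> edges J" using Q(3) f(1,2) unfolding bij_betw_def by blast
      ultimately have a: "adj J (\<pi> x) (\<pi> y)" unfolding adj_def by blast
      then have "matchable_on (adj J) (verts J - {\<pi> x, \<pi> y})" using J.mcovD(4)[OF mJ] adjD[OF J a] by blast
      then have "matchable_on (adj L) {z \<in> verts L. \<pi> z \<in> verts J - {\<pi> x, \<pi> y}}" by (rule quotient_lift[OF q J])
      moreover have "{z \<in> verts L. \<pi> z \<in> verts J - {\<pi> x, \<pi> y}} = {z \<in> verts L. \<pi> z \<notin> {\<pi> x, \<pi> y}}" using Q(2) by auto
      ultimately show ?thesis by simp
    qed
    show ?thesis
    proof (cases "crosses L \<pi> e")
      case True
      have ne: "\<pi> u \<noteq> \<pi> v" using True e(2) unfolding crosses_def by auto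
      have m: "matchable_on (adj L) (bag L \<pi> (\<pi> u) - {u})" "matchable_on (adj L) (bag L \<pi> (\<pi> v) - {v})"
        using Q(6)[OF e(1) True, of u] Q(6)[OF e(1) True, of v] e(2) by simp_all
      have "matchable_on (adj L) ({z \<in> verts L. \<pi> z \<notin> {\<pi> u, \<pi> v}} \<union> (bag L \<pi> (\<pi> u) - {u}) \<union> (bag L \<pi> (\<pi> v) - {v}))"
        by (intro matchable_on_Un rest[OF e(1) True e(2)] m) (use ne in \<open>auto simp: bag_def\<close>)
      moreover have "{z \<in> verts L. \<pi> z \<notin> {\<pi> u, \<pi> v}} \<union> (bag L \<pi> (\<pi> u) - {u}) \<union> (bag L \<pi> (\<pi> v) - {v}) = verts L - {u, v}"
        using uv ne unfolding bag_def by auto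
      ultimately show ?thesis by simp
    next
      case False
      obtain f x where f: "f \<in> edges L" "x \<in> ends L f" "crosses L \<pi> f" "x \<notin> ends L e" "\<forall>y\<in>ends L e. \<pi> y = \<pi> x"
        and mx: "matchable_on (adj L) (bag L \<pi> (\<pi> x) - ends L e - {x})" using Q(7)[OF e(1) False] by blast
      obtain y where y: "ends L f = {x, y}" "x \<noteq> y" "x \<in> verts L" "y \<in> verts L" "adj L x y"
        using multigraph_other_end[OF Q(1) f(1,2)] .
      have ne: "\<pi> x \<noteq> \<pi> y" using f(3) y(1) unfolding crosses_def by auto
      have m2: "matchable_on (adj L) {x, y}" using matchable_on_pair[of "adj L" x y] y L.sym by blast
      have m3: "matchable_on (adj L) (bag L \<pi> (\<pi> y) - {y})" using Q(6)[OF f(1,3), of y] y(1) by simp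
      have "matchable_on (adj L) ({z \<in> verts L. \<pi> z \<notin> {\<pi> x, \<pi> y}} \<union> (bag L \<pi> (\<pi> x) - ends L e - {x}) \<union> {x, y} \<union> (bag L \<pi> (\<pi> y) - {y}))"
        by (intro matchable_on_Un rest[OF f(1,3) y(1)] mx m2 m3) (use y(2) ne in \<open>auto simp: bag_def\<close>)
      moreover have "{z \<in> verts L. \<pi> z \<notin> {\<pi> x, \<pi> y}} \<union> (bag L \<pi> (\<pi> x) - ends L e - {x}) \<union> {x, y} \<union> (bag L \<pi> (\<pi> y) - {y}) = verts L - {u, v}"
        using y ne e(2) f(4,5) unfolding bag_def by auto
      ultimately show ?thesis by simp
    qed
  qed
  have "L.mcov (verts L)" unfolding L.mcov_def using fL c2 conn cov by blast
  then show ?thesis using Q(1) matching_covered_iff by blast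
qed

text \<open>Shrinking one fibre changes neither the other fibres nor the set of crossing edges, and
  the representative stays in its fibre, so the same \<open>\<pi>\<close> and \<open>g\<close>
  serve.\<close>

lemma quotient_contract:
  assumes q: "quotient_model L J \<pi> g" and w: "w \<in> verts J"
  shows "quotient_model (contract L (bag L \<pi> w)) J \<pi> g"
proof -
  note Q = quotient_modelD[OF q]
  let ?X = "bag L \<pi> w" let ?z = "SOME x. x \<in> ?X" let ?f = "\<lambda>v. if v \<in> ?X then ?z else v" let ?K = "contract L ?X"
  have X: "?X \<noteq> {}" "?X \<subseteq> verts L" using w unfolding Q(2)[symmetric] bag_def by auto
  have z: "?z \<in> ?X" using rep_in[OF X(1)] .
  have pf: "\<pi> (?f x) = \<pi> x" for x using z unfolding bag_def by auto
  have pim: "\<pi> ` ?f ` A = \<pi> ` A" for A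
  proof -
    have "\<pi> ` ?f ` A = (\<lambda>x. \<pi> (?f x)) ` A" by (simp only: image_image)
    then show ?thesis by (simp only: pf)
  qed
  have K: "multigraph ?K" by (rule multigraph_contract[OF Q(1) X(1)])
  have aK: "adj ?K = collapse (adj L) ?X ?z" by (rule adj_contract[OF Q(1) X(1)])
  have vK: "verts ?K = insert ?z (verts L - ?X)" by (rule verts_contract[OF X])
  interpret L: sym_rel "adj L" by (rule sym_rel_adj[OF Q(1)])
  have cr: "crosses ?K \<pi> e \<longleftrightarrow> crosses L \<pi> e" for e
  proof -
    have "crosses G \<pi> e \<longleftrightarrow> (\<exists>x\<in>\<pi> ` ends G e. \<exists>y\<in>\<pi> ` ends G e. x \<noteq> y)" for G :: "('a, 'b) mgraph" unfolding crosses_def by auto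
    then show ?thesis by (simp only: contract_simps pim)
  qed
  have eK: "e \<in> edges ?K" if "e \<in> edges L" "crosses L \<pi> e" for e
    using that unfolding contract_simps crosses_def bag_def by auto
  have eKL: "e \<in> edges L" if "e \<in> edges ?K" for e using that unfolding contract_simps by simp
  have bw: "bag ?K \<pi> w = {?z}" unfolding bag_def[of ?K] vK using z unfolding bag_def by auto
  have bv: "bag ?K \<pi> v = bag L \<pi> v" "bag L \<pi> v \<inter> ?X = {}" if "v \<noteq> w" for v
    unfolding bag_def[of ?K] vK using z that unfolding bag_def by auto
  have mtK: "matchable_on (adj ?K) U" if "matchable_on (adj L) U" "U \<inter> ?X = {}" for U
    unfolding aK using L.collapse_matchable_outside[OF z that(2)] that(1) by simp
  show ?thesis
    unfolding quotient_model_def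
  proof (intro conjI)
    show "multigraph ?K" by (rule K)
    show "\<pi> ` verts ?K = verts J" unfolding contract_simps pim by (rule Q(2))
    have "{e \<in> edges ?K. crosses ?K \<pi> e} = {e \<in> edges L. crosses L \<pi> e}" using eK eKL cr by auto
    then show "bij_betw g {e \<in> edges ?K. crosses ?K \<pi> e} (edges J)" using Q(3) by simp
    show "\<forall>e\<in>edges ?K. crosses ?K \<pi> e \<longrightarrow> ends J (g e) = \<pi> ` ends ?K e"
      using Q(4) eKL cr by (simp only: contract_simps pim) blast
    show "\<forall>v\<in>verts J. \<forall>Y. Y \<noteq> {} \<longrightarrow> Y \<subset> bag ?K \<pi> v \<longrightarrow> (\<exists>x\<in>Y. \<exists>y\<in>bag ?K \<pi> v - Y. adj ?K x y)"
    proof (intro ballI allI impI)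
      fix v Y assume v: "v \<in> verts J" and Y: "Y \<noteq> {}" "Y \<subset> bag ?K \<pi> v"
      have vw: "v \<noteq> w" using Y bw by auto
      obtain x y where xy: "x \<in> Y" "y \<in> bag L \<pi> v - Y" "adj L x y" using Q(5)[OF v Y(1)] Y(2) bv[OF vw] by blast
      then have "x \<notin> ?X" "y \<notin> ?X" using Y(2) bv[OF vw] by blast+
      then have "adj ?K x y" unfolding aK collapse_def using xy(3) by blast
      then show "\<exists>x\<in>Y. \<exists>y\<in>bag ?K \<pi> v - Y. adj ?K x y" using xy bv[OF vw] by blast
    qed
    show "\<forall>e\<in>edges ?K. crosses ?K \<pi> e \<longrightarrow> (\<forall>x\<in>ends ?K e. matchable_on (adj ?K) (bag ?K \<pi> (\<pi> x) - {x}))"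
    proof (intro ballI impI)
      fix e x assume e: "e \<in> edges ?K" "crosses ?K \<pi> e" and x: "x \<in> ends ?K e"
      obtain y where y: "y \<in> ends L e" "x = ?f y" using x unfolding contract_simps by blast
      show "matchable_on (adj ?K) (bag ?K \<pi> (\<pi> x) - {x})"
      proof (cases "\<pi> y = w")
        case True
        then have "y \<in> ?X" using y(1) multigraphD(3)[OF Q(1) eKL[OF e(1)]] unfolding bag_def by auto
        then have xz: "x = ?z" using y(2) by simp
        then have "\<pi> x = w" using z unfolding bag_def by auto
        then have "bag ?K \<pi> (\<pi> x) - {x} = {}" using bw xz by simp
        then show ?thesis by (simp only: matchable_on_empty)
      next
        case False
        then have "y \<notin> ?X" unfolding bag_def by simp
        then have "x = y" using y(2) by simp
        then show ?thesis
          using Q(6)[OF eKL[OF e(1)] _ y(1)] e(2) cr bv[OF False] by (intro mtK) auto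
      qed
    qed
    show "\<forall>e\<in>edges ?K. \<not> crosses ?K \<pi> e \<longrightarrow> (\<exists>f\<in>edges ?K. \<exists>x\<in>ends ?K f. crosses ?K \<pi> f \<and> x \<notin> ends ?K e \<and>
        (\<forall>y\<in>ends ?K e. \<pi> y = \<pi> x) \<and> matchable_on (adj ?K) (bag ?K \<pi> (\<pi> x) - ends ?K e - {x}))"
    proof (intro ballI impI)
      fix e assume e: "e \<in> edges ?K" "\<not> crosses ?K \<pi> e"
      have eL: "e \<in> edges L" "\<not> crosses L \<pi> e" using e eKL cr by blast+
      have eL3: "\<not> ends L e \<subseteq> ?X" using e(1) unfolding contract_simps(2) by simp
      obtain f x where f: "f \<in> edges L" "x \<in> ends L f" "crosses L \<pi> f" "x \<notin> ends L e" "\<forall>y\<in>ends L e. \<pi> y = \<pi> x"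
        and mx: "matchable_on (adj L) (bag L \<pi> (\<pi> x) - ends L e - {x})" using Q(7)[OF eL(1,2)] by blast
      have pxw: "\<pi> x \<noteq> w"
      proof
        assume "\<pi> x = w"
        then have "ends L e \<subseteq> ?X" using f(5) multigraphD(3)[OF Q(1) eL(1)] unfolding bag_def by auto
        then show False using eL3 by simp
      qed
      have nX: "y \<notin> ?X" if "\<pi> y \<noteq> w" for y using that unfolding bag_def by simp
      have "?f ` ends L e = (\<lambda>y. y) ` ends L e" by (rule image_cong) (use f(5) pxw nX in auto)
      then have ee: "ends ?K e = ends L e" unfolding contract_simps by simp
      have "?f x = x" using nX[OF pxw] by simp
      then have "x \<in> ?f ` ends L f" by (rule image_eqI[OF sym f(2)])
      then have xf: "x \<in> ends ?K f" unfolding contract_simps(3) .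
      have "matchable_on (adj ?K) (bag ?K \<pi> (\<pi> x) - ends ?K e - {x})"
        using mx bv[OF pxw] ee by (intro mtK) auto
      then show "\<exists>f\<in>edges ?K. \<exists>x\<in>ends ?K f. crosses ?K \<pi> f \<and> x \<notin> ends ?K e \<and>
        (\<forall>y\<in>ends ?K e. \<pi> y = \<pi> x) \<and> matchable_on (adj ?K) (bag ?K \<pi> (\<pi> x) - ends ?K e - {x})"
        using eK[OF f(1,3)] xf f(3,4,5) cr ee by (intro bexI[of _ f] bexI[of _ x]) auto
    qed
  qed
qed

text \<open>Every crossing edge at the fibre now ends in the contracted vertex. So the edge
  \<open>f\<close> that accompanies an edge inside the fibre covers exactly this vertex and its own
  end in the fibre.\<close>

lemma quotient_shore:
  assumes q: "quotient_model L J \<pi> g" and mcJ: "matching_covered J" and w: "w \<in> verts J"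
  shows "bag L \<pi> w \<noteq> {}" "bag L \<pi> w \<subset> verts L" "matching_covered (contract L (verts L - bag L \<pi> w))"
proof -
  note Q = quotient_modelD[OF q]
  have J: "multigraph J" using mcJ unfolding matching_covered_def by simp
  interpret J: sym_rel "adj J" by (rule sym_rel_adj[OF J])
  interpret L: sym_rel "adj L" by (rule sym_rel_adj[OF Q(1)])
  have mJ: "J.mcov (verts J)" using mcJ matching_covered_iff by blast
  let ?X = "bag L \<pi> w" let ?Y = "verts L - ?X" let ?z = "SOME x. x \<in> ?Y" let ?K = "contract L ?Y"
  show X: "?X \<noteq> {}" using w unfolding Q(2)[symmetric] bag_def by auto
  have XL: "?X \<subseteq> verts L" unfolding bag_def by auto
  have "card {w} \<noteq> card (verts J)" using J.mcovD(2)[OF mJ] by simp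
  then have "{w} \<noteq> verts J" by metis
  then have "{w} \<subset> verts J" using w by blast
  then obtain v where v: "v \<in> verts J - {w}" "adj J w v" using J.mcovD(3)[OF mJ, of "{w}"] by blast
  obtain e0 x0 y0 where e0: "e0 \<in> edges L" "crosses L \<pi> e0" "ends L e0 = {x0, y0}" "\<pi> x0 = w" "\<pi> y0 = v" "x0 \<in> verts L" "y0 \<in> verts L" "adj L x0 y0"
    using quotient_edge[OF q v(2) J] by blast
  have x0: "x0 \<in> ?X" "y0 \<in> ?Y" using e0 v(1) unfolding bag_def by auto
  then show "?X \<subset> verts L" using XL by blast
  have Y: "?Y \<noteq> {}" using x0 by blast
  have z: "?z \<in> ?Y" using rep_in[OF Y] .
  have K: "multigraph ?K" by (rule multigraph_contract[OF Q(1) Y])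
  have aK: "adj ?K = collapse (adj L) ?Y ?z" by (rule adj_contract[OF Q(1) Y])
  have vK: "verts ?K = insert ?z ?X" using verts_contract[OF Y, of L] XL by auto
  interpret K: sym_rel "adj ?K" by (rule sym_rel_adj[OF K])
  have fX: "finite ?X" using multigraphD(1)[OF Q(1)] unfolding bag_def by simp
  have zX: "?z \<notin> ?X" using z by blast
  have xz: "adj ?K x ?z" if "x \<in> ?X" "y \<notin> ?X" "adj L x y" for x y
    unfolding aK collapse_def using that adjD(2)[OF Q(1) that(3)] by blast
  have inX: "adj ?K x y" if "x \<in> ?X" "y \<in> ?X" "adj L x y" for x y
    unfolding aK collapse_def using that by blast
  have mtK: "matchable_on (adj ?K) U" if "matchable_on (adj L) U" "U \<subseteq> ?X" for U
  proof -
    have "U \<inter> ?Y = {}" using that(2) by blast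
    then show ?thesis unfolding aK using L.collapse_matchable_outside[OF z] that(1) by simp
  qed
  have "K.mcov (verts ?K)"
    unfolding K.mcov_def
  proof (intro conjI allI impI ballI)
    show "finite (verts ?K)" using vK fX by simp
    have "0 < card ?X" using X fX by (simp add: card_gt_0_iff)
    then show "2 \<le> card (verts ?K)" using vK fX zX by simp
  next
    fix A assume A: "A \<noteq> {}" "A \<subset> verts ?K"
    show "\<exists>x\<in>A. \<exists>y\<in>verts ?K - A. adj ?K x y"
    proof (cases "?X \<inter> A \<noteq> {} \<and> ?X - A \<noteq> {}")
      case True
      then have "?X \<inter> A \<subset> ?X" by blast
      then obtain x y where xy: "x \<in> ?X \<inter> A" "y \<in> ?X - (?X \<inter> A)" "adj L x y" using Q(5)[OF w, of "?X \<inter> A"] True by blast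
      then have "adj ?K x y" using inX by blast
      then show ?thesis using xy vK by blast
    next
      case False
      have ad: "adj ?K x0 ?z" by (rule xz[OF x0(1) _ e0(8)]) (use x0 in blast)
      have "A = {?z} \<or> A = ?X"
      proof (cases "?X \<inter> A = {}")
        case True
        then have "A \<subseteq> {?z}" using A(2) unfolding vK by blast
        then show ?thesis using A(1) by blast
      next
        case ne: False
        then have sub: "?X \<subseteq> A" using False by blast
        then have "?z \<notin> A" using A(2) unfolding vK by blast
        then have "A \<subseteq> ?X" using A(2) unfolding vK by blast
        then show ?thesis using sub by blast
      qed
      then show ?thesis
      proof
        assume "A = {?z}"
        then show ?thesis using K.sym[OF ad] vK x0(1) zX by blast
      next
        assume "A = ?X"
        then show ?thesis using ad vK x0(1) zX by blast
      qed
    qed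
  next
    fix a b assume ab: "a \<in> verts ?K" "b \<in> verts ?K" "adj ?K a b"
    have hub: "matchable_on (adj ?K) (verts ?K - {?z, b})" if b: "b \<in> ?X" "adj ?K ?z b" for b
    proof -
      obtain y where y: "y \<in> ?Y" "adj L y b" using b zX z unfolding aK collapse_def by blast
      then obtain e where e: "e \<in> edges L" "ends L e = {y, b}" unfolding adj_def by blast
      have "\<pi> y \<noteq> \<pi> b" using y(1) b(1) unfolding bag_def by auto
      then have "crosses L \<pi> e" using e(2) unfolding crosses_def by auto
      then have "matchable_on (adj L) (bag L \<pi> (\<pi> b) - {b})" using Q(6)[OF e(1), of b] e(2) by simp
      moreover have "bag L \<pi> (\<pi> b) = ?X" using b(1) unfolding bag_def by auto
      moreover have "verts ?K - {?z, b} = ?X - {b}" using vK zX by auto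
      ultimately show ?thesis using mtK by (metis Diff_subset)
    qed
    have "a \<noteq> b" using ab(3) K.irrefl by metis
    then consider "a = ?z" "b \<in> ?X" | "b = ?z" "a \<in> ?X" | "a \<in> ?X" "b \<in> ?X" using ab(1,2) unfolding vK by blast
    then show "matchable_on (adj ?K) (verts ?K - {a, b})"
    proof cases
      case 1 then show ?thesis using hub[of b] ab(3) by simp
    next
      case 2 then show ?thesis using hub[of a] K.sym[OF ab(3)] by (simp add: insert_commute)
    next
      case 3
      then have "adj L a b" using ab(3) zX unfolding aK collapse_def by blast
      then obtain e where e: "e \<in> edges L" "ends L e = {a, b}" unfolding adj_def by blast
      have pw: "\<pi> a = w" "\<pi> b = w" using 3 unfolding bag_def by auto
      then have "\<not> crosses L \<pi> e" using e(2) unfolding crosses_def by auto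
      then obtain f x where f: "f \<in> edges L" "x \<in> ends L f" "crosses L \<pi> f" "x \<notin> ends L e" "\<forall>y\<in>ends L e. \<pi> y = \<pi> x"
        and mx: "matchable_on (adj L) (bag L \<pi> (\<pi> x) - ends L e - {x})" using Q(7)[OF e(1)] by blast
      have px: "\<pi> x = w" using f(5) e(2) pw by auto
      obtain y where y: "ends L f = {x, y}" "x \<noteq> y" "x \<in> verts L" "y \<in> verts L" "adj L x y"
        using multigraph_other_end[OF Q(1) f(1,2)] .
      have "\<pi> y \<noteq> w" using f(3) y(1) px unfolding crosses_def by auto
      then have xX: "x \<in> ?X" "y \<notin> ?X" using y px unfolding bag_def by auto
      have "adj ?K x ?z" by (rule xz[OF xX y(5)])
      then have "matchable_on (adj ?K) {x, ?z}" using matchable_on_pair[of "adj ?K" x ?z] K.sym K.irrefl by metis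
      moreover have "matchable_on (adj ?K) (?X - ends L e - {x})" using mx px by (intro mtK) auto
      ultimately have "matchable_on (adj ?K) ({x, ?z} \<union> (?X - ends L e - {x}))" by (rule matchable_on_Un) (use zX in auto)
      moreover have "{x, ?z} \<union> (?X - ends L e - {x}) = verts ?K - {a, b}"
        using vK zX xX f(4) e(2) 3 by auto
      ultimately show ?thesis by simp
    qed
  qed
  then show "matching_covered ?K" using K matching_covered_iff by blast
qed

text \<open>Fibres with several vertices are shrunk one at a time; once \<open>\<pi>\<close> is
  injective, \<open>\<pi>\<close> and \<open>g\<close> form an isomorphism.\<close>

theorem quotient_S_steps:
  assumes mcJ: "matching_covered J" and q: "quotient_model L J \<pi> g"
  shows "\<exists>L'. S_step\<^sup>*\<^sup>* L L' \<and> graph_iso L' J"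
  using q
proof (induction "card (verts L)" arbitrary: L rule: less_induct)
  case less
  note Q = quotient_modelD[OF less.prems]
  note fL = multigraphD(1)[OF Q(1)]
  show ?case
  proof (cases "inj_on \<pi> (verts L)")
    case True
    have cr: "crosses L \<pi> e" if e: "e \<in> edges L" for e
    proof -
      obtain x y where xy: "ends L e = {x, y}" "x \<noteq> y" "x \<in> verts L" "y \<in> verts L" using multigraph_ends[OF Q(1) e] .
      then have "\<pi> x \<noteq> \<pi> y" using True by (meson inj_onD)
      then show ?thesis using xy(1) unfolding crosses_def by auto
    qed
    then have "{e \<in> edges L. crosses L \<pi> e} = edges L" by blast
    then have "graph_iso L J" unfolding graph_iso_def
      using True Q(2,3,4) cr by (intro exI[of _ \<pi>] exI[of _ g]) (auto simp: bij_betw_def)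
    then show ?thesis by blast
  next
    case False
    then obtain x y where xy: "x \<in> verts L" "y \<in> verts L" "x \<noteq> y" "\<pi> x = \<pi> y" unfolding inj_on_def by blast
    let ?X = "bag L \<pi> (\<pi> x)"
    have w: "\<pi> x \<in> verts J" using Q(2) xy(1) by blast
    have X: "{x, y} \<subseteq> ?X" "?X \<subseteq> verts L" using xy unfolding bag_def by auto
    note sh = quotient_shore[OF less.prems mcJ w]
    have q': "quotient_model (contract L ?X) J \<pi> g" by (rule quotient_contract[OF less.prems w])
    have "separating L ?X"
      unfolding separating_def using quotient_matching_covered[OF less.prems mcJ] quotient_matching_covered[OF q' mcJ] sh by blast
    then have st: "S_step L (contract L ?X)" by (rule S_step.contraction)
    have "card (verts (contract L ?X)) < card (verts L)"
    proof -
      have "card {x, y} \<le> card ?X" by (rule card_mono) (use X fL finite_subset in auto)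
      then have "2 \<le> card ?X" using xy(3) by simp
      moreover have "card (verts L - ?X) = card (verts L) - card ?X" using X fL by (intro card_Diff_subset) (auto intro: finite_subset)
      moreover have "card ?X \<le> card (verts L)" using X fL card_mono by blast
      moreover have "card (verts (contract L ?X)) \<le> Suc (card (verts L - ?X))"
        unfolding verts_contract[OF sh(1) X(2)] using fL by (simp add: card_insert_if)
      ultimately show ?thesis by linarith
    qed
    then obtain L' where "S_step\<^sup>*\<^sup>* (contract L ?X) L'" "graph_iso L' J" using less.hyps q' by blast
    then show ?thesis using st by (meson converse_rtranclp_into_rtranclp)
  qed
qed

text \<open>Needed because a bi-subdivision in \<open>G\<close>, and later the outcome of a round of
  contractions, is known only up to isomorphism.\<close>

lemma quotient_model_iso:
  assumes q: "quotient_model K J \<pi> g" and L: "multigraph L"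
    and f: "bij_betw f (verts L) (verts K)" and h: "bij_betw h (edges L) (edges K)"
    and e: "\<And>e. e \<in> edges L \<Longrightarrow> ends K (h e) = f ` ends L e"
  shows "quotient_model L J (\<pi> \<circ> f) (g \<circ> h)"
proof -
  note Q = quotient_modelD[OF q]
  have hK: "h e \<in> edges K" if "e \<in> edges L" for e using h that unfolding bij_betw_def by blast
  have injf: "inj_on f (verts L)" and fim: "f ` verts L = verts K" using f unfolding bij_betw_def by auto
  have cr: "crosses L (\<pi> \<circ> f) d \<longleftrightarrow> crosses K \<pi> (h d)" if "d \<in> edges L" for d
    unfolding crosses_def e[OF that] by auto
  have adjLK: "adj L x y" if xy: "x \<in> verts L" "y \<in> verts L" "adj K (f x) (f y)" for x y
  proof -
    obtain d where d: "d \<in> edges K" "ends K d = {f x, f y}" using xy(3) unfolding adj_def by blast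
    then have "d \<in> h ` edges L" using h unfolding bij_betw_def by simp
    then obtain d' where d': "d' \<in> edges L" "h d' = d" by blast
    have "f ` ends L d' = f ` {x, y}" using e[OF d'(1)] d'(2) d(2) by simp
    then have "ends L d' = {x, y}"
      using inj_on_image_eq_iff[OF injf multigraphD(3)[OF L d'(1)], of "{x, y}"] xy(1,2) by simp
    then show ?thesis unfolding adj_def using d'(1) by blast
  qed
  have bagf: "f ` bag L (\<pi> \<circ> f) w = bag K \<pi> w" for w using fim unfolding bag_def by auto
  have bagL: "bag L p w \<subseteq> verts L" for p :: "'e \<Rightarrow> 'c" and w unfolding bag_def by auto
  have mt: "matchable_on (adj L) U" if "matchable_on (adj K) (f ` U)" "U \<subseteq> verts L" for U
    by (rule matchable_on_transport[OF that(1) inj_on_subset[OF injf that(2)]]) (use that(2) adjLK in blast)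
  have imd: "f ` (A - B) = f ` A - f ` B" if "A \<subseteq> verts L" "B \<subseteq> verts L" for A B
    by (rule inj_on_image_set_diff[OF injf]) (use that in auto)
  show ?thesis
    unfolding quotient_model_def
  proof (intro conjI)
    show "multigraph L" by (rule L)
    show "(\<pi> \<circ> f) ` verts L = verts J" using fim Q(2) by (metis image_comp)
    have "bij_betw h {d \<in> edges L. crosses L (\<pi> \<circ> f) d} {d \<in> edges K. crosses K \<pi> d}"
    proof (rule bij_betw_subset[OF h])
      have "h ` edges L = edges K" using h unfolding bij_betw_def by simp
      then show "h ` {d \<in> edges L. crosses L (\<pi> \<circ> f) d} = {d \<in> edges K. crosses K \<pi> d}" using cr by force
    qed auto
    then show "bij_betw (g \<circ> h) {d \<in> edges L. crosses L (\<pi> \<circ> f) d} (edges J)" using Q(3) by (rule bij_betw_trans)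
    show "\<forall>d\<in>edges L. crosses L (\<pi> \<circ> f) d \<longrightarrow> ends J ((g \<circ> h) d) = (\<pi> \<circ> f) ` ends L d"
      using Q(4) hK cr e by (simp add: image_comp)
    show "\<forall>w\<in>verts J. \<forall>X. X \<noteq> {} \<longrightarrow> X \<subset> bag L (\<pi> \<circ> f) w \<longrightarrow> (\<exists>x\<in>X. \<exists>y\<in>bag L (\<pi> \<circ> f) w - X. adj L x y)"
    proof (intro ballI allI impI)
      fix w X assume w: "w \<in> verts J" and X: "X \<noteq> {}" "X \<subset> bag L (\<pi> \<circ> f) w"
      have XL: "X \<subseteq> verts L" "bag L (\<pi> \<circ> f) w \<subseteq> verts L" using X bagL by blast+
      have "f ` X \<subset> bag K \<pi> w"
      proof -
        have "f ` X \<noteq> f ` bag L (\<pi> \<circ> f) w" using inj_on_image_eq_iff[OF injf XL] X by blast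
        then show ?thesis using X bagf by blast
      qed
      then obtain a b where ab: "a \<in> f ` X" "b \<in> bag K \<pi> w - f ` X" "adj K a b" using Q(5)[OF w, of "f ` X"] X by blast
      obtain x where x: "x \<in> X" "a = f x" using ab(1) by blast
      obtain y where y: "y \<in> bag L (\<pi> \<circ> f) w" "b = f y" using ab(2) unfolding bagf[of w, symmetric] by blast
      have "x \<in> X" "y \<in> bag L (\<pi> \<circ> f) w" "y \<notin> X" "adj K (f x) (f y)" using x y ab by auto
      then show "\<exists>x\<in>X. \<exists>y\<in>bag L (\<pi> \<circ> f) w - X. adj L x y" using adjLK XL by blast
    qed
    show "\<forall>d\<in>edges L. crosses L (\<pi> \<circ> f) d \<longrightarrow> (\<forall>x\<in>ends L d. matchable_on (adj L) (bag L (\<pi> \<circ> f) ((\<pi> \<circ> f) x) - {x}))"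
    proof (intro ballI impI)
      fix d x assume d: "d \<in> edges L" "crosses L (\<pi> \<circ> f) d" and x: "x \<in> ends L d"
      have xL: "x \<in> verts L" using multigraphD(3)[OF L d(1)] x by blast
      have "matchable_on (adj K) (bag K \<pi> (\<pi> (f x)) - {f x})" using Q(6)[OF hK[OF d(1)], of "f x"] d cr e x by simp
      moreover have "f ` (bag L (\<pi> \<circ> f) (\<pi> (f x)) - {x}) = bag K \<pi> (\<pi> (f x)) - {f x}"
        using imd[OF bagL, of "{x}"] xL bagf by simp
      ultimately have "matchable_on (adj L) (bag L (\<pi> \<circ> f) (\<pi> (f x)) - {x})" using mt bagL by (metis Diff_subset subset_trans)
      then show "matchable_on (adj L) (bag L (\<pi> \<circ> f) ((\<pi> \<circ> f) x) - {x})" by simp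
    qed
    show "\<forall>d\<in>edges L. \<not> crosses L (\<pi> \<circ> f) d \<longrightarrow> (\<exists>k\<in>edges L. \<exists>x\<in>ends L k. crosses L (\<pi> \<circ> f) k \<and> x \<notin> ends L d \<and>
        (\<forall>y\<in>ends L d. (\<pi> \<circ> f) y = (\<pi> \<circ> f) x) \<and> matchable_on (adj L) (bag L (\<pi> \<circ> f) ((\<pi> \<circ> f) x) - ends L d - {x}))"
    proof (intro ballI impI)
      fix d assume d: "d \<in> edges L" "\<not> crosses L (\<pi> \<circ> f) d"
      then obtain k x where k: "k \<in> edges K" "x \<in> ends K k" "crosses K \<pi> k" "x \<notin> ends K (h d)" "\<forall>y\<in>ends K (h d). \<pi> y = \<pi> x"
        and mx: "matchable_on (adj K) (bag K \<pi> (\<pi> x) - ends K (h d) - {x})" using Q(7)[OF hK[OF d(1)]] cr by blast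
      have "k \<in> h ` edges L" using k(1) h unfolding bij_betw_def by simp
      then obtain k' where k': "k' \<in> edges L" "h k' = k" by blast
      obtain x' where x': "x' \<in> ends L k'" "x = f x'" using k(2) e[OF k'(1)] k'(2) by auto
      have L': "x' \<in> verts L" "ends L d \<subseteq> verts L" using multigraphD(3)[OF L k'(1)] x'(1) multigraphD(3)[OF L d(1)] by auto
      have dv: "bag L (\<pi> \<circ> f) (\<pi> x) - ends L d \<subseteq> verts L" using bagL by blast
      have "f ` (bag L (\<pi> \<circ> f) (\<pi> x) - ends L d - {x'}) = bag K \<pi> (\<pi> x) - ends K (h d) - {x}"
        using imd[OF dv, of "{x'}"] imd[OF bagL L'(2)] L'(1) bagf e[OF d(1)] x'(2) by simp
      then have "matchable_on (adj L) (bag L (\<pi> \<circ> f) (\<pi> x) - ends L d - {x'})" using mt[OF _ subset_trans[OF Diff_subset dv]] mx by simp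
      then show "\<exists>k\<in>edges L. \<exists>x\<in>ends L k. crosses L (\<pi> \<circ> f) k \<and> x \<notin> ends L d \<and>
        (\<forall>y\<in>ends L d. (\<pi> \<circ> f) y = (\<pi> \<circ> f) x) \<and> matchable_on (adj L) (bag L (\<pi> \<circ> f) ((\<pi> \<circ> f) x) - ends L d - {x})"
        using k k' x' cr[OF k'(1)] e[OF d(1)] by (intro bexI[of _ k'] bexI[of _ x']) auto
    qed
  qed
qed

section \<open>Bi-subdivisions as quotient models\<close>

lemma subdivide_simps:
  "verts (subdivide J s t k) = Inl ` verts J \<union> Inr ` {(e, i). e \<in> edges J \<and> 1 \<le> i \<and> i \<le> k e}"
  "edges (subdivide J s t k) = {(e, i). e \<in> edges J \<and> i \<le> k e}"
  "ends (subdivide J s t k) (e, i) = {subdivision_point s t k e i, subdivision_point s t k e (Suc i)}"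
  unfolding subdivide_def by simp_all

locale subdivision =
  fixes J :: "('v, 'e) mgraph" and s t :: "'e \<Rightarrow> 'v" and k :: "'e \<Rightarrow> nat"
  assumes J: "multigraph J" and ends: "e \<in> edges J \<Longrightarrow> ends J e = {s e, t e}" and even_k: "e \<in> edges J \<Longrightarrow> even (k e)"
begin

abbreviation "pt \<equiv> subdivision_point s t k"
abbreviation "S \<equiv> subdivide J s t k"

lemma st: "e \<in> edges J \<Longrightarrow> s e \<noteq> t e" "e \<in> edges J \<Longrightarrow> s e \<in> verts J" "e \<in> edges J \<Longrightarrow> t e \<in> verts J"
  using multigraphD(3,4)[OF J, of e] ends[of e] by auto

lemma pt_inj: "e \<in> edges J \<Longrightarrow> inj_on (pt e) {..Suc (k e)}"
  using st(1)[of e] by (auto simp: inj_on_def subdivision_point_def split: if_splits)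

lemma pt_verts: "e \<in> edges J \<Longrightarrow> pt e i \<in> verts S"
  using st(2,3)[of e] unfolding subdivide_simps subdivision_point_def by auto

lemma multigraph_subdivide: "multigraph S"
  unfolding multigraph_def
proof (intro conjI ballI)
  note fin = multigraphD(1,2)[OF J]
  have "{(e, i). e \<in> edges J \<and> 1 \<le> i \<and> i \<le> k e} \<subseteq> Sigma (edges J) (\<lambda>e. {..k e})" by auto
  then have "finite {(e, i). e \<in> edges J \<and> 1 \<le> i \<and> i \<le> k e}" using finite_subset fin(2) by blast
  then show "finite (verts S)" unfolding subdivide_simps using fin(1) by simp
  have "edges S = Sigma (edges J) (\<lambda>e. {..k e})" unfolding subdivide_simps by auto
  then show "finite (edges S)" using fin(2) by simp
  fix x assume "x \<in> edges S"
  then obtain e i where x: "x = (e, i)" "e \<in> edges J" "i \<le> k e" unfolding subdivide_simps by auto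
  show "ends S x \<subseteq> verts S" unfolding x subdivide_simps(3) using pt_verts[OF x(2)] by simp
  have "pt e i \<noteq> pt e (Suc i)" using inj_onD[OF pt_inj[OF x(2)], of i "Suc i"] x(3) by auto
  then show "card (ends S x) = 2" unfolding x subdivide_simps(3) by simp
qed

lemma adj_pt: "e \<in> edges J \<Longrightarrow> i \<le> k e \<Longrightarrow> adj S (pt e i) (pt e (Suc i))"
  unfolding adj_def by (rule bexI[of _ "(e, i)"]) (simp_all add: subdivide_simps)

lemma adj_pt': "e \<in> edges J \<Longrightarrow> i \<le> k e \<Longrightarrow> adj S (pt e (Suc i)) (pt e i)"
  using sym_rel.sym[OF sym_rel_adj[OF multigraph_subdivide] adj_pt] .

lemma matchable_segment:
  assumes e: "e \<in> edges J" and b: "b \<le> Suc (Suc (k e))" and ev: "even (b - a)"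
  shows "matchable_on (adj S) (pt e ` {a..<b})"
proof -
  have "matchable_on (adj S) (set (map (pt e) [a..<b]))"
  proof (rule matchable_on_list)
    show "distinct (map (pt e) [a..<b])"
    proof -
      have "{a..<b} \<subseteq> {..Suc (k e)}" using b by auto
      then show ?thesis using inj_on_subset[OF pt_inj[OF e], of "{a..<b}"] by (simp add: distinct_map)
    qed
    show "successively (adj S) (map (pt e) [a..<b])"
      using adj_pt[OF e] b by (auto simp: successively_conv_nth)
  qed (use ev sym_rel.sym[OF sym_rel_adj[OF multigraph_subdivide]] in auto)
  then show ?thesis by simp
qed

definition leg :: "'e \<Rightarrow> ('v + 'e \<times> nat) set" where
  "leg e = pt e ` {1..<Suc (k e)}"

lemma leg_eq: "leg e = Inr ` {(e, i) | i. 1 \<le> i \<and> i \<le> k e}"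
  unfolding leg_def subdivision_point_def by (auto simp: image_def)

lemma leg_disjoint: "e \<noteq> e' \<Longrightarrow> leg e \<inter> leg e' = {}" "Inl v \<notin> leg e"
  unfolding leg_eq by auto

lemma arm_eq: "pt e ` {0..<Suc (k e)} = insert (Inl (s e)) (leg e)"
proof -
  have "{0..<Suc (k e)} = insert 0 {1..<Suc (k e)}" by auto
  moreover have "pt e 0 = Inl (s e)" unfolding subdivision_point_def by simp
  ultimately show ?thesis unfolding leg_def by (simp only: image_insert)
qed

lemma matchable_legs:
  assumes "E \<subseteq> edges J"
  shows "matchable_on (adj S) (\<Union>e\<in>E. leg e)"
proof (rule matchable_on_UN)
  show "matchable_on (adj S) (leg e)" if "e \<in> E" for e
    unfolding leg_def by (rule matchable_segment) (use that assms even_k in auto)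
qed (use leg_disjoint in auto)

text \<open>All inner points of \<open>e\<close> go to the start \<open>s e\<close>. The fibre of
  \<open>v\<close> is then a star of even paths with centre \<open>v\<close>, and the only crossing
  edge over \<open>e\<close> is its last one, \<open>(e, k e)\<close>.\<close>

definition proj :: "'v + 'e \<times> nat \<Rightarrow> 'v" where
  "proj = case_sum (\<lambda>v. v) (\<lambda>x. s (fst x))"

definition out :: "'v \<Rightarrow> 'e set" where
  "out v = {e \<in> edges J. s e = v}"

lemma bag_eq: "v \<in> verts J \<Longrightarrow> bag S proj v = insert (Inl v) (\<Union>e\<in>out v. leg e)"
  unfolding bag_def subdivide_simps proj_def out_def leg_eq by auto

lemma bag_arm: "v \<in> verts J \<Longrightarrow> e \<in> out v \<Longrightarrow> bag S proj v = pt e ` {0..<Suc (k e)} \<union> (\<Union>e\<in>out v - {e}. leg e)"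
  unfolding bag_eq arm_eq out_def by auto

lemma proj_pt: "i \<le> k e \<Longrightarrow> proj (pt e i) = s e" "proj (pt e (Suc (k e))) = t e"
  unfolding proj_def subdivision_point_def by auto

lemma crosses_subdivide: "e \<in> edges J \<Longrightarrow> i \<le> k e \<Longrightarrow> crosses S proj (e, i) \<longleftrightarrow> i = k e"
  using proj_pt(1)[of i e] proj_pt(1)[of "Suc i" e] proj_pt(2)[of e] st(1)[of e]
  unfolding crosses_def subdivide_simps by (cases "i = k e") auto

lemma pt_image_diff: "e \<in> edges J \<Longrightarrow> A \<subseteq> {..Suc (k e)} \<Longrightarrow> B \<subseteq> {..Suc (k e)} \<Longrightarrow> pt e ` A - pt e ` B = pt e ` (A - B)"
  by (subst inj_on_image_set_diff[OF pt_inj]) auto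

lemma pt_in_leg_other: "i \<le> k e \<Longrightarrow> e' \<noteq> e \<Longrightarrow> pt e i \<notin> leg e'"
  unfolding leg_eq subdivision_point_def by auto

lemma segment_rest:
  assumes "A \<subseteq> {..k e}" "e \<notin> E"
  shows "pt e ` A \<inter> (\<Union>d\<in>E. leg d) = {}"
proof (rule ccontr)
  assume "pt e ` A \<inter> (\<Union>d\<in>E. leg d) \<noteq> {}"
  then obtain i d where "i \<in> A" "d \<in> E" "pt e i \<in> leg d" by auto
  then show False using pt_in_leg_other[of i e d] assms by auto
qed

text \<open>Of the arm of \<open>e\<close> the points \<open>0\<close> to \<open>k e - 1\<close>
  remain, an even number of them; for \<open>k e = 0\<close> the port is the centre itself.\<close>

lemma port_start:
  assumes e: "e \<in> edges J"
  shows "matchable_on (adj S) (bag S proj (s e) - {pt e (k e)})"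
proof -
  have eo: "e \<in> out (s e)" using e unfolding out_def by simp
  have "matchable_on (adj S) (pt e ` {0..<k e} \<union> (\<Union>d\<in>out (s e) - {e}. leg d))"
  proof (rule matchable_on_Un)
    show "matchable_on (adj S) (pt e ` {0..<k e})" by (rule matchable_segment) (use e even_k in auto)
    show "matchable_on (adj S) (\<Union>d\<in>out (s e) - {e}. leg d)" by (rule matchable_legs) (auto simp: out_def)
    show "pt e ` {0..<k e} \<inter> (\<Union>d\<in>out (s e) - {e}. leg d) = {}" by (rule segment_rest) auto
  qed
  moreover have "pt e ` {0..<Suc (k e)} - pt e ` {k e} = pt e ` {0..<k e}"
    by (subst pt_image_diff[OF e]) (auto intro: arg_cong[where f = "image (pt e)"])
  then have "bag S proj (s e) - {pt e (k e)} = pt e ` {0..<k e} \<union> (\<Union>d\<in>out (s e) - {e}. leg d)"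
    unfolding bag_arm[OF st(2)[OF e] eo] using pt_in_leg_other[of "k e" e] by auto
  ultimately show ?thesis by simp
qed

lemma port_end:
  assumes v: "v \<in> verts J"
  shows "matchable_on (adj S) (bag S proj v - {Inl v})"
proof -
  have "bag S proj v - {Inl v} = (\<Union>d\<in>out v. leg d)" unfolding bag_eq[OF v] using leg_disjoint(2) by auto
  then show ?thesis using matchable_legs[of "out v"] by (simp add: out_def)
qed

lemma quotient_subdivide:
  assumes deg: "\<And>e v. e \<in> edges J \<Longrightarrow> v \<in> ends J e \<Longrightarrow> \<exists>e'\<in>edges J. e' \<noteq> e \<and> v \<in> ends J e'"
  shows "quotient_model S J proj fst"
  unfolding quotient_model_def
proof (intro conjI)
  show "multigraph S" by (rule multigraph_subdivide)
  show "proj ` verts S = verts J"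
  proof (intro equalityI subsetI)
    fix v assume "v \<in> proj ` verts S"
    then show "v \<in> verts J" using st(2) unfolding subdivide_simps proj_def by auto
  next
    fix v assume "v \<in> verts J"
    then have "Inl v \<in> verts S" "proj (Inl v) = v" unfolding subdivide_simps proj_def by auto
    then show "v \<in> proj ` verts S" by (metis image_eqI)
  qed
  have cs: "{x \<in> edges S. crosses S proj x} = (\<lambda>e. (e, k e)) ` edges J"
    using crosses_subdivide unfolding subdivide_simps by auto
  show "bij_betw fst {x \<in> edges S. crosses S proj x} (edges J)"
    unfolding cs bij_betw_def by (auto simp: inj_on_def image_image)
  show "\<forall>x\<in>edges S. crosses S proj x \<longrightarrow> ends J (fst x) = proj ` ends S x"
  proof (intro ballI impI)
    fix x assume "x \<in> edges S" "crosses S proj x"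
    then obtain e where e: "e \<in> edges J" "x = (e, k e)" using cs by blast
    then show "ends J (fst x) = proj ` ends S x" using proj_pt(1)[of "k e" e] proj_pt(2)[of e] ends[OF e(1)] by (simp add: subdivide_simps)
  qed
  show "\<forall>x\<in>edges S. crosses S proj x \<longrightarrow> (\<forall>y\<in>ends S x. matchable_on (adj S) (bag S proj (proj y) - {y}))"
  proof (intro ballI impI)
    fix x y assume "x \<in> edges S" "crosses S proj x" and y: "y \<in> ends S x"
    then obtain e where e: "e \<in> edges J" "x = (e, k e)" using cs by blast
    have "pt e (Suc (k e)) = Inl (t e)" unfolding subdivision_point_def by simp
    then have "y = pt e (k e) \<or> y = Inl (t e)" using y e(2) by (simp add: subdivide_simps)
    then show "matchable_on (adj S) (bag S proj (proj y) - {y})"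
    proof
      assume "y = pt e (k e)"
      then show ?thesis using port_start[OF e(1)] proj_pt(1)[of "k e" e] by simp
    next
      assume "y = Inl (t e)"
      then show ?thesis using port_end[OF st(3)[OF e(1)]] by (simp add: proj_def)
    qed
  qed
  show "\<forall>w\<in>verts J. \<forall>X. X \<noteq> {} \<longrightarrow> X \<subset> bag S proj w \<longrightarrow> (\<exists>x\<in>X. \<exists>y\<in>bag S proj w - X. adj S x y)"
  proof (intro ballI allI impI)
    fix v X assume v: "v \<in> verts J" and X: "X \<noteq> {}" "X \<subset> bag S proj v"
    have path: "\<exists>x\<in>A. \<exists>y\<in>bag S proj v - A. adj S x y \<and> adj S y x" if A: "A \<subseteq> bag S proj v" "Inl v \<notin> A" "A \<noteq> {}" for A
    proof -
      obtain a where a: "a \<in> A" using A(3) by blast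
      then obtain e where e: "e \<in> out v" "a \<in> leg e" using A(1,2) unfolding bag_eq[OF v] by auto
      then obtain j where j: "j < Suc (k e)" "a = pt e j" unfolding leg_def by auto
      have eJ: "e \<in> edges J" "s e = v" using e(1) unfolding out_def by auto
      let ?l = "map (pt e) [0..<Suc (k e)]"
      have "?l ! 0 = pt e 0" by (simp del: upt_Suc)
      then have "?l ! 0 \<notin> A" using A(2) eJ(2) by (simp add: subdivision_point_def del: upt_Suc)
      moreover have "?l ! j \<in> A" using j a by (simp del: upt_Suc)
      ultimately obtain i where i: "Suc i < length ?l" "?l ! i \<notin> A" "?l ! Suc i \<in> A"
        using crossing_index[of "\<lambda>x. x \<in> A" ?l j] j(1) by (auto simp del: upt_Suc)
      then have i': "Suc i \<le> k e" "pt e i \<notin> A" "pt e (Suc i) \<in> A" by (simp_all del: upt_Suc)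
      have "pt e i \<in> bag S proj v" unfolding bag_arm[OF v e(1)] using i'(1) by auto
      then show ?thesis using i' adj_pt[OF eJ(1), of i] adj_pt'[OF eJ(1), of i] by (metis DiffI Suc_leD)
    qed
    show "\<exists>x\<in>X. \<exists>y\<in>bag S proj v - X. adj S x y"
    proof (cases "Inl v \<in> X")
      case False
      then show ?thesis using path[of X] X by blast
    next
      case True
      then have "\<exists>x\<in>bag S proj v - X. \<exists>y\<in>bag S proj v - (bag S proj v - X). adj S x y \<and> adj S y x" using path[of "bag S proj v - X"] X by blast
      then show ?thesis by blast
    qed
  qed
  show "\<forall>x\<in>edges S. \<not> crosses S proj x \<longrightarrow> (\<exists>f\<in>edges S. \<exists>y\<in>ends S f. crosses S proj f \<and> y \<notin> ends S x \<and>
      (\<forall>z\<in>ends S x. proj z = proj y) \<and> matchable_on (adj S) (bag S proj (proj y) - ends S x - {y}))"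
  proof (intro ballI impI)
    fix x assume "x \<in> edges S" "\<not> crosses S proj x"
    then obtain e i where e: "x = (e, i)" "e \<in> edges J" "i < k e"
      using crosses_subdivide unfolding subdivide_simps by fastforce
    let ?v = "s e"
    have v: "?v \<in> verts J" "e \<in> out ?v" using st(2) e(2) unfolding out_def by auto
    have xe: "ends S x = pt e ` {i, Suc i}" unfolding e(1) subdivide_simps(3) by simp
    have px: "\<forall>z\<in>ends S x. proj z = ?v" unfolding xe using proj_pt(1)[of i e] proj_pt(1)[of "Suc i" e] e(3) by auto
    show "\<exists>f\<in>edges S. \<exists>y\<in>ends S f. crosses S proj f \<and> y \<notin> ends S x \<and>
      (\<forall>z\<in>ends S x. proj z = proj y) \<and> matchable_on (adj S) (bag S proj (proj y) - ends S x - {y})"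
    proof (cases "even i")
      case True
      \<comment> \<open>At an even position the port of \<open>e\<close> itself completes the
        matching: the points before \<open>i\<close>, those strictly between \<open>i + 1\<close>
        and \<open>k e\<close>, and all other legs come in even numbers.\<close>
      have ik: "Suc i < k e" using True even_k[OF e(2)] e(3) by (metis Suc_lessI even_Suc)
      have f: "(e, k e) \<in> edges S" "pt e (k e) \<in> ends S (e, k e)" "crosses S proj (e, k e)"
        using e(2) crosses_subdivide[OF e(2), of "k e"] unfolding subdivide_simps by auto
      have nx: "pt e (k e) \<notin> ends S x"
        unfolding xe using inj_onD[OF pt_inj[OF e(2)], of "k e" i] inj_onD[OF pt_inj[OF e(2)], of "k e" "Suc i"] ik by auto
      let ?R = "\<Union>d\<in>out ?v - {e}. leg d"
      have "matchable_on (adj S) (pt e ` {0..<i} \<union> pt e ` {Suc (Suc i)..<k e} \<union> ?R)"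
      proof (intro matchable_on_Un)
        show "matchable_on (adj S) (pt e ` {0..<i})" by (rule matchable_segment) (use e True in auto)
        show "matchable_on (adj S) (pt e ` {Suc (Suc i)..<k e})" by (rule matchable_segment) (use e True ik even_k in auto)
        show "matchable_on (adj S) ?R" by (rule matchable_legs) (auto simp: out_def)
        show "pt e ` {0..<i} \<inter> pt e ` {Suc (Suc i)..<k e} = {}"
          by (subst inj_on_image_Int[OF pt_inj[OF e(2)], symmetric]) (use ik in auto)
        show "(pt e ` {0..<i} \<union> pt e ` {Suc (Suc i)..<k e}) \<inter> ?R = {}"
          unfolding image_Un[symmetric] by (rule segment_rest) (use e(3) in auto)
      qed
      moreover have "bag S proj ?v - ends S x - {pt e (k e)} = pt e ` {0..<i} \<union> pt e ` {Suc (Suc i)..<k e} \<union> ?R"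
      proof -
        have nr: "pt e j \<notin> ?R" if "j \<le> k e" for j using pt_in_leg_other[OF that] by blast
        have "bag S proj ?v - ends S x - {pt e (k e)} = (pt e ` {0..<Suc (k e)} - pt e ` {i, Suc i, k e}) \<union> ?R"
          unfolding bag_arm[OF v] xe using nr[of i] nr[of "Suc i"] nr[of "k e"] ik by auto
        also have "pt e ` {0..<Suc (k e)} - pt e ` {i, Suc i, k e} = pt e ` ({0..<Suc (k e)} - {i, Suc i, k e})"
          by (rule pt_image_diff[OF e(2)]) (use ik in auto)
        also have "{0..<Suc (k e)} - {i, Suc i, k e} = {0..<i} \<union> {Suc (Suc i)..<k e}" using ik by auto
        finally show ?thesis by (simp add: image_Un)
      qed
      ultimately have "matchable_on (adj S) (bag S proj (proj (pt e (k e))) - ends S x - {pt e (k e)})"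
        using proj_pt(1)[of "k e" e] by simp
      then show ?thesis using f nx px proj_pt(1)[of "k e" e] by (intro bexI[OF _ f(1)] bexI[OF _ f(2)]) simp
    next
      case False
      have i0: "0 < i" using False by (cases i) auto
      have vE: "?v \<in> ends J e" using ends[OF e(2)] by simp
      \<comment> \<open>At an odd position the rest of the leg is matchable, and the centre has to
        be treated separately. Another edge \<open>d\<close> at this vertex helps: if
        \<open>d\<close> starts there, its arm without the port contains the centre; if it ends
        there, the centre is the port.\<close>
      obtain d where d: "d \<in> edges J" "d \<noteq> e" "?v \<in> ends J d" using deg[OF e(2) vE] by blast
      have cross: "(d, k d) \<in> edges S" "crosses S proj (d, k d)"
        using d(1) crosses_subdivide[OF d(1), of "k d"] unfolding subdivide_simps by auto
      have m1: "matchable_on (adj S) (pt e ` {1..<i})" by (rule matchable_segment) (use e False in auto)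
      have m2: "matchable_on (adj S) (pt e ` {Suc (Suc i)..<Suc (k e)})"
        by (rule matchable_segment) (use e(2,3) False even_k[OF e(2)] in auto)
      have d12: "pt e ` {1..<i} \<inter> pt e ` {Suc (Suc i)..<Suc (k e)} = {}"
        by (subst inj_on_image_Int[OF pt_inj[OF e(2)], symmetric]) (use e(3) in auto)
      have m12: "matchable_on (adj S) (leg e - ends S x)"
      proof -
        have "leg e - ends S x = pt e ` ({1..<Suc (k e)} - {i, Suc i})"
          unfolding leg_def xe by (rule pt_image_diff[OF e(2)]) (use e(3) in auto)
        also have "{1..<Suc (k e)} - {i, Suc i} = {1..<i} \<union> {Suc (Suc i)..<Suc (k e)}" using i0 e(3) by auto
        finally show ?thesis using matchable_on_Un[OF m1 m2 d12] by (simp add: image_Un)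
      qed
      have xleg: "ends S x \<subseteq> leg e" unfolding xe leg_def using i0 e(3) by auto
      have base: "bag S proj ?v - ends S x - {y} = (leg e - ends S x) \<union> (insert (Inl ?v) (\<Union>a\<in>out ?v - {e}. leg a) - {y})"
        if "y \<notin> leg e" for y
        unfolding bag_eq[OF v(1)] using xleg v(2) leg_disjoint that by auto
      show ?thesis
      proof (cases "s d = ?v")
        case sd: True
        let ?y = "pt d (k d)"
        have y: "?y \<in> ends S (d, k d)" "proj ?y = ?v" "?y \<notin> leg e"
          using proj_pt(1)[of "k d" d] sd pt_in_leg_other[of "k d" d e] d(2) unfolding subdivide_simps by auto
        have dout: "d \<in> out ?v - {e}" using d sd unfolding out_def by simp
        let ?R = "\<Union>a\<in>out ?v - {e} - {d}. leg a"
        have eq: "insert (Inl ?v) (\<Union>a\<in>out ?v - {e}. leg a) - {?y} = pt d ` {0..<k d} \<union> ?R"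
        proof -
          have "insert (Inl ?v) (\<Union>a\<in>out ?v - {e}. leg a) = pt d ` {0..<Suc (k d)} \<union> ?R"
            unfolding arm_eq sd using dout by auto
          moreover have "pt d ` {0..<Suc (k d)} - pt d ` {k d} = pt d ` {0..<k d}"
            by (subst pt_image_diff[OF d(1)]) (auto intro: arg_cong[where f = "image (pt d)"])
          moreover have "?y \<notin> ?R" using pt_in_leg_other[of "k d" d] by blast
          ultimately show ?thesis by auto
        qed
        have "matchable_on (adj S) ((leg e - ends S x) \<union> (pt d ` {0..<k d} \<union> ?R))"
        proof (intro matchable_on_Un m12)
          show "matchable_on (adj S) (pt d ` {0..<k d})" by (rule matchable_segment) (use d(1) even_k in auto)
          show "matchable_on (adj S) ?R" by (rule matchable_legs) (auto simp: out_def)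
          show "pt d ` {0..<k d} \<inter> ?R = {}" by (rule segment_rest) auto
          have "{0..<k d} \<subseteq> {..k d}" by auto
          then have "pt d ` {0..<k d} \<inter> (\<Union>a\<in>{e}. leg a) = {}" by (rule segment_rest) (use d(2) in simp)
          then have "pt d ` {0..<k d} \<inter> leg e = {}" by simp
          moreover have "leg e \<inter> leg a = {}" if "a \<in> out ?v - {e} - {d}" for a
            using leg_disjoint(1)[of e a] that by blast
          then have "leg e \<inter> ?R = {}" by blast
          ultimately show "(leg e - ends S x) \<inter> (pt d ` {0..<k d} \<union> ?R) = {}" by blast
        qed
        then have "matchable_on (adj S) (bag S proj (proj ?y) - ends S x - {?y})" using base[OF y(3)] eq y(2) by simp
        then show ?thesis using y px xleg by (intro bexI[OF _ cross(1)] bexI[OF _ y(1)]) (use cross(2) in auto)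
      next
        case sd: False
        then have td: "t d = ?v" using d(3) ends[OF d(1)] by auto
        let ?y = "Inl ?v :: 'v + 'e \<times> nat"
        have "pt d (Suc (k d)) = ?y" unfolding subdivision_point_def using td by simp
        then have y: "?y \<in> ends S (d, k d)" "proj ?y = ?v" "?y \<notin> leg e"
          using leg_disjoint(2) unfolding subdivide_simps proj_def by auto
        have "insert (Inl ?v) (\<Union>a\<in>out ?v - {e}. leg a) - {?y} = (\<Union>a\<in>out ?v - {e}. leg a)"
          using leg_disjoint(2) by auto
        moreover have "matchable_on (adj S) (\<Union>a\<in>out ?v - {e}. leg a)" by (rule matchable_legs) (auto simp: out_def)
        moreover have "leg e \<inter> leg a = {}" if "a \<in> out ?v - {e}" for a
          using leg_disjoint(1)[of e a] that by blast
        then have "(leg e - ends S x) \<inter> (\<Union>a\<in>out ?v - {e}. leg a) = {}" by blast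
        ultimately have "matchable_on (adj S) (bag S proj (proj ?y) - ends S x - {?y})"
          using base[OF y(3)] y(2) matchable_on_Un[OF m12] by simp
        then show ?thesis using y px xleg by (intro bexI[OF _ cross(1)] bexI[OF _ y(1)]) (use cross(2) in auto)
      qed
    qed
  qed
qed

end

section \<open>Decorations as quotient models\<close>

lemma K4_simps:
  "verts (K4_decoration J T) = {(v, None) | v. v \<in> verts J - T} \<union>
              {(v, Some e) | v e. v \<in> verts J \<inter> T \<and> e \<in> incident_edges J v}"
  "edges (K4_decoration J T) = Inl ` edges J \<union> Inr ` {(v, e). v \<in> verts J \<inter> T \<and> e \<in> incident_edges J v}"
  "ends (K4_decoration J T) (Inl e) = (\<lambda>v. (v, if v \<in> T then Some e else None)) ` ends J e"
  "ends (K4_decoration J T) (Inr (v, e)) = (\<lambda>e'. (v, Some e')) ` (incident_edges J v - {e})"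
  unfolding K4_decoration_def by simp_all

lemma incident_edgesD:
  assumes "multigraph J" "cubic J" "v \<in> verts J"
  shows "card (incident_edges J v) = 3" "finite (incident_edges J v)"
  using assms multigraphD(2)[of J] unfolding cubic_def degree_def incident_edges_def by auto

lemma multigraph_K4:
  assumes J: "multigraph J" and c: "cubic J"
  shows "multigraph (K4_decoration J T)"
  unfolding multigraph_def
proof (intro conjI ballI)
  note fin = multigraphD(1,2)[OF J]
  have inc: "incident_edges J v \<subseteq> edges J" for v unfolding incident_edges_def by auto
  have "verts (K4_decoration J T) \<subseteq> verts J \<times> insert None (Some ` edges J)"
    unfolding K4_simps using inc by auto
  then show "finite (verts (K4_decoration J T))" by (rule finite_subset) (use fin in auto)
  have "edges (K4_decoration J T) \<subseteq> Inl ` edges J \<union> Inr ` (verts J \<times> edges J)"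
    unfolding K4_simps using inc by auto
  then show "finite (edges (K4_decoration J T))" by (rule finite_subset) (use fin in auto)
  fix x assume "x \<in> edges (K4_decoration J T)"
  then consider (l) e where "x = Inl e" "e \<in> edges J" | (r) v e where "x = Inr (v, e)" "v \<in> verts J \<inter> T" "e \<in> incident_edges J v"
    unfolding K4_simps by auto
  then have "ends (K4_decoration J T) x \<subseteq> verts (K4_decoration J T) \<and> card (ends (K4_decoration J T) x) = 2"
  proof cases
    case l
    have sub: "ends J e \<subseteq> verts J" "card (ends J e) = 2" using multigraphD(3,4)[OF J l(2)] by auto
    have "card ((\<lambda>v. (v, if v \<in> T then Some e else None)) ` ends J e) = card (ends J e)"
      by (rule card_image) (auto simp: inj_on_def)
    moreover have "e \<in> incident_edges J v" if "v \<in> ends J e" for v using that l(2) unfolding incident_edges_def by simp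
    ultimately show ?thesis unfolding l(1) K4_simps using sub by auto
  next
    case r
    have "card ((\<lambda>e'. (v, Some e')) ` (incident_edges J v - {e})) = card (incident_edges J v - {e})"
      by (rule card_image) (auto simp: inj_on_def)
    also have "\<dots> = 2" using incident_edgesD[OF J c, of v] r by simp
    finally show ?thesis unfolding r(1) K4_simps using r(2,3) by auto
  qed
  then show "ends (K4_decoration J T) x \<subseteq> verts (K4_decoration J T)" "card (ends (K4_decoration J T) x) = 2" by auto
qed

text \<open>The fibres of \<open>fst\<close> are single vertices and triangles. A triangle edge
  misses exactly the corner that carries the edge of \<open>J\<close> with the same label, so that
  edge fulfils the last condition. The values \<open>h\<close> on triangle edges are arbitrary,
  since these never cross.\<close>

lemma quotient_K4:
  assumes J: "multigraph J" and c: "cubic J" and T: "T \<subseteq> verts J"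
  shows "quotient_model (K4_decoration J T) J fst (case_sum (\<lambda>e. e) h)"
proof -
  let ?K = "K4_decoration J T"
  have K: "multigraph ?K" by (rule multigraph_K4[OF J c])
  have crl: "crosses ?K fst (Inl e)" if e: "e \<in> edges J" for e
  proof -
    obtain u v where "ends J e = {u, v}" "u \<noteq> v" using multigraph_ends[OF J e] .
    then show ?thesis unfolding crosses_def K4_simps by auto
  qed
  have crr: "\<not> crosses ?K fst (Inr x)" for x
    unfolding crosses_def by (cases x) (auto simp: K4_simps)
  have edge: "\<exists>e. x = Inl e \<and> e \<in> edges J" if "x \<in> edges ?K" "crosses ?K fst x" for x
    using that crr unfolding K4_simps by auto
  have cs: "{x \<in> edges ?K. crosses ?K fst x} = Inl ` edges J" using crl crr unfolding K4_simps by auto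
  have bN: "bag ?K fst v = {(v, None)}" if "v \<in> verts J - T" for v using that unfolding bag_def K4_simps by auto
  have bT: "bag ?K fst v = (\<lambda>e. (v, Some e)) ` incident_edges J v" if "v \<in> T" for v
    using that T unfolding bag_def K4_simps by auto
  have tri: "adj ?K (v, Some a) (v, Some b)" if v: "v \<in> T" "a \<in> incident_edges J v" "b \<in> incident_edges J v" "a \<noteq> b" for v a b
  proof -
    have vJ: "v \<in> verts J" using T v by blast
    have "card (incident_edges J v - {a, b}) = 1"
      using incident_edgesD[OF J c vJ] v by (simp add: card_Diff_subset)
    then obtain d where "incident_edges J v - {a, b} = {d}" by (rule card_1_singletonE)
    then have d: "d \<in> incident_edges J v" "incident_edges J v - {d} = {a, b}" using v by auto
    have "Inr (v, d) \<in> edges ?K" unfolding K4_simps using d(1) vJ v(1) by auto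
    moreover have "ends ?K (Inr (v, d)) = {(v, Some a), (v, Some b)}" unfolding K4_simps d(2) by auto
    ultimately show ?thesis unfolding adj_def by blast
  qed
  have bminus: "matchable_on (adj ?K) (bag ?K fst v - {(v, Some e)})" if v: "v \<in> T" and e: "e \<in> incident_edges J v" for v e
  proof -
    have vJ: "v \<in> verts J" using T v by blast
    have "card (incident_edges J v - {e}) = 2" using incident_edgesD[OF J c vJ] e by simp
    then obtain a b where ab: "incident_edges J v - {e} = {a, b}" "a \<noteq> b" by (meson card_2_iff)
    then have "bag ?K fst v - {(v, Some e)} = {(v, Some a), (v, Some b)}" unfolding bT[OF v] by auto
    moreover have "a \<in> incident_edges J v" "b \<in> incident_edges J v" using ab(1) by auto
    ultimately show ?thesis using tri[OF v, of a b] tri[OF v, of b a] ab(2) matchable_on_pair[of "adj ?K" "(v, Some a)" "(v, Some b)"] by simp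
  qed
  show ?thesis
    unfolding quotient_model_def
  proof (intro conjI)
    show "multigraph ?K" by (rule K)
    show "fst ` verts ?K = verts J"
    proof (intro equalityI subsetI)
      fix v assume v: "v \<in> verts J"
      show "v \<in> fst ` verts ?K"
      proof (cases "v \<in> T")
        case True
        have "incident_edges J v \<noteq> {}" using incident_edgesD[OF J c v] by auto
        then show ?thesis using True v unfolding K4_simps by (force simp: image_def)
      next
        case False
        then show ?thesis using v unfolding K4_simps by (force simp: image_def)
      qed
    qed (auto simp: K4_simps)
    show "bij_betw (case_sum (\<lambda>e. e) h) {x \<in> edges ?K. crosses ?K fst x} (edges J)"
      unfolding cs bij_betw_def by (auto simp: inj_on_def image_image)
    show "\<forall>x\<in>edges ?K. crosses ?K fst x \<longrightarrow> ends J (case_sum (\<lambda>e. e) h x) = fst ` ends ?K x"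
      using edge by (fastforce simp: K4_simps image_image)
    show "\<forall>w\<in>verts J. \<forall>X. X \<noteq> {} \<longrightarrow> X \<subset> bag ?K fst w \<longrightarrow> (\<exists>x\<in>X. \<exists>y\<in>bag ?K fst w - X. adj ?K x y)"
    proof (intro ballI allI impI)
      fix v X assume v: "v \<in> verts J" and X: "X \<noteq> {}" "X \<subset> bag ?K fst v"
      have vT: "v \<in> T"
      proof (rule ccontr)
        assume "v \<notin> T"
        then have "X \<subset> {(v, None)}" using X(2) bN[of v] v by simp
        then show False using X(1) by blast
      qed
      obtain x y where xy: "x \<in> X" "x \<in> bag ?K fst v" "y \<in> bag ?K fst v" "y \<notin> X" using X by blast
      then obtain a b where "x = (v, Some a)" "y = (v, Some b)" "a \<in> incident_edges J v" "b \<in> incident_edges J v"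
        unfolding bT[OF vT] by blast
      moreover from this have "a \<noteq> b" using xy by auto
      ultimately show "\<exists>x\<in>X. \<exists>y\<in>bag ?K fst v - X. adj ?K x y" using tri[OF vT] xy by blast
    qed
    show "\<forall>x\<in>edges ?K. crosses ?K fst x \<longrightarrow> (\<forall>y\<in>ends ?K x. matchable_on (adj ?K) (bag ?K fst (fst y) - {y}))"
    proof (intro ballI impI)
      fix x y assume x: "x \<in> edges ?K" "crosses ?K fst x" and y: "y \<in> ends ?K x"
      obtain e where e: "x = Inl e" "e \<in> edges J" using edge[OF x] by blast
      then obtain v where v: "v \<in> ends J e" "y = (v, if v \<in> T then Some e else None)" using y unfolding e(1) K4_simps by blast
      have vJ: "v \<in> verts J" using v(1) multigraphD(3)[OF J e(2)] by blast
      show "matchable_on (adj ?K) (bag ?K fst (fst y) - {y})"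
      proof (cases "v \<in> T")
        case True
        then show ?thesis using bminus[OF True, of e] v e(2) unfolding incident_edges_def by simp
      next
        case False
        then show ?thesis using bN[of v] v(2) vJ by simp
      qed
    qed
    show "\<forall>x\<in>edges ?K. \<not> crosses ?K fst x \<longrightarrow> (\<exists>f\<in>edges ?K. \<exists>y\<in>ends ?K f. crosses ?K fst f \<and> y \<notin> ends ?K x \<and>
        (\<forall>z\<in>ends ?K x. fst z = fst y) \<and> matchable_on (adj ?K) (bag ?K fst (fst y) - ends ?K x - {y}))"
    proof (intro ballI impI)
      fix x assume x: "x \<in> edges ?K" "\<not> crosses ?K fst x"
      then obtain v e where ve: "x = Inr (v, e)" "v \<in> verts J" "v \<in> T" "e \<in> incident_edges J v"
        using crl unfolding K4_simps by auto
      have e: "e \<in> edges J" "v \<in> ends J e" using ve(4) unfolding incident_edges_def by auto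
      have f: "Inl e \<in> edges ?K" "(v, Some e) \<in> ends ?K (Inl e)" using e ve(3) unfolding K4_simps by auto
      have "bag ?K fst v - ends ?K x - {(v, Some e)} = {}" unfolding bT[OF ve(3)] ve(1) K4_simps by auto
      then have "matchable_on (adj ?K) (bag ?K fst (fst (v, Some e)) - ends ?K x - {(v, Some e)})" by (simp only: fst_conv matchable_on_empty)
      moreover have "(v, Some e) \<notin> ends ?K x" "\<forall>z\<in>ends ?K x. fst z = fst (v, Some e)" unfolding ve(1) K4_simps by auto
      ultimately show "\<exists>f\<in>edges ?K. \<exists>y\<in>ends ?K f. crosses ?K fst f \<and> y \<notin> ends ?K x \<and>
        (\<forall>z\<in>ends ?K x. fst z = fst y) \<and> matchable_on (adj ?K) (bag ?K fst (fst y) - ends ?K x - {y})"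
        using crl[OF e(1)] by (intro bexI[OF _ f(1)] bexI[OF _ f(2)]) simp
    qed
  qed
qed

text \<open>The degree condition under which \<open>quotient_subdivide\<close> applies to a
  decoration.\<close>

lemma K4_no_leaf:
  assumes J: "multigraph J" and c: "cubic J" and T: "T \<subseteq> verts J"
    and e: "e \<in> edges (K4_decoration J T)" "x \<in> ends (K4_decoration J T) e"
  shows "\<exists>e'\<in>edges (K4_decoration J T). e' \<noteq> e \<and> x \<in> ends (K4_decoration J T) e'"
proof -
  let ?K = "K4_decoration J T"
  have "x \<in> verts ?K" using multigraphD(3)[OF multigraph_K4[OF J c] e(1)] e(2) by blast
  then consider (n) v where "x = (v, None)" "v \<in> verts J" "v \<notin> T"
    | (s) v a where "x = (v, Some a)" "v \<in> verts J" "v \<in> T" "a \<in> incident_edges J v" unfolding K4_simps by blast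
  then show ?thesis
  proof cases
    case n
    then obtain d where d: "e = Inl d" using e unfolding K4_simps(2) by (auto simp: K4_simps(4))
    have "card (incident_edges J v - {d}) \<noteq> 0" using incident_edgesD[OF J c n(2)] by (simp add: card_Diff_singleton_if)
    then have "incident_edges J v - {d} \<noteq> {}" by force
    then obtain d' where d': "d' \<in> incident_edges J v" "d' \<noteq> d" by blast
    then have "Inl d' \<in> edges ?K" "x \<in> ends ?K (Inl d')" using n unfolding K4_simps incident_edges_def by auto
    then show ?thesis using d d'(2) by blast
  next
    case s
    have "card (incident_edges J v - {a}) = 2" using incident_edgesD[OF J c s(2)] s(4) by simp
    then obtain b d where bd: "incident_edges J v - {a} = {b, d}" "b \<noteq> d" by (meson card_2_iff)
    then have "b \<in> incident_edges J v" "d \<in> incident_edges J v" "b \<noteq> a" "d \<noteq> a" by auto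
    then have "Inr (v, b) \<in> edges ?K" "x \<in> ends ?K (Inr (v, b))" "Inr (v, d) \<in> edges ?K" "x \<in> ends ?K (Inr (v, d))"
      using s unfolding K4_simps by auto
    then show ?thesis using bd(2) by (metis Pair_inject sum.inject(2))
  qed
qed

lemma K4_matching_covered:
  assumes "matching_covered J" "cubic J" "T \<subseteq> verts J"
  shows "matching_covered (K4_decoration J T)"
proof -
  have "multigraph J" using assms(1) unfolding matching_covered_def by simp
  then show ?thesis using quotient_matching_covered[OF quotient_K4[of J T "\<lambda>_. undefined"]] assms by blast
qed

lemma S_step_matching_covered:
  assumes "S_step G G'"
  shows "matching_covered G \<and> matching_covered G'"
  using assms by cases (simp_all add: removable_single_ear_def removable_double_ear_def separating_def)

lemma S_steps_matching_covered: "S_step\<^sup>*\<^sup>* G G' \<Longrightarrow> matching_covered G \<Longrightarrow> matching_covered G'"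
  by (induction rule: rtranclp_induct) (auto dest: S_step_matching_covered)

theorem conformal_decoration_S_minor:
  fixes G :: "('v, 'e) mgraph" and J :: "('a, 'b) mgraph"
  assumes mcJ: "matching_covered J" and c: "cubic J" and T: "T \<subseteq> verts J"
    and cm: "conformal_minor (K4_decoration J T) G"
  shows "S_minor J G"
proof -
  let ?K = "K4_decoration J T"
  have J: "multigraph J" using mcJ unfolding matching_covered_def by simp
  have mcK: "matching_covered ?K" by (rule K4_matching_covered[OF mcJ c T])
  have mcG: "matching_covered G" using cm unfolding conformal_minor_def by simp
  then have G: "multigraph G" unfolding matching_covered_def by simp
  obtain L0 where L0: "conformal_subgraph L0 G" "bisubdivision L0 ?K" using cm unfolding conformal_minor_def by blast
  then obtain s t k where k: "\<forall>e\<in>edges ?K. ends ?K e = {s e, t e} \<and> even (k e)" and iso: "graph_iso L0 (subdivide ?K s t k)"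
    unfolding bisubdivision_def by blast
  have sg: "multigraph L0" "verts L0 \<subseteq> verts G" "edges L0 \<subseteq> edges G" "\<And>e. e \<in> edges L0 \<Longrightarrow> ends L0 e = ends G e"
    and mt: "matchable (delete_verts G (verts L0))"
    using L0(1) unfolding conformal_subgraph_def subgraph_def by auto
  define L where "L = L0\<lparr>ends := ends G\<rparr>"
  have Ls: "verts L = verts L0" "edges L = edges L0" "ends L = ends G" unfolding L_def by simp_all
  have L: "multigraph L" using sg(1,4) unfolding multigraph_def Ls by auto
  interpret sub: subdivision ?K s t k
    by unfold_locales (use multigraph_K4[OF J c] k in auto)
  obtain f h where f: "bij_betw f (verts L0) (verts sub.S)" and h: "bij_betw h (edges L0) (edges sub.S)"
    and fh: "\<forall>e\<in>edges L0. ends sub.S (h e) = f ` ends L0 e" using iso unfolding graph_iso_def by blast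
  have "quotient_model sub.S ?K sub.proj fst"
    by (rule sub.quotient_subdivide) (rule K4_no_leaf[OF J c T])
  then have qL: "quotient_model L ?K (sub.proj \<circ> f) (fst \<circ> h)"
    by (rule quotient_model_iso[OF _ L]) (use f h fh sg(4) Ls in auto)
  have mcL: "matching_covered L" by (rule quotient_matching_covered[OF qL mcK])
  have st1: "S_step\<^sup>*\<^sup>* G L"
    by (rule conformal_subgraph_S_steps[OF mcG mcL]) (use sg Ls mt matchable_delete_verts_iff[OF G] in auto)
  obtain L1 where L1: "S_step\<^sup>*\<^sup>* L L1" "graph_iso L1 ?K" using quotient_S_steps[OF mcK qL] by blast
  have mL1: "multigraph L1" using S_steps_matching_covered[OF L1(1) mcL] unfolding matching_covered_def by simp
  obtain f' h' where f': "bij_betw f' (verts L1) (verts ?K)" and h': "bij_betw h' (edges L1) (edges ?K)"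
    and fh': "\<forall>e\<in>edges L1. ends ?K (h' e) = f' ` ends L1 e" using L1(2) unfolding graph_iso_def by blast
  have "quotient_model L1 J (fst \<circ> f') (case_sum (\<lambda>e. e) (\<lambda>_. undefined) \<circ> h')"
    by (rule quotient_model_iso[OF quotient_K4[OF J c T] mL1 f' h']) (use fh' in auto)
  then obtain L2 where L2: "S_step\<^sup>*\<^sup>* L1 L2" "graph_iso L2 J" using quotient_S_steps[OF mcJ] by blast
  have "S_step\<^sup>*\<^sup>* G L2" using st1 L1(1) L2(1) by simp
  then show ?thesis unfolding S_minor_def using mcJ mcG L2(2) by blast
qed

section \<open>Petersen's theorem\<close>

definition edge_cut :: "('v, 'e) mgraph \<Rightarrow> 'v set \<Rightarrow> 'e set" where
  "edge_cut G X = {e \<in> edges G. card (ends G e \<inter> X) = 1}"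

lemma degree_sum:
  assumes G: "multigraph G" and X: "X \<subseteq> verts G"
  shows "(\<Sum>v\<in>X. degree G v) = card (edge_cut G X) + 2 * card {e \<in> edges G. ends G e \<subseteq> X}"
proof -
  have fX: "finite X" and fE: "finite (edges G)" using X multigraphD(1,2)[OF G] finite_subset by auto
  have "(\<Sum>v\<in>X. degree G v) = (\<Sum>v\<in>X. \<Sum>e\<in>edges G. if v \<in> ends G e then 1 else 0)"
    unfolding degree_def incident_edges_def using fE by (simp add: sum.If_cases Int_def)
  also have "\<dots> = (\<Sum>e\<in>edges G. \<Sum>v\<in>X. if v \<in> ends G e then 1 else 0)" by (rule sum.swap)
  also have "\<dots> = (\<Sum>e\<in>edges G. card (ends G e \<inter> X))"
    using fX by (simp add: sum.If_cases Int_def conj_commute)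
  also have "\<dots> = (\<Sum>e\<in>edges G. (if card (ends G e \<inter> X) = 1 then 1 else 0) + (if ends G e \<subseteq> X then 2 else 0))"
  proof (rule sum.cong)
    fix e assume "e \<in> edges G"
    then obtain u v where uv: "ends G e = {u, v}" "u \<noteq> v" using multigraph_ends[OF G] by metis
    show "card (ends G e \<inter> X) = (if card (ends G e \<inter> X) = 1 then 1 else 0) + (if ends G e \<subseteq> X then 2 else 0)"
      unfolding uv(1) using uv(2) by (cases "u \<in> X"; cases "v \<in> X") simp_all
  qed simp
  also have "\<dots> = card (edge_cut G X) + 2 * card {e \<in> edges G. ends G e \<subseteq> X}"
    unfolding edge_cut_def using fE by (simp add: sum.distrib sum.If_cases Int_def)
  finally show ?thesis .
qed

text \<open>Consequently a vertex set of odd order has an odd cut.\<close>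

lemma cubic_cut_parity:
  assumes "multigraph G" "cubic G" "X \<subseteq> verts G"
  shows "3 * card X = card (edge_cut G X) + 2 * card {e \<in> edges G. ends G e \<subseteq> X}"
proof -
  have "(\<Sum>v\<in>X. degree G v) = (\<Sum>v\<in>X. 3)" by (rule sum.cong) (use assms in \<open>auto simp: cubic_def\<close>)
  then show ?thesis using degree_sum[OF assms(1,3)] by simp
qed

lemma edge_cutE:
  assumes "multigraph G" "e \<in> edge_cut G X"
  obtains u w where "ends G e = {u, w}" "u \<in> X" "w \<notin> X" "w \<in> verts G" "e \<in> edges G"
proof -
  have e: "e \<in> edges G" "card (ends G e \<inter> X) = 1" using assms(2) unfolding edge_cut_def by auto
  obtain u v where uv: "ends G e = {u, v}" "u \<noteq> v" "u \<in> verts G" "v \<in> verts G" using multigraph_ends[OF assms(1) e(1)] .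
  show thesis
  proof (cases "u \<in> X")
    case True
    then have "v \<notin> X" using e(2) uv by (auto simp: Int_absorb2)
    then show ?thesis using that[of u v] uv True e(1) by blast
  next
    case False
    then have "v \<in> X" using e(2) uv by (cases "v \<in> X") auto
    then show ?thesis using that[of v u] uv False e(1) by blast
  qed
qed

text \<open>The end \<open>u\<close> in \<open>C\<close> of a single cut edge would separate
  \<open>C - {u}\<close> from the rest. If \<open>C\<close> consists of \<open>u\<close> alone, its
  cut has three edges.\<close>

lemma cubic_no_bridge:
  assumes G: "multigraph G" and c: "cubic G" and tc: "two_connected G" and C: "C \<subset> verts G"
  shows "card (edge_cut G C) \<noteq> 1"
proof
  assume "card (edge_cut G C) = 1"
  then obtain f where f: "edge_cut G C = {f}" by (rule card_1_singletonE)
  then obtain u w where uw: "ends G f = {u, w}" "u \<in> C" "w \<notin> C" "w \<in> verts G" using edge_cutE[OF G, of f C] by blast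
  have uG: "u \<in> verts G" using C uw(2) by blast
  show False
  proof (cases "C = {u}")
    case True
    have "{e \<in> edges G. ends G e \<subseteq> {u}} = {}"
    proof (rule ccontr)
      assume "\<not> ?thesis"
      then obtain e where e: "e \<in> edges G" "ends G e \<subseteq> {u}" by blast
      then show False using card_mono[of "{u}" "ends G e"] multigraphD(4)[OF G e(1)] by simp
    qed
    then have "card {e \<in> edges G. ends G e \<subseteq> {u}} = 0" by (simp only: card.empty)
    moreover have "3 * card C = card (edge_cut G C) + 2 * card {e \<in> edges G. ends G e \<subseteq> C}"
      by (rule cubic_cut_parity[OF G c]) (use C in blast)
    moreover have "card C = 1" using True by simp
    ultimately have "card (edge_cut G C) = 3" unfolding True by linarith
    then show False using f by simp
  next
    case False
    let ?D = "delete_verts G {u}"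
    have "graph_connected ?D" using tc uG unfolding two_connected_def by blast
    then have conn: "X \<noteq> {} \<Longrightarrow> X \<subset> verts ?D \<Longrightarrow> \<exists>x\<in>X. \<exists>y\<in>verts ?D - X. adj ?D x y" for X
      using graph_connected_iff[OF multigraph_delete_verts[OF G]] by blast
    have vD: "verts ?D = verts G - {u}" unfolding delete_verts_def by simp
    have "C - {u} \<noteq> {}" using False uw(2) by blast
    moreover have "w \<in> verts ?D - (C - {u})" using uw vD by blast
    then have "C - {u} \<subset> verts ?D" using vD C by blast
    ultimately obtain a b where ab: "a \<in> C - {u}" "b \<in> verts ?D - (C - {u})" "adj ?D a b" using conn by meson
    then have "adj G a b" "b \<noteq> u" using vD unfolding adj_delete_verts by auto
    then obtain d where d: "d \<in> edges G" "ends G d = {a, b}" unfolding adj_def by blast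
    have "ends G d \<inter> C = {a}" using d(2) ab \<open>b \<noteq> u\<close> by auto
    then have "d \<in> edge_cut G C" using d(1) unfolding edge_cut_def by simp
    then have "ends G f = {a, b}" using f d(2) by simp
    then have "u = a \<or> u = b" using uw(1) by auto
    then show False using ab(1) \<open>b \<noteq> u\<close> by blast
  qed
qed

text \<open>Suppose the ends of an edge \<open>e\<close> cannot be removed. Tutte's set together
  with these ends has at most as many vertices as there are odd parts, and every odd part sends at
  least three edges to it. This would use all edge ends available there, yet \<open>e\<close> lies
  inside the set and takes two of them.\<close>

theorem cubic_two_connected_matching_covered:
  assumes G: "multigraph G" and c: "cubic G" and tc: "two_connected G"
  shows "matching_covered G"
proof -
  interpret sym_rel "adj G" by (rule sym_rel_adj[OF G])
  have fV: "finite (verts G)" by (rule multigraphD(1)[OF G])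
  have gc: "graph_connected G" and c2: "2 \<le> card (verts G)" using tc unfolding two_connected_def by auto
  have evV: "even (card (verts G))"
  proof -
    have "edge_cut G (verts G) = {}"
    proof (rule ccontr)
      assume "edge_cut G (verts G) \<noteq> {}"
      then show False using edge_cutE[OF G, of _ "verts G"] by blast
    qed
    then have "3 * card (verts G) = 2 * card {e \<in> edges G. ends G e \<subseteq> verts G}" using cubic_cut_parity[OF G c, of "verts G"] by simp
    then show ?thesis by presburger
  qed
  have "matchable_on (adj G) (verts G - {x, y})" if xy: "x \<in> verts G" "y \<in> verts G" "adj G x y" for x y
  proof (rule ccontr)
    assume nm: "\<not> ?thesis"
    have ne: "x \<noteq> y" using xy(3) irrefl by blast
    obtain e where e: "e \<in> edges G" "ends G e = {x, y}" using xy(3) unfolding adj_def by blast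
    let ?W = "verts G - {x, y}"
    have fW: "finite ?W" using fV by simp
    obtain A \<C> where A: "parts ?W A \<C>" "card A < card (odds \<C>)" using tutte[OF fW nm] by blast
    note P = partsD[OF A(1)] and fin = parts_finite[OF fW A(1)]
    have "card ?W = card (verts G) - 2" using xy ne fV by simp
    then have "even (card ?W)" using evV by simp
    then have "even (card A + card (odds \<C>))" using card_parts_parity[OF fW A(1)] by simp
    then have ge: "card A + 2 \<le> card (odds \<C>)" using A(2) by presburger
    let ?S = "insert x (insert y A)"
    have S: "?S \<subseteq> verts G" using P(1) xy by blast
    have cS: "card ?S = card A + 2" using P(1) ne fin(1) by (auto simp: card_insert_if)
    have fE: "finite (edges G)" by (rule multigraphD(2)[OF G])
    have CS: "C \<inter> ?S = {}" "C \<subset> verts G" if "C \<in> \<C>" for C using P(1,2) that xy by blast+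
    have cut3: "3 \<le> card (edge_cut G C)" if C: "C \<in> odds \<C>" for C
    proof -
      have C': "C \<in> \<C>" "odd (card C)" using C unfolding odds_def by auto
      have "3 * card C = card (edge_cut G C) + 2 * card {e \<in> edges G. ends G e \<subseteq> C}"
        using cubic_cut_parity[OF G c] CS(2)[OF C'(1)] by blast
      moreover have "odd (3 * card C)" using C'(2) by simp
      ultimately have "odd (card (edge_cut G C))" by simp
      moreover have "card (edge_cut G C) \<noteq> 1" by (rule cubic_no_bridge[OF G c tc CS(2)[OF C'(1)]])
      ultimately show ?thesis by presburger
    qed
    have toS: "\<exists>u w. ends G d = {u, w} \<and> u \<in> C \<and> w \<in> ?S" if C: "C \<in> \<C>" and d: "d \<in> edge_cut G C" for C d
    proof -
      obtain u w where uw: "ends G d = {u, w}" "u \<in> C" "w \<notin> C" "w \<in> verts G" "d \<in> edges G" using edge_cutE[OF G d] .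
      then have "adj G u w" unfolding adj_def by blast
      then have "w \<notin> D" if "D \<in> \<C>" for D using P(5)[OF C that] uw(2,3) that by blast
      then have "w \<in> ?S" using uw(4) P(2) by blast
      then show ?thesis using uw by blast
    qed
    have "3 * card (odds \<C>) \<le> (\<Sum>C\<in>odds \<C>. card (edge_cut G C))"
      using sum_mono[of "odds \<C>" "\<lambda>_. 3" "\<lambda>C. card (edge_cut G C)"] cut3 by (simp add: mult.commute)
    also have "\<dots> = card (\<Union>C\<in>odds \<C>. edge_cut G C)"
    proof (rule card_UN_disjoint[symmetric])
      show "finite (odds \<C>)" using fin(2) unfolding odds_def by simp
      show "\<forall>C\<in>odds \<C>. finite (edge_cut G C)" using fE unfolding edge_cut_def by simp
      show "\<forall>C\<in>odds \<C>. \<forall>D\<in>odds \<C>. C \<noteq> D \<longrightarrow> edge_cut G C \<inter> edge_cut G D = {}"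
      proof (intro ballI impI)
        fix C D assume CD: "C \<in> odds \<C>" "D \<in> odds \<C>" "C \<noteq> D"
        then have CD': "C \<in> \<C>" "D \<in> \<C>" unfolding odds_def by auto
        show "edge_cut G C \<inter> edge_cut G D = {}"
        proof (rule ccontr)
          assume "edge_cut G C \<inter> edge_cut G D \<noteq> {}"
          then obtain d where d: "d \<in> edge_cut G C" "d \<in> edge_cut G D" by blast
          obtain u w u' w' where "ends G d = {u, w}" "u \<in> C" "w \<in> ?S" "ends G d = {u', w'}" "u' \<in> D" "w' \<in> ?S"
            using toS[OF CD'(1) d(1)] toS[OF CD'(2) d(2)] by blast
          moreover have "u \<noteq> u'" using P(4)[OF CD' CD(3)] calculation by blast
          ultimately have "u = w'" by (auto simp: doubleton_eq_iff)
          then show False using CS(1)[OF CD'(1)] \<open>u \<in> C\<close> \<open>w' \<in> ?S\<close> by blast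
        qed
      qed
    qed
    also have "\<dots> \<le> card (edge_cut G ?S)"
    proof (rule card_mono)
      show "finite (edge_cut G ?S)" using fE unfolding edge_cut_def by simp
      show "(\<Union>C\<in>odds \<C>. edge_cut G C) \<subseteq> edge_cut G ?S"
      proof
        fix d assume "d \<in> (\<Union>C\<in>odds \<C>. edge_cut G C)"
        then obtain C where C: "C \<in> \<C>" "d \<in> edge_cut G C" unfolding odds_def by blast
        then obtain u w where uw: "ends G d = {u, w}" "u \<in> C" "w \<in> ?S" using toS by blast
        have "u \<notin> ?S" using CS(1)[OF C(1)] uw(2) by blast
        then have "ends G d \<inter> ?S = {w}" using uw by auto
        then show "d \<in> edge_cut G ?S" using C(2) unfolding edge_cut_def by simp
      qed
    qed
    finally have "3 * card (odds \<C>) \<le> card (edge_cut G ?S)" .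
    moreover have "e \<in> {e \<in> edges G. ends G e \<subseteq> ?S}" using e by simp
    then have "0 < card {e \<in> edges G. ends G e \<subseteq> ?S}" using fE by (metis (no_types, lifting) card_gt_0_iff empty_iff finite_subset mem_Collect_eq subsetI)
    ultimately show False using cubic_cut_parity[OF G c S] cS ge by linarith
  qed
  moreover have "verts G \<noteq> {}" "\<And>X. X \<noteq> {} \<Longrightarrow> X \<subset> verts G \<Longrightarrow> \<exists>x\<in>X. \<exists>y\<in>verts G - X. adj G x y"
    using gc unfolding graph_connected_iff[OF G] by blast+
  ultimately have "mcov (verts G)" unfolding mcov_def using fV c2 by blast
  then show ?thesis using G matching_covered_iff by blast
qed

section \<open>Three terminals\<close>

definition legset :: "('v \<Rightarrow> 'v \<Rightarrow> bool) \<Rightarrow> 'v \<Rightarrow> 'v set \<Rightarrow> 'v \<Rightarrow> bool" where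
  "legset R y L p \<longleftrightarrow> y \<notin> L \<and> p \<in> insert y L \<and> matchable_on R L \<and> matchable_on R (insert y L - {p})"

text \<open>A \<open>tripod\<close> stands for three even paths that join a centre to the terminals \<open>a i\<close>, and a \<open>triad\<close>
  for the analogous structure with a triangle in place of the centre; the vertices that are not used are
  matched among themselves. A \<open>legset\<close> is a set that contains such a path.\<close>

definition tripod :: "('v \<Rightarrow> 'v \<Rightarrow> bool) \<Rightarrow> 'v set \<Rightarrow> 'i set \<Rightarrow> ('i \<Rightarrow> 'v) \<Rightarrow> bool" where
  "tripod R B I a \<longleftrightarrow> (\<exists>y L. y \<in> B \<and> (\<forall>i\<in>I. L i \<subseteq> B - {y} \<and> legset R y (L i) (a i)) \<and>
     (\<forall>i\<in>I. \<forall>j\<in>I. i \<noteq> j \<longrightarrow> L i \<inter> L j = {}) \<and> matchable_on R (B - {y} - (\<Union>i\<in>I. L i)))"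

text \<open>Each corner of a triad is again a tripod over the same index set. At corner
  \<open>i\<close> the index \<open>i\<close> stands for the outer terminal, and \<open>j\<close>
  for the end of the triangle edge that leads to corner \<open>j\<close>.\<close>

definition port :: "('i \<Rightarrow> 'v) \<Rightarrow> ('i \<Rightarrow> 'i \<Rightarrow> 'v) \<Rightarrow> 'i \<Rightarrow> 'i \<Rightarrow> 'v" where
  "port a q i j = (if j = i then a i else q i j)"

definition triad :: "('v \<Rightarrow> 'v \<Rightarrow> bool) \<Rightarrow> 'v set \<Rightarrow> 'i set \<Rightarrow> ('i \<Rightarrow> 'v) \<Rightarrow> bool" where
  "triad R B I a \<longleftrightarrow> (\<exists>D q. (\<forall>i\<in>I. D i \<subseteq> B \<and> tripod R (D i) I (port a q i)) \<and>
     (\<forall>i\<in>I. \<forall>j\<in>I. i \<noteq> j \<longrightarrow> D i \<inter> D j = {} \<and> R (q i j) (q j i)) \<and> matchable_on R (B - (\<Union>i\<in>I. D i)))"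

lemma tripodE:
  assumes "tripod R B I a"
  obtains y L where "y \<in> B" "\<And>i. i \<in> I \<Longrightarrow> L i \<subseteq> B - {y}" "\<And>i. i \<in> I \<Longrightarrow> legset R y (L i) (a i)"
    "\<And>i j. i \<in> I \<Longrightarrow> j \<in> I \<Longrightarrow> i \<noteq> j \<Longrightarrow> L i \<inter> L j = {}" "matchable_on R (B - {y} - (\<Union>i\<in>I. L i))"
  using assms unfolding tripod_def by (elim exE conjE, intro that) simp_all

lemma triadE:
  assumes "triad R B I a"
  obtains D q where "\<And>i. i \<in> I \<Longrightarrow> D i \<subseteq> B" "\<And>i. i \<in> I \<Longrightarrow> tripod R (D i) I (port a q i)"
    "\<And>i j. i \<in> I \<Longrightarrow> j \<in> I \<Longrightarrow> i \<noteq> j \<Longrightarrow> D i \<inter> D j = {}" "\<And>i j. i \<in> I \<Longrightarrow> j \<in> I \<Longrightarrow> i \<noteq> j \<Longrightarrow> R (q i j) (q j i)"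
    "matchable_on R (B - (\<Union>i\<in>I. D i))"
proof -
  obtain D where "\<exists>q. (\<forall>i\<in>I. D i \<subseteq> B \<and> tripod R (D i) I (port a q i)) \<and>
     (\<forall>i\<in>I. \<forall>j\<in>I. i \<noteq> j \<longrightarrow> D i \<inter> D j = {} \<and> R (q i j) (q j i)) \<and> matchable_on R (B - (\<Union>i\<in>I. D i))"
    using assms unfolding triad_def ..
  then obtain q where h: "(\<forall>i\<in>I. D i \<subseteq> B \<and> tripod R (D i) I (port a q i)) \<and>
     (\<forall>i\<in>I. \<forall>j\<in>I. i \<noteq> j \<longrightarrow> D i \<inter> D j = {} \<and> R (q i j) (q j i)) \<and> matchable_on R (B - (\<Union>i\<in>I. D i))" ..
  show thesis by (rule that[of D q]) (use h in auto)
qed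

text \<open>Leg \<open>i\<close> is switched to its other matching, which covers the centre and
  leaves out the terminal.\<close>

lemma tripod_terminal:
  assumes "tripod R B I a" "i \<in> I"
  shows "a i \<in> B" "matchable_on R (B - {a i})"
proof -
  obtain y L where y: "y \<in> B" "\<And>i. i \<in> I \<Longrightarrow> L i \<subseteq> B - {y}" "\<And>i. i \<in> I \<Longrightarrow> legset R y (L i) (a i)"
    "\<And>i j. i \<in> I \<Longrightarrow> j \<in> I \<Longrightarrow> i \<noteq> j \<Longrightarrow> L i \<inter> L j = {}" "matchable_on R (B - {y} - (\<Union>i\<in>I. L i))"
    using tripodE[OF assms(1)] by blast
  have l: "y \<notin> L i" "a i \<in> insert y (L i)" "matchable_on R (insert y (L i) - {a i})" using y(3)[OF assms(2)] unfolding legset_def by auto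
  show aB: "a i \<in> B" using l(2) y(1) y(2)[OF assms(2)] by blast
  have m: "matchable_on R (\<Union>j\<in>I - {i}. L j)"
    by (rule matchable_on_UN) (use y(3,4) in \<open>auto simp: legset_def\<close>)
  have "L i \<inter> L j = {}" if "j \<in> I - {i}" for j using y(4)[OF assms(2), of j] that by blast
  then have d: "insert y (L i) \<inter> (\<Union>j\<in>I - {i}. L j) = {}" using y(2) by blast
  have sub: "(\<Union>j\<in>I - {i}. L j) \<subseteq> B" "(\<Union>j\<in>I. L j) = L i \<union> (\<Union>j\<in>I - {i}. L j)" using y(2) assms(2) by blast+
  have "matchable_on R ((insert y (L i) - {a i}) \<union> (\<Union>j\<in>I - {i}. L j) \<union> (B - {y} - (\<Union>i\<in>I. L i)))"
  proof (intro matchable_on_Un l(3) m y(5))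
    show "(insert y (L i) - {a i}) \<inter> (\<Union>j\<in>I - {i}. L j) = {}" using d by blast
    show "((insert y (L i) - {a i}) \<union> (\<Union>j\<in>I - {i}. L j)) \<inter> (B - {y} - (\<Union>i\<in>I. L i)) = {}" unfolding sub(2) by blast
  qed
  moreover have "(insert y (L i) - {a i}) \<union> (\<Union>j\<in>I - {i}. L j) \<union> (B - {y} - (\<Union>i\<in>I. L i)) = B - {a i}"
    unfolding sub(2) using sub(1) d l(2) y(1) y(2)[OF assms(2)] by blast
  ultimately show "matchable_on R (B - {a i})" by simp
qed

lemma tripod_add:
  assumes "tripod R B I a" "matchable_on R C" "B \<inter> C = {}"
  shows "tripod R (B \<union> C) I a"
proof -
  obtain y L where y: "y \<in> B" "\<And>i. i \<in> I \<Longrightarrow> L i \<subseteq> B - {y}" "\<And>i. i \<in> I \<Longrightarrow> legset R y (L i) (a i)"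
    "\<And>i j. i \<in> I \<Longrightarrow> j \<in> I \<Longrightarrow> i \<noteq> j \<Longrightarrow> L i \<inter> L j = {}" "matchable_on R (B - {y} - (\<Union>i\<in>I. L i))"
    using tripodE[OF assms(1)] by blast
  have "matchable_on R ((B - {y} - (\<Union>i\<in>I. L i)) \<union> C)"
    by (rule matchable_on_Un[OF y(5) assms(2)]) (use assms(3) in blast)
  moreover have "(\<Union>i\<in>I. L i) \<subseteq> B" using y(2) by blast
  then have "(B - {y} - (\<Union>i\<in>I. L i)) \<union> C = B \<union> C - {y} - (\<Union>i\<in>I. L i)" using y(1) assms(3) by blast
  ultimately have m: "matchable_on R (B \<union> C - {y} - (\<Union>i\<in>I. L i))" by simp
  have "\<forall>i\<in>I. L i \<subseteq> B \<union> C - {y}" using y(2) by blast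
  then show ?thesis unfolding tripod_def using y(1,3,4) m by (intro exI[of _ y] exI[of _ L]) simp
qed

lemma triad_add:
  assumes "triad R B I a" "matchable_on R C" "B \<inter> C = {}"
  shows "triad R (B \<union> C) I a"
proof -
  obtain D q where D: "\<And>i. i \<in> I \<Longrightarrow> D i \<subseteq> B" "\<And>i. i \<in> I \<Longrightarrow> tripod R (D i) I (port a q i)"
    "\<And>i j. i \<in> I \<Longrightarrow> j \<in> I \<Longrightarrow> i \<noteq> j \<Longrightarrow> D i \<inter> D j = {}" "\<And>i j. i \<in> I \<Longrightarrow> j \<in> I \<Longrightarrow> i \<noteq> j \<Longrightarrow> R (q i j) (q j i)"
    "matchable_on R (B - (\<Union>i\<in>I. D i))" using triadE[OF assms(1)] by blast
  have "matchable_on R ((B - (\<Union>i\<in>I. D i)) \<union> C)"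
    by (rule matchable_on_Un[OF D(5) assms(2)]) (use assms(3) in blast)
  moreover have "(\<Union>i\<in>I. D i) \<subseteq> B" using D(1) by blast
  then have "(B - (\<Union>i\<in>I. D i)) \<union> C = B \<union> C - (\<Union>i\<in>I. D i)" using assms(3) by blast
  ultimately have m: "matchable_on R (B \<union> C - (\<Union>i\<in>I. D i))" by simp
  have "\<forall>i\<in>I. D i \<subseteq> B \<union> C" using D(1) by blast
  then show ?thesis unfolding triad_def using D(2,3,4) m by (intro exI[of _ D] exI[of _ q]) simp
qed

lemma legset_trans:
  assumes "legset R y L p" "legset R p K r" "K \<inter> insert y L = {}"
  shows "legset R y (L \<union> K) r"
proof -
  have l: "y \<notin> L" "p \<in> insert y L" "matchable_on R L" "matchable_on R (insert y L - {p})" using assms(1) unfolding legset_def by auto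
  have k: "p \<notin> K" "r \<in> insert p K" "matchable_on R K" "matchable_on R (insert p K - {r})" using assms(2) unfolding legset_def by auto
  have "matchable_on R (L \<union> K)" by (rule matchable_on_Un[OF l(3) k(3)]) (use assms(3) in blast)
  moreover have "matchable_on R ((insert y L - {p}) \<union> (insert p K - {r}))" by (rule matchable_on_Un[OF l(4) k(4)]) (use assms(3) in blast)
  moreover have "(insert y L - {p}) \<union> (insert p K - {r}) = insert y (L \<union> K) - {r}" using l(1,2) k(1,2) assms(3) by blast
  ultimately show ?thesis unfolding legset_def using l(1,2) k(2) assms(3) by auto
qed

lemma legset_refl: "legset R y {} y"
  unfolding legset_def by simp

lemma tripod_extend:
  assumes t: "tripod R B I a" and K: "\<And>i. i \<in> I \<Longrightarrow> legset R (a i) (K i) (b i)" "\<And>i. i \<in> I \<Longrightarrow> K i \<inter> B = {}"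
    and disj: "\<And>i j. i \<in> I \<Longrightarrow> j \<in> I \<Longrightarrow> i \<noteq> j \<Longrightarrow> K i \<inter> K j = {}"
  shows "tripod R (B \<union> (\<Union>i\<in>I. K i)) I b"
proof -
  obtain y L where y: "y \<in> B" "\<And>i. i \<in> I \<Longrightarrow> L i \<subseteq> B - {y}" "\<And>i. i \<in> I \<Longrightarrow> legset R y (L i) (a i)"
    "\<And>i j. i \<in> I \<Longrightarrow> j \<in> I \<Longrightarrow> i \<noteq> j \<Longrightarrow> L i \<inter> L j = {}" "matchable_on R (B - {y} - (\<Union>i\<in>I. L i))"
    using tripodE[OF t] by blast
  have a: "L i \<union> K i \<subseteq> B \<union> (\<Union>i\<in>I. K i) - {y}" if i: "i \<in> I" for i using y(1) y(2)[OF i] K(2)[OF i] i by blast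
  have b: "legset R y (L i \<union> K i) (b i)" if i: "i \<in> I" for i
    by (rule legset_trans[OF y(3)[OF i] K(1)[OF i]]) (use y(1) y(2)[OF i] K(2)[OF i] in blast)
  have c: "(L i \<union> K i) \<inter> (L j \<union> K j) = {}" if ij: "i \<in> I" "j \<in> I" "i \<noteq> j" for i j
    using y(4)[OF ij] disj[OF ij] y(2)[OF ij(1)] y(2)[OF ij(2)] K(2)[OF ij(1)] K(2)[OF ij(2)] by blast
  have "(\<Union>i\<in>I. K i) \<inter> B = {}" using K(2) by blast
  then have "B \<union> (\<Union>i\<in>I. K i) - {y} - (\<Union>i\<in>I. L i \<union> K i) = B - {y} - (\<Union>i\<in>I. L i)" using y(1) by blast
  then have d: "matchable_on R (B \<union> (\<Union>i\<in>I. K i) - {y} - (\<Union>i\<in>I. L i \<union> K i))" using y(5) by simp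
  show ?thesis unfolding tripod_def
    by (rule exI[of _ y], rule exI[of _ "\<lambda>i. L i \<union> K i"]) (use a b c d y(1) in auto)
qed

lemma triad_extend:
  assumes t: "triad R B I a" and K: "\<And>i. i \<in> I \<Longrightarrow> legset R (a i) (K i) (b i)" "\<And>i. i \<in> I \<Longrightarrow> K i \<inter> B = {}"
    and disj: "\<And>i j. i \<in> I \<Longrightarrow> j \<in> I \<Longrightarrow> i \<noteq> j \<Longrightarrow> K i \<inter> K j = {}"
  shows "triad R (B \<union> (\<Union>i\<in>I. K i)) I b"
proof -
  obtain D q where D: "\<And>i. i \<in> I \<Longrightarrow> D i \<subseteq> B" "\<And>i. i \<in> I \<Longrightarrow> tripod R (D i) I (port a q i)"
    "\<And>i j. i \<in> I \<Longrightarrow> j \<in> I \<Longrightarrow> i \<noteq> j \<Longrightarrow> D i \<inter> D j = {}" "\<And>i j. i \<in> I \<Longrightarrow> j \<in> I \<Longrightarrow> i \<noteq> j \<Longrightarrow> R (q i j) (q j i)"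
    "matchable_on R (B - (\<Union>i\<in>I. D i))" using triadE[OF t] by blast
  have b: "tripod R (D i \<union> K i) I (port b q i)" if i: "i \<in> I" for i
  proof -
    \<comment> \<open>Only the outer terminal of corner \<open>i\<close> moves; its ends of triangle
      edges get empty extensions.\<close>
    let ?K = "\<lambda>j. if j = i then K i else {}"
    have "tripod R (D i \<union> (\<Union>j\<in>I. ?K j)) I (port b q i)"
    proof (rule tripod_extend[OF D(2)[OF i]])
      show "legset R (port a q i j) (?K j) (port b q i j)" if "j \<in> I" for j
        using K(1)[OF i] legset_refl unfolding port_def by auto
      show "?K j \<inter> D i = {}" for j using K(2)[OF i] D(1)[OF i] by auto
    qed auto
    moreover have "(\<Union>j\<in>I. ?K j) = K i" using i by auto
    ultimately show ?thesis by simp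
  qed
  have a: "D i \<union> K i \<subseteq> B \<union> (\<Union>i\<in>I. K i)" if i: "i \<in> I" for i using D(1)[OF i] i by blast
  have c: "(D i \<union> K i) \<inter> (D j \<union> K j) = {}" if ij: "i \<in> I" "j \<in> I" "i \<noteq> j" for i j
    using D(3)[OF ij] disj[OF ij] D(1)[OF ij(1)] D(1)[OF ij(2)] K(2)[OF ij(1)] K(2)[OF ij(2)] by blast
  have "(\<Union>i\<in>I. K i) \<inter> B = {}" using K(2) by blast
  then have "B \<union> (\<Union>i\<in>I. K i) - (\<Union>i\<in>I. D i \<union> K i) = B - (\<Union>i\<in>I. D i)" by blast
  then have d: "matchable_on R (B \<union> (\<Union>i\<in>I. K i) - (\<Union>i\<in>I. D i \<union> K i))" using D(5) by simp
  show ?thesis unfolding triad_def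
    by (rule exI[of _ "\<lambda>i. D i \<union> K i"], rule exI[of _ q]) (use a b c d D(4) in auto)
qed

context sym_rel begin

lemma matchable_on_linked:
  assumes "matchable_on R (A - {x})" "matchable_on R (B - {y})" "x \<in> A" "y \<in> B" "A \<inter> B = {}" "R x y"
  shows "matchable_on R (A \<union> B)"
proof -
  have "matchable_on R {x, y}" using matchable_on_pair[of R x y] assms(6) sym irrefl by blast
  then have "matchable_on R ((A - {x}) \<union> (B - {y}) \<union> {x, y})"
    by (intro matchable_on_Un assms(1,2)) (use assms(3-5) in auto)
  moreover have "(A - {x}) \<union> (B - {y}) \<union> {x, y} = A \<union> B" using assms(3,4) by blast
  ultimately show ?thesis by simp
qed

text \<open>The other two corners are matched with each other along the triangle edge between
  them.\<close>

lemma triad_terminal: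
  assumes "triad R B I a" "card I = 3" "i \<in> I"
  shows "a i \<in> B" "matchable_on R (B - {a i})"
proof -
  obtain D q where D: "\<And>i. i \<in> I \<Longrightarrow> D i \<subseteq> B" "\<And>i. i \<in> I \<Longrightarrow> tripod R (D i) I (port a q i)"
    "\<And>i j. i \<in> I \<Longrightarrow> j \<in> I \<Longrightarrow> i \<noteq> j \<Longrightarrow> D i \<inter> D j = {}" "\<And>i j. i \<in> I \<Longrightarrow> j \<in> I \<Longrightarrow> i \<noteq> j \<Longrightarrow> R (q i j) (q j i)"
    "matchable_on R (B - (\<Union>i\<in>I. D i))" using triadE[OF assms(1)] by blast
  have "card (I - {i}) = 2" using assms(2,3) by simp
  then obtain j k where jk: "I - {i} = {j, k}" "j \<noteq> k" by (meson card_2_iff)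
  have ji: "j \<in> I" "k \<in> I" "j \<noteq> i" "k \<noteq> i" using jk(1) by auto
  have "I = insert i {j, k}" using jk(1) assms(3) by blast
  then have U: "(\<Union>i\<in>I. D i) = D i \<union> (D j \<union> D k)" by auto
  have t1: "a i \<in> D i" "matchable_on R (D i - {a i})"
    using tripod_terminal[OF D(2)[OF assms(3)] assms(3)] unfolding port_def by simp_all
  have t2: "q j k \<in> D j" "matchable_on R (D j - {q j k})"
    using tripod_terminal[OF D(2)[OF ji(1)] ji(2)] jk(2) unfolding port_def by simp_all
  have t3: "q k j \<in> D k" "matchable_on R (D k - {q k j})"
    using tripod_terminal[OF D(2)[OF ji(2)] ji(1)] jk(2) unfolding port_def by simp_all
  have m: "matchable_on R (D j \<union> D k)"
    by (rule matchable_on_linked[OF t2(2) t3(2) t2(1) t3(1) D(3)[OF ji(1,2) jk(2)] D(4)[OF ji(1,2) jk(2)]])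
  have dj: "D i \<inter> (D j \<union> D k) = {}" using D(3)[OF assms(3) ji(1)] D(3)[OF assms(3) ji(2)] ji by blast
  show "a i \<in> B" using t1(1) D(1)[OF assms(3)] by blast
  have "matchable_on R ((D i - {a i}) \<union> (D j \<union> D k) \<union> (B - (\<Union>i\<in>I. D i)))"
    by (intro matchable_on_Un[OF matchable_on_Un[OF t1(2) m] D(5)]) (use dj in \<open>auto simp: U\<close>)
  moreover have "(D i - {a i}) \<union> (D j \<union> D k) \<union> (B - (\<Union>i\<in>I. D i)) = B - {a i}"
  proof -
    have "D i \<union> (D j \<union> D k) \<subseteq> B" using D(1) assms(3) ji by blast
    then show ?thesis unfolding U using t1(1) dj by blast
  qed
  ultimately show "matchable_on R (B - {a i})" by simp
qed

text \<open>A triangle inside a corner of a triangle: deleting the two edges opposite to the common corner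
  leaves a tripod centred there.\<close>

lemma triad_nested:
  assumes I: "card I = 3" and D: "\<And>i. i \<in> I \<Longrightarrow> D i \<subseteq> B"
      "\<And>i. i \<in> I \<Longrightarrow> tripod R (D i) I (port a q i) \<or> triad R (D i) I (port a q i)"
      "\<And>i j. i \<in> I \<Longrightarrow> j \<in> I \<Longrightarrow> i \<noteq> j \<Longrightarrow> D i \<inter> D j = {}" "\<And>i j. i \<in> I \<Longrightarrow> j \<in> I \<Longrightarrow> i \<noteq> j \<Longrightarrow> R (q i j) (q j i)"
      "matchable_on R (B - (\<Union>i\<in>I. D i))"
  shows "tripod R B I a \<or> triad R B I a"
proof (cases "\<forall>i\<in>I. tripod R (D i) I (port a q i)")
  case True
  then have "triad R B I a" unfolding triad_def using D by (intro exI[of _ D] exI[of _ q]) simp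
  then show ?thesis by blast
next
  case False
  then obtain o1 where o1: "o1 \<in> I" "triad R (D o1) I (port a q o1)" using D(2) by blast
  obtain C r where C: "\<And>i. i \<in> I \<Longrightarrow> C i \<subseteq> D o1" "\<And>i. i \<in> I \<Longrightarrow> tripod R (C i) I (port (port a q o1) r i)"
    "\<And>i j. i \<in> I \<Longrightarrow> j \<in> I \<Longrightarrow> i \<noteq> j \<Longrightarrow> C i \<inter> C j = {}" "\<And>i j. i \<in> I \<Longrightarrow> j \<in> I \<Longrightarrow> i \<noteq> j \<Longrightarrow> R (r i j) (r j i)"
    "matchable_on R (D o1 - (\<Union>i\<in>I. C i))" using triadE[OF o1(2)] by blast
  obtain y L where y: "y \<in> C o1" "\<And>i. i \<in> I \<Longrightarrow> L i \<subseteq> C o1 - {y}" "\<And>i. i \<in> I \<Longrightarrow> legset R y (L i) (port (port a q o1) r o1 i)"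
    "\<And>i j. i \<in> I \<Longrightarrow> j \<in> I \<Longrightarrow> i \<noteq> j \<Longrightarrow> L i \<inter> L j = {}" "matchable_on R (C o1 - {y} - (\<Union>i\<in>I. L i))"
    using tripodE[OF C(2)[OF o1(1)]] by blast
  \<comment> \<open>The centre \<open>y\<close> of the common corner \<open>C o1\<close> becomes the
    new centre. For \<open>l\<close> other than \<open>o1\<close> the leg runs through
    \<open>L l\<close>, along an edge of the inner triangle into \<open>C l\<close>, and along an
    edge of the outer one into \<open>D l\<close>.\<close>
  define N where "N l = L l \<union> (if l = o1 then {} else C l \<union> D l)" for l
  \<comment> \<open>All that is used of a corner \<open>D l\<close> is that it is matchable without
    a terminal, so it may itself be a triad.\<close>
  have Dt: "port a q l j \<in> D l \<and> matchable_on R (D l - {port a q l j})" if "l \<in> I" "j \<in> I" for l j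
    using D(2)[OF that(1)] tripod_terminal[of R "D l" I "port a q l" j] triad_terminal[of "D l" I "port a q l" j] I that(2) by blast
  have leg: "legset R y (N l) (a l)" if l: "l \<in> I" for l
  proof (cases "l = o1")
    case True
    then show ?thesis using y(3)[OF l] unfolding N_def port_def by simp
  next
    case False
    have L: "y \<notin> L l" "r o1 l \<in> insert y (L l)" "matchable_on R (L l)" "matchable_on R (insert y (L l) - {r o1 l})"
      using y(3)[OF l] False unfolding legset_def port_def by auto
    have c1: "q o1 l \<in> C l" "matchable_on R (C l - {q o1 l})"
      using tripod_terminal[OF C(2)[OF l] l] False unfolding port_def by auto
    have c2: "r l o1 \<in> C l" "matchable_on R (C l - {r l o1})"
      using tripod_terminal[OF C(2)[OF l] o1(1)] False unfolding port_def by auto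
    have d1: "q l o1 \<in> D l" "matchable_on R (D l - {q l o1})" using Dt[OF l o1(1)] False unfolding port_def by auto
    have d2: "a l \<in> D l" "matchable_on R (D l - {a l})" using Dt[OF l l] unfolding port_def by auto
    have CD: "C l \<inter> D l = {}" "C o1 \<inter> D l = {}" "C o1 \<inter> C l = {}"
      using C(1)[OF l] C(1)[OF o1(1)] D(3)[OF o1(1) l] C(3)[OF o1(1) l] False by blast+
    have Lc: "insert y (L l) \<subseteq> C o1" using y(1) y(2)[OF l] by blast
    have m1: "matchable_on R (C l \<union> D l)"
      by (rule matchable_on_linked[OF c1(2) d1(2) c1(1) d1(1) CD(1) D(4)[OF o1(1) l]]) (use False in simp)
    have m2: "matchable_on R (L l \<union> (C l \<union> D l))" by (rule matchable_on_Un[OF L(3) m1]) (use CD Lc in blast)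
    have m3: "matchable_on R (insert y (L l) \<union> C l)"
      by (rule matchable_on_linked[OF L(4) c2(2) L(2) c2(1) _ C(4)[OF o1(1) l]]) (use CD Lc False in blast)+
    have m4: "matchable_on R (insert y (L l) \<union> C l \<union> (D l - {a l}))"
      by (rule matchable_on_Un[OF m3 d2(2)]) (use CD Lc in blast)
    have eq: "insert y (L l) \<union> C l \<union> (D l - {a l}) = insert y (N l) - {a l}"
      unfolding N_def using False CD Lc d2(1) by auto
    have "y \<notin> N l" unfolding N_def using False CD Lc L(1) by auto
    then show ?thesis unfolding legset_def using m2 m4 eq d2(1) False unfolding N_def by auto
  qed
  have NB: "N l \<subseteq> B - {y}" if l: "l \<in> I" for l
  proof -
    have "N l \<subseteq> B" unfolding N_def using y(2)[OF l] C(1)[OF o1(1)] C(1)[OF l] D(1)[OF o1(1)] D(1)[OF l] by auto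
    then show ?thesis using leg[OF l] unfolding legset_def by blast
  qed
  have Ndisj: "N i \<inter> N j = {}" if ij: "i \<in> I" "j \<in> I" "i \<noteq> j" for i j
  proof -
    have Lo: "L i \<subseteq> C o1" "L j \<subseteq> C o1" "L i \<inter> L j = {}" using y(2)[OF ij(1)] y(2)[OF ij(2)] y(4)[OF ij] by blast+
    have Co: "C o1 \<subseteq> D o1" "C i \<subseteq> D o1" "C j \<subseteq> D o1" using C(1) ij o1(1) by blast+
    have Cij: "C i \<inter> C j = {}" "D i \<inter> D j = {}" using C(3)[OF ij] D(3)[OF ij] .
    have x: "C o1 \<inter> C l = {} \<and> D o1 \<inter> D l = {}" if "l \<in> I" "l \<noteq> o1" for l
      using C(3)[OF o1(1) that(1)] D(3)[OF o1(1) that(1)] that(2) by blast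
    consider "i = o1" "j \<noteq> o1" | "j = o1" "i \<noteq> o1" | "i \<noteq> o1" "j \<noteq> o1" using ij(3) by blast
    then show ?thesis
    proof cases
      case 1
      then have "N i = L i" "N j = L j \<union> (C j \<union> D j)" unfolding N_def by simp_all
      then show ?thesis using x[OF ij(2) 1(2)] Lo Co(1) by blast
    next
      case 2
      then have "N j = L j" "N i = L i \<union> (C i \<union> D i)" unfolding N_def by simp_all
      then show ?thesis using x[OF ij(1) 2(2)] Lo Co(1) by blast
    next
      case 3
      then have "N i = L i \<union> (C i \<union> D i)" "N j = L j \<union> (C j \<union> D j)" unfolding N_def by simp_all
      moreover have "L i \<inter> C j = {}" "C i \<inter> L j = {}" "L i \<inter> D j = {}" "D i \<inter> L j = {}" "C i \<inter> D j = {}" "D i \<inter> C j = {}"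
        using x[OF ij(1) 3(1)] x[OF ij(2) 3(2)] Lo(1,2) Co by blast+
      ultimately show ?thesis using Lo(3) Cij by (simp add: Int_Un_distrib Int_Un_distrib2)
    qed
  qed
  have "matchable_on R ((B - (\<Union>i\<in>I. D i)) \<union> (D o1 - (\<Union>i\<in>I. C i)) \<union> (C o1 - {y} - (\<Union>i\<in>I. L i)))"
    by (intro matchable_on_Un D(5) C(5) y(5)) (use o1(1) C(1) in blast)+
  moreover have "(B - (\<Union>i\<in>I. D i)) \<union> (D o1 - (\<Union>i\<in>I. C i)) \<union> (C o1 - {y} - (\<Union>i\<in>I. L i)) = B - {y} - (\<Union>i\<in>I. N i)"
  proof -
    let ?J = "I - {o1}"
    have N: "(\<Union>i\<in>I. N i) = (\<Union>i\<in>I. L i) \<union> (\<Union>i\<in>?J. C i) \<union> (\<Union>i\<in>?J. D i)" unfolding N_def by (auto split: if_splits)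
    have DU: "(\<Union>i\<in>I. D i) = D o1 \<union> (\<Union>i\<in>?J. D i)" and CU: "(\<Union>i\<in>I. C i) = C o1 \<union> (\<Union>i\<in>?J. C i)" using o1(1) by blast+
    have "D o1 \<inter> D l = {}" if "l \<in> ?J" for l using D(3)[OF o1(1), of l] that by blast
    then have d: "D o1 \<inter> (\<Union>i\<in>?J. D i) = {}" by blast
    have "C o1 \<inter> C l = {}" if "l \<in> ?J" for l using C(3)[OF o1(1), of l] that by blast
    then have c: "C o1 \<inter> (\<Union>i\<in>?J. C i) = {}" by blast
    have s: "D o1 \<subseteq> B" "C o1 \<subseteq> D o1" "(\<Union>i\<in>?J. C i) \<subseteq> D o1" "(\<Union>i\<in>I. L i) \<subseteq> C o1" "y \<in> C o1"
      using D(1) C(1) o1(1) y(1,2) by blast+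
    have sets: "(B - (D1 \<union> DJ)) \<union> (D1 - (C1 \<union> CJ)) \<union> (C1 - {y} - LL) = B - {y} - (LL \<union> CJ \<union> DJ)"
      if "D1 \<inter> DJ = {}" "C1 \<inter> CJ = {}" "D1 \<subseteq> B" "C1 \<subseteq> D1" "CJ \<subseteq> D1" "LL \<subseteq> C1" "y \<in> C1" for D1 DJ C1 CJ LL :: "'v set"
      using that by auto
    show ?thesis unfolding N DU CU by (rule sets[OF d c s])
  qed
  ultimately have "matchable_on R (B - {y} - (\<Union>i\<in>I. N i))" by simp
  moreover have "y \<in> B" using y(1) C(1)[OF o1(1)] D(1)[OF o1(1)] by blast
  ultimately have "tripod R B I a" unfolding tripod_def using NB leg Ndisj by (intro exI[of _ y] exI[of _ N]) simp
  then show ?thesis by blast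
qed

end

section \<open>Alternating paths and odd cycles\<close>

lemma alternating_path:
  assumes "finite L" "c \<notin> L" "is_mate R L m" "is_mate R (insert c L - {b}) n" "b \<in> insert c L" "\<And>u v. R u v \<Longrightarrow> R v u"
  shows "\<exists>ps. odd (length ps) \<and> distinct ps \<and> hd ps = c \<and> last ps = b \<and> set ps \<subseteq> insert c L \<and> successively R ps \<and>
    (\<forall>i. Suc i < length ps \<longrightarrow> odd i \<longrightarrow> m (ps ! i) = ps ! Suc i)"
  using assms(1-5)
proof (induction "card L" arbitrary: L c rule: less_induct)
  case less
  show ?case
  proof (cases "b = c")
    case True
    then show ?thesis by (intro exI[of _ "[c]"]) simp
  next
    case False
    define r r' where "r = n c" and "r' = m r"
    have cN: "c \<in> insert c L - {b}" using False by simp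
    note q1 = is_mateD[OF less.prems(4) cN, folded r_def]
    have r: "r \<in> L" "r \<noteq> b" using q1 by auto
    note q = is_mateD[OF less.prems(3) r(1), folded r'_def]
    let ?L = "L - {r, r'}"
    have mt: "is_mate R ?L m"
    proof (rule is_mate_subset[OF less.prems(3)])
      fix u assume u: "u \<in> ?L"
      note qu = is_mateD[OF less.prems(3), of u]
      have "m u \<noteq> r" "m u \<noteq> r'" using qu u q r'_def by auto
      then show "m u \<in> ?L" using qu u by auto
    qed auto
    have mn: "is_mate R (insert r' ?L - {b}) n"
    proof (rule is_mate_subset[OF less.prems(4)])
      show "insert r' ?L - {b} \<subseteq> insert c L - {b}" using q(1) by blast
      fix u assume u: "u \<in> insert r' ?L - {b}"
      then have u': "u \<in> insert c L - {b}" "u \<noteq> c" "u \<noteq> r" using q(1,3) less.prems(2) by auto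
      note qu = is_mateD[OF less.prems(4) u'(1)]
      have "n u \<noteq> c" "n u \<noteq> r" using qu(2) q1(2) u'(2,3) r_def by metis+
      then show "n u \<in> insert r' ?L - {b}" using qu(1) by auto
    qed
    have c: "card ?L < card L" by (rule psubset_card_mono) (use less.prems(1) r in auto)
    have "finite ?L" "r' \<notin> ?L" "b \<in> insert r' ?L" using less.prems(1,5) False r(2) by auto
    note IH = less.hyps[OF c this(1,2) mt mn this(3)]
    obtain ps where ps: "odd (length ps)" "distinct ps" "hd ps = r'" "last ps = b" "set ps \<subseteq> insert r' ?L"
      "successively R ps" "\<And>i. Suc i < length ps \<Longrightarrow> odd i \<Longrightarrow> m (ps ! i) = ps ! Suc i"
      using IH by blast
    obtain us where us: "ps = r' # us" using ps(1,3) by (cases ps) auto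
    have "distinct (c # r # ps)" using ps(2,5) r(1) q(1,3) less.prems(2) by auto
    moreover have "successively R (c # r # ps)" using ps(6) us q1(4) q(4) by (simp add: successively_Cons)
    moreover have "set (c # r # ps) \<subseteq> insert c L" using ps(5) r(1) q(1) by auto
    moreover have "\<forall>i. Suc i < length (c # r # ps) \<longrightarrow> odd i \<longrightarrow> m ((c # r # ps) ! i) = (c # r # ps) ! Suc i"
    proof (intro allI impI)
      fix i assume i: "Suc i < length (c # r # ps)" "odd i"
      consider "i = 1" | j where "i = Suc (Suc j)" using i(2) by (metis One_nat_def even_zero not0_implies_Suc)
      then show "m ((c # r # ps) ! i) = (c # r # ps) ! Suc i"
        using ps(7) i us r'_def by cases auto
    qed
    ultimately show ?thesis using ps(1,4) us by (intro exI[of _ "c # r # ps"]) simp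
  qed
qed

lemma matchable_on_odd_segment:
  assumes "odd (length ws)" "distinct ws" "successively R ws" "\<And>u v. R u v \<Longrightarrow> R v u"
  shows "matchable_on R (set (tl ws))" "matchable_on R (set ws - {last ws})"
proof -
  obtain w us where w: "ws = w # us" using assms(1) by (cases ws) auto
  show "matchable_on R (set (tl ws))" by (rule matchable_on_list) (use assms w in \<open>auto simp: successively_Cons\<close>)
  have ws: "ws = butlast ws @ [last ws]" using w by simp
  have "distinct (butlast ws @ [last ws])" "successively R (butlast ws @ [last ws])" using assms(2,3) ws by simp_all
  then have b: "distinct (butlast ws)" "successively R (butlast ws)" "last ws \<notin> set (butlast ws)" by (auto simp: successively_append_iff)
  have "set ws = set (butlast ws) \<union> {last ws}" by (subst ws) simp
  then have "set ws - {last ws} = set (butlast ws)" using b(3) by auto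
  then show "matchable_on R (set ws - {last ws})" using matchable_on_list[OF _ b(1,2) assms(4)] assms(1) by simp
qed

lemma legset_segment:
  assumes "odd (length ws)" "distinct ws" "successively R ws" "\<And>u v. R u v \<Longrightarrow> R v u"
  shows "legset R (hd ws) (set (tl ws)) (last ws)"
proof -
  obtain w us where w: "ws = w # us" using assms(1) by (cases ws) auto
  show ?thesis unfolding legset_def using matchable_on_odd_segment[OF assms] assms(2) w by auto
qed

text \<open>The first vertex is the centre: the path is the only nontrivial leg, and all other ports
  sit at the centre. The arcs of an odd cycle have this form.\<close>

lemma tripod_segment:
  assumes "odd (length ws)" "distinct ws" "successively R ws" "\<And>u v. R u v \<Longrightarrow> R v u"
    and "i0 \<in> I" "p i0 = last ws" "\<And>i. i \<in> I \<Longrightarrow> i \<noteq> i0 \<Longrightarrow> p i = hd ws"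
  shows "tripod R (set ws) I p"
proof -
  obtain w us where w: "ws = w # us" using assms(1) by (cases ws) auto
  let ?L = "\<lambda>i. if i = i0 then set (tl ws) else {}"
  have "(\<Union>i\<in>I. ?L i) = set (tl ws)" using assms(5) by auto
  moreover have "set ws - {hd ws} - set (tl ws) = {}" using w by auto
  moreover have "legset R (hd ws) (?L i) (p i)" if "i \<in> I" for i
    using legset_segment[OF assms(1-4)] assms(6,7) that legset_refl[of R "hd ws"] by auto
  moreover have "hd ws \<in> set ws" "set (tl ws) \<subseteq> set ws - {hd ws}" using w assms(2) by auto
  ultimately show ?thesis unfolding tripod_def by (intro exI[of _ "hd ws"] exI[of _ ?L]) auto
qed

lemma successively_rotate:
  assumes "successively R (xs @ w # ys)" "R (last (xs @ w # ys)) (hd (xs @ w # ys))"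
  shows "successively R (ys @ xs)"
proof -
  have "successively R xs" "successively R ys" using assms(1) by (auto simp: successively_append_iff successively_Cons)
  moreover have "R (last ys) (hd xs)" if "ys \<noteq> []" "xs \<noteq> []" using assms(2) that by simp
  ultimately show ?thesis by (auto simp: successively_append_iff)
qed

context sym_rel begin

lemma odd_cycle_critical:
  assumes "odd (length cs)" "distinct cs" "successively R cs" "R (last cs) (hd cs)" "w \<in> set cs"
  shows "matchable_on R (set cs - {w})"
proof -
  obtain xs ys where cs: "cs = xs @ w # ys" using split_list[OF assms(5)] by blast
  have "matchable_on R (set (ys @ xs))"
    by (rule matchable_on_list) (use assms(1-4) sym successively_rotate[of R xs w ys] in \<open>auto simp: cs\<close>)
  moreover have "set cs - {w} = set (ys @ xs)" using assms(2) unfolding cs by auto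
  ultimately show ?thesis by simp
qed

text \<open>Positions \<open>0\<close>, \<open>i\<close>, \<open>k\<close> with parities even, odd,
  even cut an odd cycle into three arcs with odd numbers of vertices, each beginning at a terminal;
  the cycle edges between the arcs become the triangle edges.\<close>

lemma triad_odd_cycle:
  assumes cs: "odd (length cs)" "distinct cs" "successively R cs" "R (last cs) (hd cs)"
    and I: "I = {i1, i2, i3}" "i1 \<noteq> i2" "i1 \<noteq> i3" "i2 \<noteq> i3"
    and pos: "odd i" "i < k" "even k" "k < length cs" and a: "a i1 = cs ! 0" "a i2 = cs ! i" "a i3 = cs ! k"
  shows "triad R (set cs) I a"
proof -
  define xs ys zs where "xs = take i cs" and "ys = take (k - i) (drop i cs)" and "zs = drop k cs"
  have "drop i cs = take (k - i) (drop i cs) @ drop (k - i) (drop i cs)" by (rule append_take_drop_id[symmetric])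
  also have "drop (k - i) (drop i cs) = zs" unfolding zs_def using pos(2) by simp
  finally have "drop i cs = ys @ zs" unfolding ys_def .
  then have cseq: "cs = xs @ ys @ zs" unfolding xs_def by (metis append_take_drop_id)
  have len: "length xs = i" "length ys = k - i" "length zs = length cs - k" unfolding xs_def ys_def zs_def using pos by auto
  have ne: "xs \<noteq> []" "ys \<noteq> []" "zs \<noteq> []" using len pos by (auto simp del: length_greater_0_conv simp flip: length_greater_0_conv elim: oddE)
  have d: "distinct (xs @ ys @ zs)" "successively R (xs @ ys @ zs)" using cs(2,3) cseq by simp_all
  then have s: "successively R xs" "successively R ys" "successively R zs" "R (last xs) (hd ys)" "R (last ys) (hd zs)"
    using ne by (auto simp: successively_append_iff)
  have lh: "R (last zs) (hd xs)" using cs(4) ne cseq by (metis hd_append2 last_appendR append_is_Nil_conv)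
  have od: "odd (length xs)" "odd (length ys)" "odd (length zs)" using len pos cs(1) by auto
  have hds: "hd xs = a i1" "hd ys = a i2" "hd zs = a i3"
  proof -
    show "hd xs = a i1" using a(1) ne(1) cseq by (metis hd_append2 hd_conv_nth append_is_Nil_conv)
    show "hd ys = a i2" using a(2) ne(2) len(1) unfolding cseq by (cases ys) (auto simp: nth_append)
    have "k = length (xs @ ys)" using len pos by simp
    then show "hd zs = a i3" using a(3) ne(3) unfolding cseq by (cases zs) (auto simp: nth_append)
  qed
  define D where "D j = (if j = i1 then set xs else if j = i2 then set ys else set zs)" for j
  define q where "q j l = (if j = i1 then (if l = i2 then last xs else hd xs) else
      if j = i2 then (if l = i3 then last ys else hd ys) else (if l = i1 then last zs else hd zs))" for j l
  have Dv: "D i1 = set xs" "D i2 = set ys" "D i3 = set zs" unfolding D_def using I by auto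
  have t1: "tripod R (D i1) I (port a q i1)"
    unfolding Dv by (rule tripod_segment[OF od(1) _ s(1) sym, of i2]) (use d I hds in \<open>auto simp: port_def q_def\<close>)
  have t2: "tripod R (D i2) I (port a q i2)"
    unfolding Dv by (rule tripod_segment[OF od(2) _ s(2) sym, of i3]) (use d I hds in \<open>auto simp: port_def q_def\<close>)
  have t3: "tripod R (D i3) I (port a q i3)"
    unfolding Dv by (rule tripod_segment[OF od(3) _ s(3) sym, of i1]) (use d I hds in \<open>auto simp: port_def q_def\<close>)
  have "q i1 i2 = last xs" "q i1 i3 = hd xs" "q i2 i3 = last ys" "q i2 i1 = hd ys" "q i3 i1 = last zs" "q i3 i2 = hd zs"
    unfolding q_def using I by simp_all
  then have qs: "R (q i1 i2) (q i2 i1)" "R (q i2 i1) (q i1 i2)" "R (q i2 i3) (q i3 i2)" "R (q i3 i2) (q i2 i3)"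
    "R (q i3 i1) (q i1 i3)" "R (q i1 i3) (q i3 i1)" using s(4,5) lh sym by simp_all
  have U: "(\<Union>j\<in>I. D j) = set cs" unfolding I(1) using Dv cseq by auto
  show ?thesis
    unfolding triad_def
  proof (rule exI[of _ D], rule exI[of _ q], intro conjI ballI impI)
    fix j assume j: "j \<in> I"
    show "D j \<subseteq> set cs" using U j by blast
    show "tripod R (D j) I (port a q j)" using t1 t2 t3 j unfolding I(1) by blast
    fix l assume l: "l \<in> I" "j \<noteq> l"
    show "D j \<inter> D l = {}" using j l d(1) Dv unfolding I(1) by auto
    show "R (q j l) (q l j)"
      using j l qs unfolding I(1) by blast
  next
    show "matchable_on R (set cs - (\<Union>j\<in>I. D j))" unfolding U by simp
  qed
qed

text \<open>Steps along \<open>m\<close> join odd positions to the next even ones, so the positions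
  strictly between an even and an odd number form a union of pairs.\<close>

lemma mate_segment_closed:
  assumes m: "is_mate R W m" and qs: "set (tl qs) \<subseteq> W" "\<forall>i. Suc i < length qs \<longrightarrow> odd i \<longrightarrow> m (qs ! i) = qs ! Suc i"
    and st: "even s" "odd t" "t \<le> length qs" and x: "s < x" "x < t"
  shows "\<exists>y. s < y \<and> y < t \<and> m (qs ! x) = qs ! y"
proof (cases "odd x")
  case True
  then have "Suc x < t" using x(2) st(2) by (metis Suc_lessI even_Suc)
  then show ?thesis using qs(2)[rule_format, of x] True st(3) x(1) by (intro exI[of _ "Suc x"]) auto
next
  case False
  then obtain z where z: "x = Suc z" "odd z" using x(1) by (cases x) auto
  have "s \<noteq> z" using z(2) st(1) by blast
  then have "s < z" using z(1) x(1) by simp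
  have mz: "m (qs ! z) = qs ! x" using qs(2)[rule_format, of z] z x(2) st(3) by auto
  obtain w where "z = Suc w" using \<open>s < z\<close> by (cases z) auto
  then have "qs ! z = tl qs ! w" "w < length (tl qs)" using z x(2) st(3) by (auto simp: nth_tl)
  then have "qs ! z \<in> W" using qs(1) by (metis nth_mem subsetD)
  then have "m (qs ! x) = qs ! z" using is_mateD(2)[OF m] mz by metis
  then show ?thesis using \<open>s < z\<close> z x(2) by (intro exI[of _ z]) auto
qed

lemma alternating_mates:
  assumes m: "is_mate R W m" and qs: "odd (length qs)" "set (tl qs) \<subseteq> W" "\<forall>i. Suc i < length qs \<longrightarrow> odd i \<longrightarrow> m (qs ! i) = qs ! Suc i"
    and i: "i < length qs"
  shows "odd i \<Longrightarrow> Suc i < length qs \<and> m (qs ! i) = qs ! Suc i"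
    "even i \<Longrightarrow> 0 < i \<Longrightarrow> m (qs ! i) = qs ! (i - 1)"
proof -
  show "Suc i < length qs \<and> m (qs ! i) = qs ! Suc i" if "odd i"
  proof -
    have "Suc i \<noteq> length qs" using that qs(1) by (metis even_Suc)
    then show ?thesis using i qs(3)[rule_format, of i] that by simp
  qed
  show "m (qs ! i) = qs ! (i - 1)" if ev: "even i" "0 < i"
  proof -
    obtain z where z: "i = Suc z" "odd z" using ev by (cases i) auto
    obtain w where w: "z = Suc w" using z(2) by (cases z) auto
    have "qs ! z = tl qs ! w" "w < length (tl qs)" using w z i by (auto simp: nth_tl)
    then have "qs ! z \<in> W" using qs(2) by (metis nth_mem subsetD)
    moreover have "m (qs ! z) = qs ! i" using qs(3)[rule_format, of z] z i by simp
    ultimately have "m (qs ! i) = qs ! z" using is_mateD(2)[OF m] by metis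
    then show ?thesis using z by simp
  qed
qed

text \<open>Both paths alternate with the same \<open>m\<close>, so at a common vertex their
  positions may agree or disagree in parity. Agreement at their last common vertex makes it the
  centre; disagreement produces an arc of \<open>qs\<close> that closes an odd cycle with a segment
  of \<open>ps\<close>.\<close>

lemma tripod_or_odd_cycle:
  assumes fB: "finite B" and I: "I = {i1, i2, i3}" "i1 \<noteq> i2" "i1 \<noteq> i3" "i2 \<noteq> i3"
    and a: "\<And>i. i \<in> I \<Longrightarrow> a i \<in> B" "\<And>i. i \<in> I \<Longrightarrow> matchable_on R (B - {a i})"
  shows "tripod R B I a \<or> (\<exists>Z\<subseteq>B. 3 \<le> card Z \<and> (\<forall>w\<in>Z. matchable_on R (Z - {w})) \<and> matchable_on R (B - Z) \<and>
    (Z = B \<longrightarrow> triad R B I a))"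
proof -
  define c where "c = a i1"
  have cB: "c \<in> B" and a23: "a i2 \<in> B" "a i3 \<in> B" using a(1) I(1) c_def by auto
  have ins: "insert c (B - {c}) = B" using cB by blast
  obtain m where m: "is_mate R (B - {c}) m" using a(2)[of i1] I(1) unfolding matchable_on_def c_def by auto
  have fW: "finite (B - {c})" using fB by simp
  have path: "\<exists>ps. odd (length ps) \<and> distinct ps \<and> hd ps = c \<and> last ps = a i \<and> set ps \<subseteq> B \<and> successively R ps \<and>
      (\<forall>i. Suc i < length ps \<longrightarrow> odd i \<longrightarrow> m (ps ! i) = ps ! Suc i)" if i: "i \<in> I" for i
  proof -
    obtain n where n: "is_mate R (B - {a i}) n" using a(2)[OF i] unfolding matchable_on_def by blast
    have "\<exists>ps. odd (length ps) \<and> distinct ps \<and> hd ps = c \<and> last ps = a i \<and> set ps \<subseteq> insert c (B - {c}) \<and> successively R ps \<and>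
      (\<forall>i. Suc i < length ps \<longrightarrow> odd i \<longrightarrow> m (ps ! i) = ps ! Suc i)"
      by (rule alternating_path[OF fW _ m]) (use n a(1)[OF i] sym ins in auto)
    then show ?thesis unfolding ins .
  qed
  obtain ps where ps: "odd (length ps)" "distinct ps" "hd ps = c" "last ps = a i3" "set ps \<subseteq> B" "successively R ps"
    "\<forall>i. Suc i < length ps \<longrightarrow> odd i \<longrightarrow> m (ps ! i) = ps ! Suc i" using path[of i3] I(1) by blast
  obtain qs where qs: "odd (length qs)" "distinct qs" "hd qs = c" "last qs = a i2" "set qs \<subseteq> B" "successively R qs"
    "\<forall>i. Suc i < length qs \<longrightarrow> odd i \<longrightarrow> m (qs ! i) = qs ! Suc i" using path[of i2] I(1) by blast
  have pne: "ps \<noteq> []" "qs \<noteq> []" "0 < length ps" "0 < length qs" using ps(1) qs(1) by auto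
  have p0: "ps ! 0 = c" "qs ! 0 = c" using ps(3) qs(3) pne by (simp_all add: hd_conv_nth)
  have tl: "set (tl xs) \<subseteq> B - {c}" if "distinct xs" "hd xs = c" "set xs \<subseteq> B" for xs
    using that by (cases xs) auto
  note tlp = tl[OF ps(2,3,5)] and tlq = tl[OF qs(2,3,5)]
  note pm = alternating_mates[OF m ps(1) tlp ps(7)] and qm = alternating_mates[OF m qs(1) tlq qs(7)]
  have pin: "x \<in> set ps \<Longrightarrow> \<exists>i<length ps. x = ps ! i" for x by (auto simp: in_set_conv_nth)
  have mps: "m v \<in> set ps" if v: "v \<in> set ps" "v \<noteq> c" for v
  proof -
    obtain i where i: "i < length ps" "v = ps ! i" using pin[OF v(1)] by blast
    then have "0 < i" using v(2) p0 by (cases i) auto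
    then show ?thesis using pm[OF i(1)] i by (cases "odd i") auto
  qed
  have closed: "is_mate R (B - set ps - X) m"
    if X: "X = {qs ! x | x. s < x \<and> x < t}" and st: "even s" "odd t" "t \<le> length qs" for X s t
  proof (rule is_mate_subset[OF m])
    show "B - set ps - X \<subseteq> B - {c}" using p0(1) pne(3) nth_mem by blast
    fix u assume u: "u \<in> B - set ps - X"
    then have uc: "u \<in> B - {c}" using p0(1) pne(3) nth_mem by blast
    note mu = is_mateD[OF m uc]
    have "m u \<notin> set ps" using mps[of "m u"] mu(1,2) u by auto
    moreover have "m u \<notin> X"
    proof
      assume "m u \<in> X"
      then obtain x where x: "s < x" "x < t" "m u = qs ! x" unfolding X by blast
      obtain y where y: "s < y" "y < t" "m (qs ! x) = qs ! y"
        using mate_segment_closed[OF m tlq qs(7) st x(1,2)] by blast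
      then have "u = qs ! y" using mu(2) x(3) by simp
      then have "u \<in> X" unfolding X using y(1,2) by blast
      then show False using u by blast
    qed
    ultimately show "m u \<in> B - set ps - X" using mu(1) by blast
  qed
  \<comment> \<open>The last position at which \<open>qs\<close> meets \<open>ps\<close>: the tail
    behind it is free to serve as a leg.\<close>
  define j where "j = Max {j. j < length qs \<and> qs ! j \<in> set ps}"
  have fJ: "finite {j. j < length qs \<and> qs ! j \<in> set ps}" by simp
  have "0 \<in> {j. j < length qs \<and> qs ! j \<in> set ps}" using p0 pne by (metis (mono_tags, lifting) mem_Collect_eq nth_mem)
  then have "j \<in> {j. j < length qs \<and> qs ! j \<in> set ps}" unfolding j_def by (intro Max_in[OF fJ]) blast
  then have j: "j < length qs" "qs ! j \<in> set ps" by auto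
  have jmax: "x \<le> j" if "x < length qs" "qs ! x \<in> set ps" for x unfolding j_def by (rule Max_ge[OF fJ]) (use that in simp)
  obtain i where i: "i < length ps" "qs ! j = ps ! i" using pin[OF j(2)] by blast
  \<comment> \<open>At an odd position the next vertex of \<open>qs\<close> is the partner under
    \<open>m\<close> and would lie on \<open>ps\<close> as well.\<close>
  have jev: "even j"
  proof (rule ccontr)
    assume od: "odd j"
    have "qs ! j \<noteq> c" using od p0(2) qs(2) j(1) pne(4) nth_eq_iff_index_eq[of qs j 0] by auto
    then have "m (qs ! j) \<in> set ps" using mps j(2) by blast
    then show False using qm(1)[OF j(1) od] jmax[of "Suc j"] by auto
  qed
  show ?thesis
  proof (cases "even i")
    case True
    define y where "y = ps ! i"
    \<comment> \<open>The three legs at \<open>y\<close> are the segment of \<open>ps\<close> back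
      to \<open>c\<close>, the tail of \<open>qs\<close> and the tail of \<open>ps\<close>; each has
      an even number of vertices because \<open>i\<close> and \<open>j\<close> are even.\<close>
    define L where "L l = (if l = i1 then set (take i ps) else if l = i2 then set (drop (Suc j) qs) else set (drop (Suc i) ps))" for l
    have Lv: "L i1 = set (take i ps)" "L i2 = set (drop (Suc j) qs)" "L i3 = set (drop (Suc i) ps)" unfolding L_def using I by auto
    have psd: "ps = take i ps @ y # drop (Suc i) ps" unfolding y_def using i(1) by (rule id_take_nth_drop)
    have qsd: "drop j qs = y # drop (Suc j) qs" unfolding y_def i(2)[symmetric] using j(1) by (simp add: Cons_nth_drop_Suc)
    have psd': "drop i ps = y # drop (Suc i) ps" unfolding y_def using i(1) by (simp add: Cons_nth_drop_Suc)
    have dp: "distinct (take i ps @ y # drop (Suc i) ps)" using ps(2) psd by simp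
    have qd: "set (drop (Suc j) qs) \<inter> set ps = {}"
    proof (rule ccontr)
      assume "\<not> ?thesis"
      then obtain v where v: "v \<in> set (drop (Suc j) qs)" "v \<in> set ps" by blast
      then obtain x where x: "x < length qs - Suc j" "v = qs ! (Suc j + x)" by (auto simp: in_set_conv_nth)
      then have "Suc j + x < length qs" by linarith
      then show False using jmax[of "Suc j + x"] v(2) x(2) by auto
    qed
    have yps: "y \<in> set ps" using i(1) unfolding y_def by simp
    have leg3: "legset R y (L i3) (a i3)"
    proof -
      have "legset R (hd (drop i ps)) (set (tl (drop i ps))) (last (drop i ps))"
        by (rule legset_segment) (use ps True i(1) sym in \<open>auto simp: successively_drop\<close>)
      moreover have "hd (drop i ps) = y" "tl (drop i ps) = drop (Suc i) ps" by (simp_all only: psd' list.sel)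
      moreover have "last (drop i ps) = a i3" using ps(4) i(1) by (simp add: last_drop)
      ultimately show ?thesis unfolding Lv by (simp only:)
    qed
    have leg2: "legset R y (L i2) (a i2)"
    proof -
      have "legset R (hd (drop j qs)) (set (tl (drop j qs))) (last (drop j qs))"
        by (rule legset_segment) (use qs jev j(1) sym in \<open>auto simp: successively_drop\<close>)
      moreover have "hd (drop j qs) = y" "tl (drop j qs) = drop (Suc j) qs" by (simp_all only: qsd list.sel)
      moreover have "last (drop j qs) = a i2" using qs(4) j(1) by (simp add: last_drop)
      ultimately show ?thesis unfolding Lv by (simp only:)
    qed
    have leg1: "legset R y (L i1) (a i1)"
    proof -
      have T: "take (Suc i) ps = take i ps @ [y]" unfolding y_def using i(1) by (rule take_Suc_conv_app_nth)
      have "matchable_on R (set (take i ps))"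
        by (rule matchable_on_list) (use ps True i(1) sym in \<open>auto simp: successively_take\<close>)
      moreover have "matchable_on R (set (tl (take (Suc i) ps)))"
        by (rule matchable_on_odd_segment(1)) (use ps True i(1) sym in \<open>auto simp: successively_take\<close>)
      moreover have "take (Suc i) ps = c # tl (take (Suc i) ps)" using ps(3) pne(1) by (cases ps) auto
      then have "set (tl (take (Suc i) ps)) = set (take (Suc i) ps) - {c}" "c \<in> set (take (Suc i) ps)"
        using distinct_take[OF ps(2), of "Suc i"] by (metis Diff_insert_absorb distinct.simps(2) list.simps(15), metis list.set_intros(1))
      moreover have "set (take (Suc i) ps) = insert y (set (take i ps))" unfolding T by simp
      ultimately show ?thesis unfolding legset_def Lv c_def[symmetric] using dp by auto
    qed
    have rest: "matchable_on R (B - {y} - (\<Union>l\<in>I. L l))"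
    proof -
      have "set (drop (Suc j) qs) = {qs ! x | x. j < x \<and> x < length qs}"
      proof (intro equalityI subsetI)
        fix v assume "v \<in> set (drop (Suc j) qs)"
        then obtain x where x: "x < length qs - Suc j" "v = qs ! (Suc j + x)" by (auto simp: in_set_conv_nth)
        then have "Suc j + x < length qs" by linarith
        then show "v \<in> {qs ! x | x. j < x \<and> x < length qs}" using x(2) by (intro CollectI exI[of _ "Suc j + x"]) simp
      next
        fix v assume "v \<in> {qs ! x | x. j < x \<and> x < length qs}"
        then obtain x where "j < x" "x < length qs" "v = qs ! x" by blast
        then have "v = drop (Suc j) qs ! (x - Suc j)" "x - Suc j < length (drop (Suc j) qs)" by auto
        then show "v \<in> set (drop (Suc j) qs)" by (metis nth_mem)
      qed
      then have "is_mate R (B - set ps - set (drop (Suc j) qs)) m" using closed[OF _ jev qs(1) order_refl] by blast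
      moreover have "set ps = set (take i ps) \<union> insert y (set (drop (Suc i) ps))" by (subst psd) simp
      then have "B - {y} - (\<Union>l\<in>I. L l) = B - set ps - set (drop (Suc j) qs)" unfolding I(1) using Lv by auto
      ultimately show ?thesis unfolding matchable_on_def by auto
    qed
    have dis: "L i1 \<inter> L i2 = {}" "L i1 \<inter> L i3 = {}" "L i2 \<inter> L i3 = {}"
      unfolding Lv using dp qd set_take_subset[of i ps] set_drop_subset[of "Suc i" ps] by auto
    have sub: "L l \<subseteq> B - {y} \<and> legset R y (L l) (a l)" if l: "l \<in> I" for l
    proof -
      have "L l \<subseteq> B" using ps(5) qs(5) set_take_subset[of i ps] set_drop_subset[of "Suc i" ps] set_drop_subset[of "Suc j" qs]
        unfolding L_def by auto
      moreover have "legset R y (L l) (a l)" using leg1 leg2 leg3 l unfolding I(1) by blast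
      ultimately show ?thesis unfolding legset_def by blast
    qed
    have "tripod R B I a" unfolding tripod_def
    proof (rule exI[of _ y], rule exI[of _ L], intro conjI ballI impI)
      show "y \<in> B" using yps ps(5) by blast
      show "L l \<inter> L k = {}" if "l \<in> I" "k \<in> I" "l \<noteq> k" for l k using that dis unfolding I(1) by blast
    qed (use sub rest in auto)
    then show ?thesis by blast
  next
    case iodd: False
    \<comment> \<open>Positions at which \<open>qs\<close> meets \<open>ps\<close> with the opposite
      parity; \<open>j\<close> is one of them. The switch between an agreeing meeting and the first
      disagreeing one makes the cycle odd.\<close>
    define Q where "Q x \<longleftrightarrow> x < length qs \<and> (\<exists>y<length ps. qs ! x = ps ! y \<and> even x \<noteq> even y)" for x
    have Qj: "Q j" unfolding Q_def using j i iodd jev by blast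
    define j0 where "j0 = (LEAST x. Q x)"
    have "Q j0" unfolding j0_def using Qj by (rule LeastI)
    then obtain i0 where j0: "j0 < length qs" "i0 < length ps" "qs ! j0 = ps ! i0" "even j0 \<noteq> even i0" unfolding Q_def by blast
    have least: "\<not> Q x" if "x < j0" for x using not_less_Least that unfolding j0_def by blast
    have j00: "j0 \<noteq> 0"
    proof
      assume z: "j0 = 0"
      then have "ps ! i0 = ps ! 0" using j0(3) p0 by simp
      then have "i0 = 0" using ps(2) j0(2) pne(3) by (simp add: nth_eq_iff_index_eq)
      then show False using j0(4) z by simp
    qed
    \<comment> \<open>Were \<open>j0\<close> even, its partner under \<open>m\<close> would be the
      preceding vertex of \<open>qs\<close> and the following one of \<open>ps\<close>, an earlier
      meeting with opposite parity.\<close>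
    have j0odd: "odd j0"
    proof (rule ccontr)
      assume ev: "\<not> odd j0"
      then have io: "odd i0" using j0(4) by simp
      have "qs ! (j0 - 1) = ps ! Suc i0" using qm(2)[OF j0(1)] ev j00 pm(1)[OF j0(2) io] j0(3) by simp
      then have "Q (j0 - 1)" unfolding Q_def using j0(1) pm(1)[OF j0(2) io] ev io j00
        by (intro conjI exI[of _ "Suc i0"]) auto
      then show False using least[of "j0 - 1"] j00 by simp
    qed
    then have i0ev: "even i0" using j0(4) by simp
    \<comment> \<open>The last meeting before \<open>j0\<close>. Its two positions have equal parity
      by the choice of \<open>j0\<close>, and both are even, since otherwise the next vertex would
      be another meeting before \<open>j0\<close>.\<close>
    define x0 where "x0 = Max {x. x < j0 \<and> qs ! x \<in> set ps}"
    have fX: "finite {x. x < j0 \<and> qs ! x \<in> set ps}" by simp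
    have "0 \<in> {x. x < j0 \<and> qs ! x \<in> set ps}" using p0 pne j00 by (metis (mono_tags, lifting) mem_Collect_eq nth_mem neq0_conv)
    then have "x0 \<in> {x. x < j0 \<and> qs ! x \<in> set ps}" unfolding x0_def by (intro Max_in[OF fX]) blast
    then have x0: "x0 < j0" "qs ! x0 \<in> set ps" by auto
    have xmax: "x \<le> x0" if "x < j0" "qs ! x \<in> set ps" for x unfolding x0_def by (rule Max_ge[OF fX]) (use that in simp)
    obtain y0 where y0: "y0 < length ps" "qs ! x0 = ps ! y0" using pin[OF x0(2)] by blast
    have par: "even x0 = even y0" using least[OF x0(1)] x0(1) j0(1) y0 unfolding Q_def by auto
    have x0ev: "even x0"
    proof (rule ccontr)
      assume od: "odd x0"
      have "x0 < length qs" using x0 j0 by simp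
      then have e: "qs ! Suc x0 = ps ! Suc y0" "Suc y0 < length ps" using qm(1)[of x0] od pm(1)[OF y0(1)] par y0(2) by auto
      have "Suc x0 \<noteq> j0" using od j0odd by auto
      then have "Suc x0 < j0" using x0(1) by simp
      then show False using xmax[of "Suc x0"] e by auto
    qed
    have y0ev: "even y0" using par x0ev by simp
    have y0i0: "y0 \<noteq> i0"
    proof
      assume "y0 = i0"
      then have "qs ! x0 = qs ! j0" using y0 j0 by simp
      then show False using qs(2) x0(1) j0(1) by (simp add: nth_eq_iff_index_eq)
    qed
    \<comment> \<open>From the even position \<open>s\<close> to the even position \<open>t\<close>
      the path \<open>ps\<close> has an odd number of vertices, while \<open>qs\<close> has an even
      number strictly between \<open>x0\<close> and \<open>j0\<close>: together an odd
      cycle.\<close>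
    define s t where "s = min y0 i0" and "t = max y0 i0"
    have st: "s < t" "even s" "even t" "t < length ps" unfolding s_def t_def using y0i0 y0ev i0ev y0 j0 by (auto simp: min_def max_def)
    define RR where "RR = take (j0 - Suc x0) (drop (Suc x0) qs)"
    have lRR: "length RR = j0 - Suc x0" unfolding RR_def using j0(1) by simp
    have RRn: "RR ! x = qs ! (Suc x0 + x)" if "x < j0 - Suc x0" for x unfolding RR_def using that j0(1) by simp
    have sRR: "set RR = {qs ! x | x. x0 < x \<and> x < j0}"
    proof (intro equalityI subsetI)
      fix v assume "v \<in> set RR"
      then obtain x where x: "x < j0 - Suc x0" "v = RR ! x" using lRR by (auto simp: in_set_conv_nth)
      then show "v \<in> {qs ! x | x. x0 < x \<and> x < j0}" using RRn[OF x(1)] by (intro CollectI exI[of _ "Suc x0 + x"]) auto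
    next
      fix v assume "v \<in> {qs ! x | x. x0 < x \<and> x < j0}"
      then obtain x where x: "x0 < x" "x < j0" "v = qs ! x" by blast
      then have "v = RR ! (x - Suc x0)" "x - Suc x0 < length RR" using RRn[of "x - Suc x0"] lRR by auto
      then show "v \<in> set RR" by (metis nth_mem)
    qed
    have RRp: "set RR \<inter> set ps = {}"
    proof (rule ccontr)
      assume "\<not> ?thesis"
      then obtain x where "x0 < x" "x < j0" "qs ! x \<in> set ps" unfolding sRR by blast
      then show False using xmax[of x] by simp
    qed
    have Tq: "drop x0 (take (Suc j0) qs) = qs ! x0 # RR @ [qs ! j0]"
    proof (rule nth_equalityI)
      show "length (drop x0 (take (Suc j0) qs)) = length (qs ! x0 # RR @ [qs ! j0])" using lRR x0 j0 by simp
      fix x assume x: "x < length (drop x0 (take (Suc j0) qs))"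
      then have x': "x \<le> j0 - x0" by auto
      have "drop x0 (take (Suc j0) qs) ! x = qs ! (x0 + x)" using x' x0 j0 by simp
      moreover have "(qs ! x0 # RR @ [qs ! j0]) ! x = qs ! (x0 + x)"
      proof (cases x)
        case (Suc z)
        show ?thesis
        proof (cases "z < length RR")
          case True
          then show ?thesis using Suc RRn[of z] lRR by (simp add: nth_append)
        next
          case False
          then have "z = length RR" using x' Suc lRR by simp
          moreover from this have "x0 + x = j0" using Suc lRR x0(1) by simp
          ultimately show ?thesis using Suc by (simp add: nth_append)
        qed
      qed simp
      ultimately show "drop x0 (take (Suc j0) qs) ! x = (qs ! x0 # RR @ [qs ! j0]) ! x" by simp
    qed
    have sT: "successively R (qs ! x0 # RR @ [qs ! j0])" using successively_drop[OF successively_take[OF qs(6)], of x0 "Suc j0"] Tq by simp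
    \<comment> \<open>The arc is reversed if necessary, so that it leads from \<open>ps ! t\<close>
      back to \<open>ps ! s\<close>.\<close>
    define RR' where "RR' = (if y0 = t then RR else rev RR)"
    have setRR': "set RR' = set RR" "length RR' = length RR" "distinct RR'" unfolding RR'_def using qs(2) unfolding RR_def by auto
    have sR': "successively R (ps ! t # RR' @ [ps ! s])"
    proof (cases "y0 = t")
      case True
      then have "s = i0" unfolding s_def t_def by (auto simp: min_def max_def split: if_splits)
      then show ?thesis using sT True y0(2) j0(3) unfolding RR'_def by simp
    next
      case False
      then have "t = i0" "s = y0" unfolding s_def t_def by (auto simp: min_def max_def split: if_splits)
      moreover have "successively (\<lambda>x y. R y x) (qs ! x0 # RR @ [qs ! j0])" using sT by (rule successively_mono) (use sym in auto)
      then have "successively R (rev (qs ! x0 # RR @ [qs ! j0]))" by (simp only: successively_rev)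
      ultimately show ?thesis using False y0(2) j0(3) unfolding RR'_def by simp
    qed
    define seg where "seg = drop s (take (Suc t) ps)"
    have lseg: "length seg = Suc t - s" unfolding seg_def using st by simp
    have segn: "seg ! x = ps ! (s + x)" if "x \<le> t - s" for x unfolding seg_def using that st by simp
    have segne: "seg \<noteq> []" using lseg st by auto
    have hl: "hd seg = ps ! s" "last seg = ps ! t" using segne lseg st segn[of 0] segn[of "t - s"] by (simp_all add: hd_conv_nth last_conv_nth)
    have segp: "set seg \<subseteq> set ps" "distinct seg" "successively R seg" unfolding seg_def
      using ps(2,6) set_drop_subset[of s "take (Suc t) ps"] set_take_subset[of "Suc t" ps] by (auto simp: successively_drop successively_take)
    define cs where "cs = seg @ RR'"
    have cs1: "odd (length cs)" unfolding cs_def using lseg setRR'(2) lRR st j0odd x0ev x0(1) by simp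
    have cs2: "distinct cs" unfolding cs_def using segp setRR' RRp by auto
    have "successively R ((ps ! t # RR') @ [ps ! s])" using sR' by simp
    then have tR: "successively R (ps ! t # RR')" "R (last (ps ! t # RR')) (ps ! s)"
      by (simp_all only: successively_append_iff) simp_all
    have cs3: "successively R cs" unfolding cs_def using segp(3) tR(1) hl(2) segne
      by (auto simp: successively_append_iff successively_Cons)
    have cs4: "R (last cs) (hd cs)" unfolding cs_def using tR(2) hl segne
      by (cases "RR' = []") auto
    define Z where "Z = set cs"
    have ZB: "Z \<subseteq> B" unfolding Z_def cs_def using segp(1) ps(5) setRR'(1) sRR qs(5) j0(1) by auto
    have "card Z = length cs" unfolding Z_def using cs2 by (rule distinct_card)
    moreover have "2 \<le> t - s" using st by presburger
    ultimately have Z3: "3 \<le> card Z" unfolding cs_def using lseg by simp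
    have Zc: "\<forall>w\<in>Z. matchable_on R (Z - {w})" unfolding Z_def using odd_cycle_critical[OF cs1 cs2 cs3 cs4] by blast
    have psd: "ps = take s ps @ seg @ drop (Suc t) ps"
    proof -
      have "take s ps = take s (take (Suc t) ps)" using st by (simp add: min_def)
      then have "take s ps @ seg = take (Suc t) ps" unfolding seg_def by (metis append_take_drop_id)
      then show ?thesis by (metis append.assoc append_take_drop_id)
    qed
    have dps: "distinct (take s ps @ seg @ drop (Suc t) ps)" using ps(2) psd by simp
    have BZ: "matchable_on R (B - Z)"
    proof -
      have m1: "matchable_on R (set (take s ps))"
        by (rule matchable_on_list) (use ps st sym in \<open>auto simp: successively_take\<close>)
      have m2: "matchable_on R (set (drop (Suc t) ps))"
        by (rule matchable_on_list) (use ps st sym in \<open>auto simp: successively_drop\<close>)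
      have m3: "matchable_on R (B - set ps - set RR)"
        using closed[OF sRR x0ev j0odd] j0(1) unfolding matchable_on_def by auto
      have sub: "set (take s ps) \<subseteq> set ps" "set (drop (Suc t) ps) \<subseteq> set ps" by (rule set_take_subset, rule set_drop_subset)
      have "matchable_on R (set (take s ps) \<union> set (drop (Suc t) ps) \<union> (B - set ps - set RR))"
        by (intro matchable_on_Un m1 m2 m3) (use dps sub in auto)
      moreover have "set ps = set (take s ps) \<union> set seg \<union> set (drop (Suc t) ps)" by (subst psd) auto
      then have "set (take s ps) \<union> set (drop (Suc t) ps) \<union> (B - set ps - set RR) = B - Z"
        unfolding Z_def cs_def using setRR'(1) RRp dps ps(5) by auto
      ultimately show ?thesis by simp
    qed
    \<comment> \<open>If nothing is left outside the cycle, the segment is all of \<open>ps\<close>,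
      and \<open>a i2\<close>, the last vertex of \<open>qs\<close>, lies on it at the odd position
      \<open>i\<close>. The terminals then have the positions that \<open>triad_odd_cycle\<close>
      asks for.\<close>
    have "triad R B I a" if ZeqB: "Z = B"
    proof -
      have inseg: "v \<in> set seg" if "v \<in> set ps" for v
      proof -
        have "v \<in> set cs" using that ps(5) ZeqB unfolding Z_def by blast
        then show ?thesis using that RRp setRR'(1) unfolding cs_def by auto
      qed
      have "s = 0"
      proof (rule ccontr)
        assume "s \<noteq> 0"
        then have "c \<in> set (take s ps)" using p0(1) pne st(4) st(1) by (metis (no_types, lifting) hd_conv_nth hd_in_set hd_take neq0_conv take_eq_Nil)
        moreover have "c \<in> set seg" using inseg p0(1) pne(3) nth_mem by blast
        ultimately show False using dps by auto
      qed
      moreover have tl: "t = length ps - 1"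
      proof (rule ccontr)
        assume "t \<noteq> length ps - 1"
        then have "drop (Suc t) ps \<noteq> []" using st(4) by simp
        then have "last ps \<in> set (drop (Suc t) ps)" by (metis last_drop last_in_set length_greater_0_conv length_drop zero_less_diff)
        moreover have "last ps \<in> set seg" using inseg pne(1) by simp
        ultimately show False using dps by auto
      qed
      ultimately have segps: "seg = ps" unfolding seg_def using pne(3) by simp
      have csn: "cs ! x = ps ! x" if "x < length ps" for x unfolding cs_def segps using that by (simp add: nth_append)
      have lq: "last qs = qs ! (length qs - 1)" using pne by (simp add: last_conv_nth)
      have "a i2 \<in> set cs" using a23(1) ZeqB unfolding Z_def by blast
      moreover have "a i2 \<notin> set RR"
      proof
        assume "a i2 \<in> set RR"
        then obtain x where x: "x < j0" "qs ! (length qs - 1) = qs ! x" using qs(4) lq unfolding sRR by auto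
        then have "length qs - 1 = x" using qs(2) j0(1) pne(4) by (simp add: nth_eq_iff_index_eq)
        then show False using x(1) j0(1) by simp
      qed
      ultimately have "a i2 \<in> set ps" unfolding cs_def segps using setRR'(1) by auto
      then have "length qs - 1 \<le> j" using jmax[of "length qs - 1"] qs(4) lq pne(4) by simp
      then have "j = length qs - 1" using j(1) by simp
      then have ai: "a i2 = ps ! i" using i(2) qs(4) lq by simp
      have "i < t" using i(1) tl iodd st(3) by (metis Suc_pred' less_antisym pne(3))
      have "triad R (set cs) I a"
      proof (rule triad_odd_cycle[OF cs1 cs2 cs3 cs4 I, of i t])
        show "a i1 = cs ! 0" using csn[of 0] p0(1) pne(3) c_def by simp
        show "a i2 = cs ! i" using csn[OF i(1)] ai by simp
        show "a i3 = cs ! t" using csn[OF st(4)] ps(4) tl pne(1) by (simp add: last_conv_nth)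
      qed (use iodd \<open>i < t\<close> st cs_def segps in auto)
      then show ?thesis using ZeqB unfolding Z_def by simp
    qed
    then show ?thesis using ZB Z3 Zc BZ by blast
  qed
qed

end

section \<open>Undoing the contraction of a critical set\<close>

definition expand :: "'v set \<Rightarrow> 'v \<Rightarrow> 'v set \<Rightarrow> 'v set" where
  "expand Z z X = (if z \<in> X then X - {z} \<union> Z else X)"

context sym_rel begin

context
  fixes Z :: "'v set" and z :: 'v
  assumes z: "z \<in> Z" and crit: "\<And>w. w \<in> Z \<Longrightarrow> matchable_on R (Z - {w})"
begin

lemma matchable_on_expand:
  assumes "X \<inter> Z \<subseteq> {z}" "matchable_on (collapse R Z z) X"
  shows "matchable_on R (expand Z z X)"
proof (cases "z \<in> X")
  case True
  then have "X \<inter> Z = {z}" using assms(1) z by blast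
  then show ?thesis using collapse_matchable_lift[OF z _ assms(2)] crit True unfolding expand_def by simp
next
  case False
  then have "X \<inter> Z = {}" using assms(1) by blast
  then show ?thesis using collapse_matchable_outside[OF z] assms(2) False unfolding expand_def by simp
qed

text \<open>If the centre is \<open>z\<close>, the legs start at vertices \<open>w i\<close> of
  \<open>Z\<close>, not necessarily distinct, and the structure found in \<open>Z\<close> for these
  terminals is prolonged by the legs. Otherwise \<open>z\<close> lies on a leg or among the matched
  vertices, and \<open>Z\<close> without the one vertex used there is matchable.\<close>

lemma tripod_expand:
  assumes t: "tripod (collapse R Z z) D I p'" and D: "D \<inter> Z \<subseteq> {z}"
    and p: "\<And>i. i \<in> I \<Longrightarrow> p' i = (if p i \<in> Z then z else p i)"
    and IH: "\<And>w. (\<And>i. i \<in> I \<Longrightarrow> w i \<in> Z) \<Longrightarrow> tripod R Z I w \<or> triad R Z I w"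
  shows "tripod R (expand Z z D) I p \<or> triad R (expand Z z D) I p"
proof -
  let ?R = "collapse R Z z"
  obtain y L where y: "y \<in> D" "\<And>i. i \<in> I \<Longrightarrow> L i \<subseteq> D - {y}" "\<And>i. i \<in> I \<Longrightarrow> legset ?R y (L i) (p' i)"
    "\<And>i j. i \<in> I \<Longrightarrow> j \<in> I \<Longrightarrow> i \<noteq> j \<Longrightarrow> L i \<inter> L j = {}" "matchable_on ?R (D - {y} - (\<Union>i\<in>I. L i))"
    using tripodE[OF t] by blast
  show ?thesis
  proof (cases "y = z")
    case True
    have LZ: "L i \<inter> Z = {}" if "i \<in> I" for i using y(2)[OF that] True D by blast
    have ex: "\<exists>w\<in>Z. legset R w (L i) (p i)" if i: "i \<in> I" for i
    proof -
      have l: "p' i \<in> insert z (L i)" "matchable_on ?R (L i)" "matchable_on ?R (insert z (L i) - {p' i})"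
        using y(3)[OF i] unfolding legset_def True by auto
      have mL: "matchable_on R (L i)" using collapse_matchable_outside[OF z LZ[OF i]] l(2) by simp
      show ?thesis
      proof (cases "p i \<in> Z")
        case True
        then have "p i \<notin> L i" using LZ[OF i] by blast
        then have "legset R (p i) (L i) (p i)" unfolding legset_def using mL by simp
        then show ?thesis using True by blast
      next
        case False
        then have pp: "p' i = p i" using p[OF i] by simp
        then have pz: "p i \<noteq> z" using False z by blast
        obtain n where n: "is_mate ?R (insert z (L i) - {p i}) n" using l(3) pp unfolding matchable_on_def by auto
        have zin: "z \<in> insert z (L i) - {p i}" using pz by simp
        note q = is_mateD[OF n zin]
        have nz: "n z \<in> L i" "n z \<notin> Z" "n z \<noteq> p i" using q LZ[OF i] by auto
        obtain w where w: "w \<in> Z" "R w (n z)" using q(4) nz(2) z unfolding collapse_def by blast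
        have "is_mate ?R (L i - {p i} - {n z}) n"
        proof (rule is_mate_subset[OF n])
          fix u assume u: "u \<in> L i - {p i} - {n z}"
          have uz: "u \<noteq> z" using u LZ[OF i] z by blast
          note qu = is_mateD[OF n, of u]
          have "n u \<noteq> z" using qu u by auto
          moreover have "n u \<noteq> n z" using qu(2) q(2) u uz by auto
          ultimately show "n u \<in> L i - {p i} - {n z}" using qu u by auto
        qed auto
        moreover have "(L i - {p i} - {n z}) \<inter> Z = {}" using LZ[OF i] by blast
        ultimately have m1: "matchable_on R (L i - {p i} - {n z})"
          using collapse_matchable_outside[OF z] unfolding matchable_on_def by blast
        have "matchable_on R {w, n z}" by (rule matchable_on_pair) (use w nz sym in auto)
        then have "matchable_on R ({w, n z} \<union> (L i - {p i} - {n z}))" by (rule matchable_on_Un[OF _ m1]) (use w LZ[OF i] in blast)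
        moreover have "{w, n z} \<union> (L i - {p i} - {n z}) = insert w (L i) - {p i}" using nz w False by auto
        moreover have "w \<notin> L i" using w LZ[OF i] by blast
        moreover have "p i \<in> insert w (L i)" using l(1) pp pz by auto
        ultimately have "legset R w (L i) (p i)" unfolding legset_def using mL by simp
        then show ?thesis using w(1) by blast
      qed
    qed
    then obtain w where w: "\<And>i. i \<in> I \<Longrightarrow> w i \<in> Z \<and> legset R (w i) (L i) (p i)" by metis
    let ?C = "D - {z} - (\<Union>i\<in>I. L i)"
    have mC: "matchable_on R ?C"
      using collapse_matchable_outside[OF z, of ?C] D y(5) True by blast
    have ZC: "(Z \<union> (\<Union>i\<in>I. L i)) \<inter> ?C = {}" using D by blast
    have ed: "expand Z z D = Z \<union> (\<Union>i\<in>I. L i) \<union> ?C" unfolding expand_def using y(1,2) True by auto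
    have k1: "\<And>i. i \<in> I \<Longrightarrow> legset R (w i) (L i) (p i)" "\<And>i. i \<in> I \<Longrightarrow> L i \<inter> Z = {}" using w LZ by blast+
    consider "tripod R Z I w" | "triad R Z I w" using IH[of w] w by blast
    then show ?thesis
    proof cases
      case 1
      then have "tripod R (Z \<union> (\<Union>i\<in>I. L i)) I p" by (rule tripod_extend[OF _ k1 y(4)])
      then show ?thesis unfolding ed using tripod_add[OF _ mC ZC] by blast
    next
      case 2
      then have "triad R (Z \<union> (\<Union>i\<in>I. L i)) I p" by (rule triad_extend[OF _ k1 y(4)])
      then show ?thesis unfolding ed using triad_add[OF _ mC ZC] by blast
    qed
  next
    case False
    then have yZ: "y \<notin> Z" using y(1) D by blast
    let ?E = "expand Z z"
    have LZ: "L i \<inter> Z \<subseteq> {z}" if "i \<in> I" for i using y(2)[OF that] D by blast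
    have eD: "?E X \<subseteq> ?E D - {y}" if "X \<subseteq> D - {y}" for X
      using that yZ D unfolding expand_def by auto
    have leg: "legset R y (?E (L i)) (p i)" if i: "i \<in> I" for i
    proof -
      have l: "y \<notin> L i" "p' i \<in> insert y (L i)" "matchable_on ?R (L i)" "matchable_on ?R (insert y (L i) - {p' i})"
        using y(3)[OF i] unfolding legset_def by auto
      have "matchable_on R (?E (L i))" by (rule matchable_on_expand[OF LZ[OF i] l(3)])
      moreover have yE: "y \<notin> ?E (L i)" using l(1) yZ unfolding expand_def by auto
      moreover have "p i \<in> insert y (?E (L i)) \<and> matchable_on R (insert y (?E (L i)) - {p i})"
      proof (cases "p i \<in> Z")
        case True
        then have pz: "p' i = z" using p[OF i] by simp
        then have zL: "z \<in> L i" using l(2) False by blast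
        have "(insert y (L i) - {z}) \<inter> Z = {}" using LZ[OF i] yZ by blast
        then have "matchable_on R (insert y (L i) - {z})" using collapse_matchable_outside[OF z] l(4) pz by simp
        then have "matchable_on R ((insert y (L i) - {z}) \<union> (Z - {p i}))"
          by (rule matchable_on_Un[OF _ crit[OF True]]) (use LZ[OF i] yZ in blast)
        moreover have "(insert y (L i) - {z}) \<union> (Z - {p i}) = insert y (?E (L i)) - {p i}"
          unfolding expand_def using zL True yZ LZ[OF i] z by auto
        ultimately show ?thesis using True zL unfolding expand_def by simp
      next
        case pZ: False
        then have pp: "p' i = p i" "p i \<noteq> z" using p[OF i] z by auto
        have "(insert y (L i) - {p i}) \<inter> Z \<subseteq> {z}" using LZ[OF i] yZ by blast
        then have "matchable_on R (?E (insert y (L i) - {p i}))" using matchable_on_expand l(4) pp by simp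
        moreover have "?E (insert y (L i) - {p i}) = insert y (?E (L i)) - {p i}"
          unfolding expand_def using pp(2) pZ False yZ by auto
        moreover have "p i \<in> insert y (?E (L i))" using l(2) pp unfolding expand_def by auto
        ultimately show ?thesis by simp
      qed
      ultimately show ?thesis unfolding legset_def by blast
    qed
    have dis: "?E (L i) \<inter> ?E (L j) = {}" if ij: "i \<in> I" "j \<in> I" "i \<noteq> j" for i j
      using y(4)[OF ij] LZ[OF ij(1)] LZ[OF ij(2)] unfolding expand_def by auto
    have rest: "matchable_on R (?E D - {y} - (\<Union>i\<in>I. ?E (L i)))"
    proof -
      have "matchable_on R (?E (D - {y} - (\<Union>i\<in>I. L i)))" by (rule matchable_on_expand[OF _ y(5)]) (use D in blast)
      moreover have "?E (D - {y} - (\<Union>i\<in>I. L i)) = ?E D - {y} - (\<Union>i\<in>I. ?E (L i))"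
      proof (cases "z \<in> (\<Union>i\<in>I. L i)")
        case True
        then obtain k where k: "k \<in> I" "z \<in> L k" by blast
        have zk: "z \<notin> L i" if "i \<in> I" "i \<noteq> k" for i using y(4)[OF that(1) k(1) that(2)] k(2) by blast
        have "?E (L i) = (if i = k then L k - {z} \<union> Z else L i)" if "i \<in> I" for i
          using zk[OF that] k(2) unfolding expand_def by simp
        then have "(\<Union>i\<in>I. ?E (L i)) = (\<Union>i\<in>I. if i = k then L k - {z} \<union> Z else L i)" by simp
        also have "\<dots> = ((\<Union>i\<in>I. L i) - {z}) \<union> Z" using k zk by (auto split: if_splits)
        finally have "(\<Union>i\<in>I. ?E (L i)) = ((\<Union>i\<in>I. L i) - {z}) \<union> Z" .
        moreover have "z \<in> D" using k y(2) by blast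
        ultimately show ?thesis using True D yZ unfolding expand_def by auto
      next
        case Fz: False
        then have "?E (L i) = L i" if "i \<in> I" for i using that unfolding expand_def by auto
        then have "(\<Union>i\<in>I. ?E (L i)) = (\<Union>i\<in>I. L i)" by simp
        moreover have "(\<Union>i\<in>I. L i) \<inter> Z = {}" using LZ Fz by blast
        ultimately show ?thesis using Fz yZ False unfolding expand_def by auto
      qed
      ultimately show ?thesis by simp
    qed
    have "y \<in> ?E D" using y(1) False unfolding expand_def by auto
    then have "tripod R (?E D) I p"
      unfolding tripod_def using leg dis rest eD[OF y(2)] by (intro exI[of _ y] exI[of _ "\<lambda>i. ?E (L i)"]) simp
    then show ?thesis by blast
  qed
qed

text \<open>The corner that contains \<open>z\<close> may itself become a triad when it is expanded;
  this is where \<open>triad_nested\<close> is needed.\<close>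

lemma triad_expand:
  assumes t: "triad (collapse R Z z) D I p'" and D: "D \<inter> Z \<subseteq> {z}" and I: "card I = 3"
    and p: "\<And>i. i \<in> I \<Longrightarrow> p' i = (if p i \<in> Z then z else p i)"
    and IH: "\<And>w. (\<And>i. i \<in> I \<Longrightarrow> w i \<in> Z) \<Longrightarrow> tripod R Z I w \<or> triad R Z I w"
  shows "tripod R (expand Z z D) I p \<or> triad R (expand Z z D) I p"
proof -
  let ?R = "collapse R Z z" let ?E = "expand Z z"
  obtain C q where C: "\<And>i. i \<in> I \<Longrightarrow> C i \<subseteq> D" "\<And>i. i \<in> I \<Longrightarrow> tripod ?R (C i) I (port p' q i)"
    "\<And>i j. i \<in> I \<Longrightarrow> j \<in> I \<Longrightarrow> i \<noteq> j \<Longrightarrow> C i \<inter> C j = {}" "\<And>i j. i \<in> I \<Longrightarrow> j \<in> I \<Longrightarrow> i \<noteq> j \<Longrightarrow> ?R (q i j) (q j i)"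
    "matchable_on ?R (D - (\<Union>i\<in>I. C i))" using triadE[OF t] by blast
  have CZ: "C i \<inter> Z \<subseteq> {z}" if "i \<in> I" for i using C(1)[OF that] D by blast
  have qC: "q i j \<in> C i" if "i \<in> I" "j \<in> I" "i \<noteq> j" for i j
    using tripod_terminal(1)[OF C(2)[OF that(1)] that(2)] that(3) unfolding port_def by simp
  \<comment> \<open>A triangle edge that ended in \<open>z\<close> gets an end in \<open>Z\<close>
    adjacent to its other end. The two ends cannot both be \<open>z\<close>, because the corners are
    disjoint.\<close>
  define r where "r i j = (if q i j = z then (SOME w. w \<in> Z \<and> R w (q j i)) else q i j)" for i j
  have r: "q i j = (if r i j \<in> Z then z else r i j) \<and> R (r i j) (r j i)" if ij: "i \<in> I" "j \<in> I" "i \<noteq> j" for i j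
  proof -
    have link: "?R (q i j) (q j i)" by (rule C(4)[OF ij])
    have ne: "q i j \<noteq> q j i" using qC[OF ij] qC[OF ij(2,1) ij(3)[symmetric]] C(3)[OF ij] by auto
    have out: "q k l \<notin> Z" if "k \<in> I" "l \<in> I" "k \<noteq> l" "q k l \<noteq> z" for k l using qC[OF that(1-3)] CZ[OF that(1)] that(4) by blast
    consider "q i j = z" "q j i \<noteq> z" | "q j i = z" "q i j \<noteq> z" | "q i j \<noteq> z" "q j i \<noteq> z" using ne by metis
    then show ?thesis
    proof cases
      case 1
      have o: "q j i \<notin> Z" using out[OF ij(2,1) _ 1(2)] ij(3) by simp
      then have "\<exists>w. w \<in> Z \<and> R w (q j i)" using link 1 z unfolding collapse_def by auto
      then have "r i j \<in> Z \<and> R (r i j) (q j i)" unfolding r_def using 1(1) by (simp add: someI_ex[where P = "\<lambda>w. w \<in> Z \<and> R w (q j i)"])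
      then show ?thesis using 1 unfolding r_def[of j i] by simp
    next
      case 2
      have o: "q i j \<notin> Z" using out[OF ij 2(2)] .
      then have "\<exists>w. w \<in> Z \<and> R w (q i j)" using link 2 z sym unfolding collapse_def by auto
      then have "r j i \<in> Z \<and> R (r j i) (q i j)" unfolding r_def using 2(1) by (simp add: someI_ex[where P = "\<lambda>w. w \<in> Z \<and> R w (q i j)"])
      then show ?thesis using 2 o sym unfolding r_def[of i j] by simp
    next
      case 3
      have o: "q i j \<notin> Z" "q j i \<notin> Z" using out[OF ij 3(1)] out[OF ij(2,1) _ 3(2)] ij(3) by auto
      then have "R (q i j) (q j i)" using link z 3 unfolding collapse_def by blast
      then show ?thesis using 3 o unfolding r_def by simp
    qed
  qed
  have sub: "?E (C i) \<subseteq> ?E D" if "i \<in> I" for i using C(1)[OF that] unfolding expand_def by auto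
  have dis: "?E (C i) \<inter> ?E (C j) = {}" if ij: "i \<in> I" "j \<in> I" "i \<noteq> j" for i j
    using C(3)[OF ij] CZ[OF ij(1)] CZ[OF ij(2)] unfolding expand_def by auto
  have tt: "tripod R (?E (C i)) I (port p r i) \<or> triad R (?E (C i)) I (port p r i)" if i: "i \<in> I" for i
  proof (rule tripod_expand[OF C(2)[OF i] CZ[OF i] _ IH])
    fix j assume j: "j \<in> I"
    show "port p' q i j = (if port p r i j \<in> Z then z else port p r i j)"
      using p[OF i] r[OF i j] unfolding port_def by auto
  qed
  have rest: "matchable_on R (?E D - (\<Union>i\<in>I. ?E (C i)))"
  proof -
    have "matchable_on R (?E (D - (\<Union>i\<in>I. C i)))" by (rule matchable_on_expand[OF _ C(5)]) (use D in blast)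
    moreover have "?E (D - (\<Union>i\<in>I. C i)) = ?E D - (\<Union>i\<in>I. ?E (C i))"
    proof (cases "z \<in> (\<Union>i\<in>I. C i)")
      case True
      then obtain k where k: "k \<in> I" "z \<in> C k" by blast
      have zk: "z \<notin> C i" if "i \<in> I" "i \<noteq> k" for i using C(3)[OF that(1) k(1) that(2)] k(2) by blast
      have "?E (C i) = (if i = k then C k - {z} \<union> Z else C i)" if "i \<in> I" for i
        using zk[OF that] k(2) unfolding expand_def by simp
      then have "(\<Union>i\<in>I. ?E (C i)) = (\<Union>i\<in>I. if i = k then C k - {z} \<union> Z else C i)" by simp
      also have "\<dots> = ((\<Union>i\<in>I. C i) - {z}) \<union> Z" using k zk by (auto split: if_splits)
      finally have "(\<Union>i\<in>I. ?E (C i)) = ((\<Union>i\<in>I. C i) - {z}) \<union> Z" .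
      moreover have "z \<in> D" using k C(1) by blast
      ultimately show ?thesis using True D unfolding expand_def by auto
    next
      case Fz: False
      then have "?E (C i) = C i" if "i \<in> I" for i using that unfolding expand_def by auto
      then have "(\<Union>i\<in>I. ?E (C i)) = (\<Union>i\<in>I. C i)" by simp
      moreover have "(\<Union>i\<in>I. C i) \<inter> Z = {}" using CZ Fz by blast
      ultimately show ?thesis using Fz unfolding expand_def by auto
    qed
    ultimately show ?thesis by simp
  qed
  show ?thesis by (rule triad_nested[OF I sub tt dis _ rest]) (use r in auto)
qed

end

text \<open>For \<open>v\<close> outside \<open>Z\<close>, the alternating path that leaves
  \<open>v\<close> along the matching of \<open>B - Z\<close> must reach \<open>Z\<close> along the
  matching of \<open>B - {v}\<close>. Its last edge becomes the edge at \<open>z\<close>.\<close>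

lemma near_perfect_collapse:
  assumes fB: "finite B" and Z: "Z \<subseteq> B" "z \<in> Z" "matchable_on R (B - Z)" and v: "v \<in> B" "matchable_on R (B - {v})"
  shows "matchable_on (collapse R Z z) (insert z (B - Z) - {if v \<in> Z then z else v})"
proof (cases "v \<in> Z")
  case True
  have "insert z (B - Z) - {z} = B - Z" using Z(2) by blast
  moreover have "matchable_on (collapse R Z z) (B - Z)" using collapse_matchable_outside[OF Z(2)] Z(3) by blast
  ultimately show ?thesis using True by simp
next
  case False
  obtain m where m: "is_mate R (B - Z) m" using Z(3) unfolding matchable_on_def by blast
  obtain n where n: "is_mate R (B - {v}) n" using v(2) unfolding matchable_on_def by blast
  have vW: "v \<in> B - Z" using v(1) False by blast
  note mv = is_mateD[OF m vW]
  let ?L = "B - Z - {v, m v}"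
  have ins: "insert (m v) ?L = B - Z - {v}" using mv by auto
  have "is_mate R ?L m"
  proof (rule is_mate_subset[OF m])
    fix u assume u: "u \<in> ?L"
    note q = is_mateD[OF m, of u]
    have "m u \<noteq> v" "m u \<noteq> m v" using q mv u by auto
    then show "m u \<in> ?L" using q u by auto
  qed auto
  then have "\<exists>P u. P \<subseteq> insert (m v) ?L \<and> u \<in> P \<and> n u \<notin> insert (m v) ?L \<and> (\<forall>x\<in>P - {u}. n x \<in> P - {u}) \<and>
      matchable_on R (insert (m v) ?L - P)"
    by (intro alternating_exit) (use fB is_mateD[OF n] mv in auto)
  then obtain P u where P: "P \<subseteq> B - Z - {v}" "u \<in> P" "n u \<notin> B - Z - {v}" "\<And>x. x \<in> P - {u} \<Longrightarrow> n x \<in> P - {u}"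
    "matchable_on R (B - Z - {v} - P)" unfolding ins by blast
  have uB: "u \<in> B - {v}" using P(1,2) by blast
  note nu = is_mateD[OF n uB]
  have nuZ: "n u \<in> Z" using nu(1) P(3) by blast
  have uZ: "u \<notin> Z" using P(1,2) by blast
  have m1: "matchable_on R (P - {u})"
    unfolding matchable_on_def by (rule exI, rule is_mate_subset[OF n]) (use P(1,4) in auto)
  have "matchable_on R ((P - {u}) \<union> (B - Z - {v} - P))" by (rule matchable_on_Un[OF m1 P(5)]) blast
  then have m2: "matchable_on (collapse R Z z) ((P - {u}) \<union> (B - Z - {v} - P))"
    by (subst collapse_matchable_outside[OF Z(2)]) (use P(1) in auto)
  have "collapse R Z z z u" "collapse R Z z u z" unfolding collapse_def using uZ nuZ nu(4) sym by blast+
  then have "matchable_on (collapse R Z z) {z, u}" by (rule matchable_on_pair) (use uZ Z(2) in blast)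
  then have "matchable_on (collapse R Z z) ({z, u} \<union> ((P - {u}) \<union> (B - Z - {v} - P)))"
    by (rule matchable_on_Un[OF _ m2]) (use P(1,2) Z(2) in blast)
  moreover have "{z, u} \<union> ((P - {u}) \<union> (B - Z - {v} - P)) = insert z (B - Z) - {v}" using P(1,2) Z(2) False by blast
  ultimately show ?thesis using False by simp
qed

end

text \<open>Either the alternating paths between the terminals form a tripod, or they close an odd cycle, which
  is contracted.\<close>

theorem three_terminals:
  assumes "sym_rel R" "finite B" "card I = 3" "\<And>i. i \<in> I \<Longrightarrow> a i \<in> B" "\<And>i. i \<in> I \<Longrightarrow> matchable_on R (B - {a i})"
  shows "tripod R B I a \<or> triad R B I a"
  using assms(1,2,4,5)
proof (induction "card B" arbitrary: R B a rule: less_induct)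
  case less
  interpret sym_rel R by (rule less.prems(1))
  obtain i1 i2 i3 where I: "I = {i1, i2, i3}" "i1 \<noteq> i2" "i1 \<noteq> i3" "i2 \<noteq> i3"
    using assms(3) by (metis card_3_iff)
  have dich: "tripod R B I a \<or> (\<exists>Z\<subseteq>B. 3 \<le> card Z \<and> (\<forall>w\<in>Z. matchable_on R (Z - {w})) \<and> matchable_on R (B - Z) \<and>
      (Z = B \<longrightarrow> triad R B I a))"
    by (rule tripod_or_odd_cycle[OF less.prems(2) I less.prems(3,4)])
  show ?case
  proof (cases "tripod R B I a")
    case False
    then have "\<exists>Z. Z \<subseteq> B \<and> 3 \<le> card Z \<and> (\<forall>w\<in>Z. matchable_on R (Z - {w})) \<and> matchable_on R (B - Z) \<and> (Z = B \<longrightarrow> triad R B I a)"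
      using dich by simp
    then obtain Z where "Z \<subseteq> B \<and> 3 \<le> card Z \<and> (\<forall>w\<in>Z. matchable_on R (Z - {w})) \<and> matchable_on R (B - Z) \<and> (Z = B \<longrightarrow> triad R B I a)" ..
    then have 2: "Z \<subseteq> B" "3 \<le> card Z" "\<forall>w\<in>Z. matchable_on R (Z - {w})" "matchable_on R (B - Z)" "Z = B \<longrightarrow> triad R B I a"
      by simp_all
    show ?thesis
    proof (cases "Z = B")
      case False
      then have ZB: "Z \<subset> B" using 2(1) by blast
      obtain z where z: "z \<in> Z" using 2(2) by fastforce
      let ?R = "collapse R Z z" let ?B = "insert z (B - Z)" let ?a = "\<lambda>i. if a i \<in> Z then z else a i"
      have fZ: "finite Z" using less.prems(2) 2(1) finite_subset by blast
      have crit: "\<And>w. w \<in> Z \<Longrightarrow> matchable_on R (Z - {w})" using 2(3) by blast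
      \<comment> \<open>The induction hypothesis is used twice: for \<open>Z\<close>, which is a
        proper subset, and for the contracted set, which is smaller because \<open>Z\<close> has at
        least three vertices.\<close>
      have IHZ: "tripod R Z I w \<or> triad R Z I w" if "\<And>i. i \<in> I \<Longrightarrow> w i \<in> Z" for w
        by (rule less.hyps[OF psubset_card_mono[OF less.prems(2) ZB] less.prems(1) fZ]) (use that crit in auto)
      have "card ?B \<le> Suc (card B - card Z)" using z fZ 2(1) less.prems(2) by (simp add: card_insert_if card_Diff_subset)
      moreover have "card Z \<le> card B" using 2(1) less.prems(2) card_mono by blast
      ultimately have c: "card ?B < card B" using 2(2) by linarith
      have "tripod ?R ?B I ?a \<or> triad ?R ?B I ?a"
      proof (rule less.hyps[OF c sym_rel_collapse[OF z]])
        fix i assume i: "i \<in> I"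
        show "?a i \<in> ?B" using less.prems(3)[OF i] by auto
        show "matchable_on ?R (?B - {?a i})"
          by (rule near_perfect_collapse[OF less.prems(2) 2(1) z 2(4) less.prems(3)[OF i] less.prems(4)[OF i]])
      qed (use less.prems(2) in simp)
      moreover have "?B \<inter> Z \<subseteq> {z}" by blast
      moreover have "expand Z z ?B = B" unfolding expand_def using z 2(1) by auto
      ultimately show ?thesis
        using tripod_expand[OF z crit, of ?B I ?a a] triad_expand[OF z crit, of ?B I ?a a] IHZ assms(3) by auto
    qed (use 2(5) in blast)
  qed blast
qed

section \<open>Lifting minors\<close>

text \<open>\<open>J\<close> is obtained from a conformal subgraph of \<open>G\<close> by shrinking the vertex sets \<open>B w\<close>; the edge \<open>f\<close> of \<open>J\<close>
  is the edge \<open>h f\<close> of \<open>G\<close>, which meets \<open>B w\<close> in \<open>c w f\<close>.\<close>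

definition frame :: "('w, 'f) mgraph \<Rightarrow> ('v, 'e) mgraph \<Rightarrow> ('w \<Rightarrow> 'v set) \<Rightarrow> ('f \<Rightarrow> 'e) \<Rightarrow> ('w \<Rightarrow> 'f \<Rightarrow> 'v) \<Rightarrow> bool" where
  "frame J G B h c \<longleftrightarrow> (\<forall>w\<in>verts J. B w \<subseteq> verts G) \<and> (\<forall>v\<in>verts J. \<forall>w\<in>verts J. v \<noteq> w \<longrightarrow> B v \<inter> B w = {}) \<and>
     matchable_on (adj G) (verts G - (\<Union>w\<in>verts J. B w)) \<and> inj_on h (edges J) \<and> h ` edges J \<subseteq> edges G \<and>
     (\<forall>f\<in>edges J. (\<forall>w\<in>ends J f. c w f \<in> B w) \<and> ends G (h f) = (\<lambda>w. c w f) ` ends J f)"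

definition bag_minor :: "('w, 'f) mgraph \<Rightarrow> ('v, 'e) mgraph \<Rightarrow> bool" where
  "bag_minor J G \<longleftrightarrow> (\<exists>B h c. frame J G B h c \<and>
     (\<forall>f\<in>edges J. \<forall>w\<in>ends J f. matchable_on (adj G) (B w - {c w f})))"

lemma frameD:
  assumes "frame J G B h c"
  shows "\<And>w. w \<in> verts J \<Longrightarrow> B w \<subseteq> verts G" "\<And>v w. v \<in> verts J \<Longrightarrow> w \<in> verts J \<Longrightarrow> v \<noteq> w \<Longrightarrow> B v \<inter> B w = {}"
    "matchable_on (adj G) (verts G - (\<Union>w\<in>verts J. B w))" "inj_on h (edges J)" "h ` edges J \<subseteq> edges G"
    "\<And>f w. f \<in> edges J \<Longrightarrow> w \<in> ends J f \<Longrightarrow> c w f \<in> B w" "\<And>f. f \<in> edges J \<Longrightarrow> ends G (h f) = (\<lambda>w. c w f) ` ends J f"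
  using assms unfolding frame_def by auto

lemma bag_minor_iso:
  assumes G: "multigraph G" and iso: "graph_iso G J"
  shows "bag_minor J G"
proof -
  obtain f g where f: "bij_betw f (verts G) (verts J)" and g: "bij_betw g (edges G) (edges J)"
    and fg: "\<forall>e\<in>edges G. ends J (g e) = f ` ends G e" using iso unfolding graph_iso_def by blast
  define F where "F = inv_into (verts G) f"
  define H where "H = inv_into (edges G) g"
  have F: "bij_betw F (verts J) (verts G)" unfolding F_def by (rule bij_betw_inv_into[OF f])
  have H: "bij_betw H (edges J) (edges G)" unfolding H_def by (rule bij_betw_inv_into[OF g])
  have Ff: "F (f x) = x" if "x \<in> verts G" for x unfolding F_def using f that by (simp add: bij_betw_inv_into_left)
  have gH: "g (H d) = d" if "d \<in> edges J" for d unfolding H_def using g that by (simp add: bij_betw_inv_into_right)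
  have HG: "H d \<in> edges G" if "d \<in> edges J" for d using H that unfolding bij_betw_def by blast
  have "frame J G (\<lambda>w. {F w}) H (\<lambda>w d. F w)"
    unfolding frame_def
  proof (intro conjI ballI impI)
    show "{F w} \<subseteq> verts G" if "w \<in> verts J" for w using F that unfolding bij_betw_def by blast
    show "{F v} \<inter> {F w} = {}" if "v \<in> verts J" "w \<in> verts J" "v \<noteq> w" for v w
      using F that unfolding bij_betw_def inj_on_def by blast
    have "(\<Union>w\<in>verts J. {F w}) = verts G" using F unfolding bij_betw_def by blast
    then show "matchable_on (adj G) (verts G - (\<Union>w\<in>verts J. {F w}))" by simp
    show "inj_on H (edges J)" "H ` edges J \<subseteq> edges G" using H unfolding bij_betw_def by auto
    fix d assume d: "d \<in> edges J"
    show "F w \<in> {F w}" for w by simp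
    have "ends J d = f ` ends G (H d)" using fg HG[OF d] gH[OF d] by metis
    then have "F ` ends J d = (\<lambda>x. F (f x)) ` ends G (H d)" by (simp add: image_image)
    also have "\<dots> = (\<lambda>x. x) ` ends G (H d)" by (rule image_cong) (use Ff multigraphD(3)[OF G HG[OF d]] in auto)
    finally show "ends G (H d) = F ` ends J d" by simp
  qed
  then show ?thesis unfolding bag_minor_def by (intro exI[of _ "\<lambda>w. {F w}"] exI[of _ H] exI[of _ "\<lambda>w d. F w"]) auto
qed

lemma bag_minor_subgraph:
  assumes sub: "verts K \<subseteq> verts G" "edges K \<subseteq> edges G" "ends K = ends G"
    and mt: "matchable_on (adj G) (verts G - verts K)" and bm: "bag_minor J K"
  shows "bag_minor J G"
proof -
  obtain B h c where fr: "frame J K B h c" and w: "\<And>f w. f \<in> edges J \<Longrightarrow> w \<in> ends J f \<Longrightarrow> matchable_on (adj K) (B w - {c w f})"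
    using bm unfolding bag_minor_def by blast
  note F = frameD[OF fr]
  have up: "matchable_on (adj G) U" if "matchable_on (adj K) U" for U
    using that by (rule matchable_on_mono) (use sub in \<open>auto simp: adj_def\<close>)
  have "matchable_on (adj G) ((verts K - (\<Union>w\<in>verts J. B w)) \<union> (verts G - verts K))"
    by (rule matchable_on_Un[OF up[OF F(3)] mt]) blast
  moreover have "(\<Union>w\<in>verts J. B w) \<subseteq> verts K" using F(1) by blast
  then have "(verts K - (\<Union>w\<in>verts J. B w)) \<union> (verts G - verts K) = verts G - (\<Union>w\<in>verts J. B w)" using sub(1) by blast
  ultimately have m: "matchable_on (adj G) (verts G - (\<Union>w\<in>verts J. B w))" by simp
  have s: "\<And>w. w \<in> verts J \<Longrightarrow> B w \<subseteq> verts G" "h ` edges J \<subseteq> edges G" using F(1,5) sub by blast+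
  have "frame J G B h c" unfolding frame_def using F s m sub(3) by simp
  then show ?thesis unfolding bag_minor_def using w up by blast
qed

lemma internal_verts_matchable:
  assumes G: "multigraph G" and P: "odd_ear_path G P"
  shows "matchable_on (adj G) (internal_verts P)" "internal_verts P \<subseteq> set (fst P)" "internal_verts P \<subseteq> verts G"
proof -
  obtain vs es where Pe: "P = (vs, es)" by (cases P)
  have p: "length vs = Suc (length es)" "distinct vs" "set vs \<subseteq> verts G" "odd (length es)"
    "\<And>i. i < length es \<Longrightarrow> es ! i \<in> edges G \<and> ends G (es ! i) = {vs ! i, vs ! Suc i}"
    using P unfolding odd_ear_path_def is_path_def Pe by auto
  have "successively (adj G) vs" unfolding successively_conv_nth
  proof (intro allI impI)
    fix i assume "Suc i < length vs"
    then show "adj G (vs ! i) (vs ! Suc i)" using p(5)[of i] p(1) unfolding adj_def by auto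
  qed
  then have s: "successively (adj G) (butlast (tl vs))"
    by (simp add: successively_conv_nth nth_butlast nth_tl)
  have "even (length (butlast (tl vs)))" using p(1,4) by simp
  moreover have "distinct (butlast (tl vs))" using p(2) by (simp add: distinct_tl distinct_butlast)
  ultimately have "matchable_on (adj G) (set (butlast (tl vs)))"
    using s sym_rel.sym[OF sym_rel_adj[OF G]] by (intro matchable_on_list)
  then show "matchable_on (adj G) (internal_verts P)" unfolding internal_verts_def Pe by simp
  have "set (butlast (tl vs)) \<subseteq> set vs" by (cases vs) (auto dest: in_set_butlastD)
  then show "internal_verts P \<subseteq> set (fst P)" "internal_verts P \<subseteq> verts G" using p(3) unfolding internal_verts_def Pe by auto
qed

text \<open>The contraction vertex, be it in a bag or among the matched vertices, is replaced by all
  of \<open>X\<close>. Whatever edge is used at it, the other contraction provides a matching of the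
  rest of \<open>X\<close>.\<close>

lemma bag_minor_contract:
  fixes G :: "('v, 'e) mgraph" and J :: "('w, 'f) mgraph"
  assumes J: "multigraph J" and sep: "separating G X" and bm: "bag_minor J (contract G X)"
  shows "bag_minor J G"
proof -
  let ?K = "contract G X" let ?z = "SOME x. x \<in> X" let ?E = "expand X ?z"
  let ?Y = "verts G - X" let ?y = "SOME y. y \<in> ?Y" let ?H = "contract G ?Y"
  have G: "multigraph G" and X: "X \<noteq> {}" "X \<subset> verts G" and mH: "matching_covered ?H"
    using sep unfolding separating_def matching_covered_def by auto
  interpret G: sym_rel "adj G" by (rule sym_rel_adj[OF G])
  have Y: "?Y \<noteq> {}" "?Y \<subseteq> verts G" using X by blast+
  have z: "?z \<in> X" and y: "?y \<in> ?Y" using rep_in[OF X(1)] rep_in[OF Y(1)] .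
  have aK: "adj ?K = collapse (adj G) X ?z" by (rule adj_contract[OF G X(1)])
  have aH: "adj ?H = collapse (adj G) ?Y ?y" by (rule adj_contract[OF G Y(1)])
  have vK: "verts ?K = insert ?z (verts G - X)" by (rule verts_contract) (use X in auto)
  have vH: "verts ?H = insert ?y X" using verts_contract[OF Y] X(2) by (simp add: double_diff)
  have H: "multigraph ?H" using mH unfolding matching_covered_def by simp
  \<comment> \<open>The edge from \<open>w\<close> to the contracted complement lies in a perfect
    matching of the other contraction, and the rest of that matching stays in
    \<open>X\<close>.\<close>
  have crit: "matchable_on (adj G) (X - {w})" if w: "w \<in> X" "v \<notin> X" "adj G w v" for w v
  proof -
    have vY: "v \<in> ?Y" using adjD[OF G w(3)] w(2) by blast
    have a: "adj ?H w ?y" unfolding aH collapse_def using w vY by blast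
    have "matchable_on (adj ?H) (verts ?H - {w, ?y})"
      using sym_rel.mcovD(4)[OF sym_rel_adj[OF H]] mH matching_covered_iff a adjD[OF H a] by blast
    moreover have "verts ?H - {w, ?y} = X - {w}" using vH y by blast
    ultimately have "matchable_on (collapse (adj G) ?Y ?y) (X - {w})" unfolding aH by simp
    then show ?thesis using G.collapse_matchable_outside[OF y] by blast
  qed
  have lift: "matchable_on (adj G) (?E U)" if U: "matchable_on (adj ?K) U" "U \<inter> X \<subseteq> {?z}" for U
  proof (cases "?z \<in> U")
    case True
    then have "U \<inter> X = {?z}" using U(2) z by blast
    moreover have "matchable_on (adj G) (X - {w})" if "w \<in> X" "v \<in> U - {?z}" "adj G w v" for w v
      using crit[OF that(1) _ that(3)] that(2) U(2) by blast
    ultimately show ?thesis using G.collapse_matchable_lift[OF z _ U(1)[unfolded aK]] True unfolding expand_def by simp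
  next
    case False
    then have "U \<inter> X = {}" using U(2) by blast
    then show ?thesis using G.collapse_matchable_outside[OF z] U(1) False unfolding aK expand_def by simp
  qed
  obtain B h c where fr: "frame J ?K B h c" and wk: "\<And>f w. f \<in> edges J \<Longrightarrow> w \<in> ends J f \<Longrightarrow> matchable_on (adj ?K) (B w - {c w f})"
    using bm unfolding bag_minor_def by blast
  note F = frameD[OF fr]
  have BX: "B w \<inter> X \<subseteq> {?z}" if "w \<in> verts J" for w using F(1)[OF that] vK by blast
  \<comment> \<open>An edge that ended in the contraction vertex has exactly one end in
    \<open>X\<close>, since the edges inside \<open>X\<close> have disappeared; that end is
    taken.\<close>
  define c' where "c' w f = (if c w f = ?z then (SOME x. x \<in> X \<inter> ends G (h f)) else c w f)" for w f
  have hK: "h f \<in> edges ?K" if "f \<in> edges J" for f using F(5) that by blast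
  then have hG: "h f \<in> edges G" "\<not> ends G (h f) \<subseteq> X" if "f \<in> edges J" for f using that unfolding contract_simps by auto
  have key: "ends G (h f) = {c' v f, c' w f} \<and> (c v f = ?z \<longrightarrow> c' v f \<in> X \<and> adj G (c' v f) (c w f) \<and> c w f \<notin> X) \<and>
      (c v f \<noteq> ?z \<longrightarrow> c' v f = c v f \<and> c v f \<notin> X)"
    if f: "f \<in> edges J" and vw: "ends J f = {v, w}" "v \<noteq> w" for f v w
  proof -
    have vJ: "v \<in> verts J" "w \<in> verts J" using multigraphD(3)[OF J f] vw by auto
    have cB: "c v f \<in> B v" "c w f \<in> B w" using F(6)[OF f] vw by auto
    have ne: "c v f \<noteq> c w f" using cB F(2)[OF vJ vw(2)] by (metis disjoint_iff)
    have out: "c u f \<notin> X" if "u \<in> {v, w}" "c u f \<noteq> ?z" for u using cB vJ BX that by blast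
    obtain p q where pq: "ends G (h f) = {p, q}" "p \<noteq> q" "adj G p q" using multigraph_ends[OF G hG(1)[OF f]] by metis
    have im: "{if p \<in> X then ?z else p, if q \<in> X then ?z else q} = {c v f, c w f}"
      using F(7)[OF f] vw(1) pq(1) unfolding contract_simps by (simp only: image_insert image_empty)
    have qp: "adj G q p" by (rule G.sym[OF pq(3)])
    have sing: "(SOME x. x \<in> X \<inter> {p, q}) = p" if "p \<in> X" "q \<notin> X"
    proof -
      have "X \<inter> {p, q} = {p}" using that by blast
      then show ?thesis by simp
    qed
    have sing': "(SOME x. x \<in> X \<inter> {p, q}) = q" if "q \<in> X" "p \<notin> X"
    proof -
      have "X \<inter> {p, q} = {q}" using that by blast
      then show ?thesis by simp
    qed
    have nboth: "\<not> (p \<in> X \<and> q \<in> X)" using hG(2)[OF f] pq(1) by auto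
    consider (a) "p \<in> X" "q \<notin> X" | (b) "q \<in> X" "p \<notin> X" | (n) "p \<notin> X" "q \<notin> X" using nboth by blast
    then show ?thesis
    proof cases
      case a
      then have "{?z, q} = {c v f, c w f}" "q \<noteq> ?z" using im z by auto
      then have "c v f = ?z \<and> c w f = q \<or> c v f = q \<and> c w f = ?z" by (auto simp: doubleton_eq_iff)
      then show ?thesis using a pq qp sing[OF a] \<open>q \<noteq> ?z\<close> unfolding c'_def pq(1) by auto
    next
      case b
      then have "{?z, p} = {c v f, c w f}" "p \<noteq> ?z" using im z by auto
      then have "c v f = ?z \<and> c w f = p \<or> c v f = p \<and> c w f = ?z" by (auto simp: doubleton_eq_iff)
      then show ?thesis using b pq qp sing'[OF b] \<open>p \<noteq> ?z\<close> unfolding c'_def pq(1) by auto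
    next
      case n
      then have e: "{p, q} = {c v f, c w f}" "p \<noteq> ?z" "q \<noteq> ?z" using im z by auto
      then have "c v f \<noteq> ?z" "c w f \<noteq> ?z" by (auto simp: doubleton_eq_iff)
      moreover have "c v f \<notin> X" using e(1) n by (auto simp: doubleton_eq_iff)
      ultimately show ?thesis using e(1) pq(1) unfolding c'_def by simp
    qed
  qed
  have other: "\<exists>v. ends J f = {w, v} \<and> w \<noteq> v" if "f \<in> edges J" "w \<in> ends J f" for f w
    using multigraph_other_end[OF J that] by metis
  have "frame J G (\<lambda>w. ?E (B w)) h c'"
    unfolding frame_def
  proof (intro conjI ballI impI)
    show "?E (B w) \<subseteq> verts G" if "w \<in> verts J" for w
      using F(1)[OF that] vK X(2) z unfolding expand_def by auto
    show "?E (B v) \<inter> ?E (B w) = {}" if vw: "v \<in> verts J" "w \<in> verts J" "v \<noteq> w" for v w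
      using F(2)[OF vw] BX[OF vw(1)] BX[OF vw(2)] unfolding expand_def by auto
    show "inj_on h (edges J)" by (rule F(4))
    show "h ` edges J \<subseteq> edges G" using hG by blast
    let ?U = "\<Union>w\<in>verts J. B w"
    have m: "matchable_on (adj G) (?E (verts ?K - ?U))" by (rule lift[OF F(3)]) (use vK in blast)
    have "?E (verts ?K - ?U) = verts G - (\<Union>w\<in>verts J. ?E (B w))"
    proof (cases "?z \<in> ?U")
      case True
      then obtain k where k: "k \<in> verts J" "?z \<in> B k" by blast
      have zk: "?z \<notin> B i" if "i \<in> verts J" "i \<noteq> k" for i using F(2)[OF that(1) k(1) that(2)] k(2) by blast
      have "?E (B i) = (if i = k then B k - {?z} \<union> X else B i)" if "i \<in> verts J" for i
        using zk[OF that] k(2) unfolding expand_def by simp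
      then have "(\<Union>i\<in>verts J. ?E (B i)) = (\<Union>i\<in>verts J. if i = k then B k - {?z} \<union> X else B i)" by simp
      also have "\<dots> = (?U - {?z}) \<union> X" using k zk by (auto split: if_splits)
      finally have e: "(\<Union>i\<in>verts J. ?E (B i)) = (?U - {?z}) \<union> X" .
      have "?E (verts ?K - ?U) = verts ?K - ?U" using True unfolding expand_def by simp
      also have "\<dots> = verts G - ((?U - {?z}) \<union> X)" unfolding vK using True z by blast
      finally show ?thesis unfolding e .
    next
      case Fz: False
      then have "?E (B i) = B i" if "i \<in> verts J" for i using that unfolding expand_def by auto
      then have e: "(\<Union>i\<in>verts J. ?E (B i)) = ?U" by simp
      have UX: "?U \<inter> X = {}" using BX Fz by blast
      have zK: "?z \<in> verts ?K - ?U" using vK Fz by blast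
      have "?E (verts ?K - ?U) = (verts ?K - ?U) - {?z} \<union> X" unfolding expand_def by (simp only: zK if_True)
      also have "\<dots> = verts G - ?U" unfolding vK using UX X(2) z by blast
      finally show ?thesis unfolding e .
    qed
    then show "matchable_on (adj G) (verts G - (\<Union>w\<in>verts J. ?E (B w)))" using m by simp
  next
    fix f w assume f: "f \<in> edges J" and w: "w \<in> ends J f"
    obtain v where v: "ends J f = {w, v}" "w \<noteq> v" using other[OF f w] by blast
    show "c' w f \<in> ?E (B w)" using key[OF f v] F(6)[OF f w] unfolding expand_def by auto
  next
    fix f assume f: "f \<in> edges J"
    obtain v w where vw: "ends J f = {v, w}" "v \<noteq> w" using multigraph_ends[OF J f] by metis
    then show "ends G (h f) = (\<lambda>w. c' w f) ` ends J f" using key[OF f vw] by simp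
  qed
  moreover have "matchable_on (adj G) (?E (B w) - {c' w f})" if f: "f \<in> edges J" and w: "w \<in> ends J f" for f w
  proof -
    obtain v where v: "ends J f = {w, v}" "w \<noteq> v" using other[OF f w] by blast
    have wJ: "w \<in> verts J" using multigraphD(3)[OF J f] w by blast
    note k = key[OF f v]
    show ?thesis
    proof (cases "c w f = ?z")
      case True
      then have k': "c' w f \<in> X" "adj G (c' w f) (c v f)" "c v f \<notin> X" using k by auto
      have zB: "?z \<in> B w" using F(6)[OF f w] True by simp
      have "(B w - {?z}) \<inter> X = {}" using BX[OF wJ] by blast
      then have "matchable_on (adj G) (B w - {?z})" using wk[OF f w] True G.collapse_matchable_outside[OF z] unfolding aK by simp
      moreover have "matchable_on (adj G) (X - {c' w f})" by (rule crit[OF k'(1,3,2)])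
      ultimately have "matchable_on (adj G) ((B w - {?z}) \<union> (X - {c' w f}))" by (rule matchable_on_Un) (use BX[OF wJ] in blast)
      moreover have "(B w - {?z}) \<union> (X - {c' w f}) = ?E (B w) - {c' w f}"
        unfolding expand_def using zB k'(1) BX[OF wJ] by auto
      ultimately show ?thesis by simp
    next
      case False
      then have k': "c' w f = c w f" "c w f \<notin> X" using k by auto
      have "matchable_on (adj G) (?E (B w - {c w f}))" by (rule lift[OF wk[OF f w]]) (use BX[OF wJ] in blast)
      moreover have "?E (B w - {c w f}) = ?E (B w) - {c' w f}" unfolding expand_def k'(1) using k'(2) False by auto
      ultimately show ?thesis by simp
    qed
  qed
  ultimately show ?thesis unfolding bag_minor_def by blast
qed

text \<open>The steps are undone from the last to the first. The inner vertices of a deleted ear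
  form a path with an even number of vertices and are matched along it.\<close>

theorem S_minor_bag_minor:
  assumes "S_minor J G"
  shows "bag_minor J G"
proof -
  obtain G' where st: "S_step\<^sup>*\<^sup>* G G'" and iso: "graph_iso G' J" and mc: "matching_covered J" "matching_covered G"
    using assms unfolding S_minor_def by blast
  have J: "multigraph J" using mc(1) unfolding matching_covered_def by simp
  have G': "multigraph G'" using S_steps_matching_covered[OF st mc(2)] unfolding matching_covered_def by simp
  from st bag_minor_iso[OF G' iso] show ?thesis
  proof (induction rule: converse_rtranclp_induct)
    case (step G K)
    then have bm: "bag_minor J K" by blast
    show ?case
      using step.hyps(1)
    proof cases
      case (single_ear P)
      then have "multigraph G" and P: "odd_ear_path G P" unfolding removable_single_ear_def matching_covered_def by auto
      note i = internal_verts_matchable[OF this]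
      show ?thesis
      proof (rule bag_minor_subgraph[OF _ _ _ _ bm])
        have "verts G - verts K = internal_verts P" unfolding single_ear(1) delete_path_def using i(3) by auto
        then show "matchable_on (adj G) (verts G - verts K)" using i(1) by simp
      qed (auto simp: single_ear(1) delete_path_def)
    next
      case (double_ear P Q)
      then have G: "multigraph G" and P: "odd_ear_path G P" and Q: "odd_ear_path G Q" and d: "set (fst P) \<inter> set (fst Q) = {}"
        unfolding removable_double_ear_def matching_covered_def by auto
      note i = internal_verts_matchable[OF G P] and j = internal_verts_matchable[OF G Q]
      show ?thesis
      proof (rule bag_minor_subgraph[OF _ _ _ _ bm])
        have "verts G - verts K = internal_verts P \<union> internal_verts Q" unfolding double_ear(1) delete_path_def using i(3) j(3) by auto
        then show "matchable_on (adj G) (verts G - verts K)" using matchable_on_Un[OF i(1) j(1)] i(2) j(2) d by auto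
      qed (auto simp: double_ear(1) delete_path_def)
    next
      case (contraction X)
      then show ?thesis using bag_minor_contract[OF J contraction(2)] bm by simp
    qed
  qed
qed

section \<open>Tripods for the vertices of a decoration\<close>

lemma tripod_reindex:
  assumes "tripod R B I a" "bij_betw \<sigma> I' I" "\<And>i. i \<in> I' \<Longrightarrow> b i = a (\<sigma> i)"
  shows "tripod R B I' b"
proof -
  obtain y L where y: "y \<in> B" "\<And>i. i \<in> I \<Longrightarrow> L i \<subseteq> B - {y}" "\<And>i. i \<in> I \<Longrightarrow> legset R y (L i) (a i)"
    "\<And>i j. i \<in> I \<Longrightarrow> j \<in> I \<Longrightarrow> i \<noteq> j \<Longrightarrow> L i \<inter> L j = {}" "matchable_on R (B - {y} - (\<Union>i\<in>I. L i))"
    using tripodE[OF assms(1)] by blast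
  have s: "\<sigma> i \<in> I" if "i \<in> I'" for i using assms(2) that unfolding bij_betw_def by blast
  have ne: "\<sigma> i \<noteq> \<sigma> j" if "i \<in> I'" "j \<in> I'" "i \<noteq> j" for i j
    using assms(2) that unfolding bij_betw_def inj_on_def by blast
  have "(\<Union>i\<in>I'. L (\<sigma> i)) = \<Union>(L ` (\<sigma> ` I'))" by blast
  also have "\<dots> = (\<Union>i\<in>I. L i)" using assms(2) unfolding bij_betw_def by simp
  finally have "matchable_on R (B - {y} - (\<Union>i\<in>I'. L (\<sigma> i)))" using y(5) by simp
  then show ?thesis unfolding tripod_def
    using y(1) y(2,3)[OF s] assms(3) y(4)[OF s s ne] by (intro exI[of _ y] exI[of _ "\<lambda>i. L (\<sigma> i)"]) simp
qed

text \<open>The triangle edge labelled \<open>b\<close> is opposite to corner \<open>b\<close>; seen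
  from corner \<open>x\<close> it therefore leads to the third corner.\<close>

definition third :: "'a set \<Rightarrow> 'a \<Rightarrow> 'a \<Rightarrow> 'a" where
  "third I b x = (THE y. y \<in> I \<and> y \<noteq> b \<and> y \<noteq> x)"

lemma third:
  assumes "card I = 3" "b \<in> I" "x \<in> I" "b \<noteq> x"
  shows "third I b x \<in> I" "third I b x \<noteq> b" "third I b x \<noteq> x" "I = {b, x, third I b x}" "third I (third I b x) x = b"
proof -
  have "card (I - {b} - {x}) = 1" using assms by simp
  then obtain y where "I - {b} - {x} = {y}" using card_1_singletonE by blast
  then have y: "I = {b, x, y}" "y \<noteq> b" "y \<noteq> x" using assms(2,3) by auto
  have t: "third I b x = y" unfolding third_def by (rule the_equality) (use y in auto)
  show "third I b x \<in> I" "third I b x \<noteq> b" "third I b x \<noteq> x" "I = {b, x, third I b x}" using t y by auto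
  have "third I y x = b" unfolding third_def by (rule the_equality) (use y assms in auto)
  then show "third I (third I b x) x = b" using t by simp
qed

lemma K4_incident_None:
  assumes "v \<notin> T" "multigraph J"
  shows "incident_edges (K4_decoration J T) (v, None) = Inl ` incident_edges J v"
  using assms unfolding incident_edges_def K4_simps by (auto simp: K4_simps incident_edges_def image_iff)

lemma K4_incident_Some:
  assumes "v \<in> T" "v \<in> verts J" "x \<in> incident_edges J v"
  shows "incident_edges (K4_decoration J T) (v, Some x) = insert (Inl x) ((\<lambda>b. Inr (v, b)) ` (incident_edges J v - {x}))"
  using assms unfolding incident_edges_def K4_simps by (auto simp: K4_simps incident_edges_def image_iff)

definition tripod_frame :: "('w, 'f) mgraph \<Rightarrow> ('v, 'e) mgraph \<Rightarrow> ('w \<Rightarrow> 'v set) \<Rightarrow> ('f \<Rightarrow> 'e) \<Rightarrow> ('w \<Rightarrow> 'f \<Rightarrow> 'v) \<Rightarrow> bool" where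
  "tripod_frame J G B h c \<longleftrightarrow> frame J G B h c \<and> (\<forall>w\<in>verts J. tripod (adj G) (B w) (incident_edges J w) (c w))"

theorem bag_minor_tripod_frame:
  fixes J :: "('w, 'f) mgraph" and G :: "('v, 'e) mgraph"
  assumes J: "multigraph J" and cub: "cubic J" and G: "multigraph G" and bm: "bag_minor J G"
  shows "\<exists>T\<subseteq>verts J. \<exists>B h c. tripod_frame (K4_decoration J T) G B h c"
proof -
  let ?R = "adj G" let ?I = "incident_edges J"
  interpret G: sym_rel ?R by (rule sym_rel_adj[OF G])
  obtain B h c where fr: "frame J G B h c" and wk: "\<And>f w. f \<in> edges J \<Longrightarrow> w \<in> ends J f \<Longrightarrow> matchable_on ?R (B w - {c w f})"
    using bm unfolding bag_minor_def by blast
  note F = frameD[OF fr]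
  have I3: "card (?I v) = 3" if "v \<in> verts J" for v using incident_edgesD(1)[OF J cub that] .
  have ID: "e \<in> edges J" "v \<in> ends J e" if "e \<in> ?I v" for e v using that unfolding incident_edges_def by auto
  have tt: "tripod ?R (B v) (?I v) (c v) \<or> triad ?R (B v) (?I v) (c v)" if v: "v \<in> verts J" for v
  proof (rule three_terminals[OF sym_rel_adj[OF G] _ I3[OF v]])
    show "finite (B v)" using F(1)[OF v] multigraphD(1)[OF G] finite_subset by blast
    show "c v e \<in> B v" "matchable_on ?R (B v - {c v e})" if "e \<in> ?I v" for e
      using F(6)[OF ID[OF that]] wk[OF ID[OF that]] .
  qed
  \<comment> \<open>Exactly the bags without a tripod are split; by \<open>three_terminals\<close>
    they are triads, and their three corners become the triangle.\<close>
  define T where "T = {v \<in> verts J. \<not> tripod ?R (B v) (?I v) (c v)}"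
  have TJ: "T \<subseteq> verts J" unfolding T_def by blast
  have "\<forall>v. \<exists>D q. v \<in> T \<longrightarrow> (\<forall>i\<in>?I v. D i \<subseteq> B v \<and> tripod ?R (D i) (?I v) (port (c v) q i)) \<and>
     (\<forall>i\<in>?I v. \<forall>j\<in>?I v. i \<noteq> j \<longrightarrow> D i \<inter> D j = {} \<and> ?R (q i j) (q j i)) \<and> matchable_on ?R (B v - (\<Union>i\<in>?I v. D i))"
    (is "\<forall>v. \<exists>D q. v \<in> T \<longrightarrow> ?P v D q")
  proof
    fix v
    show "\<exists>D q. v \<in> T \<longrightarrow> ?P v D q"
    proof (cases "v \<in> T")
      case True
      then have "triad ?R (B v) (?I v) (c v)" using tt unfolding T_def by blast
      then show ?thesis unfolding triad_def by (elim exE) (rule exI, rule exI, rule impI)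
    qed simp
  qed
  then obtain D q where Dq: "\<forall>v. v \<in> T \<longrightarrow> (\<forall>i\<in>?I v. D v i \<subseteq> B v \<and> tripod ?R (D v i) (?I v) (port (c v) (q v) i)) \<and>
     (\<forall>i\<in>?I v. \<forall>j\<in>?I v. i \<noteq> j \<longrightarrow> D v i \<inter> D v j = {} \<and> ?R (q v i j) (q v j i)) \<and> matchable_on ?R (B v - (\<Union>i\<in>?I v. D v i))"
    by metis
  have D: "D v i \<subseteq> B v" "tripod ?R (D v i) (?I v) (port (c v) (q v) i)" if "v \<in> T" "i \<in> ?I v" for v i
    using Dq that by auto
  have Dd: "D v i \<inter> D v j = {}" "?R (q v i j) (q v j i)" if "v \<in> T" "i \<in> ?I v" "j \<in> ?I v" "i \<noteq> j" for v i j
    using Dq that by auto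
  have Dm: "matchable_on ?R (B v - (\<Union>i\<in>?I v. D v i))" if "v \<in> T" for v using Dq that by auto
  have pD: "port (c v) (q v) i j \<in> D v i" if "v \<in> T" "i \<in> ?I v" "j \<in> ?I v" for v i j
    using tripod_terminal(1)[OF D(2)[OF that(1,2)] that(3)] .
  have qD: "q v i j \<in> D v i" if "v \<in> T" "i \<in> ?I v" "j \<in> ?I v" "i \<noteq> j" for v i j
    using pD[OF that(1-3)] that(4) unfolding port_def by simp
  have cD: "c v i \<in> D v i" if "v \<in> T" "i \<in> ?I v" for v i using pD[OF that that(2)] unfolding port_def by simp
  let ?K = "K4_decoration J T"
  define tri where "tri v b x = third (?I v) b x" for v b x
  have tri: "tri v b x \<in> ?I v" "tri v b x \<noteq> b" "tri v b x \<noteq> x" "?I v = {b, x, tri v b x}" "tri v (tri v b x) x = b"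
    if "v \<in> T" "b \<in> ?I v" "x \<in> ?I v" "b \<noteq> x" for v b x
    using third[OF I3 that(2-4)] that(1) TJ unfolding tri_def by auto
  \<comment> \<open>The edge of \<open>G\<close> that realises the triangle edge opposite to corner
    \<open>b\<close>. The choice refers to one of the other two corners; by symmetry the description
    holds for both, which is \<open>HEall\<close>.\<close>
  define HE where "HE v b = (SOME e. e \<in> edges G \<and> (\<exists>x\<in>?I v. x \<noteq> b \<and> ends G e = {q v x (tri v b x), q v (tri v b x) x}))" for v b
  have HE: "HE v b \<in> edges G \<and> (\<exists>x\<in>?I v. x \<noteq> b \<and> ends G (HE v b) = {q v x (tri v b x), q v (tri v b x) x})"
    if v: "v \<in> T" and b: "b \<in> ?I v" for v b
  proof -
    have "card (?I v - {b}) = 2" using I3 v b TJ by auto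
    then obtain x where "x \<in> ?I v - {b}" by (metis card.empty equals0I zero_neq_numeral)
    then have x: "x \<in> ?I v" "x \<noteq> b" by auto
    note t = tri[OF v b x(1) x(2)[symmetric]]
    have "?R (q v x (tri v b x)) (q v (tri v b x) x)" by (rule Dd(2)[OF v x(1) t(1) t(3)[symmetric]])
    then obtain e where "e \<in> edges G" "ends G e = {q v x (tri v b x), q v (tri v b x) x}" unfolding adj_def by blast
    then have "\<exists>e. e \<in> edges G \<and> (\<exists>x\<in>?I v. x \<noteq> b \<and> ends G e = {q v x (tri v b x), q v (tri v b x) x})" using x by blast
    then show ?thesis unfolding HE_def by (rule someI_ex)
  qed
  have HEall: "ends G (HE v b) = {q v x (tri v b x), q v (tri v b x) x}" if v: "v \<in> T" and b: "b \<in> ?I v" and x: "x \<in> ?I v" "x \<noteq> b" for v b x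
  proof -
    obtain z where z: "z \<in> ?I v" "z \<noteq> b" "ends G (HE v b) = {q v z (tri v b z), q v (tri v b z) z}" using HE[OF v b] by blast
    note t = tri[OF v b z(1) z(2)[symmetric]]
    show ?thesis
    proof (cases "x = z")
      case False
      then have "x = tri v b z" using x t(4) by blast
      moreover have "tri v b x = z"
      proof -
        note u = tri[OF v b x(1) x(2)[symmetric]]
        show ?thesis using u(4) z(1,2) False by blast
      qed
      ultimately show ?thesis using z(3) by (simp add: insert_commute)
    qed (use z in simp)
  qed
  have HED: "ends G (HE v b) \<inter> D v x \<noteq> {} \<longleftrightarrow> x \<noteq> b" if v: "v \<in> T" and b: "b \<in> ?I v" and x: "x \<in> ?I v" for v b x
  proof (cases "x = b")
    case False
    note t = tri[OF v b x False[symmetric]]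
    show ?thesis using HEall[OF v b x False] qD[OF v x t(1) t(3)[symmetric]] False by auto
  next
    case True
    obtain z where z: "z \<in> ?I v" "z \<noteq> b" "ends G (HE v b) = {q v z (tri v b z), q v (tri v b z) z}" using HE[OF v b] by blast
    note t = tri[OF v b z(1) z(2)[symmetric]]
    have "q v z (tri v b z) \<in> D v z" "q v (tri v b z) z \<in> D v (tri v b z)"
      using qD[OF v z(1) t(1) t(3)[symmetric]] qD[OF v t(1) z(1) t(3)] .
    then show ?thesis using z(3) True Dd(1)[OF v z(1) b z(2)] Dd(1)[OF v t(1) b t(2)] by auto
  qed
  have HEB: "ends G (HE v b) \<subseteq> B v" if v: "v \<in> T" and b: "b \<in> ?I v" for v b
  proof -
    obtain z where z: "z \<in> ?I v" "z \<noteq> b" "ends G (HE v b) = {q v z (tri v b z), q v (tri v b z) z}" using HE[OF v b] by blast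
    note t = tri[OF v b z(1) z(2)[symmetric]]
    show ?thesis using z(3) qD[OF v z(1) t(1) t(3)[symmetric]] qD[OF v t(1) z(1) t(3)] D(1)[OF v z(1)] D(1)[OF v t(1)] by auto
  qed
  define B' where "B' w = (case snd w of None \<Rightarrow> B (fst w) | Some e \<Rightarrow> D (fst w) e)" for w
  define h' where "h' = case_sum h (\<lambda>(v, b). HE v b)"
  \<comment> \<open>Translates the edges of the decoration at corner \<open>x\<close> into the
    indices of its tripod: the edge \<open>Inl x\<close> becomes the index of the outer terminal,
    and a triangle edge becomes the corner at its other end.\<close>
  define idx where "idx v x = case_sum (\<lambda>e. e) (\<lambda>(u :: 'w, b). tri v b x)" for v x
  define c' where "c' w f = (case snd w of None \<Rightarrow> c (fst w) (projl f) | Some x \<Rightarrow> port (c (fst w)) (q (fst w)) x (idx (fst w) x f))" for w f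
  have Bs: "B' (v, None) = B v" "B' (v, Some e) = D v e" for v e unfolding B'_def by auto
  have hs: "h' (Inl e) = h e" "h' (Inr (v, b)) = HE v b" for e v b unfolding h'_def by auto
  have cs: "c' (v, None) (Inl e) = c v e" "c' (v, Some x) f = port (c v) (q v) x (idx v x f)" for v e x f unfolding c'_def by auto
  have ix: "idx v x (Inl e) = e" "idx v x (Inr (u, b)) = tri v b x" for v x e u b unfolding idx_def by auto
  have vK: "(\<exists>v\<in>verts J - T. w = (v, None)) \<or> (\<exists>v\<in>T. \<exists>x\<in>?I v. w = (v, Some x))" if "w \<in> verts ?K" for w
    using that TJ unfolding K4_simps by auto
  have B'B: "B' w \<subseteq> B (fst w)" "fst w \<in> verts J" if "w \<in> verts ?K" for w
    using vK[OF that] TJ by (auto simp: Bs dest: subsetD[OF D(1)])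
  have trip: "tripod ?R (B' w) (incident_edges ?K w) (c' w)" if w: "w \<in> verts ?K" for w
    using vK[OF w]
  proof
    assume "\<exists>v\<in>verts J - T. w = (v, None)"
    then obtain v where v: "v \<in> verts J" "v \<notin> T" "w = (v, None)" by blast
    have "tripod ?R (B v) (?I v) (c v)" using v unfolding T_def by blast
    moreover have "bij_betw projl (Inl ` ?I v) (?I v)" by (rule bij_betw_byWitness[where f' = Inl]) auto
    ultimately have "tripod ?R (B v) (Inl ` ?I v) (c' w)"
      by (rule tripod_reindex) (auto simp: v(3) cs)
    then show ?thesis using v(3) K4_incident_None[OF v(2) J] by (simp add: Bs)
  next
    assume "\<exists>v\<in>T. \<exists>x\<in>?I v. w = (v, Some x)"
    then obtain v x where v: "v \<in> T" "x \<in> ?I v" "w = (v, Some x)" by blast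
    let ?I' = "insert (Inl x) ((\<lambda>b. Inr (v, b)) ` (?I v - {x}))"
    have tv: "tri v b x \<in> ?I v \<and> tri v b x \<noteq> x \<and> tri v (tri v b x) x = b" if "b \<in> ?I v" "b \<noteq> x" for b
      using tri(1,3,5)[OF v(1) that(1) v(2) that(2)] by simp
    have "bij_betw (idx v x) ?I' (?I v)"
    proof (rule bij_betw_byWitness[where f' = "\<lambda>e. if e = x then Inl x else Inr (v, tri v e x)"])
      show "idx v x ` ?I' \<subseteq> ?I v"
      proof
        fix e assume "e \<in> idx v x ` ?I'"
        then obtain f where f: "f \<in> ?I'" "e = idx v x f" by blast
        then consider "f = Inl x" | b where "b \<in> ?I v" "b \<noteq> x" "f = Inr (v, b)" by blast
        then show "e \<in> ?I v" by cases (use v(2) tv f(2) in \<open>simp_all add: ix\<close>)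
      qed
      show "(\<lambda>e. if e = x then Inl x else Inr (v, tri v e x)) ` ?I v \<subseteq> ?I'"
      proof
        fix f assume "f \<in> (\<lambda>e. if e = x then Inl x else Inr (v, tri v e x)) ` ?I v"
        then obtain e where "e \<in> ?I v" "f = (if e = x then Inl x else Inr (v, tri v e x))" by blast
        then show "f \<in> ?I'" using tv[of e] by (cases "e = x") simp_all
      qed
      show "\<forall>f\<in>?I'. (if idx v x f = x then Inl x else Inr (v, tri v (idx v x f) x)) = f"
      proof
        fix f assume "f \<in> ?I'"
        then consider "f = Inl x" | b where "b \<in> ?I v" "b \<noteq> x" "f = Inr (v, b)" by blast
        then show "(if idx v x f = x then Inl x else Inr (v, tri v (idx v x f) x)) = f" by cases (use tv in \<open>simp_all add: ix\<close>)
      qed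
      show "\<forall>e\<in>?I v. idx v x (if e = x then Inl x else Inr (v, tri v e x)) = e"
      proof
        fix e assume "e \<in> ?I v"
        then show "idx v x (if e = x then Inl x else Inr (v, tri v e x)) = e" using tv[of e] by (cases "e = x") (simp_all add: ix)
      qed
    qed
    then have "tripod ?R (D v x) ?I' (c' w)" by (rule tripod_reindex[OF D(2)[OF v(1,2)]]) (simp add: v(3) cs)
    moreover have "incident_edges ?K w = ?I'" using K4_incident_Some[OF v(1) _ v(2)] v(1,3) TJ by blast
    ultimately show ?thesis using v(3) by (simp add: Bs)
  qed
  have cB: "c' w f \<in> B' w" if "f \<in> edges ?K" "w \<in> ends ?K f" for f w
  proof -
    have "w \<in> verts ?K" using multigraphD(3)[OF multigraph_K4[OF J cub] that(1)] that(2) by blast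
    then show ?thesis using tripod_terminal(1)[OF trip] that unfolding incident_edges_def by blast
  qed
  have hB: "\<not> ends G (h e) \<subseteq> B v" if e: "e \<in> edges J" and v: "v \<in> verts J" for e v
  proof
    assume s: "ends G (h e) \<subseteq> B v"
    obtain x y where xy: "ends J e = {x, y}" "x \<noteq> y" "x \<in> verts J" "y \<in> verts J" using multigraph_ends[OF J e] by metis
    have "c x e \<in> B v" "c y e \<in> B v" "c x e \<in> B x" "c y e \<in> B y" using s F(7)[OF e] F(6)[OF e] xy(1) by auto
    then have "x = v" "y = v" using F(2)[OF xy(3) v] F(2)[OF xy(4) v] by auto
    then show False using xy(2) by simp
  qed
  have eK: "(\<exists>e\<in>edges J. f = Inl e) \<or> (\<exists>v\<in>T. \<exists>b\<in>?I v. f = Inr (v, b))" if "f \<in> edges ?K" for f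
    using that unfolding K4_simps by auto
  have "frame ?K G B' h' c'"
    unfolding frame_def
  proof (intro conjI ballI impI)
    show "B' w \<subseteq> verts G" if "w \<in> verts ?K" for w using B'B[OF that] F(1) by blast
    show "B' v \<inter> B' w = {}" if vw: "v \<in> verts ?K" "w \<in> verts ?K" "v \<noteq> w" for v w
    proof (cases "fst v = fst w")
      case False
      then show ?thesis using B'B[OF vw(1)] B'B[OF vw(2)] F(2)[of "fst v" "fst w"] by blast
    next
      case True
      show ?thesis
      proof (cases "fst v \<in> T")
        case T: True
        obtain x where x: "x \<in> ?I (fst v)" "v = (fst v, Some x)" using vK[OF vw(1)] T by auto
        have "fst w \<in> T" using T True by simp
        then obtain y where "y \<in> ?I (fst w)" "w = (fst w, Some y)" using vK[OF vw(2)] by auto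
        then have y: "y \<in> ?I (fst v)" "w = (fst v, Some y)" using True by simp_all
        have "x \<noteq> y" using x(2) y(2) vw(3) by auto
        then have "D (fst v) x \<inter> D (fst v) y = {}" by (rule Dd(1)[OF T x(1) y(1)])
        then show ?thesis using Bs(2)[of "fst v" x] Bs(2)[of "fst v" y] x(2) y(2) by simp
      next
        case False
        moreover have "fst w \<notin> T" using False True by simp
        ultimately have "v = (fst v, None)" "w = (fst w, None)" using vK[OF vw(1)] vK[OF vw(2)] by auto
        then show ?thesis using vw(3) True by simp
      qed
    qed
    let ?U = "\<Union>w\<in>verts J. B w"
    have "matchable_on ?R (\<Union>v\<in>T. B v - (\<Union>i\<in>?I v. D v i))"
    proof (rule matchable_on_UN[OF Dm])
      fix u v assume uv: "u \<in> T" "v \<in> T" "u \<noteq> v"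
      then have "B u \<inter> B v = {}" using F(2) TJ by blast
      then show "(B u - (\<Union>i\<in>?I u. D u i)) \<inter> (B v - (\<Union>i\<in>?I v. D v i)) = {}" by blast
    qed
    with F(3) have m: "matchable_on ?R ((verts G - ?U) \<union> (\<Union>v\<in>T. B v - (\<Union>i\<in>?I v. D v i)))"
      by (rule matchable_on_Un) (use TJ in blast)
    have U': "(\<Union>w\<in>verts ?K. B' w) = (\<Union>v\<in>verts J - T. B v) \<union> (\<Union>v\<in>T. \<Union>i\<in>?I v. D v i)"
    proof -
      have "verts ?K = (\<lambda>v. (v, None)) ` (verts J - T) \<union> (\<Union>v\<in>T. (\<lambda>e. (v, Some e)) ` ?I v)"
        unfolding K4_simps using TJ by auto
      then show ?thesis by (simp add: Bs UN_Un)
    qed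
    have "verts G - (\<Union>w\<in>verts ?K. B' w) = (verts G - ?U) \<union> (\<Union>v\<in>T. B v - (\<Union>i\<in>?I v. D v i))"
    proof (intro equalityI subsetI)
      fix x assume x: "x \<in> verts G - (\<Union>w\<in>verts ?K. B' w)"
      show "x \<in> (verts G - ?U) \<union> (\<Union>v\<in>T. B v - (\<Union>i\<in>?I v. D v i))"
      proof (cases "x \<in> ?U")
        case True
        then obtain v where v: "v \<in> verts J" "x \<in> B v" by blast
        then have "v \<in> T" using x unfolding U' by blast
        then have "x \<in> B v - (\<Union>i\<in>?I v. D v i)" using x v(2) unfolding U' by blast
        then show ?thesis using \<open>v \<in> T\<close> by blast
      qed (use x in blast)
    next
      fix x assume x: "x \<in> (verts G - ?U) \<union> (\<Union>v\<in>T. B v - (\<Union>i\<in>?I v. D v i))"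
      then show "x \<in> verts G - (\<Union>w\<in>verts ?K. B' w)"
      proof
        assume x: "x \<in> verts G - ?U"
        moreover have "(\<Union>w\<in>verts ?K. B' w) \<subseteq> ?U" using B'B by blast
        ultimately show ?thesis by blast
      next
        assume "x \<in> (\<Union>v\<in>T. B v - (\<Union>i\<in>?I v. D v i))"
        then obtain v where v: "v \<in> T" "x \<in> B v" "x \<notin> (\<Union>i\<in>?I v. D v i)" by blast
        have vJ: "v \<in> verts J" using v(1) TJ by blast
        have n: "u = v" if "u \<in> verts J" "x \<in> B u" for u using F(2)[OF that(1) vJ] that(2) v(2) by blast
        have "x \<notin> (\<Union>v\<in>verts J - T. B v)" using n v(1) by auto
        moreover have "x \<notin> (\<Union>v\<in>T. \<Union>i\<in>?I v. D v i)"
        proof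
          assume "x \<in> (\<Union>v\<in>T. \<Union>i\<in>?I v. D v i)"
          then obtain u i where u: "u \<in> T" "i \<in> ?I u" "x \<in> D u i" by blast
          then have "u = v" using n D(1)[OF u(1,2)] TJ by blast
          then show False using u v(3) by blast
        qed
        ultimately show ?thesis unfolding U' using F(1)[OF vJ] v(2) by blast
      qed
    qed
    then show "matchable_on ?R (verts G - (\<Union>w\<in>verts ?K. B' w))" using m by simp
    \<comment> \<open>An edge \<open>h e\<close> never lies inside a bag, whereas
      \<open>HE v b\<close> lies inside \<open>B v\<close>. Among the triangle edges of one vertex,
      \<open>HE v b\<close> is the one that avoids the corner \<open>D v b\<close>.\<close>
    show "inj_on h' (edges ?K)"
    proof (rule inj_onI)
      fix f g assume fg: "f \<in> edges ?K" "g \<in> edges ?K" "h' f = h' g"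
      have lr: False if "e \<in> edges J" "v \<in> T" "b \<in> ?I v" "h e = HE v b" for e v b
        using hB[OF that(1), of v] HEB[OF that(2,3)] that(2,4) TJ by auto
      have rr: "u = v \<and> a = b" if u: "u \<in> T" "a \<in> ?I u" and v: "v \<in> T" "b \<in> ?I v" and e: "HE u a = HE v b" for u v a b
      proof -
        have "ends G (HE u a) \<noteq> {}" using HE[OF u] by auto
        then have "B u \<inter> B v \<noteq> {}" using HEB[OF u] HEB[OF v] e by auto
        then have uv: "u = v" using F(2)[of u v] u(1) v(1) TJ by blast
        then show ?thesis using HED[OF u, of a] HED[OF v, of a] u(2) e by simp
      qed
      from eK[OF fg(1)] eK[OF fg(2)] show "f = g"
      proof (elim disjE bexE)
        fix a b assume "a \<in> edges J" "b \<in> edges J" "f = Inl a" "g = Inl b"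
        then show "f = g" using fg(3) F(4) by (auto simp: hs inj_on_def)
      next
        fix a v b assume "a \<in> edges J" "v \<in> T" "b \<in> ?I v" "f = Inl a" "g = Inr (v, b)"
        then show "f = g" using fg(3) lr by (simp add: hs)
      next
        fix a v b assume "a \<in> edges J" "v \<in> T" "b \<in> ?I v" "g = Inl a" "f = Inr (v, b)"
        then show "f = g" using fg(3) lr[of a v b] by (simp add: hs)
      next
        fix u v a b assume "u \<in> T" "a \<in> ?I u" "v \<in> T" "b \<in> ?I v" "f = Inr (u, a)" "g = Inr (v, b)"
        then show "f = g" using fg(3) rr[of u a v b] by (simp add: hs)
      qed
    qed
    show "h' ` edges ?K \<subseteq> edges G"
    proof
      fix d assume "d \<in> h' ` edges ?K"
      then obtain f where f: "f \<in> edges ?K" "d = h' f" by blast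
      from eK[OF f(1)] show "d \<in> edges G" using F(5) HE f(2) by (auto simp: hs)
    qed
    show "c' w f \<in> B' w" if "f \<in> edges ?K" "w \<in> ends ?K f" for f w by (rule cB[OF that])
    fix f assume f: "f \<in> edges ?K"
    from eK[OF f] show "ends G (h' f) = (\<lambda>w. c' w f) ` ends ?K f"
    proof (elim disjE bexE)
      fix e assume e: "e \<in> edges J" "f = Inl e"
      have "c' (v, if v \<in> T then Some e else None) (Inl e) = c v e" for v by (simp add: cs ix port_def)
      then show ?thesis using F(7)[OF e(1)] unfolding e(2) K4_simps hs image_image by simp
    next
      fix v b assume v: "v \<in> T" "b \<in> ?I v" "f = Inr (v, b)"
      obtain x where x: "x \<in> ?I v" "x \<noteq> b" using HE[OF v(1,2)] by blast
      note t = tri[OF v(1,2) x(1) x(2)[symmetric]]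
      let ?y = "tri v b x"
      note t' = tri[OF v(1,2) t(1) t(2)[symmetric]]
      have "x \<in> {b, ?y, tri v b ?y}" using x(1) t'(4) by (rule back_subst)
      then have xy: "tri v b ?y = x" using x(2) t(3) by auto
      have "{b, x, ?y} - {b} = {x, ?y}" using t(2) x(2) by auto
      then have e: "?I v - {b} = {x, ?y}" using t(4) by (rule back_subst[of "\<lambda>I. I - {b} = {x, ?y}", OF _ sym])
      have "c' (v, Some x) f = q v x ?y" "c' (v, Some ?y) f = q v ?y x"
        using t(3) by (auto simp: v(3) cs ix xy port_def)
      then show ?thesis using HEall[OF v(1,2) x] unfolding v(3) K4_simps hs e by simp
    qed
  qed
  then show ?thesis unfolding tripod_frame_def using trip TJ by blast
qed

section \<open>From tripods to a bi-subdivision\<close>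

context sym_rel begin

text \<open>The union of the two matchings of a legset contains the required path, and what the path
  leaves over is still matched by \<open>m\<close>.\<close>

lemma legset_path:
  assumes "legset R y L p" "finite L"
  shows "\<exists>ps. odd (length ps) \<and> distinct ps \<and> hd ps = y \<and> last ps = p \<and> set ps \<subseteq> insert y L \<and> successively R ps \<and>
    matchable_on R (L - set ps)"
proof -
  have l: "y \<notin> L" "p \<in> insert y L" using assms(1) unfolding legset_def by auto
  obtain m n where m: "is_mate R L m" and n: "is_mate R (insert y L - {p}) n"
    using assms(1) unfolding legset_def matchable_on_def by blast
  obtain ps where ps: "odd (length ps)" "distinct ps" "hd ps = y" "last ps = p" "set ps \<subseteq> insert y L" "successively R ps"
    and alt: "\<forall>i. Suc i < length ps \<longrightarrow> odd i \<longrightarrow> m (ps ! i) = ps ! Suc i"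
    using alternating_path[OF assms(2) l(1) m n l(2) sym] by blast
  obtain qs where q: "ps = y # qs" using ps(1,3) by (cases ps) auto
  have tl: "set (tl ps) \<subseteq> L" using ps(2,5) unfolding q by auto
  have "is_mate R (L - set ps) m"
  proof (rule is_mate_subset[OF m])
    fix u assume u: "u \<in> L - set ps"
    have mu: "m u \<in> L" "m (m u) = u" using is_mateD[OF m, of u] u by auto
    have "m u \<notin> set ps"
    proof
      assume "m u \<in> set ps"
      then obtain i where i: "i < length ps" "ps ! i = m u" unfolding in_set_conv_nth by blast
      have "0 < i" using i(2) mu(1) l(1) unfolding q by (cases i) auto
      then have "m (ps ! i) \<in> set ps"
        using alternating_mates[OF m ps(1) tl alt i(1)] i(1) by (cases "odd i") auto
      then show False using i(2) mu(2) u by simp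
    qed
    then show "m u \<in> L - set ps" using mu(1) by blast
  qed blast
  then have "matchable_on R (L - set ps)" unfolding matchable_on_def by blast
  then show ?thesis using ps by blast
qed

end

lemma graph_iso_sym:
  assumes iso: "graph_iso S H" and S: "multigraph S"
  shows "graph_iso H S"
proof -
  obtain f g where f: "bij_betw f (verts S) (verts H)" and g: "bij_betw g (edges S) (edges H)"
    and fg: "\<forall>e\<in>edges S. ends H (g e) = f ` ends S e" using iso unfolding graph_iso_def by blast
  let ?f = "inv_into (verts S) f" and ?g = "inv_into (edges S) g"
  have ff: "?f (f x) = x" if "x \<in> verts S" for x using f that by (simp add: bij_betw_inv_into_left)
  have gg: "?g d \<in> edges S" "g (?g d) = d" if "d \<in> edges H" for d
    using bij_betw_apply[OF bij_betw_inv_into[OF g] that] g that by (auto simp: bij_betw_inv_into_right)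
  have "ends S (?g d) = ?f ` ends H d" if d: "d \<in> edges H" for d
  proof -
    have "?f ` ends H d = ?f ` (f ` ends S (?g d))" using fg gg[OF d] by metis
    also have "\<dots> = (\<lambda>x. x) ` ends S (?g d)" unfolding image_image
      by (rule image_cong) (use multigraphD(3)[OF S gg(1)[OF d]] ff in auto)
    finally show ?thesis by simp
  qed
  then show ?thesis unfolding graph_iso_def using bij_betw_inv_into[OF f] bij_betw_inv_into[OF g] by blast
qed

context subdivision begin

text \<open>An inner point belongs to one edge of \<open>J\<close> only, so two edges of the
  subdivision can share both ends only if they come from unsubdivided parallel edges.\<close>

lemma parallel_edges_unsubdivided:
  assumes e: "e \<in> edges J" "i \<le> k e" and e': "e' \<in> edges J" "i' \<le> k e'"
    and eq: "{pt e i, pt e (Suc i)} = {pt e' i', pt e' (Suc i')}"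
  shows "e = e' \<and> i = i' \<or> k e = 0 \<and> k e' = 0"
proof (cases "e = e'")
  case True
  have inj: "i = j" if "pt e i = pt e j" "i \<le> Suc (k e)" "j \<le> Suc (k e)" for i j
    using inj_onD[OF pt_inj[OF e(1)] that(1)] that(2,3) by simp
  from eq consider "pt e i = pt e i'" | "pt e i = pt e (Suc i')" "pt e (Suc i) = pt e i'"
    unfolding True doubleton_eq_iff by blast
  then have "i = i'"
  proof cases
    case 1
    then show ?thesis using inj[of i i'] e(2) e'(2) True by simp
  next
    case 2
    then show ?thesis using inj[of i "Suc i'"] inj[of "Suc i" i'] e(2) e'(2) True by simp
  qed
  then show ?thesis using True by simp
next
  case False
  have "k d = 0" if "i \<le> k d" "{pt d i, pt d (Suc i)} = {pt d' i', pt d' (Suc i')}" "d \<noteq> d'" for d d' i i'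
  proof (rule ccontr)
    assume "k d \<noteq> 0"
    then have "Inr (d, if i = 0 then 1 else i) \<in> {pt d i, pt d (Suc i)}"
      using that(1) unfolding subdivision_point_def by auto
    then have "Inr (d, if i = 0 then 1 else i) \<in> {pt d' i', pt d' (Suc i')}" unfolding that(2) .
    then show False using that(3) unfolding subdivision_point_def by (auto split: if_splits)
  qed
  then show ?thesis using e(2) e'(2) eq False by metis
qed

end

theorem tripod_frame_bisubdivision:
  fixes J :: "('w, 'f) mgraph" and G :: "('v, 'e) mgraph"
  assumes J: "multigraph J" and G: "multigraph G" and tf: "tripod_frame J G B h c"
  shows "\<exists>H. conformal_subgraph H G \<and> bisubdivision H J"
proof -
  let ?R = "adj G" let ?I = "incident_edges J"
  interpret G: sym_rel ?R by (rule sym_rel_adj[OF G])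
  have fr: "frame J G B h c" and tr: "\<And>w. w \<in> verts J \<Longrightarrow> tripod ?R (B w) (?I w) (c w)"
    using tf unfolding tripod_frame_def by auto
  note F = frameD[OF fr]
  have "\<forall>w. \<exists>y L. w \<in> verts J \<longrightarrow> y \<in> B w \<and> (\<forall>i\<in>?I w. L i \<subseteq> B w - {y} \<and> legset ?R y (L i) (c w i)) \<and>
     (\<forall>i\<in>?I w. \<forall>j\<in>?I w. i \<noteq> j \<longrightarrow> L i \<inter> L j = {}) \<and> matchable_on ?R (B w - {y} - (\<Union>i\<in>?I w. L i))"
    (is "\<forall>w. \<exists>y L. w \<in> verts J \<longrightarrow> ?P w y L")
  proof
    fix w
    show "\<exists>y L. w \<in> verts J \<longrightarrow> ?P w y L"
    proof (cases "w \<in> verts J")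
      case True
      then show ?thesis using tr[OF True] unfolding tripod_def by (elim exE) (rule exI, rule exI, rule impI)
    qed simp
  qed
  then obtain y L where yL: "\<forall>w. w \<in> verts J \<longrightarrow> ?P w (y w) (L w)" by metis
  have y: "y w \<in> B w" and rest: "matchable_on ?R (B w - {y w} - (\<Union>i\<in>?I w. L w i))" if "w \<in> verts J" for w using yL that by auto
  have L: "L w i \<subseteq> B w - {y w}" "legset ?R (y w) (L w i) (c w i)" if "w \<in> verts J" "i \<in> ?I w" for w i using yL that by auto
  have Ld: "L w i \<inter> L w j = {}" if "w \<in> verts J" "i \<in> ?I w" "j \<in> ?I w" "i \<noteq> j" for w i j using yL that by auto
  define path where "path w i ps \<longleftrightarrow> odd (length ps) \<and> distinct ps \<and> hd ps = y w \<and> last ps = c w i \<and>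
    set ps \<subseteq> insert (y w) (L w i) \<and> successively ?R ps \<and> matchable_on ?R (L w i - set ps)" for w i ps
  define pl where "pl w i = (SOME ps. path w i ps)" for w i
  have pl': "path w i (pl w i)" if wi: "w \<in> verts J" "i \<in> ?I w" for w i
  proof -
    have "finite (L w i)" using L(1)[OF wi] F(1)[OF wi(1)] multigraphD(1)[OF G] by (meson Diff_subset finite_subset)
    then have "\<exists>ps. path w i ps" unfolding path_def using G.legset_path[OF L(2)[OF wi]] by blast
    then show ?thesis unfolding pl_def by (rule someI_ex)
  qed
  have pl: "odd (length (pl w i))" "distinct (pl w i)" "hd (pl w i) = y w" "last (pl w i) = c w i"
      "set (pl w i) \<subseteq> insert (y w) (L w i)" "successively ?R (pl w i)" "matchable_on ?R (L w i - set (pl w i))"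
    if "w \<in> verts J" "i \<in> ?I w" for w i using pl'[OF that] unfolding path_def by auto
  have "\<forall>f. \<exists>s t. f \<in> edges J \<longrightarrow> ends J f = {s, t} \<and> s \<noteq> t" using multigraph_ends[OF J] by metis
  then obtain s t where st': "\<forall>f. f \<in> edges J \<longrightarrow> ends J f = {s f, t f} \<and> s f \<noteq> t f" by metis
  have st: "ends J f = {s f, t f}" "s f \<noteq> t f" "s f \<in> verts J" "t f \<in> verts J" "f \<in> ?I (s f)" "f \<in> ?I (t f)" if "f \<in> edges J" for f
    using st' multigraphD(3)[OF J that] that unfolding incident_edges_def by auto
  \<comment> \<open>From centre to centre: the leg at \<open>s f\<close>, the edge
    \<open>h f\<close>, and the leg at \<open>t f\<close> reversed. Both legs have odd numbers of
    vertices, so the number \<open>k f\<close> of inner vertices is even.\<close>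
  define vs where "vs f = pl (s f) f @ rev (pl (t f) f)" for f
  define k where "k f = length (vs f) - 2" for f
  have plB: "set (pl w i) \<subseteq> B w" if "w \<in> verts J" "i \<in> ?I w" for w i using pl(5)[OF that] L(1)[OF that] y[OF that(1)] by blast
  have vs: "length (vs f) = Suc (Suc (k f))" "even (k f)" "distinct (vs f)" "vs f ! 0 = y (s f)" "vs f ! Suc (k f) = y (t f)"
      "set (vs f) = set (pl (s f) f) \<union> set (pl (t f) f)" if f: "f \<in> edges J" for f
  proof -
    note S = st[OF f]
    note ps = pl[OF S(3,5)] and pt = pl[OF S(4,6)]
    have ne: "pl (s f) f \<noteq> []" "pl (t f) f \<noteq> []" using ps(1) pt(1) by auto
    have len: "length (vs f) = length (pl (s f) f) + length (pl (t f) f)" unfolding vs_def by simp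
    moreover have "1 \<le> length (pl (s f) f)" "1 \<le> length (pl (t f) f)" using ne by (simp_all add: Suc_le_eq)
    ultimately show kl: "length (vs f) = Suc (Suc (k f))" unfolding k_def by linarith
    have "even (length (vs f))" using len ps(1) pt(1) by simp
    then show "even (k f)" using kl by simp
    have "set (pl (s f) f) \<inter> set (pl (t f) f) = {}" using plB[OF S(3,5)] plB[OF S(4,6)] F(2)[OF S(3,4,2)] by blast
    then show "distinct (vs f)" unfolding vs_def using ps(2) pt(2) by simp
    show "vs f ! 0 = y (s f)" using ne(1) ps(3) unfolding vs_def by (simp add: nth_append hd_conv_nth)
    have "last (vs f) = y (t f)" using ne(2) pt(3) unfolding vs_def by (simp add: last_rev)
    moreover have "vs f \<noteq> []" using kl by auto
    ultimately show "vs f ! Suc (k f) = y (t f)" using kl by (simp add: last_conv_nth)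
    show "set (vs f) = set (pl (s f) f) \<union> set (pl (t f) f)" unfolding vs_def by simp
  qed
  interpret S: subdivision J s t k by unfold_locales (use J st(1) vs(2) in auto)
  let ?S = "subdivide J s t k"
  have mS: "multigraph ?S" by (rule S.multigraph_subdivide)
  define \<phi> where "\<phi> = case_sum y (\<lambda>(f, i). vs f ! i)"
  have \<phi>: "\<phi> (Inl w) = y w" "\<phi> (Inr (f, i)) = vs f ! i" for w f i unfolding \<phi>_def by auto
  have \<phi>pt: "\<phi> (S.pt f i) = vs f ! i" if "f \<in> edges J" "i \<le> Suc (k f)" for f i
    using vs(4,5)[OF that(1)] that(2) unfolding subdivision_point_def by (auto simp: \<phi> le_Suc_eq)
  \<comment> \<open>Within a leg any edge of \<open>G\<close> with the right ends will do, but the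
    middle edge has to be \<open>h f\<close>: this keeps the labels of parallel unsubdivided edges
    of \<open>J\<close> distinct.\<close>
  define label where "label f i = (if Suc i = length (pl (s f) f) then h f else
    (SOME e. e \<in> edges G \<and> ends G e = {vs f ! i, vs f ! Suc i}))" for f i
  have label: "label f i \<in> edges G \<and> ends G (label f i) = {vs f ! i, vs f ! Suc i}" if f: "f \<in> edges J" and i: "i \<le> k f" for f i
  proof -
    note S = st[OF f]
    let ?p = "pl (s f) f" and ?q = "pl (t f) f"
    have ne: "?p \<noteq> []" "?q \<noteq> []" using pl(1)[OF S(3,5)] pl(1)[OF S(4,6)] by auto
    show ?thesis
    proof (cases "Suc i = length ?p")
      case True
      have "vs f ! i = last ?p" using True ne(1) unfolding vs_def by (simp add: nth_append last_conv_nth flip: True)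
      moreover have "vs f ! Suc i = last ?q" using True ne(2) unfolding vs_def by (simp add: nth_append rev_nth last_conv_nth)
      ultimately have "{vs f ! i, vs f ! Suc i} = {c (s f) f, c (t f) f}" using pl(4)[OF S(3,5)] pl(4)[OF S(4,6)] by simp
      then have "ends G (h f) = {vs f ! i, vs f ! Suc i}" using F(7)[OF f] S(1) by simp
      then show ?thesis unfolding label_def using True F(5) f by auto
    next
      case False
      have "?R (vs f ! i) (vs f ! Suc i)"
      proof (cases "Suc i < length ?p")
        case True
        then show ?thesis using pl(6)[OF S(3,5)] unfolding vs_def successively_conv_nth by (simp add: nth_append)
      next
        case F: False
        then have li: "length ?p \<le> i" using False by simp
        have "successively ?R (rev ?q)" using pl(6)[OF S(4,6)] G.sym
          by (simp add: successively_rev) (metis (no_types, lifting) successively_mono)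
        moreover have "Suc (i - length ?p) < length (rev ?q)" using vs(1)[OF f] i li unfolding vs_def by simp
        moreover have "Suc i - length ?p = Suc (i - length ?p)" using li by simp
        ultimately show ?thesis using li unfolding vs_def successively_conv_nth by (simp add: nth_append)
      qed
      then have "\<exists>e. e \<in> edges G \<and> ends G e = {vs f ! i, vs f ! Suc i}" unfolding adj_def by blast
      then have "(SOME e. e \<in> edges G \<and> ends G e = {vs f ! i, vs f ! Suc i}) \<in> edges G \<and>
          ends G (SOME e. e \<in> edges G \<and> ends G e = {vs f ! i, vs f ! Suc i}) = {vs f ! i, vs f ! Suc i}" by (rule someI_ex)
      then show ?thesis unfolding label_def using False by simp
    qed
  qed
  have inner: "\<exists>w\<in>verts J. f \<in> ?I w \<and> vs f ! i \<in> L w f" if f: "f \<in> edges J" and i: "1 \<le> i" "i \<le> k f" for f i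
  proof -
    note S = st[OF f] and V = vs[OF f]
    have "vs f ! i \<in> set (vs f)" using V(1) i(2) by simp
    then have "vs f ! i \<in> insert (y (s f)) (L (s f) f) \<union> insert (y (t f)) (L (t f) f)"
      unfolding V(6) using pl(5)[OF S(3,5)] pl(5)[OF S(4,6)] by blast
    moreover have "vs f ! i \<noteq> y (s f)" unfolding V(4)[symmetric] using V(1,3) i by (simp add: nth_eq_iff_index_eq)
    moreover have "vs f ! i \<noteq> y (t f)" unfolding V(5)[symmetric] using V(1,3) i by (simp add: nth_eq_iff_index_eq)
    ultimately show ?thesis using S(3-6) by blast
  qed
  have sep: "v = w" if "v \<in> verts J" "w \<in> verts J" "x \<in> B v" "x \<in> B w" for v w x using F(2)[OF that(1,2)] that(3,4) by blast
  have LB: "L w f \<subseteq> B w" "y w \<notin> L w f" if "w \<in> verts J" "f \<in> ?I w" for w f using L(1)[OF that] by auto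
  have inj\<phi>: "inj_on \<phi> (verts ?S)"
  proof (rule inj_onI)
    have yi: False if w: "w \<in> verts J" and f: "f \<in> edges J" "1 \<le> i" "i \<le> k f" and e: "y w = vs f ! i" for w f i
    proof -
      obtain v where v: "v \<in> verts J" "f \<in> ?I v" "y w \<in> L v f" using inner[OF f] e by auto
      have "y w \<in> B v" using v LB(1) by blast
      then have "v = w" by (rule sep[OF v(1) w _ y[OF w]])
      then show False using LB(2)[OF v(1,2)] v(3) by simp
    qed
    have ii: "f = g \<and> i = j" if f: "f \<in> edges J" "1 \<le> i" "i \<le> k f" and g: "g \<in> edges J" "1 \<le> j" "j \<le> k g" and e: "vs f ! i = vs g ! j" for f g i j
    proof -
      obtain v where v: "v \<in> verts J" "f \<in> ?I v" "vs f ! i \<in> L v f" using inner[OF f] by blast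
      obtain w where w: "w \<in> verts J" "g \<in> ?I w" "vs f ! i \<in> L w g" using inner[OF g] e by auto
      have "vs f ! i \<in> B v" "vs f ! i \<in> B w" using v w LB(1) by blast+
      then have vw: "v = w" by (rule sep[OF v(1) w(1)])
      have fg: "f = g"
      proof (rule ccontr)
        assume "f \<noteq> g"
        then have "L v f \<inter> L v g = {}" using Ld[OF v(1,2)] w(2) vw by blast
        then show False using v(3) w(3) vw by blast
      qed
      then show ?thesis using e vs(1,3)[OF f(1)] f(3) g(3) by (simp add: nth_eq_iff_index_eq)
    qed
    have cs: "(\<exists>w\<in>verts J. a = Inl w) \<or> (\<exists>f\<in>edges J. \<exists>i. 1 \<le> i \<and> i \<le> k f \<and> a = Inr (f, i))" if "a \<in> verts ?S" for a
      using that unfolding subdivide_simps by auto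
    fix a b assume a: "a \<in> verts ?S" and b: "b \<in> verts ?S" and e: "\<phi> a = \<phi> b"
    from cs[OF a] cs[OF b] show "a = b"
    proof (elim disjE bexE exE conjE)
      fix v w assume "v \<in> verts J" "w \<in> verts J" "a = Inl v" "b = Inl w"
      then show "a = b" using e sep[of v w "y v"] y[of v] y[of w] by (simp add: \<phi>)
    next
      fix w f i assume "w \<in> verts J" "a = Inl w" "f \<in> edges J" "1 \<le> i" "i \<le> k f" "b = Inr (f, i)"
      then show "a = b" using e yi[of w f i] by (simp add: \<phi>)
    next
      fix w f i assume "w \<in> verts J" "b = Inl w" "f \<in> edges J" "1 \<le> i" "i \<le> k f" "a = Inr (f, i)"
      then show "a = b" using e yi[of w f i] by (simp add: \<phi>)
    next
      fix f i g j assume "f \<in> edges J" "1 \<le> i" "i \<le> k f" "a = Inr (f, i)" "g \<in> edges J" "1 \<le> j" "j \<le> k g" "b = Inr (g, j)"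
      then show "a = b" using e ii[of f i g j] by (simp add: \<phi>)
    qed
  qed
  define \<psi> where "\<psi> = (\<lambda>(f, i). label f i)"
  have eS: "\<exists>f i. x = (f, i) \<and> f \<in> edges J \<and> i \<le> k f" if "x \<in> edges ?S" for x using that unfolding subdivide_simps by auto
  have \<psi>: "\<psi> x \<in> edges G \<and> ends G (\<psi> x) = \<phi> ` ends ?S x" if xe: "x \<in> edges ?S" for x
  proof -
    obtain f i where x: "x = (f, i)" "f \<in> edges J" "i \<le> k f" using eS[OF xe] by blast
    have "\<phi> ` ends ?S x = {vs f ! i, vs f ! Suc i}" using x \<phi>pt[OF x(2), of i] \<phi>pt[OF x(2), of "Suc i"] by (simp add: subdivide_simps)
    then show ?thesis using label[OF x(2,3)] unfolding \<psi>_def x(1) by simp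
  qed
  have inj\<psi>: "inj_on \<psi> (edges ?S)"
  proof (rule inj_onI)
    fix x x' assume x: "x \<in> edges ?S" and x': "x' \<in> edges ?S" and e: "\<psi> x = \<psi> x'"
    obtain f i where f: "x = (f, i)" "f \<in> edges J" "i \<le> k f" using eS[OF x] by blast
    obtain g j where g: "x' = (g, j)" "g \<in> edges J" "j \<le> k g" using eS[OF x'] by blast
    have "\<phi> ` ends ?S x = \<phi> ` ends ?S x'" using \<psi>[OF x] \<psi>[OF x'] e by simp
    then have "ends ?S x = ends ?S x'"
      using inj_on_image_eq_iff[OF inj\<phi> multigraphD(3)[OF mS x] multigraphD(3)[OF mS x']] by simp
    then have "f = g \<and> i = j \<or> k f = 0 \<and> k g = 0"
      using S.parallel_edges_unsubdivided[OF f(2,3) g(2,3)] unfolding f(1) g(1) by (simp add: subdivide_simps)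
    then show "x = x'"
    proof
      assume k0: "k f = 0 \<and> k g = 0"
      \<comment> \<open>An unsubdivided edge comes from two legs with one vertex each, so position
        \<open>0\<close> is the middle edge.\<close>
      have "label d 0 = h d" if d: "d \<in> edges J" "k d = 0" for d
      proof -
        note S = st[OF d(1)]
        have "length (pl (s d) d) + length (pl (t d) d) = 2" using vs(1)[OF d(1)] d(2) unfolding vs_def by simp
        moreover have "odd (length (pl (s d) d))" "odd (length (pl (t d) d))" using pl(1)[OF S(3,5)] pl(1)[OF S(4,6)] .
        ultimately have "length (pl (s d) d) = 1" by presburger
        then show ?thesis unfolding label_def by simp
      qed
      then have "h f = h g" using k0 f g e unfolding \<psi>_def by auto
      then have "f = g" using F(4) f(2) g(2) by (simp add: inj_on_def)
      then show ?thesis using k0 f g by simp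
    qed (use f g in simp)
  qed
  let ?H = "\<lparr>verts = \<phi> ` verts ?S, edges = \<psi> ` edges ?S, ends = ends G\<rparr>"
  have "graph_iso ?S ?H" unfolding graph_iso_def
    by (rule exI[of _ \<phi>], rule exI[of _ \<psi>]) (use inj\<phi> inj\<psi> \<psi> in \<open>auto simp: bij_betw_def\<close>)
  then have "graph_iso ?H ?S" by (rule graph_iso_sym[OF _ mS])
  then have bis: "bisubdivision ?H J" unfolding bisubdivision_def using st(1) vs(2) by blast
  \<comment> \<open>The vertices of the bag that are used. The others are matched: those outside the
    legs by the tripod, those inside a leg by what its path leaves over.\<close>
  define P where "P w = insert (y w) (\<Union>f\<in>?I w. set (pl w f))" for w
  have PB: "P w \<subseteq> B w" if "w \<in> verts J" for w unfolding P_def using y[OF that] plB[OF that] by blast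
  have im: "\<phi> ` verts ?S = (\<Union>w\<in>verts J. P w)"
  proof (intro equalityI subsetI)
    fix x assume "x \<in> \<phi> ` verts ?S"
    then consider w where "w \<in> verts J" "x = y w" | f i where "f \<in> edges J" "i \<le> k f" "x = vs f ! i"
      unfolding subdivide_simps by (auto simp: \<phi>)
    then show "x \<in> (\<Union>w\<in>verts J. P w)"
    proof cases
      case 2
      then have "x \<in> set (vs f)" using vs(1) by simp
      then show ?thesis unfolding vs(6)[OF 2(1)] P_def using st(3-6)[OF 2(1)] by blast
    qed (auto simp: P_def)
  next
    fix x assume "x \<in> (\<Union>w\<in>verts J. P w)"
    then obtain w where w: "w \<in> verts J" "x \<in> P w" by blast
    show "x \<in> \<phi> ` verts ?S"
    proof (cases "x = y w")
      case True
      then have "x = \<phi> (Inl w)" by (simp add: \<phi>)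
      moreover have "Inl w \<in> verts ?S" using w(1) unfolding subdivide_simps by blast
      ultimately show ?thesis by blast
    next
      case False
      then obtain f where f: "f \<in> ?I w" "x \<in> set (pl w f)" using w(2) unfolding P_def by blast
      then have fJ: "f \<in> edges J" "w \<in> ends J f" unfolding incident_edges_def by auto
      have "x \<in> set (vs f)" using f(2) fJ(2) st(1)[OF fJ(1)] unfolding vs(6)[OF fJ(1)] by auto
      then obtain i where "i < length (vs f)" "x = vs f ! i" unfolding in_set_conv_nth by blast
      then have "x = \<phi> (S.pt f i)" using \<phi>pt[OF fJ(1), of i] vs(1)[OF fJ(1)] by simp
      then show ?thesis using S.pt_verts[OF fJ(1)] by blast
    qed
  qed
  have mP: "matchable_on ?R (B w - P w)" if w: "w \<in> verts J" for w
  proof -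
    have "matchable_on ?R (\<Union>f\<in>?I w. L w f - set (pl w f))"
    proof (rule matchable_on_UN)
      show "matchable_on ?R (L w f - set (pl w f))" if "f \<in> ?I w" for f using pl(7)[OF w that] .
      show "(L w f - set (pl w f)) \<inter> (L w g - set (pl w g)) = {}" if "f \<in> ?I w" "g \<in> ?I w" "f \<noteq> g" for f g
        using Ld[OF w that] by blast
    qed
    with rest[OF w] have "matchable_on ?R ((B w - {y w} - (\<Union>i\<in>?I w. L w i)) \<union> (\<Union>f\<in>?I w. L w f - set (pl w f)))"
      by (rule matchable_on_Un) blast
    moreover have "(B w - {y w} - (\<Union>i\<in>?I w. L w i)) \<union> (\<Union>f\<in>?I w. L w f - set (pl w f)) = B w - P w"
    proof (intro equalityI subsetI)
      fix x assume "x \<in> (B w - {y w} - (\<Union>i\<in>?I w. L w i)) \<union> (\<Union>f\<in>?I w. L w f - set (pl w f))"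
      then show "x \<in> B w - P w"
      proof
        assume x: "x \<in> B w - {y w} - (\<Union>i\<in>?I w. L w i)"
        have "x \<notin> set (pl w f)" if "f \<in> ?I w" for f using pl(5)[OF w that] x that by blast
        then show ?thesis using x unfolding P_def by blast
      next
        assume "x \<in> (\<Union>f\<in>?I w. L w f - set (pl w f))"
        then obtain f where f: "f \<in> ?I w" "x \<in> L w f" "x \<notin> set (pl w f)" by blast
        have xB: "x \<in> B w" "x \<noteq> y w" using L(1)[OF w f(1)] f(2) by auto
        have "x \<notin> set (pl w g)" if g: "g \<in> ?I w" for g
        proof (cases "g = f")
          case False
          then show ?thesis using Ld[OF w g f(1)] pl(5)[OF w g] f(2) xB(2) by blast
        qed (use f(3) in simp)
        then show ?thesis using xB unfolding P_def by blast
      qed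
    next
      fix x assume x: "x \<in> B w - P w"
      then have "x \<noteq> y w" "\<And>f. f \<in> ?I w \<Longrightarrow> x \<notin> set (pl w f)" unfolding P_def by auto
      then show "x \<in> (B w - {y w} - (\<Union>i\<in>?I w. L w i)) \<union> (\<Union>f\<in>?I w. L w f - set (pl w f))" using x by blast
    qed
    ultimately show ?thesis by simp
  qed
  have "matchable_on ?R (\<Union>w\<in>verts J. B w - P w)"
  proof (rule matchable_on_UN[OF mP])
    show "(B v - P v) \<inter> (B w - P w) = {}" if "v \<in> verts J" "w \<in> verts J" "v \<noteq> w" for v w using F(2)[OF that] by blast
  qed
  with F(3) have "matchable_on ?R ((verts G - (\<Union>w\<in>verts J. B w)) \<union> (\<Union>w\<in>verts J. B w - P w))"
    by (rule matchable_on_Un) blast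
  moreover have "(verts G - (\<Union>w\<in>verts J. B w)) \<union> (\<Union>w\<in>verts J. B w - P w) = verts G - (\<Union>w\<in>verts J. P w)"
  proof (intro equalityI subsetI)
    fix x assume "x \<in> (verts G - (\<Union>w\<in>verts J. B w)) \<union> (\<Union>w\<in>verts J. B w - P w)"
    then show "x \<in> verts G - (\<Union>w\<in>verts J. P w)"
    proof
      assume "x \<in> verts G - (\<Union>w\<in>verts J. B w)"
      then show ?thesis using PB by blast
    next
      assume "x \<in> (\<Union>w\<in>verts J. B w - P w)"
      then obtain w where w: "w \<in> verts J" "x \<in> B w" "x \<notin> P w" by blast
      have "x \<notin> P v" if v: "v \<in> verts J" for v
      proof
        assume "x \<in> P v"
        then have "v = w" using sep[OF v w(1) _ w(2)] PB[OF v] by blast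
        then show False using \<open>x \<in> P v\<close> w(3) by simp
      qed
      then show ?thesis using F(1)[OF w(1)] w(2) by blast
    qed
  qed blast
  ultimately have "matchable_on ?R (verts G - verts ?H)" using im by simp
  then have "matchable (delete_verts G (verts ?H))" using matchable_delete_verts_iff[OF G] by blast
  moreover have "subgraph ?H G"
    unfolding subgraph_def
  proof (intro conjI ballI)
    show "verts ?H \<subseteq> verts G" using im PB F(1) by fastforce
    show eG: "edges ?H \<subseteq> edges G" using \<psi> by auto
    show "multigraph ?H" unfolding multigraph_def
    proof (intro conjI ballI)
      show "finite (verts ?H)" "finite (edges ?H)" using multigraphD(1,2)[OF mS] by auto
      fix e assume e: "e \<in> edges ?H"
      then obtain x where x: "x \<in> edges ?S" "e = \<psi> x" by auto
      show "ends ?H e \<subseteq> verts ?H" using \<psi>[OF x(1)] multigraphD(3)[OF mS x(1)] x(2) by auto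
      show "card (ends ?H e) = 2" using multigraphD(4)[OF G, of e] eG e by auto
    qed
  qed simp
  ultimately show ?thesis using bis unfolding conformal_subgraph_def by blast
qed

theorem theorem1p19:
  fixes \<H> :: "('a, 'b) mgraph set" and \<G> :: "('v, 'e) mgraph set" and G :: "('v, 'e) mgraph"
  assumes "finite \<H>"
    and "\<And>H. H \<in> \<H> \<Longrightarrow> multigraph H \<and> cubic H \<and> two_connected H"
    and "\<G> = {G. matching_covered G \<and> (\<forall>H\<in>\<H>. \<not> S_minor H G)}"
    and "matching_covered G"
  shows "G \<in> \<G> \<longleftrightarrow> free_of (\<Union>H\<in>\<H>. K4_decorations H) G"
proof -
  have G: "multigraph G" using assms(4) unfolding matching_covered_def by simp
  have iff: "S_minor H G \<longleftrightarrow> (\<exists>K\<in>K4_decorations H. conformal_minor K G)" if H: "H \<in> \<H>" for H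
  proof
    have h: "multigraph H" "cubic H" "two_connected H" using assms(2)[OF H] by auto
    \<comment> \<open>Both notions of minor demand that the smaller graph be matching covered; for
      \<open>H\<close> this is Petersen's theorem, and the decorations inherit it.\<close>
    have mc: "matching_covered H" by (rule cubic_two_connected_matching_covered[OF h])
    show "S_minor H G" if "\<exists>K\<in>K4_decorations H. conformal_minor K G"
      using that conformal_decoration_S_minor[OF mc h(2)] unfolding K4_decorations_def by blast
    assume "S_minor H G"
    then have "bag_minor H G" by (rule S_minor_bag_minor)
    then obtain T B h' c where T: "T \<subseteq> verts H" and tf: "tripod_frame (K4_decoration H T) G B h' c"
      using bag_minor_tripod_frame[OF h(1,2) G] by blast
    have "conformal_minor (K4_decoration H T) G"
      unfolding conformal_minor_def
      using K4_matching_covered[OF mc h(2) T] assms(4) tripod_frame_bisubdivision[OF multigraph_K4[OF h(1,2)] G tf] by blast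
    then show "\<exists>K\<in>K4_decorations H. conformal_minor K G" unfolding K4_decorations_def using T by blast
  qed
  have "G \<in> \<G> \<longleftrightarrow> (\<forall>H\<in>\<H>. \<not> S_minor H G)" unfolding assms(3) using assms(4) by simp
  also have "\<dots> \<longleftrightarrow> (\<forall>H\<in>\<H>. \<forall>K\<in>K4_decorations H. \<not> conformal_minor K G)" using iff by blast
  also have "\<dots> \<longleftrightarrow> free_of (\<Union>H\<in>\<H>. K4_decorations H) G" unfolding free_of_def by blast
  finally show ?thesis .
qed

end
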